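(* Let $Y\neq\{0\}$ be a separable Hilbert space and let $B:D(B)\to Y$ be a positive self-adjoint operator with dense domain. Consider in $X=L^2_{\mathrm{ul-w}}(\mathbb{R},Y)$ the operator $A=-\partial_{xx}^2+B$ with domain $D(A)=H^2_{\mathrm{ul-w}}(\mathbb{R},Y)\cap L^2_{\mathrm{ul-w}}(\mathbb{R},D(B))$. Then $A$ is a closed operator satisfying sectorial-like resolvent estimates, that is: there exist $\omega\in\mathbb{R}$, $\phi\in(0,\pi/2)$ and $M>0$ such that the sector $S_{\omega,\phi}=\{z\in\mathbb{C}\setminus\{\omega\}:\ \phi\le|\arg(z-\omega)|\le\pi\}$ is contained in the resolvent set of $A$ and $\|(z\,\mathrm{id}-A)^{-1}\|_{\mathcal{L}(X)}\le \frac{M}{|z-\omega|}$ for all $z\in S_{\omega,\phi}$. However, the domain $D(A)$ is not dense in $X$. Moreover, there exist functions $u_0\in L^2_{\mathrm{ul-w}}(\mathbb{R},Y)$ such that the associated semigroup trajectory $t\mapsto e^{-At}u_0$ is not continuous at $t=0$ in $L^2_{\mathrm{ul-w}}(\mathbb{R},Y)$ (i.e. $e^{-At}u_0$ does not converge to $u_0$ in $L^2_{\mathrm{ul-w}}(\mathbb{R},Y)$ as $t\to0^+$).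
   Context: Positive means $\langle Bu|u\rangle_Y\ge0$ for all $u\in D(B)$; $D(B)$ carries its graph norm. For a Banach space $E$, $\|u\|_{L^2_{\mathrm{ul}}(\mathbb{R},E)}=\sup_{a\in\mathbb{R}}\big(\int_a^{a+1}|u(x)|_E^2\,dx\big)^{1/2}$; $L^2_{\mathrm{ul-w}}(\mathbb{R},E)$ is the space of $u\in L^2_{\mathrm{loc}}(\mathbb{R},E)$ (Bochner sense) for which this norm is finite, and $H^2_{\mathrm{ul-w}}(\mathbb{R},E)$ is the space of $u$ whose weak derivatives of order $\le2$ belong to $L^2_{\mathrm{ul-w}}(\mathbb{R},E)$. If $Y$ is real, resolvents are understood after complexification. For a closed operator $A$ with resolvent estimates as in the claim, the semigroup is defined for $t>0$ by $e^{-At}=\frac{1}{2i\pi}\int_\Gamma(\lambda+A)^{-1}e^{\lambda t}\,d\lambda$, where $\Gamma$ is a contour in the resolvent set of $-A$, running from $\infty e^{-i\psi}$ to $\infty e^{i\psi}$ with $\psi\in(\pi/2,\pi-\phi)$ and passing to the right of $-\omega$; at $t=0$ it is the identity. *)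

theory Defs
  imports "HOL-Analysis.Analysis" "HOL-Library.Nonpos_Ints"
begin

section \<open>Complex Hilbert spaces\<close>

class scaleC =
  fixes scaleC :: "complex \<Rightarrow> 'a \<Rightarrow> 'a"  (infixr "*\<^sub>C" 75)

class complex_vector = real_vector + scaleC +
  assumes scaleC_add_right: "c *\<^sub>C (x + y) = c *\<^sub>C x + c *\<^sub>C y"
    and scaleC_add_left: "(c + d) *\<^sub>C x = c *\<^sub>C x + d *\<^sub>C x"
    and scaleC_scaleC: "c *\<^sub>C d *\<^sub>C x = (c * d) *\<^sub>C x"
    and scaleC_of_real: "complex_of_real r *\<^sub>C x = r *\<^sub>R x"

class complex_normed_vector = complex_vector + real_normed_vector +
  assumes norm_scaleC: "norm (c *\<^sub>C x) = cmod c * norm x"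

text \<open>The complex inner product is linear in its second argument. Its real part is the
  inner product of the underlying real space, so the norm is the one induced by either.\<close>

class complex_inner = complex_normed_vector + real_inner +
  fixes cinner :: "'a \<Rightarrow> 'a \<Rightarrow> complex"
  assumes cinner_commute: "cinner x y = cnj (cinner y x)"
    and cinner_add_right: "cinner x (y + z) = cinner x y + cinner x z"
    and cinner_scaleC_right: "cinner x (c *\<^sub>C y) = c * cinner x y"
    and Re_cinner: "Re (cinner x y) = inner x y"

class chilbert_space = complex_inner + banach


section \<open>Complexification of a real Hilbert space\<close>

datatype 'a complexified = Complexify (re_part: 'a) (im_part: 'a)

lemma complexified_eqI:
  "re_part z = re_part w \<Longrightarrow> im_part z = im_part w \<Longrightarrow> z = w"
  by (cases z; cases w) auto

instantiation complexified :: (real_inner) complex_inner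
begin

definition "0 = Complexify 0 0"
definition "z + w = Complexify (re_part z + re_part w) (im_part z + im_part w)"
definition "z - w = Complexify (re_part z - re_part w) (im_part z - im_part w)"
definition "- z = Complexify (- re_part z) (- im_part z)"
definition "r *\<^sub>R z = Complexify (r *\<^sub>R re_part z) (r *\<^sub>R im_part z)"
definition "c *\<^sub>C z = Complexify (Re c *\<^sub>R re_part z - Im c *\<^sub>R im_part z)
                             (Re c *\<^sub>R im_part z + Im c *\<^sub>R re_part z)"
definition "inner z w = inner (re_part z) (re_part w) + inner (im_part z) (im_part w)"
definition "cinner z w =
  Complex (inner (re_part z) (re_part w) + inner (im_part z) (im_part w))
          (inner (re_part z) (im_part w) - inner (im_part z) (re_part w))"
definition norm_complexified :: "'a complexified \<Rightarrow> real" where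
  "norm_complexified z = sqrt (inner z z)"
definition sgn_complexified :: "'a complexified \<Rightarrow> 'a complexified" where
  "sgn_complexified z = inverse (norm z) *\<^sub>R z"
definition dist_complexified :: "'a complexified \<Rightarrow> 'a complexified \<Rightarrow> real" where
  "dist_complexified z w = norm (z - w)"
definition uniformity_complexified :: "('a complexified \<times> 'a complexified) filter" where
  "uniformity_complexified = (INF e\<in>{0 <..}. principal {(z, w). dist z w < e})"
definition open_complexified :: "'a complexified set \<Rightarrow> bool" where
  "open_complexified U \<longleftrightarrow>
     (\<forall>z\<in>U. eventually (\<lambda>(z', w). z' = z \<longrightarrow> w \<in> U) uniformity)"

lemmas complexified_defs =
  zero_complexified_def plus_complexified_def minus_complexified_def uminus_complexified_def
  scaleR_complexified_def scaleC_complexified_def inner_complexified_def cinner_complexified_def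

lemma norm_complexified_eq: "norm z = norm (re_part z, im_part z)"
  by (simp add: norm_complexified_def norm_prod_def inner_complexified_def power2_norm_eq_inner)

instance
proof
  fix x y z :: "'a complexified" and a b r :: real and c d :: complex
  show "x + y + z = x + (y + z)" "x + y = y + x" "0 + x = x" "- x + x = 0" "x - y = x + - y"
    by (auto simp: complexified_defs intro!: complexified_eqI)
  show "a *\<^sub>R (x + y) = a *\<^sub>R x + a *\<^sub>R y" "(a + b) *\<^sub>R x = a *\<^sub>R x + b *\<^sub>R x"
    "a *\<^sub>R b *\<^sub>R x = (a * b) *\<^sub>R x" "1 *\<^sub>R x = x"
    by (auto simp: complexified_defs algebra_simps intro!: complexified_eqI)
  show "c *\<^sub>C (x + y) = c *\<^sub>C x + c *\<^sub>C y" "(c + d) *\<^sub>C x = c *\<^sub>C x + d *\<^sub>C x"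
    "c *\<^sub>C d *\<^sub>C x = (c * d) *\<^sub>C x" "complex_of_real r *\<^sub>C x = r *\<^sub>R x"
    by (auto simp: complexified_defs algebra_simps intro!: complexified_eqI)
  show "sgn x = inverse (norm x) *\<^sub>R x" by (rule sgn_complexified_def)
  show "dist x y = norm (x - y)" by (rule dist_complexified_def)
  show "(uniformity :: ('a complexified \<times> 'a complexified) filter)
      = (INF e\<in>{0 <..}. principal {(z, w). dist z w < e})"
    by (rule uniformity_complexified_def)
  fix U :: "'a complexified set"
  show "open U \<longleftrightarrow> (\<forall>z\<in>U. eventually (\<lambda>(z', w). z' = z \<longrightarrow> w \<in> U) uniformity)"
    by (rule open_complexified_def)
next
  fix x y z :: "'a complexified" and a b r :: real and c d :: complex
  show "norm x = 0 \<longleftrightarrow> x = 0"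
    unfolding norm_complexified_eq norm_eq_zero
    by (auto simp: complexified_defs zero_prod_def intro!: complexified_eqI)
  have "norm (x + y) = norm ((re_part x, im_part x) + (re_part y, im_part y))"
    by (simp add: norm_complexified_eq complexified_defs)
  also have "\<dots> \<le> norm x + norm y"
    unfolding norm_complexified_eq by (rule norm_triangle_ineq)
  finally show "norm (x + y) \<le> norm x + norm y" .
  have "norm (a *\<^sub>R x) = norm (a *\<^sub>R (re_part x, im_part x))"
    by (simp add: norm_complexified_eq complexified_defs)
  then show "norm (a *\<^sub>R x) = \<bar>a\<bar> * norm x"
    unfolding norm_complexified_eq norm_scaleR .
  have "inner (c *\<^sub>C x) (c *\<^sub>C x) = (cmod c)\<^sup>2 * inner x x"
    unfolding cmod_power2
    by (simp add: complexified_defs inner_diff inner_add_left inner_add_right algebra_simps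
        power2_eq_square inner_commute)
  then show "norm (c *\<^sub>C x) = cmod c * norm x"
    by (simp add: norm_complexified_def real_sqrt_mult)
next
  fix x y z :: "'a complexified" and r :: real and c :: complex
  show "inner x y = inner y x" "inner (x + y) z = inner x z + inner y z"
    "inner (r *\<^sub>R x) y = r * inner x y" "0 \<le> inner x x"
    by (simp_all add: complexified_defs inner_commute inner_add_left algebra_simps)
  show "inner x x = 0 \<longleftrightarrow> x = 0"
    by (auto simp: complexified_defs add_nonneg_eq_0_iff intro!: complexified_eqI)
  show "norm x = sqrt (inner x x)" by (rule norm_complexified_def)
  show "cinner x y = cnj (cinner y x)" "cinner x (y + z) = cinner x y + cinner x z"
    "Re (cinner x y) = inner x y"
    by (simp_all add: complexified_defs complex_eq_iff inner_commute inner_add_right)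
  show "cinner x (c *\<^sub>C y) = c * cinner x y"
    by (simp add: complexified_defs complex_eq_iff inner_add_right inner_diff_right algebra_simps)
qed

end

lemma dist_complexified_eq:
  "dist z w = dist (re_part z, im_part z) (re_part w, im_part w)"
  by (simp add: dist_norm norm_complexified_eq minus_complexified_def)

instance complexified :: ("{real_inner, banach}") chilbert_space
proof
  fix X :: "nat \<Rightarrow> 'a complexified"
  assume "Cauchy X"
  then have "Cauchy (\<lambda>n. (re_part (X n), im_part (X n)))"
    by (simp add: Cauchy_def dist_complexified_eq)
  then obtain l where "(\<lambda>n. (re_part (X n), im_part (X n))) \<longlonglongrightarrow> l"
    using Cauchy_convergent convergent_def by blast
  then have "X \<longlonglongrightarrow> Complexify (fst l) (snd l)"
    by (simp add: tendsto_iff dist_complexified_eq)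
  then show "convergent X" by (auto simp: convergent_def)
qed

instance complexified :: ("{real_inner, second_countable_topology}") second_countable_topology
proof
  let ?f = "\<lambda>z::'a complexified. (re_part z, im_part z)"
  obtain B :: "('a \<times> 'a) set set" where B: "countable B" "topological_basis B"
    using ex_countable_basis by blast
  have c: "continuous_on UNIV ?f"
    unfolding continuous_on_iff by (auto simp: dist_complexified_eq)
  have "topological_basis ((\<lambda>U. ?f -` U) ` B)"
    unfolding topological_basis_iff
  proof (rule topological_basisI)
    fix V assume "V \<in> (\<lambda>U. ?f -` U) ` B"
    then show "open V"
      using B(2) c by (auto intro!: open_vimage dest: topological_basis_open)
  next
    fix V :: "'a complexified set" and z assume V: "open V" "z \<in> V"
    then obtain e where e: "e > 0" "ball z e \<subseteq> V"
      by (meson openE)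
    obtain U where U: "U \<in> B" "?f z \<in> U" "U \<subseteq> ball (?f z) e"
      by (meson B(2) centre_in_ball e(1) open_ball topological_basisE)
    have "?f -` U \<subseteq> ball z e"
      using U(3) by (auto simp: dist_complexified_eq subset_iff)
    then show "\<exists>W\<in>(\<lambda>U. ?f -` U) ` B. z \<in> W \<and> W \<subseteq> V"
      using U e by blast
  qed
  then show "\<exists>B::'a complexified set set. countable B \<and> open = generate_topology B"
    using B(1) topological_basis_imp_subbasis by blast
qed


section \<open>Uniformly local L2 spaces\<close>

definition L2_loc :: "(real \<Rightarrow> 'a::{real_normed_vector, second_countable_topology}) set" where
  "L2_loc = {u \<in> borel_measurable lborel.
     \<forall>a b. set_integrable lborel {a..b} (\<lambda>x. (norm (u x))\<^sup>2)}"

definition unit_L2_norm :: "real \<Rightarrow> (real \<Rightarrow> 'a::real_normed_vector) \<Rightarrow> real" where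
  "unit_L2_norm a u = sqrt (LINT x:{a..a+1}|lborel. (norm (u x))\<^sup>2)"

definition ul_norm :: "(real \<Rightarrow> 'a::real_normed_vector) \<Rightarrow> real" where
  "ul_norm u = (SUP a. unit_L2_norm a u)"

definition L2_ul :: "(real \<Rightarrow> 'a::{real_normed_vector, second_countable_topology}) set" where
  "L2_ul = {u \<in> L2_loc. bdd_above (range (\<lambda>a. unit_L2_norm a u))}"

definition ul_eq ::
  "(real \<Rightarrow> 'a::{real_normed_vector, second_countable_topology}) \<Rightarrow> (real \<Rightarrow> 'a) \<Rightarrow> bool" where
  "ul_eq u v \<longleftrightarrow> u \<in> L2_ul \<and> v \<in> L2_ul \<and> (AE x in lborel. u x = v x)"

lemma L2_loc_zero: "(\<lambda>x. 0) \<in> L2_loc"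
  by (simp add: L2_loc_def set_integrable_def)

lemma L2_loc_add:
  assumes "u \<in> L2_loc" "v \<in> L2_loc"
  shows "(\<lambda>x. u x + v x) \<in> L2_loc"
proof -
  have [measurable]: "u \<in> borel_measurable lborel" "v \<in> borel_measurable lborel"
    using assms by (auto simp: L2_loc_def)
  have "set_integrable lborel {a..b} (\<lambda>x. (norm (u x + v x))\<^sup>2)" for a b
  proof (rule set_integrable_bound)
    show "set_integrable lborel {a..b} (\<lambda>x. 2 * (norm (u x))\<^sup>2 + 2 * (norm (v x))\<^sup>2)"
      using assms by (intro set_integral_add set_integrable_mult_right) (auto simp: L2_loc_def)
    show "set_borel_measurable lborel {a..b} (\<lambda>x. (norm (u x + v x))\<^sup>2)"
      by (simp add: set_borel_measurable_def)
    have "(norm (u x + v x))\<^sup>2 \<le> 2 * (norm (u x))\<^sup>2 + 2 * (norm (v x))\<^sup>2" for x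
    proof -
      have "(norm (u x + v x))\<^sup>2 \<le> (norm (u x) + norm (v x))\<^sup>2"
        by (simp add: norm_triangle_ineq power_mono)
      also have "\<dots> \<le> 2 * (norm (u x))\<^sup>2 + 2 * (norm (v x))\<^sup>2"
        using sum_squares_bound[of "norm (u x)" "norm (v x)"] by (simp add: power2_sum)
      finally show ?thesis .
    qed
    then show "AE x in lborel. x \<in> {a..b} \<longrightarrow>
        norm ((norm (u x + v x))\<^sup>2) \<le> norm (2 * (norm (u x))\<^sup>2 + 2 * (norm (v x))\<^sup>2)"
      by (auto simp: order.trans[OF _ abs_ge_self])
  qed
  then show ?thesis by (auto simp: L2_loc_def)
qed

lemma unit_L2_norm_nonneg: "0 \<le> unit_L2_norm a u"
  unfolding unit_L2_norm_def set_lebesgue_integral_def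
  by (intro real_sqrt_ge_zero Bochner_Integration.integral_nonneg) auto

lemma unit_L2_norm_power2:
  "(unit_L2_norm a u)\<^sup>2 = (LINT x:{a..a+1}|lborel. (norm (u x))\<^sup>2)"
proof -
  have "0 \<le> (LINT x:{a..a+1}|lborel. (norm (u x))\<^sup>2)"
    unfolding set_lebesgue_integral_def by (intro Bochner_Integration.integral_nonneg) auto
  then show ?thesis by (simp add: unit_L2_norm_def)
qed

lemma weighted_square_sum:
  fixes p q s t :: real
  assumes "s > 0" "t > 0"
  shows "(p + q)\<^sup>2 \<le> (s + t) / s * p\<^sup>2 + (s + t) / t * q\<^sup>2"
proof -
  have "(s + t) / s * p\<^sup>2 + (s + t) / t * q\<^sup>2 - (p + q)\<^sup>2 = (t * p - s * q)\<^sup>2 / (s * t)"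
    using assms by (simp add: field_simps power2_eq_square)
  also have "\<dots> \<ge> 0" using assms by simp
  finally show ?thesis by simp
qed

lemma unit_L2_norm_triangle:
  assumes u: "u \<in> L2_loc" and v: "v \<in> L2_loc"
  shows "unit_L2_norm a (\<lambda>x. u x + v x) \<le> unit_L2_norm a u + unit_L2_norm a v"
proof (rule field_le_epsilon)
  fix e :: real assume "e > 0"
  define s where "s = unit_L2_norm a u + e / 2"
  define t where "t = unit_L2_norm a v + e / 2"
  have st: "s > 0" "t > 0"
    using \<open>e > 0\<close> unit_L2_norm_nonneg[of a u] unit_L2_norm_nonneg[of a v]
    by (auto simp: s_def t_def)
  let ?I = "\<lambda>u. LINT x:{a..a+1}|lborel. (norm (u x))\<^sup>2"
  have int: "set_integrable lborel {a..a+1} (\<lambda>x. (norm (w x))\<^sup>2)" if "w \<in> L2_loc" for w :: "real \<Rightarrow> 'a"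
    using that by (simp add: L2_loc_def)
  have "?I (\<lambda>x. u x + v x)
      \<le> (LINT x:{a..a+1}|lborel. (s + t) / s * (norm (u x))\<^sup>2 + (s + t) / t * (norm (v x))\<^sup>2)"
  proof (rule set_integral_mono)
    show "set_integrable lborel {a..a+1} (\<lambda>x. (norm (u x + v x))\<^sup>2)"
      using int[OF L2_loc_add[OF u v]] .
    show "set_integrable lborel {a..a+1}
        (\<lambda>x. (s + t) / s * (norm (u x))\<^sup>2 + (s + t) / t * (norm (v x))\<^sup>2)"
      by (intro set_integral_add set_integrable_mult_right) (use int u v in auto)
    fix x
    have "(norm (u x + v x))\<^sup>2 \<le> (norm (u x) + norm (v x))\<^sup>2"
      by (simp add: norm_triangle_ineq power_mono)
    also have "\<dots> \<le> (s + t) / s * (norm (u x))\<^sup>2 + (s + t) / t * (norm (v x))\<^sup>2"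
      by (rule weighted_square_sum[OF st])
    finally show "(norm (u x + v x))\<^sup>2
        \<le> (s + t) / s * (norm (u x))\<^sup>2 + (s + t) / t * (norm (v x))\<^sup>2" .
  qed
  also have "\<dots> = (LINT x:{a..a+1}|lborel. (s + t) / s * (norm (u x))\<^sup>2)
                + (LINT x:{a..a+1}|lborel. (s + t) / t * (norm (v x))\<^sup>2)"
    by (intro set_integral_add set_integrable_mult_right) (use int u v in auto)
  also have "\<dots> = (s + t) / s * ?I u + (s + t) / t * ?I v"
    by (simp only: set_integral_mult_right)
  also have "\<dots> \<le> (s + t) / s * s\<^sup>2 + (s + t) / t * t\<^sup>2"
  proof (intro add_mono mult_left_mono)
    show "?I u \<le> s\<^sup>2"
      unfolding unit_L2_norm_power2[symmetric] using \<open>e > 0\<close> unit_L2_norm_nonneg[of a u]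
      by (intro power_mono) (auto simp: s_def)
    show "?I v \<le> t\<^sup>2"
      unfolding unit_L2_norm_power2[symmetric] using \<open>e > 0\<close> unit_L2_norm_nonneg[of a v]
      by (intro power_mono) (auto simp: t_def)
  qed (use st in auto)
  also have "\<dots> = (s + t)\<^sup>2"
    using st by (simp add: field_simps power2_eq_square)
  finally have "(unit_L2_norm a (\<lambda>x. u x + v x))\<^sup>2 \<le> (s + t)\<^sup>2"
    by (simp add: unit_L2_norm_power2)
  then have "unit_L2_norm a (\<lambda>x. u x + v x) \<le> s + t"
    using st by (auto intro: power2_le_imp_le)
  then show "unit_L2_norm a (\<lambda>x. u x + v x) \<le> unit_L2_norm a u + unit_L2_norm a v + e"
    by (simp add: s_def t_def)
qed

text \<open>Scalar multiplications and changes of values are handled together: \<open>v\<close> is measurable with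
  \<open>norm (v x) = k * norm (u x)\<close> almost everywhere.\<close>

lemma norm_scaled_L2:
  fixes u :: "real \<Rightarrow> 'a::{real_normed_vector, second_countable_topology}"
    and v :: "real \<Rightarrow> 'b::{real_normed_vector, second_countable_topology}"
  assumes u: "u \<in> L2_loc" and v[measurable]: "v \<in> borel_measurable lborel" and k: "k \<ge> 0"
    and eq: "AE x in lborel. norm (v x) = k * norm (u x)"
  shows "v \<in> L2_loc" "unit_L2_norm a v = k * unit_L2_norm a u"
proof -
  have [measurable]: "u \<in> borel_measurable lborel" using u by (simp add: L2_loc_def)
  have "set_integrable lborel {b..c} (\<lambda>x. (norm (v x))\<^sup>2)" for b c
  proof -
    have "set_integrable lborel {b..c} (\<lambda>x. k\<^sup>2 * (norm (u x))\<^sup>2)"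
      using u by (intro set_integrable_mult_right) (simp add: L2_loc_def)
    moreover have "AE x in lborel. indicator {b..c} x *\<^sub>R (k\<^sup>2 * (norm (u x))\<^sup>2)
        = indicator {b..c} x *\<^sub>R (norm (v x))\<^sup>2"
      using eq by eventually_elim (simp add: power_mult_distrib)
    ultimately show ?thesis
      unfolding set_integrable_def
      by (subst (asm) integrable_cong_AE) auto
  qed
  then show "v \<in> L2_loc" by (simp add: L2_loc_def)
  have "(LINT x:{a..a+1}|lborel. (norm (v x))\<^sup>2)
      = (LINT x:{a..a+1}|lborel. k\<^sup>2 * (norm (u x))\<^sup>2)"
    unfolding set_lebesgue_integral_def
  proof (rule integral_cong_AE)
    show "AE x in lborel. indicator {a..a+1} x *\<^sub>R (norm (v x))\<^sup>2
        = indicator {a..a+1} x *\<^sub>R (k\<^sup>2 * (norm (u x))\<^sup>2)"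
      using eq by eventually_elim (simp add: power_mult_distrib)
  qed auto
  then show "unit_L2_norm a v = k * unit_L2_norm a u"
    using k by (simp add: unit_L2_norm_def real_sqrt_mult)
qed

lemma unit_le_ul: "u \<in> L2_ul \<Longrightarrow> unit_L2_norm a u \<le> ul_norm u"
  unfolding ul_norm_def L2_ul_def by (auto intro: cSUP_upper)

lemma norm_scaled_L2_ul:
  fixes u :: "real \<Rightarrow> 'a::{real_normed_vector, second_countable_topology}"
    and v :: "real \<Rightarrow> 'b::{real_normed_vector, second_countable_topology}"
  assumes u: "u \<in> L2_ul" and v: "v \<in> borel_measurable lborel" and k: "k \<ge> 0"
    and eq: "AE x in lborel. norm (v x) = k * norm (u x)"
  shows "v \<in> L2_ul" "ul_norm v = k * ul_norm u"
proof -
  have u': "u \<in> L2_loc" using u by (simp add: L2_ul_def)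
  note n = norm_scaled_L2[OF u' v k eq]
  have le: "unit_L2_norm a v \<le> k * ul_norm u" for a
    using k unit_le_ul[OF u] by (simp add: n(2) mult_left_mono)
  then show "v \<in> L2_ul" using n(1) by (auto simp: L2_ul_def bdd_above_def)
  show "ul_norm v = k * ul_norm u"
  proof (cases "k = 0")
    case True
    then show ?thesis by (simp add: ul_norm_def n(2))
  next
    case False
    have "ul_norm v \<le> k * ul_norm u"
      unfolding ul_norm_def[of v] using le
      by (intro cSUP_least) auto
    moreover have "ul_norm u \<le> ul_norm v / k"
      unfolding ul_norm_def[of u]
    proof (rule cSUP_least)
      fix a
      show "unit_L2_norm a u \<le> ul_norm v / k"
        using unit_le_ul[OF \<open>v \<in> L2_ul\<close>, of a] False k by (simp add: n(2) field_simps)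
    qed simp
    ultimately show ?thesis using False k by (simp add: field_simps)
  qed
qed

lemma L2_ul_zero: "(\<lambda>x. 0) \<in> L2_ul" "ul_norm (\<lambda>x. 0) = 0"
  using L2_loc_zero by (simp_all add: L2_ul_def unit_L2_norm_def ul_norm_def)

lemma L2_ul_add:
  assumes u: "u \<in> L2_ul" and v: "v \<in> L2_ul"
  shows "(\<lambda>x. u x + v x) \<in> L2_ul" "ul_norm (\<lambda>x. u x + v x) \<le> ul_norm u + ul_norm v"
proof -
  have loc: "u \<in> L2_loc" "v \<in> L2_loc" using u v by (auto simp: L2_ul_def)
  have le: "unit_L2_norm a (\<lambda>x. u x + v x) \<le> ul_norm u + ul_norm v" for a
    using unit_L2_norm_triangle[OF loc, of a] unit_le_ul[OF u, of a] unit_le_ul[OF v, of a]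
    by linarith
  then show "(\<lambda>x. u x + v x) \<in> L2_ul"
    using L2_loc_add[OF loc] by (auto simp: L2_ul_def bdd_above_def)
  show "ul_norm (\<lambda>x. u x + v x) \<le> ul_norm u + ul_norm v"
    unfolding ul_norm_def[of "\<lambda>x. u x + v x"] using le by (intro cSUP_least) auto
qed

lemma L2_ul_measurable: "u \<in> L2_ul \<Longrightarrow> u \<in> borel_measurable borel"
  by (simp add: L2_ul_def L2_loc_def)

lemma L2_ul_scaleR:
  assumes "u \<in> L2_ul"
  shows "(\<lambda>x. r *\<^sub>R u x) \<in> L2_ul" "ul_norm (\<lambda>x. r *\<^sub>R u x) = \<bar>r\<bar> * ul_norm u"
proof -
  have [measurable]: "u \<in> borel_measurable borel" by (rule L2_ul_measurable[OF assms])
  show "(\<lambda>x. r *\<^sub>R u x) \<in> L2_ul" "ul_norm (\<lambda>x. r *\<^sub>R u x) = \<bar>r\<bar> * ul_norm u"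
    using norm_scaled_L2_ul[OF assms, of "\<lambda>x. r *\<^sub>R u x" "\<bar>r\<bar>"] by auto
qed

lemma L2_ul_uminus: "u \<in> L2_ul \<Longrightarrow> (\<lambda>x. - u x) \<in> L2_ul"
  using L2_ul_scaleR(1)[of u "-1"] by simp

lemma L2_ul_diff: "u \<in> L2_ul \<Longrightarrow> v \<in> L2_ul \<Longrightarrow> (\<lambda>x. u x - v x) \<in> L2_ul"
  using L2_ul_add(1)[of u "\<lambda>x. - v x"] by (simp add: L2_ul_uminus)

lemma bounded_linear_scaleC:
  "bounded_linear (\<lambda>x::'a::complex_normed_vector. c *\<^sub>C x)"
proof (rule bounded_linear_intro[where K = "cmod c"])
  fix x y :: 'a and r :: real
  show "c *\<^sub>C (x + y) = c *\<^sub>C x + c *\<^sub>C y" by (rule scaleC_add_right)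
  show "c *\<^sub>C r *\<^sub>R x = r *\<^sub>R c *\<^sub>C x"
    by (metis mult.commute scaleC_of_real scaleC_scaleC)
  show "norm (c *\<^sub>C x) \<le> norm x * cmod c" by (simp add: norm_scaleC)
qed

lemma L2_ul_scaleC:
  fixes u :: "real \<Rightarrow> 'a::{complex_normed_vector, second_countable_topology}"
  assumes "u \<in> L2_ul"
  shows "(\<lambda>x. c *\<^sub>C u x) \<in> L2_ul" "ul_norm (\<lambda>x. c *\<^sub>C u x) = cmod c * ul_norm u"
proof -
  have "continuous_on UNIV (\<lambda>x::'a. c *\<^sub>C x)"
    using bounded_linear_scaleC by (rule linear_continuous_on)
  from borel_measurable_continuous_on[OF this L2_ul_measurable[OF assms]]
  have "(\<lambda>x. c *\<^sub>C u x) \<in> borel_measurable lborel" by simp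
  from norm_scaled_L2_ul[OF assms this, of "cmod c"]
  show "(\<lambda>x. c *\<^sub>C u x) \<in> L2_ul" "ul_norm (\<lambda>x. c *\<^sub>C u x) = cmod c * ul_norm u"
    by (auto simp: norm_scaleC)
qed

lemma ul_eq_part_equivp:
  "part_equivp (ul_eq :: (real \<Rightarrow> 'a::{real_normed_vector, second_countable_topology}) \<Rightarrow> _)"
proof (rule part_equivpI)
  show "\<exists>u::real \<Rightarrow> 'a. ul_eq u u"
    using L2_ul_zero(1) by (auto simp: ul_eq_def)
  show "symp (ul_eq :: (real \<Rightarrow> 'a) \<Rightarrow> _)"
    by (auto simp: symp_def ul_eq_def eq_commute)
  show "transp (ul_eq :: (real \<Rightarrow> 'a) \<Rightarrow> _)"
    unfolding transp_def ul_eq_def by (auto elim: AE_mp[OF AE_conjI])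
qed

lemma ul_eq_norm:
  assumes "ul_eq u v" shows "ul_norm u = ul_norm v"
proof -
  have "u \<in> L2_ul" "v \<in> borel_measurable lborel" "AE x in lborel. norm (v x) = 1 * norm (u x)"
    using assms by (auto simp: ul_eq_def dest: L2_ul_measurable elim!: eventually_mono)
  from norm_scaled_L2_ul(2)[OF this(1,2) _ this(3)] show ?thesis by simp
qed

lemma ul_norm_eq_zero:
  assumes "u \<in> L2_ul" "ul_norm u = 0"
  shows "AE x in lborel. u x = 0"
proof -
  have [measurable]: "u \<in> borel_measurable borel" by (rule L2_ul_measurable[OF assms(1)])
  have "AE x in lborel. x \<in> {real_of_int n..real_of_int n + 1} \<longrightarrow> u x = 0" for n
  proof -
    let ?J = "{real_of_int n..real_of_int n + 1}"
    have "unit_L2_norm (real_of_int n) u = 0"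
      using unit_le_ul[OF assms(1), of "real_of_int n"] unit_L2_norm_nonneg[of "real_of_int n" u]
        assms(2) by linarith
    then have "(LINT x|lborel. indicator ?J x *\<^sub>R (norm (u x))\<^sup>2) = 0"
      using unit_L2_norm_power2[of "real_of_int n" u] by (simp add: set_lebesgue_integral_def)
    moreover have "integrable lborel (\<lambda>x. indicator ?J x *\<^sub>R (norm (u x))\<^sup>2)"
      using assms(1) unfolding L2_ul_def L2_loc_def set_integrable_def by blast
    ultimately have "AE x in lborel. indicator ?J x *\<^sub>R (norm (u x))\<^sup>2 = 0"
      by (subst (asm) integral_nonneg_eq_0_iff_AE) auto
    then show ?thesis by eventually_elim (auto simp: indicator_def)
  qed
  then have "AE x in lborel. \<forall>n::int. x \<in> {real_of_int n..real_of_int n + 1} \<longrightarrow> u x = 0"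
    by (subst AE_all_countable) simp
  then show ?thesis
  proof eventually_elim
    case (elim x)
    then show ?case by (auto dest!: spec[of _ "\<lfloor>x\<rfloor>"])
  qed
qed

quotient_type (overloaded) 'a ul_space =
  "real \<Rightarrow> 'a::{real_normed_vector, second_countable_topology}" / partial: ul_eq
  by (rule ul_eq_part_equivp)

instantiation ul_space :: ("{real_normed_vector, second_countable_topology}") real_normed_vector
begin

lift_definition zero_ul_space :: "'a ul_space" is "\<lambda>x. 0"
  by (simp add: ul_eq_def L2_ul_zero)
lift_definition plus_ul_space :: "'a ul_space \<Rightarrow> 'a ul_space \<Rightarrow> 'a ul_space"
  is "\<lambda>u v x. u x + v x"
  by (auto simp: ul_eq_def L2_ul_add elim: eventually_elim2)
lift_definition uminus_ul_space :: "'a ul_space \<Rightarrow> 'a ul_space" is "\<lambda>u x. - u x"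
  by (auto simp: ul_eq_def L2_ul_uminus)
lift_definition minus_ul_space :: "'a ul_space \<Rightarrow> 'a ul_space \<Rightarrow> 'a ul_space"
  is "\<lambda>u v x. u x - v x"
  by (auto simp: ul_eq_def L2_ul_diff elim: eventually_elim2)
lift_definition scaleR_ul_space :: "real \<Rightarrow> 'a ul_space \<Rightarrow> 'a ul_space" is "\<lambda>r u x. r *\<^sub>R u x"
  by (auto simp: ul_eq_def L2_ul_scaleR elim: eventually_mono)
lift_definition norm_ul_space :: "'a ul_space \<Rightarrow> real" is ul_norm
  by (rule ul_eq_norm)
definition sgn_ul_space :: "'a ul_space \<Rightarrow> 'a ul_space" where
  "sgn_ul_space u = inverse (norm u) *\<^sub>R u"
definition dist_ul_space :: "'a ul_space \<Rightarrow> 'a ul_space \<Rightarrow> real" where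
  "dist_ul_space u v = norm (u - v)"
definition uniformity_ul_space :: "('a ul_space \<times> 'a ul_space) filter" where
  "uniformity_ul_space = (INF e\<in>{0 <..}. principal {(u, v). dist u v < e})"
definition open_ul_space :: "'a ul_space set \<Rightarrow> bool" where
  "open_ul_space U \<longleftrightarrow> (\<forall>u\<in>U. eventually (\<lambda>(u', v). u' = u \<longrightarrow> v \<in> U) uniformity)"

instance
proof
  fix u v w :: "'a ul_space" and a b :: real and U :: "'a ul_space set"
  show "u + v + w = u + (v + w)"
    by transfer (auto simp: ul_eq_def L2_ul_add add.assoc)
  show "u + v = v + u"
    by transfer (auto simp: ul_eq_def L2_ul_add add.commute)
  show "0 + u = u"
    by transfer (auto simp: ul_eq_def)
  show "- u + u = 0"
    by transfer (auto simp: ul_eq_def L2_ul_zero)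
  show "u - v = u + - v"
    by transfer (auto simp: ul_eq_def L2_ul_diff L2_ul_add L2_ul_uminus)
  show "a *\<^sub>R (u + v) = a *\<^sub>R u + a *\<^sub>R v"
    by transfer (auto simp: ul_eq_def L2_ul_add L2_ul_scaleR scaleR_add_right)
  show "(a + b) *\<^sub>R u = a *\<^sub>R u + b *\<^sub>R u"
    by transfer (auto simp: ul_eq_def L2_ul_add L2_ul_scaleR scaleR_add_left)
  show "a *\<^sub>R b *\<^sub>R u = (a * b) *\<^sub>R u"
    by transfer (auto simp: ul_eq_def L2_ul_scaleR)
  show "1 *\<^sub>R u = u"
    by transfer (auto simp: ul_eq_def)
  show "sgn u = inverse (norm u) *\<^sub>R u" by (rule sgn_ul_space_def)
  show "dist u v = norm (u - v)" by (rule dist_ul_space_def)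
  show "(uniformity :: ('a ul_space \<times> 'a ul_space) filter)
      = (INF e\<in>{0 <..}. principal {(u, v). dist u v < e})"
    by (rule uniformity_ul_space_def)
  show "open U \<longleftrightarrow> (\<forall>u\<in>U. eventually (\<lambda>(u', v). u' = u \<longrightarrow> v \<in> U) uniformity)"
    by (rule open_ul_space_def)
  show "norm u = 0 \<longleftrightarrow> u = 0"
  proof transfer
    fix u :: "real \<Rightarrow> 'a" assume "ul_eq u u"
    then have u: "u \<in> L2_ul" by (simp add: ul_eq_def)
    show "ul_norm u = 0 \<longleftrightarrow> ul_eq u (\<lambda>x. 0)"
    proof
      assume "ul_norm u = 0"
      then show "ul_eq u (\<lambda>x. 0)"
        using u ul_norm_eq_zero[OF u] by (simp add: ul_eq_def L2_ul_zero)
    next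
      assume "ul_eq u (\<lambda>x. 0)"
      then show "ul_norm u = 0" using ul_eq_norm L2_ul_zero(2) by metis
    qed
  qed
  show "norm (u + v) \<le> norm u + norm v"
    by transfer (auto simp: ul_eq_def L2_ul_add)
  show "norm (a *\<^sub>R u) = \<bar>a\<bar> * norm u"
    by transfer (auto simp: ul_eq_def L2_ul_scaleR)
qed

end

instantiation ul_space ::
  ("{complex_normed_vector, second_countable_topology}") complex_normed_vector
begin

lift_definition scaleC_ul_space :: "complex \<Rightarrow> 'a ul_space \<Rightarrow> 'a ul_space" is "\<lambda>c u x. c *\<^sub>C u x"
  by (auto simp: ul_eq_def L2_ul_scaleC elim: eventually_mono)

instance
proof
  fix u v :: "'a ul_space" and c d :: complex and r :: real
  show "c *\<^sub>C (u + v) = c *\<^sub>C u + c *\<^sub>C v"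
    by transfer (auto simp: ul_eq_def L2_ul_add L2_ul_scaleC scaleC_add_right)
  show "(c + d) *\<^sub>C u = c *\<^sub>C u + d *\<^sub>C u"
    by transfer (auto simp: ul_eq_def L2_ul_add L2_ul_scaleC scaleC_add_left)
  show "c *\<^sub>C d *\<^sub>C u = (c * d) *\<^sub>C u"
    by transfer (auto simp: ul_eq_def L2_ul_scaleC scaleC_scaleC)
  show "complex_of_real r *\<^sub>C u = r *\<^sub>R u"
    by transfer (auto simp: ul_eq_def L2_ul_scaleR scaleC_of_real)
  show "norm (c *\<^sub>C u) = cmod c * norm u"
    by transfer (auto simp: ul_eq_def L2_ul_scaleC)
qed

end

lift_definition complexify_ul ::
  "'a::{real_inner, second_countable_topology} ul_space \<Rightarrow> 'a complexified ul_space"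
  is "\<lambda>u x. Complexify (u x) 0"
proof -
  fix u v :: "real \<Rightarrow> 'a" assume uv: "ul_eq u v"
  have c: "continuous_on UNIV (\<lambda>y::'a. Complexify y 0)"
    unfolding continuous_on_iff by (auto simp: dist_complexified_eq dist_prod_def)
  have "(\<lambda>x. Complexify (w x) 0) \<in> L2_ul" if "w \<in> L2_ul" for w :: "real \<Rightarrow> 'a"
    using borel_measurable_continuous_on[OF c L2_ul_measurable[OF that]]
    by (intro norm_scaled_L2_ul(1)[OF that, of _ 1]) (auto simp: norm_complexified_eq)
  then show "ul_eq (\<lambda>x. Complexify (u x) 0) (\<lambda>x. Complexify (v x) 0)"
    using uv by (auto simp: ul_eq_def elim: eventually_mono)
qed


section \<open>Unbounded operators\<close>

text \<open>An unbounded operator is given by its domain \<open>D\<close> and a total function \<open>T\<close>, of which only the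
  restriction to \<open>D\<close> matters. The parameters \<open>sc\<close> and \<open>ip\<close> are \<^const>\<open>scaleR\<close> and \<^const>\<open>inner\<close>
  for real spaces, \<^const>\<open>scaleC\<close> and \<^const>\<open>cinner\<close> for complex ones.\<close>

definition linear_operator ::
  "('k \<Rightarrow> 'a \<Rightarrow> 'a) \<Rightarrow> 'a::ab_group_add set \<Rightarrow> ('a \<Rightarrow> 'a) \<Rightarrow> bool" where
  "linear_operator sc D T \<longleftrightarrow> 0 \<in> D
     \<and> (\<forall>u\<in>D. \<forall>v\<in>D. u + v \<in> D \<and> T (u + v) = T u + T v)
     \<and> (\<forall>c. \<forall>u\<in>D. sc c u \<in> D \<and> T (sc c u) = sc c (T u))"

definition operator_graph :: "'a set \<Rightarrow> ('a \<Rightarrow> 'a) \<Rightarrow> ('a \<times> 'a) set" where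
  "operator_graph D T = {(u, T u) |u. u \<in> D}"

definition closed_operator ::
  "('k \<Rightarrow> 'a \<Rightarrow> 'a) \<Rightarrow> 'a::real_normed_vector set \<Rightarrow> ('a \<Rightarrow> 'a) \<Rightarrow> bool" where
  "closed_operator sc D T \<longleftrightarrow> linear_operator sc D T \<and> closed (operator_graph D T)"

definition adjoint_graph ::
  "('a \<Rightarrow> 'a \<Rightarrow> 'k) \<Rightarrow> 'a set \<Rightarrow> ('a \<Rightarrow> 'a) \<Rightarrow> ('a \<times> 'a) set" where
  "adjoint_graph ip D T = {(v, w). \<forall>u\<in>D. ip (T u) v = ip u w}"

definition positive_self_adjoint ::
  "('k \<Rightarrow> 'a \<Rightarrow> 'a) \<Rightarrow> ('a \<Rightarrow> 'a \<Rightarrow> 'k::real_algebra_1) \<Rightarrow>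
   'a::real_normed_vector set \<Rightarrow> ('a \<Rightarrow> 'a) \<Rightarrow> bool" where
  "positive_self_adjoint sc ip D T \<longleftrightarrow>
     linear_operator sc D T \<and> closure D = UNIV
     \<and> adjoint_graph ip D T = operator_graph D T
     \<and> (\<forall>u\<in>D. ip (T u) u \<in> \<real>\<^sub>\<ge>\<^sub>0)"

definition complexify_dom :: "'a set \<Rightarrow> 'a complexified set" where
  "complexify_dom D = {z. re_part z \<in> D \<and> im_part z \<in> D}"

definition complexify_op :: "('a \<Rightarrow> 'a) \<Rightarrow> 'a complexified \<Rightarrow> 'a complexified" where
  "complexify_op T z = Complexify (T (re_part z)) (T (im_part z))"

definition resolvent ::
  "'a::complex_normed_vector set \<Rightarrow> ('a \<Rightarrow> 'a) \<Rightarrow> complex \<Rightarrow> 'a \<Rightarrow> 'a" where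
  "resolvent D T z = inv_into D (\<lambda>u. z *\<^sub>C u - T u)"

definition resolvent_set ::
  "'a::complex_normed_vector set \<Rightarrow> ('a \<Rightarrow> 'a) \<Rightarrow> complex set" where
  "resolvent_set D T =
     {z. bij_betw (\<lambda>u. z *\<^sub>C u - T u) D UNIV \<and> bounded_linear (resolvent D T z)}"

definition sector :: "real \<Rightarrow> real \<Rightarrow> complex set" where
  "sector \<omega> \<phi> = {z. z \<noteq> of_real \<omega> \<and> \<phi> \<le> \<bar>Arg (z - of_real \<omega>)\<bar> \<and> \<bar>Arg (z - of_real \<omega>)\<bar> \<le> pi}"

definition resolvent_estimates ::
  "'a::complex_normed_vector set \<Rightarrow> ('a \<Rightarrow> 'a) \<Rightarrow> real \<Rightarrow> real \<Rightarrow> real \<Rightarrow> bool" where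
  "resolvent_estimates D T \<omega> \<phi> M \<longleftrightarrow>
     0 < \<phi> \<and> \<phi> < pi / 2 \<and> 0 < M \<and> sector \<omega> \<phi> \<subseteq> resolvent_set D T
     \<and> (\<forall>z\<in>sector \<omega> \<phi>. onorm (resolvent D T z) \<le> M / cmod (z - of_real \<omega>))"


section \<open>The semigroup as a contour integral\<close>

text \<open>The contour is parametrised by the whole real line and consists of two rays outside a bounded
  part. The boundedness of the derivative is part of the usual meaning of "piecewise continuously
  differentiable", but \<^const>\<open>piecewise_C1_differentiable_on\<close> does not control the derivative near
  the break points. That the contour passes to the right of \<open>- \<omega>\<close> means that it crosses the real axis only there,
  i.e. that it avoids the half-line \<open>]- \<infinity>, - \<omega>]\<close>.\<close>

definition semigroup_contour ::
  "'a::complex_normed_vector set \<Rightarrow> ('a \<Rightarrow> 'a) \<Rightarrow> real \<Rightarrow> real \<Rightarrow> (real \<Rightarrow> complex) \<Rightarrow> bool" where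
  "semigroup_contour D T \<omega> \<phi> \<Gamma> \<longleftrightarrow>
     (\<forall>r. \<Gamma> piecewise_C1_differentiable_on {-r..r})
     \<and> bounded (range (\<lambda>s. vector_derivative \<Gamma> (at s)))
     \<and> range \<Gamma> \<subseteq> resolvent_set D (\<lambda>u. - T u)
     \<and> (\<exists>\<psi>. pi / 2 < \<psi> \<and> \<psi> < pi - \<phi>
         \<and> (\<exists>a b r. \<forall>s\<ge>r. \<Gamma> s = a + of_real s * cis \<psi> \<and> \<Gamma> (- s) = b + of_real s * cis (- \<psi>)))
     \<and> (\<forall>s. \<Gamma> s \<in> \<real> \<longrightarrow> - \<omega> < Re (\<Gamma> s))"

definition semigroup_integrand ::
  "(real \<Rightarrow> complex) \<Rightarrow> 'a::complex_normed_vector set \<Rightarrow> ('a \<Rightarrow> 'a) \<Rightarrow> real \<Rightarrow> 'a \<Rightarrow> real \<Rightarrow> 'a" where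
  "semigroup_integrand \<Gamma> D T t u s =
     (exp (\<Gamma> s * of_real t) * vector_derivative \<Gamma> (at s)) *\<^sub>C resolvent D (\<lambda>u. - T u) (\<Gamma> s) u"

definition contour_semigroup ::
  "(real \<Rightarrow> complex) \<Rightarrow> 'a::complex_normed_vector set \<Rightarrow> ('a \<Rightarrow> 'a) \<Rightarrow> real \<Rightarrow> 'a \<Rightarrow> 'a" where
  "contour_semigroup \<Gamma> D T t u =
     (if t = 0 then u
      else (1 / (2 * \<i> * of_real pi)) *\<^sub>C integral UNIV (semigroup_integrand \<Gamma> D T t u))"

lemma resolvent_uminus:
  assumes "- z \<in> resolvent_set D T"
  shows "z \<in> resolvent_set D (\<lambda>u. - T u)"
    and "resolvent D (\<lambda>u. - T u) z v = - resolvent D T (- z) v"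
proof -
  let ?F = "\<lambda>u. (- z) *\<^sub>C u - T u" and ?G = "\<lambda>u. z *\<^sub>C u - - T u"
  have neg: "(- z) *\<^sub>C u = - (z *\<^sub>C u)" for u :: 'a
    using scaleC_scaleC[of "-1" z u] scaleC_of_real[of "-1" "z *\<^sub>C u"] by simp
  from neg have FG: "?G u = - ?F u" for u by simp
  have F: "bij_betw ?F D UNIV" "bounded_linear (resolvent D T (- z))"
    using assms by (auto simp: resolvent_set_def)
  have "bij_betw (uminus \<circ> ?F) D UNIV"
    by (rule bij_betw_trans[OF F(1)]) (simp add: bij_uminus)
  then have G: "bij_betw ?G D UNIV" by (simp add: o_def neg add.commute)
  have res: "resolvent D (\<lambda>u. - T u) z v = resolvent D T (- z) (- v)" for v
  proof -
    let ?w = "resolvent D T (- z) (- v)"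
    have "?w \<in> D" "?F ?w = - v"
      using F(1) unfolding resolvent_def bij_betw_def
      by (auto intro: inv_into_into f_inv_into_f)
    then have "?w \<in> D" "?G ?w = v" by (simp_all only: FG minus_minus)
    then show ?thesis
      using G unfolding resolvent_def[of D "\<lambda>u. - T u"] bij_betw_def
      by (metis (mono_tags, lifting) inv_into_f_f)
  qed
  then show "resolvent D (\<lambda>u. - T u) z v = - resolvent D T (- z) v"
    using F(2) by (simp add: linear_simps)
  have "bounded_linear (\<lambda>v. resolvent D T (- z) (- v))"
    by (rule bounded_linear_compose[OF F(2)]) (simp add: bounded_linear_minus bounded_linear_ident)
  then show "z \<in> resolvent_set D (\<lambda>u. - T u)"
    using G by (simp add: resolvent_set_def flip: res)
qed

lemma sector_complement:
  assumes \<psi>: "pi / 2 < \<psi>" "\<psi> < pi - \<phi>" and \<phi>: "0 < \<phi>" "\<phi> < pi / 2"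
    and r: "r \<ge> 0" and w: "w = 1 + of_real r * cis \<psi> \<or> w = 1 + of_real r * cis (- \<psi>)"
  shows "w \<noteq> 0" "\<phi> \<le> \<bar>Arg (- w)\<bar>" "w \<in> \<real> \<Longrightarrow> 0 < Re w"
proof -
  have s: "sin \<psi> > 0" using \<psi> \<phi> by (intro sin_gt_zero) auto
  have Re: "Re w = 1 + r * cos \<psi>" and Im: "\<bar>Im w\<bar> = r * sin \<psi>"
    using w r s by (auto simp: abs_mult)
  have key: "sin \<psi> * Re w - cos \<psi> * \<bar>Im w\<bar> = sin \<psi>"
    unfolding Re Im by (simp add: algebra_simps)
  show "w \<noteq> 0" using key s by auto
  show "0 < Re w" if "w \<in> \<real>"
    using that Im Re s by (auto simp: complex_is_Real_iff)
  show "\<phi> \<le> \<bar>Arg (- w)\<bar>"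
  proof (rule ccontr)
    assume c: "\<not> \<phi> \<le> \<bar>Arg (- w)\<bar>"
    define \<alpha> where "\<alpha> = \<bar>Arg (- w)\<bar>"
    have e: "- w = of_real (cmod w) * cis (Arg (- w))"
      using Arg_eq[of "- w"] \<open>w \<noteq> 0\<close> by (simp add: cis_conv_exp)
    have "Re (- w) = cmod w * cos (Arg (- w))" "Im (- w) = cmod w * sin (Arg (- w))"
      by (subst e, simp)+
    moreover have "cos (Arg (- w)) = cos \<alpha>" by (simp add: \<alpha>_def)
    moreover have "\<bar>sin (Arg (- w))\<bar> = sin \<alpha>"
    proof -
      have "0 \<le> sin \<alpha>" using c \<phi> by (intro sin_ge_zero) (auto simp: \<alpha>_def)
      then show ?thesis by (auto simp: \<alpha>_def abs_if split: if_splits)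
    qed
    ultimately have "Re w = - cmod w * cos \<alpha>" "\<bar>Im w\<bar> = cmod w * sin \<alpha>"
      by (auto simp: abs_mult) (metis abs_minus_cancel abs_mult abs_norm_cancel)
    with key have "- (cmod w * sin (\<psi> + \<alpha>)) = sin \<psi>"
      by (simp add: sin_add algebra_simps)
    moreover have "0 \<le> sin (\<psi> + \<alpha>)"
      using c \<psi> \<phi> by (intro sin_ge_zero) (auto simp: \<alpha>_def)
    ultimately show False using s by (smt (verit) mult_nonneg_nonneg norm_ge_zero)
  qed
qed

lemma semigroup_contour_exists:
  assumes est: "resolvent_estimates D T \<omega> \<phi> M"
  shows "\<exists>\<Gamma>. semigroup_contour D T \<omega> \<phi> \<Gamma>"
proof -
  have \<phi>: "0 < \<phi>" "\<phi> < pi / 2" using est by (auto simp: resolvent_estimates_def)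
  define \<psi> where "\<psi> = (pi / 2 + (pi - \<phi>)) / 2"
  have \<psi>: "pi / 2 < \<psi>" "\<psi> < pi - \<phi>" using \<phi> by (auto simp: \<psi>_def)
  define a where "a = complex_of_real (1 - \<omega>)"
  define \<Gamma> where "\<Gamma> = (\<lambda>s. if s \<le> 0 then a + of_real (- s) * cis (- \<psi>) else a + of_real s * cis \<psi>)"
  have w: "\<exists>r\<ge>0. \<Gamma> s + of_real \<omega> = 1 + of_real r * cis \<psi>
      \<or> \<Gamma> s + of_real \<omega> = 1 + of_real r * cis (- \<psi>)" for s
  proof -
    have "\<bar>s\<bar> \<ge> 0 \<and> (\<Gamma> s + of_real \<omega> = 1 + of_real \<bar>s\<bar> * cis \<psi>
      \<or> \<Gamma> s + of_real \<omega> = 1 + of_real \<bar>s\<bar> * cis (- \<psi>))"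
      by (auto simp: \<Gamma>_def a_def)
    then show ?thesis by blast
  qed
  have "\<Gamma> s \<in> resolvent_set D (\<lambda>u. - T u) \<and> (\<Gamma> s \<in> \<real> \<longrightarrow> - \<omega> < Re (\<Gamma> s))" for s
  proof -
    obtain r where r: "r \<ge> 0" "\<Gamma> s + of_real \<omega> = 1 + of_real r * cis \<psi>
      \<or> \<Gamma> s + of_real \<omega> = 1 + of_real r * cis (- \<psi>)" using w by blast
    note S = sector_complement[OF \<psi> \<phi> r]
    have "- \<Gamma> s - of_real \<omega> = - (\<Gamma> s + of_real \<omega>)" by simp
    then have "- \<Gamma> s \<in> sector \<omega> \<phi>"
      using S(1,2) Arg_bounded[of "- (\<Gamma> s + of_real \<omega>)"]
      unfolding sector_def by (auto simp: add_eq_0_iff)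
    then have "\<Gamma> s \<in> resolvent_set D (\<lambda>u. - T u)"
      using est resolvent_uminus(1) by (auto simp: resolvent_estimates_def)
    moreover have "- \<omega> < Re (\<Gamma> s)" if "\<Gamma> s \<in> \<real>"
      using S(3) that by (simp add: complex_is_Real_iff)
    ultimately show ?thesis by blast
  qed
  moreover have \<Gamma>': "\<Gamma> = (\<lambda>s. if s \<le> 0 then a + of_real s * (- cis (- \<psi>)) else a + of_real s * cis \<psi>)"
    by (auto simp: \<Gamma>_def)
  moreover have "bounded (range (\<lambda>s. vector_derivative \<Gamma> (at s)))"
  proof -
    have line: "((\<lambda>s. a + of_real s * c) has_vector_derivative c) (at s)" for c s
      by (auto intro!: derivative_eq_intros)
    have "vector_derivative \<Gamma> (at s) = cis \<psi>" if "s > 0" for s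
      using that by (intro vector_derivative_at has_vector_derivative_transform_within_open
          [OF line, where S = "{0<..}"]) (auto simp: \<Gamma>_def)
    moreover have "vector_derivative \<Gamma> (at s) = - cis (- \<psi>)" if "s < 0" for s
      using that by (intro vector_derivative_at has_vector_derivative_transform_within_open
          [OF line, where S = "{..<0}"]) (auto simp: \<Gamma>_def)
    ultimately have "range (\<lambda>s. vector_derivative \<Gamma> (at s))
        \<subseteq> {cis \<psi>, - cis (- \<psi>), vector_derivative \<Gamma> (at 0)}"
      by auto (metis linorder_neqE_linordered_idom)
    then show ?thesis by (rule bounded_subset[rotated]) (simp add: finite_imp_bounded)
  qed
  moreover have "\<Gamma> piecewise_C1_differentiable_on {-r..r}" for r
  proof (cases "r \<ge> 0")
    case True
    have C1: "(\<lambda>s. b + of_real s * c) piecewise_C1_differentiable_on S" for b c :: complex and S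
      by (intro C1_differentiable_imp_piecewise C1_differentiable_on_add C1_differentiable_on_mult
          C1_differentiable_on_of_real C1_differentiable_on_const)
    then show ?thesis
      unfolding \<Gamma>' using True by (intro piecewise_C1_differentiable_cases C1) auto
  next
    case False
    then show ?thesis by (auto simp: piecewise_C1_differentiable_on_def)
  qed
  moreover have "\<forall>s\<ge>1. \<Gamma> s = a + of_real s * cis \<psi> \<and> \<Gamma> (- s) = a + of_real s * cis (- \<psi>)"
    by (auto simp: \<Gamma>_def)
  ultimately have "semigroup_contour D T \<omega> \<phi> \<Gamma>"
    unfolding semigroup_contour_def using \<psi> by blast
  then show ?thesis by blast
qed


section \<open>The differential operator\<close>

definition test_function :: "(real \<Rightarrow> real) \<Rightarrow> bool" where
  "test_function \<theta> \<longleftrightarrow>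
     (\<forall>n x. (deriv ^^ n) \<theta> differentiable (at x)) \<and> compact (closure {x. \<theta> x \<noteq> 0})"

definition weak_derivative ::
  "nat \<Rightarrow> (real \<Rightarrow> 'a::{banach, second_countable_topology}) \<Rightarrow> (real \<Rightarrow> 'a) \<Rightarrow> bool" where
  "weak_derivative k u v \<longleftrightarrow>
     (\<forall>\<theta>. test_function \<theta> \<longrightarrow>
        (LINT x|lborel. (deriv ^^ k) \<theta> x *\<^sub>R u x) = (-1) ^ k *\<^sub>R (LINT x|lborel. \<theta> x *\<^sub>R v x))"

lemma test_function_measurable:
  assumes "test_function \<theta>" shows "(deriv ^^ n) \<theta> \<in> borel_measurable borel"
proof (rule borel_measurable_continuous_onI)
  show "continuous_on UNIV ((deriv ^^ n) \<theta>)"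
    using assms unfolding test_function_def
    by (auto intro: continuous_at_imp_continuous_on differentiable_imp_continuous_within)
qed

lift_definition has_weak_deriv ::
  "nat \<Rightarrow> 'a::{banach, second_countable_topology} ul_space \<Rightarrow> 'a ul_space \<Rightarrow> bool"
  is weak_derivative
proof -
  fix k and u u' v v' :: "real \<Rightarrow> 'a"
  assume eq: "ul_eq u u'" "ul_eq v v'"
  have "(LINT x|lborel. (deriv ^^ n) \<theta> x *\<^sub>R w x) = (LINT x|lborel. (deriv ^^ n) \<theta> x *\<^sub>R w' x)"
    if w: "ul_eq w w'" and \<theta>: "test_function \<theta>" for n \<theta> and w w' :: "real \<Rightarrow> 'a"
  proof (rule integral_cong_AE)
    have [measurable]: "w \<in> borel_measurable borel" "w' \<in> borel_measurable borel"
      "(deriv ^^ n) \<theta> \<in> borel_measurable borel"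
      using w test_function_measurable[OF \<theta>] by (auto simp: ul_eq_def L2_ul_measurable)
    show "(\<lambda>x. (deriv ^^ n) \<theta> x *\<^sub>R w x) \<in> borel_measurable lborel"
      "(\<lambda>x. (deriv ^^ n) \<theta> x *\<^sub>R w' x) \<in> borel_measurable lborel"
      by simp_all
    show "AE x in lborel. (deriv ^^ n) \<theta> x *\<^sub>R w x = (deriv ^^ n) \<theta> x *\<^sub>R w' x"
      using w by (auto simp: ul_eq_def)
  qed
  from this[OF eq(1)] this[OF eq(2), of _ 0]
  show "weak_derivative k u v = weak_derivative k u' v'"
    by (simp add: weak_derivative_def)
qed

definition weak_deriv ::
  "nat \<Rightarrow> 'a::{banach, second_countable_topology} ul_space \<Rightarrow> 'a ul_space" where
  "weak_deriv k u = (THE v. has_weak_deriv k u v)"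

definition H2_ul :: "'a::{banach, second_countable_topology} ul_space set" where
  "H2_ul = {u. \<forall>k\<le>2. \<exists>v. has_weak_deriv k u v}"

text \<open>The map sending \<open>y\<close> to \<open>(y, T y)\<close> is an isometry of \<open>D\<close> with the graph norm onto the graph of
  \<open>T\<close> with the norm of the product, so \<open>f\<close> lies in the uniformly local space with values in \<open>D\<close> iff
  its composition with this map does so with values in the product.\<close>

definition has_pointwise_image ::
  "'a::{real_normed_vector, second_countable_topology} set \<Rightarrow> ('a \<Rightarrow> 'a) \<Rightarrow>
   'a ul_space \<Rightarrow> 'a ul_space \<Rightarrow> bool" where
  "has_pointwise_image D T u v \<longleftrightarrow>
     (\<exists>f. (\<forall>x. f x \<in> D) \<and> (\<lambda>x. (f x, T (f x))) \<in> L2_ul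
        \<and> u = abs_ul_space f \<and> v = abs_ul_space (\<lambda>x. T (f x)))"

definition pointwise_image ::
  "'a::{real_normed_vector, second_countable_topology} set \<Rightarrow> ('a \<Rightarrow> 'a) \<Rightarrow>
   'a ul_space \<Rightarrow> 'a ul_space" where
  "pointwise_image D T u = (THE v. has_pointwise_image D T u v)"

definition L2_ul_dom ::
  "'a::{real_normed_vector, second_countable_topology} set \<Rightarrow> ('a \<Rightarrow> 'a) \<Rightarrow> 'a ul_space set" where
  "L2_ul_dom D T = {u. \<exists>v. has_pointwise_image D T u v}"

definition A_dom ::
  "'a::{banach, second_countable_topology} set \<Rightarrow> ('a \<Rightarrow> 'a) \<Rightarrow> 'a ul_space set" where
  "A_dom D B = H2_ul \<inter> L2_ul_dom D B"

definition A_op ::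
  "'a::{banach, second_countable_topology} set \<Rightarrow> ('a \<Rightarrow> 'a) \<Rightarrow> 'a ul_space \<Rightarrow> 'a ul_space" where
  "A_op D B u = - weak_deriv 2 u + pointwise_image D B u"

end

theory Submission
  imports Defs "HOL-Probability.Sinc_Integral" "HOL-Real_Asymp.Real_Asymp" "HOL-Computational_Algebra.Polynomial"
begin

text \<open>Everything rests on the equation \<open>- u'' + B u + u - w u = f\<close> on the line, for complex \<open>w\<close> outside
  the sector \<open>\<bar>arg w\<bar> < \<pi> / 3\<close>, that is \<open>Re w \<le> \<bar>w\<bar> / 2\<close>. With \<open>w = z + 1\<close> this is the resolvent equation
  of \<open>A\<close> at \<open>z\<close>, and a solution with \<open>(1 + \<bar>w\<bar>) \<parallel>u\<parallel> \<le> C \<parallel>f\<parallel>\<close> gives the resolvent estimates for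
  \<open>\<omega> = - 1\<close> and \<open>\<phi> = \<pi> / 3\<close>. The equation is solved by energy
  estimates.

  Elements of the uniformly local space need not be square integrable, so the equation is tested with
  \<open>\<rho> u\<close>, where \<open>\<rho> x = 1 / (1 + ((x - a) / 4)\<^sup>2)\<close>. The weight varies so slowly that the term
  with \<open>\<rho>'\<close> can be absorbed. After multiplication by a number of modulus one all terms of the equation
  act in the same direction, which bounds \<open>u\<close> and \<open>u'\<close>. Testing with the Yosida approximations of \<open>B u\<close>
  bounds \<open>B u\<close>, and then the equation itself bounds \<open>u''\<close> (\<open>energy_estimate\<close>). The constants do not
  depend on the centre \<open>a\<close>. Taking the supremum over \<open>a\<close> turns weighted norms into the uniformly local
  norm, up to constants (\<open>L2_ul_weighted_bound\<close>, \<open>weighted_L2_ul\<close>).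

  Solutions are found in the Hilbert space with the weight centred at the origin. The estimate makes
  the range of the operator closed (\<open>solution_range_complete\<close>). A function orthogonal to the range,
  multiplied by the weight and smoothed by \<open>(B + 1)\<^sup>-\<^sup>1\<close>, is a strong solution of the
  adjoint equation with right-hand side zero, hence zero (\<open>orthogonal_to_range_zero\<close>). If the right-hand side is
  uniformly local, the estimates for all centres show that so is the solution (\<open>shifted_surj\<close>).

  Elements of the domain of \<open>A\<close> are bounded functions, because they have a weak derivative that is
  uniformly locally square integrable. Spikes of height \<open>sqrt n\<close> and width \<open>1 / n\<close> near every
  integer \<open>n \<ge> 2\<close> have a finite uniformly local norm, but far out they carry a unit of mass where a
  bounded function carries almost none. So they are not in the closure of the domain
  (\<open>spikes_not_in_closure\<close>).

  The integrand in the contour integral takes its values in the domain, therefore \<open>e\<^sup>-\<^sup>A\<^sup>t u\<close> lies in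
  the closure of the domain for \<open>t > 0\<close>, for every \<open>u\<close>. If \<open>u\<close> itself is not in this closure, the
  trajectory cannot converge to \<open>u\<close> (\<open>contour_semigroup_not_continuous\<close>). Real Hilbert spaces are reduced
  to complex ones, since complexification commutes with the construction of \<open>A\<close> (\<open>A_complexify\<close>).\<close>

section \<open>Test functions\<close>

lemma higher_deriv_eq:
  assumes "\<And>n x. (F n has_real_derivative F (Suc n) x) (at x)"
  shows "(deriv ^^ n) (F 0) = F n"
proof (induction n)
  case (Suc n)
  have "deriv (F n) = F (Suc n)" by (intro ext DERIV_imp_deriv assms)
  then show ?case using Suc by simp
qed simp

lemma test_functionI:
  assumes "\<And>n x. (F n has_real_derivative F (Suc n) x) (at x)"
    and "\<And>x. x \<notin> {a..b} \<Longrightarrow> F 0 x = 0"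
  shows "test_function (F 0)"
proof -
  have "{x. F 0 x \<noteq> 0} \<subseteq> {a..b}" using assms(2) by blast
  then have "closure {x. F 0 x \<noteq> 0} \<subseteq> {a..b}" by (simp add: closure_minimal)
  then have "compact (closure {x. F 0 x \<noteq> 0})"
    unfolding compact_eq_bounded_closed using bounded_subset[OF bounded_closed_interval] by auto
  then show ?thesis
    unfolding test_function_def higher_deriv_eq[of F, OF assms(1)]
    using assms(1) real_differentiable_def by blast
qed

lemma test_function_DERIV:
  assumes "test_function \<theta>"
  shows "((deriv ^^ n) \<theta> has_real_derivative (deriv ^^ Suc n) \<theta> x) (at x)"
  using assms unfolding test_function_def
  by (simp add: DERIV_deriv_iff_real_differentiable)

lemma test_function_support:
  assumes "test_function \<theta>"
  shows "\<exists>L>0. \<forall>n x. x \<notin> {-L..L} \<longrightarrow> (deriv ^^ n) \<theta> x = 0"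
proof -
  have "bounded {x. \<theta> x \<noteq> 0}"
    using assms bounded_subset[OF compact_imp_bounded closure_subset]
    unfolding test_function_def by blast
  then obtain L where L: "L > 0" "\<And>x. \<theta> x \<noteq> 0 \<Longrightarrow> \<bar>x\<bar> \<le> L"
    unfolding bounded_pos by auto
  have "\<forall>x. x \<notin> {-L..L} \<longrightarrow> (deriv ^^ n) \<theta> x = 0" for n
  proof (induction n)
    case 0
    then show ?case using L(2) by force
  next
    case (Suc n)
    show ?case
    proof (intro allI impI)
      fix x assume x: "x \<notin> {-L..L}"
      have "((\<lambda>x. 0) has_real_derivative 0) (at x)" by simp
      then have "((deriv ^^ n) \<theta> has_real_derivative 0) (at x)"
        by (rule has_field_derivative_transform_within_open[of _ _ _ "- {-L..L}"]) (use x Suc in auto)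
      then show "(deriv ^^ Suc n) \<theta> x = 0"
        using test_function_DERIV[OF assms, of n x] DERIV_unique by blast
    qed
  qed
  then show ?thesis using L(1) by blast
qed

lemma test_function_deriv:
  assumes "test_function \<theta>" shows "test_function (deriv \<theta>)"
proof -
  obtain L where L: "\<forall>n x. x \<notin> {-L..L} \<longrightarrow> (deriv ^^ n) \<theta> x = 0"
    using test_function_support[OF assms] by blast
  have "test_function ((deriv ^^ Suc 0) \<theta>)"
  proof (rule test_functionI[where F = "\<lambda>n. (deriv ^^ Suc n) \<theta>" and a = "-L" and b = L])
    show "((deriv ^^ Suc n) \<theta> has_real_derivative (deriv ^^ Suc (Suc n)) \<theta> x) (at x)" for n x
      by (rule test_function_DERIV[OF assms])
    show "(deriv ^^ Suc 0) \<theta> x = 0" if "x \<notin> {-L..L}" for x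
      using L that by blast
  qed
  then show ?thesis by simp
qed

lemma test_function_linear:
  assumes "test_function \<theta>" "test_function \<eta>"
  shows "test_function (\<lambda>x. \<theta> x + c * \<eta> x)"
    and "(deriv ^^ n) (\<lambda>x. \<theta> x + c * \<eta> x) = (\<lambda>x. (deriv ^^ n) \<theta> x + c * (deriv ^^ n) \<eta> x)"
proof -
  let ?F = "\<lambda>n x. (deriv ^^ n) \<theta> x + c * (deriv ^^ n) \<eta> x"
  have D: "(?F n has_real_derivative ?F (Suc n) x) (at x)" for n x
    by (intro derivative_intros DERIV_cmult test_function_DERIV assms)
  obtain L where L: "\<forall>n x. x \<notin> {-L..L} \<longrightarrow> (deriv ^^ n) \<theta> x = 0"
    using test_function_support[OF assms(1)] by blast
  obtain K where K: "\<forall>n x. x \<notin> {-K..K} \<longrightarrow> (deriv ^^ n) \<eta> x = 0"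
    using test_function_support[OF assms(2)] by blast
  have "test_function (?F 0)"
  proof (rule test_functionI[where F = ?F and a = "- max L K" and b = "max L K"])
    fix x assume "x \<notin> {- max L K..max L K}"
    then have "x \<notin> {-L..L}" "x \<notin> {-K..K}" by auto
    then show "?F 0 x = 0" using L[rule_format, where n = 0 and x = x] K[rule_format, where n = 0 and x = x] by simp
  qed (rule D)
  then show "test_function (\<lambda>x. \<theta> x + c * \<eta> x)" by simp
  show "(deriv ^^ n) (\<lambda>x. \<theta> x + c * \<eta> x) = ?F n"
    using higher_deriv_eq[of ?F n, OF D] by simp
qed

lemma test_function_antiderivative:
  assumes "test_function \<theta>" "\<And>x. (\<Theta> has_real_derivative \<theta> x) (at x)"
    and "\<And>x. x \<notin> {a..b} \<Longrightarrow> \<Theta> x = 0"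
  shows "test_function \<Theta>" "deriv \<Theta> = \<theta>"
proof -
  let ?F = "\<lambda>n. if n = 0 then \<Theta> else (deriv ^^ (n - 1)) \<theta>"
  have D: "(?F n has_real_derivative ?F (Suc n) x) (at x)" for n x
  proof (cases n)
    case 0
    then show ?thesis using assms(2) by simp
  next
    case (Suc m)
    then show ?thesis using test_function_DERIV[OF assms(1), of m x] by simp
  qed
  have "test_function (?F 0)"
    by (rule test_functionI[where F = ?F and a = a and b = b]) (rule D, simp add: assms(3))
  then show "test_function \<Theta>" by simp
  show "deriv \<Theta> = \<theta>" by (intro ext DERIV_imp_deriv assms(2))
qed

text \<open>These functions on the half-line, extended by zero, are closed under differentiation. This yields
  smooth functions with compact support without computing higher derivatives.\<close>

definition flat :: "real poly \<Rightarrow> real \<Rightarrow> real" where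
  "flat p x = (if x > 0 then poly p (1 / x) * exp (- (1 / x)) else 0)"

lemma flat_over_x_tendsto: "((\<lambda>x. flat p x / x) \<longlongrightarrow> 0) (at 0)"
proof -
  have "((\<lambda>t::real. poly q t / exp t) \<longlongrightarrow> 0) at_top" for q :: "real poly"
  proof -
    have "((\<lambda>t::real. \<Sum>i\<le>degree q. coeff q i * (t ^ i / exp t)) \<longlongrightarrow> (\<Sum>i\<le>degree q. coeff q i * 0)) at_top"
      by (intro tendsto_intros tendsto_power_div_exp_0)
    then show ?thesis by (simp add: poly_altdef sum_divide_distrib)
  qed
  from filterlim_compose[OF this[of "pCons 0 p"] filterlim_inverse_at_top_right]
  have "((\<lambda>x. flat p x / x) \<longlongrightarrow> 0) (at_right 0)"
    by (rule Lim_transform_eventually)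
      (auto simp: flat_def exp_minus field_simps eventually_at_right_less intro!: eventually_at_rightI[of 0 1])
  moreover have "((\<lambda>x. flat p x / x) \<longlongrightarrow> 0) (at_left 0)"
    by (rule tendsto_eventually) (auto simp: flat_def intro!: eventually_at_leftI[of "-1"])
  ultimately show ?thesis by (simp add: filterlim_at_split)
qed

lemma DERIV_flat: "\<exists>q. \<forall>x. (flat p has_real_derivative flat q x) (at x)"
proof -
  define q where "q = [:0, 0, 1:] * (p - pderiv p)"
  have "(flat p has_real_derivative flat q x) (at x)" for x
  proof (cases x "0::real" rule: linorder_cases)
    case less
    have "((\<lambda>x. 0) has_real_derivative 0) (at x)" by simp
    then have "(flat p has_real_derivative 0) (at x)"
      by (rule has_field_derivative_transform_within_open[of _ _ _ "{..<0}"]) (use less in \<open>auto simp: flat_def\<close>)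
    then show ?thesis using less by (simp add: flat_def)
  next
    case equal
    show ?thesis
      using flat_over_x_tendsto[of p] unfolding equal has_field_derivative_iff
      by (simp add: flat_def)
  next
    case greater
    have "((\<lambda>x. poly p (1 / x) * exp (- (1 / x))) has_real_derivative
        poly q (1 / x) * exp (- (1 / x))) (at x)"
      using greater
      by (auto intro!: derivative_eq_intros poly_DERIV[THEN DERIV_chain2] simp: q_def field_simps power2_eq_square)
    then have "(flat p has_real_derivative poly q (1 / x) * exp (- (1 / x))) (at x)"
      by (rule has_field_derivative_transform_within_open[of _ _ _ "{0<..}"]) (use greater in \<open>auto simp: flat_def\<close>)
    then show ?thesis using greater by (simp add: flat_def)
  qed
  then show ?thesis by blast
qed

text \<open>Affine substitutions and products suffice to localise to an interval, and with linear combinations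
  the class stays closed under differentiation.\<close>

inductive_set flat_algebra :: "(real \<Rightarrow> real) set" where
  base: "(\<lambda>x. flat p (a * x + b)) \<in> flat_algebra"
| scale: "g \<in> flat_algebra \<Longrightarrow> (\<lambda>x. c * g x) \<in> flat_algebra"
| add: "g \<in> flat_algebra \<Longrightarrow> h \<in> flat_algebra \<Longrightarrow> (\<lambda>x. g x + h x) \<in> flat_algebra"
| mult: "g \<in> flat_algebra \<Longrightarrow> h \<in> flat_algebra \<Longrightarrow> (\<lambda>x. g x * h x) \<in> flat_algebra"

lemma DERIV_flat_algebra:
  assumes "g \<in> flat_algebra"
  shows "\<exists>g'\<in>flat_algebra. \<forall>x. (g has_real_derivative g' x) (at x)"
  using assms
proof induction
  case (base p a b)
  obtain q where q: "\<And>x. (flat p has_real_derivative flat q x) (at x)" using DERIV_flat by blast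
  have "((\<lambda>x. flat p (a * x + b)) has_real_derivative a * flat q (a * x + b)) (at x)" for x
    by (rule DERIV_cong[OF DERIV_chain2[OF q]]) (auto intro!: derivative_eq_intros)
  moreover have "(\<lambda>x. a * flat q (a * x + b)) \<in> flat_algebra"
    by (intro flat_algebra.scale flat_algebra.base)
  ultimately show ?case by (intro bexI[of _ "\<lambda>x. a * flat q (a * x + b)"]) auto
next
  case (scale g c)
  then obtain g' where g: "g' \<in> flat_algebra" "\<And>x. (g has_real_derivative g' x) (at x)" by blast
  show ?case
    by (intro bexI[of _ "\<lambda>x. c * g' x"] allI DERIV_cmult g(2) flat_algebra.scale g(1))
next
  case (add g h)
  then obtain g' h' where gh: "g' \<in> flat_algebra" "\<And>x. (g has_real_derivative g' x) (at x)"
    "h' \<in> flat_algebra" "\<And>x. (h has_real_derivative h' x) (at x)" by blast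
  show ?case
    by (intro bexI[of _ "\<lambda>x. g' x + h' x"] allI DERIV_add gh flat_algebra.add)
next
  case (mult g h)
  then obtain g' h' where gh: "g' \<in> flat_algebra" "\<And>x. (g has_real_derivative g' x) (at x)"
    "h' \<in> flat_algebra" "\<And>x. (h has_real_derivative h' x) (at x)" by blast
  have "(\<lambda>x. g' x * h x + h' x * g x) \<in> flat_algebra"
    by (intro flat_algebra.add flat_algebra.mult gh(1,3) mult.hyps)
  then show ?case
    by (intro bexI[of _ "\<lambda>x. g' x * h x + h' x * g x"] allI DERIV_mult gh(2,4))
qed

lemma test_function_flat_algebra:
  assumes "g \<in> flat_algebra" "\<And>x. x \<notin> {a..b} \<Longrightarrow> g x = 0"
  shows "test_function g"
proof -
  obtain d where d: "\<And>g. g \<in> flat_algebra \<Longrightarrow> d g \<in> flat_algebra \<and> (\<forall>x. (g has_real_derivative d g x) (at x))"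
    using DERIV_flat_algebra by metis
  have mem: "(d ^^ n) g \<in> flat_algebra" for n
    by (induction n) (use assms d in auto)
  have "test_function ((d ^^ 0) g)"
  proof (rule test_functionI[where F = "\<lambda>n. (d ^^ n) g"])
    show "((d ^^ n) g has_real_derivative (d ^^ Suc n) g x) (at x)" for n x
      using d mem by simp
  qed (use assms in simp)
  then show ?thesis by simp
qed

text \<open>As \<open>n\<close> grows these functions converge to the indicator of the open interval.\<close>

definition bump :: "real \<Rightarrow> real \<Rightarrow> nat \<Rightarrow> real \<Rightarrow> real" where
  "bump a b n x = flat 1 (real n * x + - (real n * a)) * flat 1 (- real n * x + real n * b)"

lemma test_function_bump: "test_function (bump a b n)"
proof -
  have "(\<lambda>x. flat 1 (real n * x + - (real n * a)) * flat 1 (- real n * x + real n * b)) \<in> flat_algebra"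
    by (intro flat_algebra.intros)
  then have "bump a b n \<in> flat_algebra" by (simp add: bump_def[abs_def])
  moreover have "bump a b n x = 0" if "x \<notin> {a..b}" for x
  proof -
    have "real n * x \<le> real n * a \<or> real n * b \<le> real n * x"
      using that by (auto intro: mult_left_mono)
    then show ?thesis by (auto simp: bump_def flat_def)
  qed
  ultimately show ?thesis by (rule test_function_flat_algebra)
qed

lemma bump_bounds: "0 \<le> bump a b n x" "bump a b n x \<le> 1"
  by (auto simp: bump_def flat_def mult_le_one)

lemma bump_eq_0: "x \<notin> {a<..<b} \<Longrightarrow> bump a b n x = 0"
  using mult_left_mono[of x a "real n"] mult_left_mono[of b x "real n"]
  by (auto simp: bump_def flat_def)

lemma bump_tendsto: "(\<lambda>n. bump a b n x) \<longlonglongrightarrow> indicator {a<..<b} x"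
proof (cases "x \<in> {a<..<b}")
  case True
  have "(\<lambda>n. exp (- (1 / (real n * c)))) \<longlonglongrightarrow> 1" if "c > 0" for c
    using that by real_asymp
  from tendsto_mult[OF this[of "x - a"] this[of "b - x"]] True
  have "(\<lambda>n. exp (- (1 / (real n * (x - a)))) * exp (- (1 / (real n * (b - x))))) \<longlonglongrightarrow> 1" by simp
  moreover have "\<forall>\<^sub>F n in sequentially. exp (- (1 / (real n * (x - a)))) * exp (- (1 / (real n * (b - x)))) = bump a b n x"
    using eventually_gt_at_top[of 0]
    by eventually_elim (use True in \<open>auto simp: bump_def flat_def algebra_simps\<close>)
  ultimately show ?thesis using True by (auto elim: Lim_transform_eventually)
next
  case False
  then show ?thesis using bump_eq_0[OF False] by simp
qed


section \<open>Locally integrable functions\<close>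

definition locally_integrable :: "(real \<Rightarrow> 'a::{banach, second_countable_topology}) \<Rightarrow> bool" where
  "locally_integrable f \<longleftrightarrow> f \<in> borel_measurable borel \<and> (\<forall>a b. set_integrable lborel {a..b} f)"

lemma L2_loc_locally_integrable:
  assumes "u \<in> L2_loc" shows "locally_integrable u"
proof -
  have [measurable]: "u \<in> borel_measurable borel" using assms by (simp add: L2_loc_def)
  have "set_integrable lborel {a..b} u" for a b
  proof (rule set_integrable_bound)
    show "set_integrable lborel {a..b} (\<lambda>x. 1 + (norm (u x))\<^sup>2)"
      using assms borel_integrable_atLeastAtMost'[of a b "\<lambda>x. 1 :: real"]
      by (intro set_integral_add) (auto simp: L2_loc_def)
    show "set_borel_measurable lborel {a..b} u" by (simp add: set_borel_measurable_def)
    have "norm (u x) \<le> 1 + (norm (u x))\<^sup>2" for x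
      using sum_squares_bound[of 1 "norm (u x)"] norm_ge_zero[of "u x"]
      by (simp only: one_power2 mult_1_right)
    then show "AE x in lborel. x \<in> {a..b} \<longrightarrow> norm (u x) \<le> norm (1 + (norm (u x))\<^sup>2)"
      by (auto simp: order.trans[OF _ abs_ge_self])
  qed
  then show ?thesis by (simp add: locally_integrable_def)
qed

lemma locally_integrable_add:
  "locally_integrable f \<Longrightarrow> locally_integrable g \<Longrightarrow> locally_integrable (\<lambda>x. f x + g x)"
  by (auto simp: locally_integrable_def intro: set_integral_add)

lemma locally_integrable_linear:
  assumes T: "bounded_linear T" and f: "locally_integrable f"
  shows "locally_integrable (\<lambda>x. T (f x))"
proof -
  have "set_integrable lborel {a..b} (\<lambda>x. T (f x))" for a b
  proof -
    have "integrable lborel (\<lambda>x. T (indicator {a..b} x *\<^sub>R f x))"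
      using f by (intro integrable_bounded_linear[OF T]) (simp add: locally_integrable_def set_integrable_def)
    then show ?thesis by (simp add: set_integrable_def linear_cmul[OF bounded_linear.linear[OF T]])
  qed
  moreover have "(\<lambda>x. T (f x)) \<in> borel_measurable borel"
    using f borel_measurable_continuous_on[OF linear_continuous_on[OF T], of f]
    by (simp add: locally_integrable_def)
  ultimately show ?thesis by (simp add: locally_integrable_def)
qed

lemma locally_integrable_scaleR:
  "locally_integrable f \<Longrightarrow> locally_integrable (\<lambda>x. c *\<^sub>R f x)"
  by (rule locally_integrable_linear[OF bounded_linear_scaleR_right])

lemma locally_integrable_diff:
  "locally_integrable f \<Longrightarrow> locally_integrable g \<Longrightarrow> locally_integrable (\<lambda>x. f x - g x)"
  using locally_integrable_add[OF _ locally_integrable_scaleR[of g "-1"], of f] by simp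

lemma locally_integrable_bilinear:
  fixes pr :: "'a::{banach, second_countable_topology} \<Rightarrow> 'b::{banach, second_countable_topology} \<Rightarrow>
    'c::{banach, second_countable_topology}"
  assumes pr: "bounded_bilinear pr" and g: "continuous_on UNIV g" and f: "locally_integrable f"
  shows "locally_integrable (\<lambda>x. pr (g x) (f x))"
proof -
  have [measurable]: "f \<in> borel_measurable borel" using f by (simp add: locally_integrable_def)
  have [measurable]: "g \<in> borel_measurable borel" by (rule borel_measurable_continuous_onI[OF g])
  have m[measurable]: "(\<lambda>x. pr (g x) (f x)) \<in> borel_measurable borel"
    by (rule borel_measurable_continuous_Pair[where H = pr])
      (auto intro!: bounded_bilinear.continuous_on[OF pr] continuous_intros)
  obtain K where K: "K > 0" "\<And>x y. norm (pr x y) \<le> norm x * norm y * K"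
    using bounded_bilinear.pos_bounded[OF pr] by blast
  have "set_integrable lborel {a..b} (\<lambda>x. pr (g x) (f x))" for a b
  proof -
    have "compact (g ` {a..b})"
      using g by (intro compact_continuous_image) (auto intro: continuous_on_subset)
    then obtain C where C: "C > 0" "\<forall>x\<in>{a..b}. norm (g x) \<le> C"
      using compact_imp_bounded[of "g ` {a..b}"] unfolding bounded_pos by auto
    show ?thesis
    proof (rule set_integrable_bound)
      show "set_integrable lborel {a..b} (\<lambda>x. (C * K) *\<^sub>R f x)"
        using f by (auto simp: locally_integrable_def intro: set_integrable_scaleR_right)
      show "set_borel_measurable lborel {a..b} (\<lambda>x. pr (g x) (f x))"
        by (simp add: set_borel_measurable_def)
      have "norm (pr (g x) (f x)) \<le> norm ((C * K) *\<^sub>R f x)" if "x \<in> {a..b}" for x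
      proof -
        have "norm (pr (g x) (f x)) \<le> norm (g x) * norm (f x) * K" by (rule K(2))
        also have "\<dots> \<le> C * norm (f x) * K"
          using K(1) C(2) that by (intro mult_right_mono) auto
        finally show ?thesis using K(1) C(1) by (simp add: mult_ac)
      qed
      then show "AE x in lborel. x \<in> {a..b} \<longrightarrow> norm (pr (g x) (f x)) \<le> norm ((C * K) *\<^sub>R f x)"
        by simp
    qed
  qed
  then show ?thesis using m by (simp add: locally_integrable_def)
qed

lemma locally_integrable_continuous:
  fixes g :: "real \<Rightarrow> 'a::{banach, second_countable_topology}"
  shows "continuous_on UNIV g \<Longrightarrow> locally_integrable g"
  unfolding locally_integrable_def
  by (auto intro!: borel_integrable_atLeastAtMost' borel_measurable_continuous_onI
      intro: continuous_on_subset)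

lemma integrable_compact_support:
  assumes f: "locally_integrable f" and 0: "\<And>x. x \<notin> {a..b} \<Longrightarrow> f x = 0"
  shows "integrable lborel f" "integral\<^sup>L lborel f = (LINT x:{a..b}|lborel. f x)"
proof -
  have "f = (\<lambda>x. indicator {a..b} x *\<^sub>R f x)" using 0 by (force simp: indicator_def)
  moreover have "integrable lborel (\<lambda>x. indicator {a..b} x *\<^sub>R f x)"
    using f by (simp add: locally_integrable_def set_integrable_def)
  ultimately show "integrable lborel f" "integral\<^sup>L lborel f = (LINT x:{a..b}|lborel. f x)"
    by (simp_all add: set_lebesgue_integral_def)
qed

lemma test_function_continuous:
  "test_function \<theta> \<Longrightarrow> continuous_on UNIV ((deriv ^^ n) \<theta>)"
  using test_function_DERIV by (meson DERIV_continuous continuous_at_imp_continuous_on)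

lemma test_function_integrable:
  assumes \<theta>: "test_function \<theta>" and f: "locally_integrable f"
  shows "integrable lborel (\<lambda>x. (deriv ^^ n) \<theta> x *\<^sub>R f x)"
proof -
  obtain L where L: "\<forall>n x. x \<notin> {-L..L} \<longrightarrow> (deriv ^^ n) \<theta> x = 0"
    using test_function_support[OF \<theta>] by blast
  show ?thesis
    by (rule integrable_compact_support(1)[where a = "-L" and b = L,
          OF locally_integrable_bilinear[OF bounded_bilinear_scaleR test_function_continuous[OF \<theta>] f]])
      (use L in auto)
qed

lemma test_function_integrable_real:
  assumes \<theta>: "test_function \<theta>" and f: "continuous_on UNIV f"
  shows "integrable lborel (\<lambda>x. (deriv ^^ n) \<theta> x * f x)"
  using test_function_integrable[OF \<theta> locally_integrable_continuous[OF f]] by simp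

text \<open>Open intervals generate the Borel sets, so a function whose integrals over all of them are zero
  has zero integral over every bounded Borel set.\<close>

lemma AE_zero_of_interval_integrals:
  fixes w :: "real \<Rightarrow> 'a::{banach, second_countable_topology}"
  assumes w: "locally_integrable w" and 0: "\<And>a b. (LINT x:{a<..<b}|lborel. w x) = 0"
  shows "AE x in lborel. w x = 0"
proof -
  have "AE x in lborel. indicator {-real N<..<real N} x *\<^sub>R w x = 0" for N
  proof -
    let ?f = "\<lambda>x. indicator {-real N<..<real N} x *\<^sub>R w x"
    have "set_integrable lborel {-real N<..<real N} w"
      by (rule set_integrable_subset[of _ "{-real N..real N}"]) (use w in \<open>auto simp: locally_integrable_def\<close>)
    then have int: "integrable lborel ?f" by (simp add: set_integrable_def)
    have "(LINT x:A|lborel. ?f x) = 0" if "A \<in> sets lborel" for A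
    proof -
      have sets: "sets (lborel::real measure) = sigma_sets UNIV (range (\<lambda>(a, b). box a b))"
        by (simp add: borel_eq_box[where 'a = real])
      have "A \<in> sigma_sets UNIV (range (\<lambda>(a, b). box a b))"
        using that unfolding sets .
      then show ?thesis
      proof (induction rule: sigma_sets_induct_disjoint[rotated 2, consumes 1, case_names basic empty compl union])
        case (basic A)
        then obtain a b where A: "A = {a<..<b}" by auto
        have "(\<lambda>x. indicator A x *\<^sub>R ?f x) = (\<lambda>x. indicator {max a (-real N)<..<min b (real N)} x *\<^sub>R w x)"
          by (auto simp: A indicator_def)
        then show ?case using 0 by (simp add: set_lebesgue_integral_def)
      next
        case empty
        then show ?case by (simp add: set_lebesgue_integral_def)
      next
        case (compl A)
        then have A: "A \<in> sets lborel" unfolding sets by blast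
        have "(LINT x:UNIV - A|lborel. ?f x) = integral\<^sup>L lborel ?f - (LINT x:A|lborel. ?f x)"
          unfolding set_lebesgue_integral_def
          by (subst Bochner_Integration.integral_diff[symmetric, OF int])
            (use integrable_mult_indicator[OF A int] in \<open>auto intro!: Bochner_Integration.integral_cong
              split: split_indicator\<close>)
        moreover have "integral\<^sup>L lborel ?f = 0" using 0 by (simp add: set_lebesgue_integral_def)
        ultimately show ?case using compl by simp
      next
        case (union A)
        then have A: "A i \<in> sets lborel" for i unfolding sets by blast
        have "(LINT x:(\<Union>i. A i)|lborel. ?f x) = (\<Sum>i. (LINT x:A i|lborel. ?f x))"
        proof (rule lebesgue_integral_countable_add)
          show "set_integrable lborel (\<Union>i. A i) ?f"
            unfolding set_integrable_def by (rule integrable_mult_indicator[OF _ int]) (use A in auto)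
        qed (use A union(1) in \<open>auto simp: disjoint_family_on_def\<close>)
        then show ?case using union by simp
      qed (auto simp: Int_stable_def Int_interval)
    qed
    then show ?thesis by (rule sigma_finite_measure.density_zero[OF sigma_finite_lborel int])
  qed
  then have "AE x in lborel. \<forall>N::nat. indicator {-real N<..<real N} x *\<^sub>R w x = 0"
    unfolding AE_all_countable by blast
  then show ?thesis
  proof eventually_elim
    case (elim x)
    obtain N where "real N > \<bar>x\<bar>" using reals_Archimedean2 by blast
    then show ?case using elim[rule_format, of N] by (auto simp: indicator_def)
  qed
qed

text \<open>The indicators of intervals are dominated limits of test functions.\<close>

lemma fundamental_lemma:
  fixes w :: "real \<Rightarrow> 'a::{banach, second_countable_topology}"
  assumes w: "locally_integrable w"
    and 0: "\<And>\<theta>. test_function \<theta> \<Longrightarrow> (LINT x|lborel. \<theta> x *\<^sub>R w x) = 0"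
  shows "AE x in lborel. w x = 0"
proof (rule AE_zero_of_interval_integrals[OF w])
  fix a b :: real
  have [measurable]: "w \<in> borel_measurable borel" using w by (simp add: locally_integrable_def)
  have [measurable]: "bump a b n \<in> borel_measurable borel" for n
    using test_function_measurable[OF test_function_bump, of 0] by simp
  have "(\<lambda>n. LINT x|lborel. bump a b n x *\<^sub>R w x) \<longlonglongrightarrow> (LINT x|lborel. indicator {a<..<b} x *\<^sub>R w x)"
  proof (rule integral_dominated_convergence)
    show "integrable lborel (\<lambda>x. norm (indicator {a..b} x *\<^sub>R w x))"
      using w by (intro integrable_norm) (simp add: locally_integrable_def set_integrable_def)
    show "AE x in lborel. (\<lambda>n. bump a b n x *\<^sub>R w x) \<longlonglongrightarrow> indicator {a<..<b} x *\<^sub>R w x"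
      by (intro AE_I2 tendsto_scaleR bump_tendsto tendsto_const)
    show "AE x in lborel. norm (bump a b n x *\<^sub>R w x) \<le> norm (indicator {a..b} x *\<^sub>R w x)" for n
    proof (rule AE_I2)
      fix x
      show "norm (bump a b n x *\<^sub>R w x) \<le> norm (indicator {a..b} x *\<^sub>R w x)"
        using bump_bounds[of a b n x] bump_eq_0[of x a b n]
        by (cases "x \<in> {a<..<b}") (auto intro: mult_left_le_one_le)
    qed
  qed auto
  then show "(LINT x:{a<..<b}|lborel. w x) = 0"
    using 0[OF test_function_bump] by (simp add: set_lebesgue_integral_def LIMSEQ_const_iff)
qed


section \<open>Antiderivatives and weak derivatives\<close>

text \<open>An absolutely continuous function together with a density of its increments. The integral form
  makes sense for any Banach space and leaves the choice of the density free on null sets.\<close>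

definition antiderivative ::
  "(real \<Rightarrow> 'a::{banach, second_countable_topology}) \<Rightarrow> (real \<Rightarrow> 'a) \<Rightarrow> bool" where
  "antiderivative f f' \<longleftrightarrow> locally_integrable f'
     \<and> (\<forall>a b. a \<le> b \<longrightarrow> f b - f a = (LINT x:{a..b}|lborel. f' x))"

lemma antiderivative_diff:
  "antiderivative f f' \<Longrightarrow> a \<le> b \<Longrightarrow> f b - f a = (LINT x:{a..b}|lborel. f' x)"
  by (simp add: antiderivative_def)

lemma antiderivative_locally_integrable: "antiderivative f f' \<Longrightarrow> locally_integrable f'"
  by (simp add: antiderivative_def)

lemma locally_integrable_indicator:
  "locally_integrable f \<Longrightarrow> integrable lborel (\<lambda>x. indicator {a..b} x *\<^sub>R f x)"
  by (simp add: locally_integrable_def set_integrable_def)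

lemma antiderivative_exists:
  assumes f: "locally_integrable f"
  shows "\<exists>F. antiderivative F f"
proof -
  let ?I = "\<lambda>a b t. indicator {a..b::real} t *\<^sub>R f t"
  have [measurable]: "f \<in> borel_measurable borel" using f by (simp add: locally_integrable_def)
  note int = locally_integrable_indicator[OF f]
  define F where "F = (\<lambda>x::real. LINT t|lborel. ?I 0 x t - ?I x 0 t)"
  have "F b - F a = (LINT x:{a..b}|lborel. f x)" if "a \<le> b" for a b
  proof -
    have "F b - F a = (LINT t|lborel. (?I 0 b t - ?I b 0 t) - (?I 0 a t - ?I a 0 t))"
      unfolding F_def by (intro Bochner_Integration.integral_diff[symmetric] Bochner_Integration.integrable_diff int)
    also have "\<dots> = (LINT t|lborel. ?I a b t)"
    proof (rule integral_cong_AE)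
      show "AE t in lborel. (?I 0 b t - ?I b 0 t) - (?I 0 a t - ?I a 0 t) = ?I a b t"
        using AE_lborel_singleton[of 0] AE_lborel_singleton[of a] AE_lborel_singleton[of b]
        by eventually_elim (use that in \<open>auto simp: indicator_def\<close>)
    qed measurable
    finally show ?thesis by (simp add: set_lebesgue_integral_def)
  qed
  then show ?thesis using f by (auto simp: antiderivative_def)
qed

lemma antiderivative_continuous:
  assumes F: "antiderivative F f"
  shows "continuous_on UNIV F"
proof -
  have f: "locally_integrable f" using F by (simp add: antiderivative_def)
  have [measurable]: "f \<in> borel_measurable borel" using f by (simp add: locally_integrable_def)
  have "isCont F x" for x
  proof (rule continuous_at_sequentiallyI)
    fix u :: "nat \<Rightarrow> real" assume u: "u \<longlonglongrightarrow> x"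
    then obtain R where R: "\<And>n. \<bar>u n\<bar> \<le> R"
      using convergent_imp_Bseq[OF convergentI[OF u]] by (auto simp: Bseq_def)
    have Ru: "-R \<le> u n" for n using R[of n] by simp
    then have xR: "-R \<le> x" by (intro LIMSEQ_le_const[OF u]) blast
    have "(\<lambda>n. LINT t|lborel. indicator {-R..u n} t *\<^sub>R f t) \<longlonglongrightarrow> (LINT t|lborel. indicator {-R..x} t *\<^sub>R f t)"
    proof (rule integral_dominated_convergence)
      show "integrable lborel (\<lambda>t. norm (indicator {-R..R} t *\<^sub>R f t))"
        by (intro integrable_norm locally_integrable_indicator f)
      show "AE t in lborel. (\<lambda>n. indicator {-R..u n} t *\<^sub>R f t) \<longlonglongrightarrow> indicator {-R..x} t *\<^sub>R f t"
        using AE_lborel_singleton[of x]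
      proof eventually_elim
        case (elim t)
        have "\<forall>\<^sub>F n in sequentially. indicator {-R..x} t *\<^sub>R f t = indicator {-R..u n} t *\<^sub>R f t"
        proof (cases "t < x")
          case True
          show ?thesis using order_tendstoD(1)[OF u True]
            by eventually_elim (use True in \<open>auto simp: indicator_def\<close>)
        next
          case False
          then have "x < t" using elim by simp
          show ?thesis using order_tendstoD(2)[OF u \<open>x < t\<close>]
            by eventually_elim (use \<open>x < t\<close> in \<open>auto simp: indicator_def\<close>)
        qed
        then show ?case by (rule Lim_transform_eventually[OF tendsto_const])
      qed
      show "AE t in lborel. norm (indicator {-R..u n} t *\<^sub>R f t) \<le> norm (indicator {-R..R} t *\<^sub>R f t)" for n
        using abs_le_D1[OF R[of n]] by (intro AE_I2) (simp add: indicator_def)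
    qed measurable
    from tendsto_add[OF tendsto_const this, of "F (-R)"]
    have "(\<lambda>n. F (-R) + (LINT t|lborel. indicator {-R..u n} t *\<^sub>R f t)) \<longlonglongrightarrow>
      F (-R) + (LINT t|lborel. indicator {-R..x} t *\<^sub>R f t)" .
    moreover have "F y = F (-R) + (LINT t|lborel. indicator {-R..y} t *\<^sub>R f t)" if "-R \<le> y" for y
      using antiderivative_diff[OF F that] by (simp add: set_lebesgue_integral_def algebra_simps)
    ultimately show "(\<lambda>n. F (u n)) \<longlonglongrightarrow> F x"
      using xR Ru by presburger
  qed
  then show ?thesis by (simp add: continuous_at_imp_continuous_on)
qed

lemma antiderivative_self_locally_integrable: "antiderivative F f \<Longrightarrow> locally_integrable F"
  by (intro locally_integrable_continuous antiderivative_continuous)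

lemma antiderivative_add:
  assumes "antiderivative f f'" "antiderivative g g'"
  shows "antiderivative (\<lambda>x. f x + g x) (\<lambda>x. f' x + g' x)"
proof -
  have "(f b + g b) - (f a + g a) = (LINT x:{a..b}|lborel. f' x + g' x)" if "a \<le> b" for a b
    using antiderivative_diff[OF assms(1) that] antiderivative_diff[OF assms(2) that] assms
    by (subst set_integral_add) (auto simp: antiderivative_def locally_integrable_def algebra_simps)
  then show ?thesis using assms by (auto simp: antiderivative_def intro: locally_integrable_add)
qed

lemma antiderivative_linear:
  assumes T: "bounded_linear T" and f: "antiderivative f f'"
  shows "antiderivative (\<lambda>x. T (f x)) (\<lambda>x. T (f' x))"
proof -
  have "T (f b) - T (f a) = (LINT x:{a..b}|lborel. T (f' x))" if "a \<le> b" for a b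
  proof -
    have "T (f b) - T (f a) = T (LINT x|lborel. indicator {a..b} x *\<^sub>R f' x)"
      using antiderivative_diff[OF f that]
      by (simp add: set_lebesgue_integral_def linear_diff[OF bounded_linear.linear[OF T], symmetric])
    also have "\<dots> = (LINT x|lborel. T (indicator {a..b} x *\<^sub>R f' x))"
      by (intro integral_bounded_linear[OF T, symmetric] locally_integrable_indicator
          antiderivative_locally_integrable[OF f])
    finally show ?thesis
      by (simp add: set_lebesgue_integral_def linear_cmul[OF bounded_linear.linear[OF T]])
  qed
  then show ?thesis
    using f locally_integrable_linear[OF T] by (auto simp: antiderivative_def)
qed

lemma antiderivative_const: "antiderivative (\<lambda>x. c) (\<lambda>x. 0)"
  by (simp add: antiderivative_def locally_integrable_continuous set_lebesgue_integral_def)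

lemma antiderivative_DERIV:
  assumes F: "\<And>x. (F has_real_derivative f x) (at x)" and f: "continuous_on UNIV f"
  shows "antiderivative F f"
proof -
  have "F b - F a = (LINT x:{a..b}|lborel. f x)" if "a \<le> b" for a b
    unfolding set_lebesgue_integral_def
    by (rule integral_FTC_atLeastAtMost[OF that, symmetric])
      (use F f in \<open>auto intro: has_vector_derivative_at_within continuous_on_subset
        simp: has_real_derivative_iff_has_vector_derivative\<close>)
  then show ?thesis using f by (simp add: antiderivative_def locally_integrable_continuous)
qed

text \<open>The product rule. Expressing one of the factors by the integral of its density turns each of the two
  terms into an integral over a triangle; Fubini's theorem shows that the triangles match.\<close>

lemma antiderivative_bilinear:
  fixes pr :: "'a::{banach, second_countable_topology} \<Rightarrow> 'b::{banach, second_countable_topology} \<Rightarrow>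
    'c::{banach, second_countable_topology}"
  assumes pr: "bounded_bilinear pr" and f: "antiderivative f f'" and g: "antiderivative g g'"
  shows "antiderivative (\<lambda>x. pr (f x) (g x)) (\<lambda>x. pr (f' x) (g x) + pr (f x) (g' x))"
proof -
  interpret pr: bounded_bilinear pr by (rule pr)
  have f': "locally_integrable f'" and g': "locally_integrable g'"
    using f g by (auto simp: antiderivative_def)
  have [measurable]: "f' \<in> borel_measurable borel" "g' \<in> borel_measurable borel"
    using f' g' by (auto simp: locally_integrable_def)
  have L1: "locally_integrable (\<lambda>x. pr (f' x) (g x))"
    using locally_integrable_bilinear[OF pr.flip antiderivative_continuous[OF g] f'] .
  have L2: "locally_integrable (\<lambda>x. pr (f x) (g' x))"
    using locally_integrable_bilinear[OF pr antiderivative_continuous[OF f] g'] .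
  have [measurable]: "(\<lambda>p. pr (h1 p) (h2 p)) \<in> borel_measurable M"
    if "h1 \<in> borel_measurable M" "h2 \<in> borel_measurable M" for h1 h2 and M :: "'z measure"
    by (rule borel_measurable_continuous_Pair[OF that, of pr])
      (auto intro!: pr.continuous_on continuous_intros)
  have "pr (f b) (g b) - pr (f a) (g a) = (LINT x:{a..b}|lborel. pr (f' x) (g x) + pr (f x) (g' x))"
    if ab: "a \<le> b" for a b
  proof -
    let ?i = "\<lambda>x. indicator {a..b::real} x :: real"
    let ?F = "\<lambda>x. ?i x *\<^sub>R f' x" and ?G = "\<lambda>x. ?i x *\<^sub>R g' x"
    let ?K = "\<lambda>x y. indicator {(x, y). x \<le> y} (x, y) *\<^sub>R pr (?F x) (?G y)"
    have iF: "integrable lborel ?F" and iG: "integrable lborel ?G"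
      by (intro locally_integrable_indicator f' g')+
    obtain K where K: "K > 0" "\<And>x y. norm (pr x y) \<le> norm x * norm y * K"
      using pr.pos_bounded by blast
    have "integrable (lborel \<Otimes>\<^sub>M lborel) (\<lambda>(x, y). norm (?F x) * norm (?G y))"
    proof (rule lborel_pair.Fubini_integrable)
      show "integrable lborel (\<lambda>x. LINT y|lborel. norm (case (x, y) of (x, y) \<Rightarrow> norm (?F x) * norm (?G y)))"
        using integrable_norm[OF iF] by simp
      show "AE x in lborel. integrable lborel (\<lambda>y. case (x, y) of (x, y) \<Rightarrow> norm (?F x) * norm (?G y))"
        using integrable_norm[OF iG] by simp
    qed measurable
    then have "integrable (lborel \<Otimes>\<^sub>M lborel) (\<lambda>p. K * (case p of (x, y) \<Rightarrow> norm (?F x) * norm (?G y)))"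
      by (rule integrable_mult_right)
    then have iK: "integrable (lborel \<Otimes>\<^sub>M lborel) (case_prod ?K)"
    proof (rule Bochner_Integration.integrable_bound)
      show "case_prod ?K \<in> borel_measurable (lborel \<Otimes>\<^sub>M lborel)" by measurable
      show "AE p in lborel \<Otimes>\<^sub>M lborel. norm (case p of (x, y) \<Rightarrow> ?K x y)
          \<le> norm (K * (case p of (x, y) \<Rightarrow> norm (?F x) * norm (?G y)))"
        using K by (intro AE_I2) (auto simp: indicator_def abs_mult mult_ac pr.zero_left pr.zero_right)
    qed
    have gx: "?i x *\<^sub>R pr (f' x) (g x) = pr (?F x) (g b) - (LINT y|lborel. ?K x y)" for x
    proof (cases "x \<in> {a..b}")
      case True
      have "(LINT y|lborel. ?K x y) = (LINT y|lborel. pr (?F x) (indicator {x..b} y *\<^sub>R g' y))"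
        using True by (intro Bochner_Integration.integral_cong) (auto simp: indicator_def pr.zero_right)
      also have "\<dots> = pr (?F x) (LINT y|lborel. indicator {x..b} y *\<^sub>R g' y)"
        by (intro integral_bounded_linear pr.bounded_linear_right locally_integrable_indicator g')
      also have "\<dots> = pr (?F x) (g b - g x)"
        using antiderivative_diff[OF g, of x b] True by (simp add: set_lebesgue_integral_def)
      finally show ?thesis using True by (simp add: pr.diff_right)
    qed (simp add: pr.zero_left)
    have fy: "?i y *\<^sub>R pr (f y) (g' y) = pr (f a) (?G y) + (LINT x|lborel. ?K x y)" for y
    proof (cases "y \<in> {a..b}")
      case True
      have "(LINT x|lborel. ?K x y) = (LINT x|lborel. pr (indicator {a..y} x *\<^sub>R f' x) (?G y))"
        using True by (intro Bochner_Integration.integral_cong) (auto simp: indicator_def pr.zero_left)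
      also have "\<dots> = pr (LINT x|lborel. indicator {a..y} x *\<^sub>R f' x) (?G y)"
        by (intro integral_bounded_linear[of "\<lambda>z. pr z (?G y)"] pr.bounded_linear_left locally_integrable_indicator f')
      also have "\<dots> = pr (f y - f a) (?G y)"
        using antiderivative_diff[OF f, of a y] True by (simp add: set_lebesgue_integral_def)
      finally show ?thesis using True by (simp add: pr.diff_left)
    qed (simp add: pr.zero_right)
    have iK1: "integrable lborel (\<lambda>x. LINT y|lborel. ?K x y)"
      using lborel_pair.integrable_fst[OF iK] .
    have iK2: "integrable lborel (\<lambda>y. LINT x|lborel. ?K x y)"
      using lborel_pair.integrable_snd[OF iK] .
    have iF2: "integrable lborel (\<lambda>x. pr (?F x) (g b))"
      by (rule integrable_bounded_linear[OF pr.bounded_linear_left iF])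
    have iG2: "integrable lborel (\<lambda>x. pr (f a) (?G x))"
      by (rule integrable_bounded_linear[OF pr.bounded_linear_right iG])
    have "(LINT x:{a..b}|lborel. pr (f' x) (g x) + pr (f x) (g' x))
      = (LINT x:{a..b}|lborel. pr (f' x) (g x)) + (LINT x:{a..b}|lborel. pr (f x) (g' x))"
      using L1 L2 by (intro set_integral_add) (auto simp: locally_integrable_def)
    also have "(LINT x:{a..b}|lborel. pr (f' x) (g x))
        = (LINT x|lborel. pr (?F x) (g b)) - (LINT x|lborel. LINT y|lborel. ?K x y)"
      unfolding set_lebesgue_integral_def gx by (rule Bochner_Integration.integral_diff[OF iF2 iK1])
    also have "(LINT x|lborel. pr (?F x) (g b)) = pr (LINT x|lborel. ?F x) (g b)"
      by (rule integral_bounded_linear[OF pr.bounded_linear_left iF])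
    also have "(LINT x|lborel. ?F x) = f b - f a"
      using antiderivative_diff[OF f ab] by (simp add: set_lebesgue_integral_def)
    also have "(LINT x:{a..b}|lborel. pr (f x) (g' x))
        = (LINT y|lborel. pr (f a) (?G y)) + (LINT y|lborel. LINT x|lborel. ?K x y)"
      unfolding set_lebesgue_integral_def fy by (rule Bochner_Integration.integral_add[OF iG2 iK2])
    also have "(LINT y|lborel. pr (f a) (?G y)) = pr (f a) (LINT x|lborel. ?G x)"
      by (rule integral_bounded_linear[OF pr.bounded_linear_right iG])
    also have "(LINT x|lborel. ?G x) = g b - g a"
      using antiderivative_diff[OF g ab] by (simp add: set_lebesgue_integral_def)
    also have "(LINT y|lborel. LINT x|lborel. ?K x y) = (LINT x|lborel. LINT y|lborel. ?K x y)"
      by (rule lborel_pair.Fubini_integral[OF iK])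
    finally show ?thesis by (simp add: pr.diff_left pr.diff_right)
  qed
  then show ?thesis using locally_integrable_add[OF L1 L2] by (simp add: antiderivative_def)
qed

lemma integral_of_compactly_supported_antiderivative:
  assumes f: "antiderivative f f'" and 0: "\<And>x. x \<notin> {-L..L} \<Longrightarrow> f x = 0 \<and> f' x = 0"
  shows "integrable lborel f'" "integral\<^sup>L lborel f' = 0"
proof -
  have e: "- \<bar>L\<bar> - 1 \<notin> {-L..L}" "\<bar>L\<bar> + 1 \<notin> {-L..L}" by auto
  have s: "\<And>x. x \<notin> {- \<bar>L\<bar> - 1..\<bar>L\<bar> + 1} \<Longrightarrow> f' x = 0" using 0 by force
  note i = integrable_compact_support[OF antiderivative_locally_integrable[OF f] s]
  show "integrable lborel f'" by (rule i(1))
  have "integral\<^sup>L lborel f' = (LINT x:{- \<bar>L\<bar> - 1..\<bar>L\<bar> + 1}|lborel. f' x)" by (rule i(2))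
  also have "\<dots> = f (\<bar>L\<bar> + 1) - f (- \<bar>L\<bar> - 1)" by (rule antiderivative_diff[OF f, symmetric]) simp
  also have "\<dots> = 0" using 0[OF e(1)] 0[OF e(2)] by simp
  finally show "integral\<^sup>L lborel f' = 0" .
qed

lemma weak_derivative_antiderivative:
  assumes "antiderivative U V" shows "weak_derivative 1 U V"
  unfolding weak_derivative_def
proof (intro allI impI)
  fix \<theta> assume \<theta>: "test_function \<theta>"
  obtain L where L: "\<forall>n x. x \<notin> {-L..L} \<longrightarrow> (deriv ^^ n) \<theta> x = 0"
    using test_function_support[OF \<theta>] by blast
  have "antiderivative \<theta> (deriv \<theta>)"
    using antiderivative_DERIV[of "(deriv ^^ 0) \<theta>" "(deriv ^^ 1) \<theta>"] test_function_DERIV[OF \<theta>, of 0]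
      test_function_continuous[OF \<theta>, of 1] by simp
  note p = antiderivative_bilinear[OF bounded_bilinear_scaleR this assms]
  have "(LINT x|lborel. deriv \<theta> x *\<^sub>R U x + \<theta> x *\<^sub>R V x) = 0"
    by (rule integral_of_compactly_supported_antiderivative(2)[OF p, of L])
      (use L[rule_format, of _ 0] L[rule_format, of _ 1] in auto)
  then show "(LINT x|lborel. (deriv ^^ 1) \<theta> x *\<^sub>R U x) = (- 1) ^ 1 *\<^sub>R (LINT x|lborel. \<theta> x *\<^sub>R V x)"
    using test_function_integrable[OF \<theta> antiderivative_self_locally_integrable[OF assms], of 1]
      test_function_integrable[OF \<theta> antiderivative_locally_integrable[OF assms], of 0]
    by (simp add: eq_neg_iff_add_eq_0)
qed

lemma weak_derivative_trans:
  assumes "weak_derivative 1 U V" "weak_derivative 1 V W" shows "weak_derivative 2 U W"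
  unfolding weak_derivative_def
proof (intro allI impI)
  fix \<theta> assume \<theta>: "test_function \<theta>"
  show "(LINT x|lborel. (deriv ^^ 2) \<theta> x *\<^sub>R U x) = (- 1)\<^sup>2 *\<^sub>R (LINT x|lborel. \<theta> x *\<^sub>R W x)"
    using assms(1)[unfolded weak_derivative_def, rule_format, OF test_function_deriv[OF \<theta>]]
      assms(2)[unfolded weak_derivative_def, rule_format, OF \<theta>]
    by (simp add: numeral_2_eq_2)
qed

lemma weak_derivative_unique:
  assumes v: "locally_integrable v" and w: "locally_integrable w"
    and "weak_derivative k u v" "weak_derivative k u w"
  shows "AE x in lborel. v x = w x"
proof -
  have "AE x in lborel. v x - w x = 0"
  proof (rule fundamental_lemma[OF locally_integrable_diff[OF v w]])
    fix \<theta> assume \<theta>: "test_function \<theta>"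
    have "(- 1::real) ^ k *\<^sub>R (LINT x|lborel. \<theta> x *\<^sub>R v x) = (- 1) ^ k *\<^sub>R (LINT x|lborel. \<theta> x *\<^sub>R w x)"
      using assms(3,4) \<theta> by (simp add: weak_derivative_def)
    then show "(LINT x|lborel. \<theta> x *\<^sub>R (v x - w x)) = 0"
      using test_function_integrable[OF \<theta> v, of 0] test_function_integrable[OF \<theta> w, of 0]
      by (simp add: scaleR_diff_right)
  qed
  then show ?thesis by simp
qed

text \<open>Outside the support every antiderivative is constant on both sides, and the two constants agree
  because the total integral is zero.\<close>

lemma test_function_antiderivative_exists:
  assumes \<theta>: "test_function \<theta>" and 0: "integral\<^sup>L lborel \<theta> = 0"
  shows "\<exists>\<Theta>. test_function \<Theta> \<and> deriv \<Theta> = \<theta>"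
proof -
  obtain L where L: "L > 0" "\<forall>n x. x \<notin> {-L..L} \<longrightarrow> (deriv ^^ n) \<theta> x = 0"
    using test_function_support[OF \<theta>] by blast
  have L0: "\<theta> x = 0" if "x \<notin> {-L..L}" for x using L(2)[rule_format, of x 0] that by simp
  have c: "continuous_on UNIV \<theta>" using test_function_continuous[OF \<theta>, of 0] by simp
  obtain G where G: "\<And>x. (G has_real_derivative \<theta> x) (at x)"
    using einterval_antiderivative[of "-\<infinity>" "\<infinity>" \<theta>] c
    by (auto simp: has_real_derivative_iff_has_vector_derivative continuous_on_eq_continuous_at)
  have AG: "antiderivative G \<theta>" by (rule antiderivative_DERIV[OF G c])
  have "G L - G (-L) = (LINT x:{-L..L}|lborel. \<theta> x)"
    by (rule antiderivative_diff[OF AG]) (use L(1) in simp)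
  also have "\<dots> = integral\<^sup>L lborel \<theta>"
    by (rule integrable_compact_support(2)[OF antiderivative_locally_integrable[OF AG] L0, symmetric])
  finally have "G L - G (-L) = 0" using 0 by simp
  moreover have flat: "G b = G a" if "a \<le> b" "b \<le> -L \<or> L \<le> a" for a b
  proof -
    have "G b - G a = (LINT y:{a..b}|lborel. \<theta> y)" by (rule antiderivative_diff[OF AG that(1)])
    also have "\<dots> = (LINT y::real|lborel. 0)"
      unfolding set_lebesgue_integral_def
    proof (rule integral_cong_AE)
      show "AE y in lborel. indicator {a..b} y *\<^sub>R \<theta> y = 0"
        using AE_lborel_singleton[of a] AE_lborel_singleton[of b]
        by eventually_elim (use that(2) L0 in \<open>auto simp: indicator_def\<close>)
    qed (use borel_measurable_continuous_onI[OF c] in auto)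
    finally show ?thesis by simp
  qed
  ultimately have "G x - G (-L) = 0" if "x \<notin> {-L..L}" for x
  proof (cases "x < -L")
    case True
    then show ?thesis using flat[of x "-L"] by simp
  next
    case False
    then have "G x = G L" using that by (intro flat) auto
    then show ?thesis using \<open>G L - G (-L) = 0\<close> by simp
  qed
  moreover have "((\<lambda>x. G x - G (-L)) has_real_derivative \<theta> x) (at x)" for x
    using DERIV_diff[OF G[of x] DERIV_const[of "G (-L)"]] by simp
  ultimately show ?thesis
    using test_function_antiderivative[OF \<theta>, of "\<lambda>x. G x - G (-L)" "-L" L] by blast
qed

text \<open>The lemma of Du Bois-Reymond in second order. Subtracting from a test function a combination of a
  fixed bump and its derivative makes it a second derivative of a test function, so integration against
  \<open>w\<close> depends only on the first two moments of the test function.\<close>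

lemma affine_of_weak_derivative_zero:
  fixes w :: "real \<Rightarrow> 'a::{banach, second_countable_topology}"
  assumes w: "locally_integrable w"
    and 0: "\<And>\<theta>. test_function \<theta> \<Longrightarrow> (LINT x|lborel. (deriv ^^ 2) \<theta> x *\<^sub>R w x) = 0"
  shows "\<exists>c d. AE x in lborel. w x = c + x *\<^sub>R d"
proof -
  define k where "k = (LINT x|lborel. bump 0 1 1 x)"
  define b where "b = (\<lambda>x. (1 / k) * bump 0 1 1 x)"
  have int: "integrable lborel \<theta>" if "test_function \<theta>" for \<theta>
    using test_function_integrable_real[OF that, of "\<lambda>x. 1" 0] by simp
  have k: "k > 0"
  proof -
    have "k \<noteq> 0"
    proof
      assume "k = 0"
      then have "AE x in lborel. bump 0 1 1 x = 0"
        unfolding k_def by (subst (asm) integral_nonneg_eq_0_iff_AE) (auto simp: int test_function_bump bump_bounds)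
      then have "AE x in lborel. x \<notin> {0<..<1::real}"
        by eventually_elim (auto simp: bump_def flat_def split: if_splits)
      then have "emeasure lborel {0<..<1::real} = 0"
        by (subst (asm) AE_iff_measurable[where N = "{0<..<1}"]) auto
      then show False by simp
    qed
    moreover have "k \<ge> 0" unfolding k_def by (rule Bochner_Integration.integral_nonneg) (simp add: bump_bounds)
    ultimately show ?thesis by simp
  qed
  have tb: "test_function b"
    using test_function_linear(1)[OF test_functionI[of "\<lambda>n x. 0" 0 0] test_function_bump, of "1 / k" 0 1 1]
    by (simp add: b_def)
  have b1: "integral\<^sup>L lborel b = 1" using k by (simp add: b_def k_def)
  have split: "\<exists>\<zeta>. test_function \<zeta> \<and> deriv \<zeta> = (\<lambda>x. \<eta> x + (- integral\<^sup>L lborel \<eta>) * b x)"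
    if \<eta>: "test_function \<eta>" for \<eta>
  proof (rule test_function_antiderivative_exists)
    show "test_function (\<lambda>x. \<eta> x + (- integral\<^sup>L lborel \<eta>) * b x)"
      by (rule test_function_linear(1)[OF \<eta> tb])
    show "(LINT x|lborel. \<eta> x + (- integral\<^sup>L lborel \<eta>) * b x) = 0"
      using int[OF \<eta>] int[OF tb] b1 by simp
  qed
  define \<Lambda> where "\<Lambda> = (\<lambda>\<eta>. LINT x|lborel. \<eta> x *\<^sub>R w x)"
  have \<Lambda>: "\<Lambda> (\<lambda>x. \<eta> x + c * \<zeta> x) = \<Lambda> \<eta> + c *\<^sub>R \<Lambda> \<zeta>" if "test_function \<eta>" "test_function \<zeta>" for \<eta> \<zeta> c
    using test_function_integrable[OF that(1) w, of 0] test_function_integrable[OF that(2) w, of 0]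
    by (simp add: \<Lambda>_def scaleR_add_left flip: scaleR_scaleR)
  define m where "m = (LINT x|lborel. x * b x)"
  define d where "d = - \<Lambda> (deriv b)"
  define c where "c = \<Lambda> b - m *\<^sub>R d"
  have xint: "integrable lborel (\<lambda>x. x * \<theta> x)" if "test_function \<theta>" for \<theta>
    using test_function_integrable_real[OF that, of "\<lambda>x. x" 0] by (simp add: mult.commute)
  have main: "\<Lambda> \<eta> = integral\<^sup>L lborel \<eta> *\<^sub>R c + (LINT x|lborel. x * \<eta> x) *\<^sub>R d" if \<eta>: "test_function \<eta>" for \<eta>
  proof -
    obtain \<theta> where \<theta>: "test_function \<theta>" "deriv \<theta> = (\<lambda>x. \<eta> x + (- integral\<^sup>L lborel \<eta>) * b x)"
      using split[OF \<eta>] by blast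
    obtain \<zeta> where \<zeta>: "test_function \<zeta>" "deriv \<zeta> = (\<lambda>x. \<theta> x + (- integral\<^sup>L lborel \<theta>) * b x)"
      using split[OF \<theta>(1)] by blast
    have "(deriv ^^ 2) \<zeta> = (deriv ^^ 1) (\<lambda>x. \<theta> x + (- integral\<^sup>L lborel \<theta>) * b x)"
      by (simp add: numeral_2_eq_2 \<zeta>(2))
    also have "\<dots> = (\<lambda>x. deriv \<theta> x + (- integral\<^sup>L lborel \<theta>) * deriv b x)"
      using test_function_linear(2)[OF \<theta>(1) tb, of 1 "- integral\<^sup>L lborel \<theta>"] by simp
    finally have "\<Lambda> (\<lambda>x. deriv \<theta> x + (- integral\<^sup>L lborel \<theta>) * deriv b x) = 0"
      using 0[OF \<zeta>(1)] by (simp add: \<Lambda>_def)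
    then have 1: "\<Lambda> (deriv \<theta>) = - integral\<^sup>L lborel \<theta> *\<^sub>R d"
      using \<Lambda>[OF test_function_deriv[OF \<theta>(1)] test_function_deriv[OF tb], of "- integral\<^sup>L lborel \<theta>"]
      by (simp add: d_def)
    have 2: "\<Lambda> (deriv \<theta>) = \<Lambda> \<eta> - integral\<^sup>L lborel \<eta> *\<^sub>R \<Lambda> b"
      unfolding \<theta>(2) using \<Lambda>[OF \<eta> tb, of "- integral\<^sup>L lborel \<eta>"] by simp
    have "antiderivative (\<lambda>x. x) (\<lambda>x. 1)"
      by (rule antiderivative_DERIV) auto
    from weak_derivative_antiderivative[OF this] \<theta>(1)
    have "(LINT x|lborel. deriv \<theta> x * x) = - integral\<^sup>L lborel \<theta>"
      by (simp add: weak_derivative_def)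
    moreover have "(LINT x|lborel. deriv \<theta> x * x) = (LINT x|lborel. x * \<eta> x) - integral\<^sup>L lborel \<eta> * m"
    proof -
      have "(LINT x|lborel. deriv \<theta> x * x) = (LINT x|lborel. x * \<eta> x + (- integral\<^sup>L lborel \<eta>) * (x * b x))"
        unfolding \<theta>(2) by (intro Bochner_Integration.integral_cong) (auto simp: algebra_simps)
      also have "\<dots> = (LINT x|lborel. x * \<eta> x) + (- integral\<^sup>L lborel \<eta>) * m"
        using xint[OF \<eta>] xint[OF tb] by (simp add: m_def)
      finally show ?thesis by simp
    qed
    ultimately have "- integral\<^sup>L lborel \<theta> = (LINT x|lborel. x * \<eta> x) - integral\<^sup>L lborel \<eta> * m" by simp
    then have "\<Lambda> \<eta> - integral\<^sup>L lborel \<eta> *\<^sub>R \<Lambda> b = ((LINT x|lborel. x * \<eta> x) - integral\<^sup>L lborel \<eta> * m) *\<^sub>R d"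
      using 1 2 by (metis scaleR_minus_left)
    then show ?thesis
      by (simp add: c_def algebra_simps scaleR_diff_left scaleR_diff_right)
  qed
  have aff: "continuous_on UNIV (\<lambda>x. c + x *\<^sub>R d)" by (intro continuous_intros)
  have "AE x in lborel. w x - (c + x *\<^sub>R d) = 0"
  proof (rule fundamental_lemma[OF locally_integrable_diff[OF w locally_integrable_continuous[OF aff]]])
    fix \<eta> assume \<eta>: "test_function \<eta>"
    have "(LINT x|lborel. \<eta> x *\<^sub>R (w x - (c + x *\<^sub>R d)))
        = (LINT x|lborel. \<eta> x *\<^sub>R w x - (\<eta> x *\<^sub>R c + (x * \<eta> x) *\<^sub>R d))"
      by (intro Bochner_Integration.integral_cong) (auto simp: algebra_simps)
    also have "\<dots> = \<Lambda> \<eta> - (integral\<^sup>L lborel \<eta> *\<^sub>R c + (LINT x|lborel. x * \<eta> x) *\<^sub>R d)"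
      using test_function_integrable[OF \<eta> w, of 0] int[OF \<eta>] xint[OF \<eta>]
      by (simp add: \<Lambda>_def)
    finally show "(LINT x|lborel. \<eta> x *\<^sub>R (w x - (c + x *\<^sub>R d))) = 0" using main[OF \<eta>] by simp
  qed
  then show ?thesis by (intro exI[of _ c] exI[of _ d]) simp
qed

text \<open>The iterated antiderivative of \<open>v\<close> has the same second weak derivative as \<open>u\<close>, so the two differ by
  an affine function.\<close>

lemma second_weak_derivative_representation:
  assumes u: "locally_integrable u" and v: "locally_integrable v" and d: "weak_derivative 2 u v"
  obtains U U1 where "antiderivative U U1" "antiderivative U1 v" "AE x in lborel. u x = U x"
proof -
  obtain V1 where V1: "antiderivative V1 v" using antiderivative_exists[OF v] by blast
  obtain V where V: "antiderivative V V1"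
    using antiderivative_exists[OF antiderivative_self_locally_integrable[OF V1]] by blast
  note lV = antiderivative_self_locally_integrable[OF V]
  have dV: "weak_derivative 2 V v"
    by (rule weak_derivative_trans[OF weak_derivative_antiderivative[OF V] weak_derivative_antiderivative[OF V1]])
  have "\<exists>c d. AE x in lborel. u x - V x = c + x *\<^sub>R d"
  proof (rule affine_of_weak_derivative_zero[OF locally_integrable_diff[OF u lV]])
    fix \<theta> assume \<theta>: "test_function \<theta>"
    show "(LINT x|lborel. (deriv ^^ 2) \<theta> x *\<^sub>R (u x - V x)) = 0"
      using test_function_integrable[OF \<theta> u, of 2] test_function_integrable[OF \<theta> lV, of 2] d dV \<theta>
      by (simp add: scaleR_diff_right weak_derivative_def)
  qed
  then obtain c e where ce: "AE x in lborel. u x - V x = c + x *\<^sub>R e" by blast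
  have lin: "antiderivative (\<lambda>x. x *\<^sub>R e) (\<lambda>x. 1 *\<^sub>R e)"
    by (intro antiderivative_linear[OF bounded_linear_scaleR_left, of "\<lambda>x. x"] antiderivative_DERIV) auto
  have U: "antiderivative (\<lambda>x. V x + (c + x *\<^sub>R e)) (\<lambda>x. V1 x + (0 + 1 *\<^sub>R e))"
    by (intro antiderivative_add V antiderivative_const lin)
  have U1: "antiderivative (\<lambda>x. V1 x + (0 + 1 *\<^sub>R e)) v"
    using antiderivative_add[OF V1 antiderivative_const, of e] by simp
  show thesis
    by (rule that[OF U U1]) (use ce in \<open>auto simp: algebra_simps elim!: eventually_mono\<close>)
qed


section \<open>Completeness and minimisers in spaces of square integrable functions\<close>

lemma sq_norm_add: "(norm (x + y))\<^sup>2 \<le> 2 * (norm x)\<^sup>2 + 2 * (norm (y::'a::real_normed_vector))\<^sup>2"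
proof -
  have "(norm (x + y))\<^sup>2 \<le> (norm x + norm y)\<^sup>2" by (simp add: norm_triangle_ineq power_mono)
  also have "\<dots> \<le> 2 * (norm x)\<^sup>2 + 2 * (norm y)\<^sup>2"
    using sum_squares_bound[of "norm x" "norm y"] by (simp add: power2_sum)
  finally show ?thesis .
qed

text \<open>A subsequence with summable increments converges almost everywhere, and Fatou's lemma identifies its
  limit. The subsequence is part of the conclusion because pointwise limits are what a closed operator in
  the target space can be applied to.\<close>

lemma L2_complete:
  fixes f :: "nat \<Rightarrow> 'm \<Rightarrow> 'a::{banach, second_countable_topology}"
  assumes meas[measurable]: "\<And>n. f n \<in> borel_measurable M"
    and int: "\<And>n. integrable M (\<lambda>x. (norm (f n x))\<^sup>2)"
    and Cauchy: "\<And>e. e > 0 \<Longrightarrow> \<exists>N. \<forall>m\<ge>N. \<forall>n\<ge>N. (LINT x|M. (norm (f m x - f n x))\<^sup>2) < e"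
  obtains g r where "g \<in> borel_measurable M" "integrable M (\<lambda>x. (norm (g x))\<^sup>2)"
    "(\<lambda>n. LINT x|M. (norm (f n x - g x))\<^sup>2) \<longlonglongrightarrow> 0"
    "strict_mono (r :: nat \<Rightarrow> nat)" "AE x in M. (\<lambda>n. f (r n) x) \<longlonglongrightarrow> g x"
proof -
  have intd: "integrable M (\<lambda>x. (norm (f m x - f n x))\<^sup>2)" for m n
  proof (rule Bochner_Integration.integrable_bound)
    show "integrable M (\<lambda>x. 2 * (norm (f m x))\<^sup>2 + 2 * (norm (f n x))\<^sup>2)" using int by simp
    show "AE x in M. norm ((norm (f m x - f n x))\<^sup>2) \<le> norm (2 * (norm (f m x))\<^sup>2 + 2 * (norm (f n x))\<^sup>2)"
      using sq_norm_add[of "f m _" "- f n _"] by (intro AE_I2) simp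
  qed measurable
  have "\<exists>N. \<forall>k. \<forall>m\<ge>N k. \<forall>n\<ge>N k. (LINT x|M. (norm (f m x - f n x))\<^sup>2) < (1/4)^k"
    by (intro choice allI Cauchy) simp
  then obtain N where "\<forall>k. \<forall>m\<ge>N k. \<forall>n\<ge>N k. (LINT x|M. (norm (f m x - f n x))\<^sup>2) < (1/4)^k" ..
  note N = this[rule_format]
  define r where "r = (\<lambda>k. k + (\<Sum>i\<le>k. N i))"
  have r: "strict_mono r" by (rule strict_mono_Suc_iff[THEN iffD2]) (simp add: r_def)
  have rN: "N k \<le> r k" "N k \<le> r (Suc k)" for k
    using member_le_sum[of k "{..k}" N] by (auto simp: r_def)
  define d where "d = (\<lambda>k x. norm (f (r (Suc k)) x - f (r k) x))"
  have [measurable]: "d k \<in> borel_measurable M" for k by (simp add: d_def)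
  have "(\<integral>\<^sup>+x. (\<Sum>k. ennreal (2^k * (d k x)\<^sup>2)) \<partial>M) = (\<Sum>k. \<integral>\<^sup>+x. ennreal (2^k * (d k x)\<^sup>2) \<partial>M)"
    by (rule nn_integral_suminf) measurable
  also have "\<dots> \<le> (\<Sum>k. ennreal ((1/2)^k))"
  proof (intro suminf_le allI summableI)
    fix k
    have "(\<integral>\<^sup>+x. ennreal (2^k * (d k x)\<^sup>2) \<partial>M) = ennreal (LINT x|M. 2^k * (d k x)\<^sup>2)"
      using intd by (intro nn_integral_eq_integral) (auto simp: d_def)
    also have "\<dots> \<le> ennreal (2^k * (1/4)^k)"
      using N[OF rN(2) rN(1), of k] by (intro ennreal_leI) (simp add: d_def)
    also have "(2::real)^k * (1/4)^k = (1/2)^k"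
      unfolding power_mult_distrib[symmetric] by simp
    finally show "(\<integral>\<^sup>+x. ennreal (2^k * (d k x)\<^sup>2) \<partial>M) \<le> ennreal ((1/2)^k)" .
  qed
  also have "\<dots> = ennreal (\<Sum>k. (1/2)^k)" by (rule suminf_ennreal2) (auto simp: summable_geometric)
  finally have "(\<integral>\<^sup>+x. (\<Sum>k. ennreal (2^k * (d k x)\<^sup>2)) \<partial>M) \<noteq> \<infinity>" by (auto simp: top_unique)
  then have "AE x in M. (\<Sum>k. ennreal (2^k * (d k x)\<^sup>2)) \<noteq> \<infinity>"
    by (rule nn_integral_PInf_AE[rotated]) measurable
  then have conv: "AE x in M. convergent (\<lambda>n. f (r n) x)"
  proof eventually_elim
    case (elim x)
    have s: "summable (\<lambda>k. 2^k * (d k x)\<^sup>2)"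
      by (rule summable_suminf_not_top) (use elim in simp_all)
    have sg: "summable (\<lambda>k. (1/2) * ((1/2)^k + 2^k * (d k x)\<^sup>2))"
      by (intro summable_mult summable_add s summable_geometric) simp
    have le: "d k x \<le> (1/2) * ((1/2)^k + 2^k * (d k x)\<^sup>2)" for k
    proof -
      have "0 \<le> (1 - 2^k * d k x)\<^sup>2" by simp
      then have "2^k * (2 * d k x) \<le> 1 + 2^k * (2^k * (d k x)\<^sup>2)"
        by (simp add: power2_eq_square algebra_simps)
      then have "2^k * (2 * d k x) \<le> 2^k * (1 / 2^k + 2^k * (d k x)\<^sup>2)"
        by (simp add: distrib_left)
      then have "2 * d k x \<le> 1 / 2^k + 2^k * (d k x)\<^sup>2"
        by (rule mult_left_le_imp_le) simp
      then show ?thesis by (simp add: power_one_over)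
    qed
    have "norm (d k x) \<le> (1/2) * ((1/2)^k + 2^k * (d k x)\<^sup>2)" for k
      using le[of k] by (simp add: d_def)
    from summable_comparison_test'[OF sg this]
    have "summable (\<lambda>k. norm (f (r (Suc k)) x - f (r k) x))" by (simp only: d_def)
    then have "summable (\<lambda>k. f (r (Suc k)) x - f (r k) x)" by (rule summable_norm_cancel)
    then have "convergent (\<lambda>n. \<Sum>k<n. f (r (Suc k)) x - f (r k) x)"
      by (simp add: summable_iff_convergent)
    then have "convergent (\<lambda>n. f (r n) x - f (r 0) x)"
      by (simp add: sum_lessThan_telescope[of "\<lambda>k. f (r k) x"])
    from convergent_add[OF this convergent_const[of "f (r 0) x"]] show ?case by simp
  qed
  define g where "g = (\<lambda>x. lim (\<lambda>n. f (r n) x))"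
  have gm[measurable]: "g \<in> borel_measurable M" unfolding g_def by measurable
  have lim: "AE x in M. (\<lambda>n. f (r n) x) \<longlonglongrightarrow> g x"
    using conv by eventually_elim (simp add: g_def convergent_LIMSEQ_iff)
  have bd: "integrable M (\<lambda>x. (norm (f n x - g x))\<^sup>2) \<and> (LINT x|M. (norm (f n x - g x))\<^sup>2) \<le> e"
    if n: "n \<ge> K" and K: "\<And>m n. m \<ge> K \<Longrightarrow> n \<ge> K \<Longrightarrow> (LINT x|M. (norm (f m x - f n x))\<^sup>2) < e" for n K e
  proof -
    have e: "e \<ge> 0" using K[of K K] by simp
    have "(\<integral>\<^sup>+x. ennreal ((norm (f n x - g x))\<^sup>2) \<partial>M) =
      (\<integral>\<^sup>+x. liminf (\<lambda>k. ennreal ((norm (f n x - f (r k) x))\<^sup>2)) \<partial>M)"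
    proof (rule nn_integral_cong_AE)
      show "AE x in M. ennreal ((norm (f n x - g x))\<^sup>2) = liminf (\<lambda>k. ennreal ((norm (f n x - f (r k) x))\<^sup>2))"
        using lim
      proof eventually_elim
        case (elim x)
        then have "(\<lambda>k. ennreal ((norm (f n x - f (r k) x))\<^sup>2)) \<longlonglongrightarrow> ennreal ((norm (f n x - g x))\<^sup>2)"
          by (intro tendsto_ennrealI tendsto_intros)
        from lim_imp_Liminf[OF sequentially_bot this] show ?case by simp
      qed
    qed
    also have "\<dots> \<le> liminf (\<lambda>k. \<integral>\<^sup>+x. ennreal ((norm (f n x - f (r k) x))\<^sup>2) \<partial>M)"
      by (rule nn_integral_liminf) measurable
    also have "\<dots> \<le> liminf (\<lambda>k. ennreal e)"
    proof (rule Liminf_mono)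
      show "\<forall>\<^sub>F k in sequentially. (\<integral>\<^sup>+x. ennreal ((norm (f n x - f (r k) x))\<^sup>2) \<partial>M) \<le> ennreal e"
        using eventually_ge_at_top[of K]
      proof eventually_elim
        case (elim k)
        have "r k \<ge> K" using elim strict_mono_imp_increasing[OF r, of k] by simp
        have "(\<integral>\<^sup>+x. ennreal ((norm (f n x - f (r k) x))\<^sup>2) \<partial>M) = ennreal (LINT x|M. (norm (f n x - f (r k) x))\<^sup>2)"
          by (intro nn_integral_eq_integral intd) simp
        also have "\<dots> \<le> ennreal e" using K[OF n \<open>r k \<ge> K\<close>] by (intro ennreal_leI) simp
        finally show ?case .
      qed
    qed
    also have "\<dots> = ennreal e" by (rule Liminf_const) simp
    finally have le: "(\<integral>\<^sup>+x. ennreal ((norm (f n x - g x))\<^sup>2) \<partial>M) \<le> ennreal e" .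
    then have i: "integrable M (\<lambda>x. (norm (f n x - g x))\<^sup>2)"
      by (intro integrableI_nonneg) (simp_all add: le_less_trans[OF le])
    then have "ennreal (LINT x|M. (norm (f n x - g x))\<^sup>2) \<le> ennreal e"
      using le by (subst (asm) nn_integral_eq_integral) auto
    then show ?thesis using i e by simp
  qed
  have lim0: "(\<lambda>n. LINT x|M. (norm (f n x - g x))\<^sup>2) \<longlonglongrightarrow> 0"
  proof (rule LIMSEQ_I)
    fix e :: real assume "e > 0"
    then obtain K where K: "\<forall>m\<ge>K. \<forall>n\<ge>K. (LINT x|M. (norm (f m x - f n x))\<^sup>2) < e / 2"
      using Cauchy[of "e / 2"] by auto
    have "norm ((LINT x|M. (norm (f n x - g x))\<^sup>2) - 0) < e" if "n \<ge> K" for n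
    proof -
      have "(LINT x|M. (norm (f n x - g x))\<^sup>2) \<le> e / 2" using bd[OF that K[rule_format]] by simp
      then show ?thesis using \<open>e > 0\<close> by simp
    qed
    then show "\<exists>no. \<forall>n\<ge>no. norm ((LINT x|M. (norm (f n x - g x))\<^sup>2) - 0) < e" by blast
  qed
  have "integrable M (\<lambda>x. (norm (g x))\<^sup>2)"
  proof -
    obtain K where K: "\<forall>m\<ge>K. \<forall>n\<ge>K. (LINT x|M. (norm (f m x - f n x))\<^sup>2) < 1"
      using Cauchy[of 1] by auto
    have i: "integrable M (\<lambda>x. (norm (f K x - g x))\<^sup>2)" using bd[OF order_refl K[rule_format]] by simp
    show ?thesis
    proof (rule Bochner_Integration.integrable_bound)
      show "integrable M (\<lambda>x. 2 * (norm (f K x))\<^sup>2 + 2 * (norm (f K x - g x))\<^sup>2)" using int i by simp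
      show "AE x in M. norm ((norm (g x))\<^sup>2) \<le> norm (2 * (norm (f K x))\<^sup>2 + 2 * (norm (f K x - g x))\<^sup>2)"
      proof (rule AE_I2)
        fix x
        show "norm ((norm (g x))\<^sup>2) \<le> norm (2 * (norm (f K x))\<^sup>2 + 2 * (norm (f K x - g x))\<^sup>2)"
          using sq_norm_add[of "f K x" "g x - f K x"] by (simp add: norm_minus_commute)
      qed
    qed measurable
  qed
  from that[OF gm this lim0 r lim] show thesis .
qed

text \<open>The parallelogram law makes minimising sequences Cauchy. The set \<open>R\<close> need not consist of points
  of a normed space, \<open>N\<close> stands for the square of the distance to a given point and \<open>d\<close> for the
  square of the distance inside \<open>R\<close>.\<close>

lemma minimizer_exists:
  fixes N :: "'v \<Rightarrow> real" and d :: "'v \<Rightarrow> 'v \<Rightarrow> real"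
  assumes ne: "R \<noteq> {}" and nonneg: "\<And>r. r \<in> R \<Longrightarrow> 0 \<le> N r"
    and mid: "\<And>r s. r \<in> R \<Longrightarrow> s \<in> R \<Longrightarrow> \<exists>m\<in>R. d r s \<le> 2 * N r + 2 * N s - 4 * N m"
    and complete: "\<And>X. (\<And>n::nat. X n \<in> R) \<Longrightarrow> (\<And>e. e > 0 \<Longrightarrow> \<exists>K. \<forall>m\<ge>K. \<forall>n\<ge>K. d (X m) (X n) < e)
      \<Longrightarrow> \<exists>r\<in>R. (\<lambda>n. N (X n)) \<longlonglongrightarrow> N r"
  shows "\<exists>r\<in>R. \<forall>s\<in>R. N r \<le> N s"
proof -
  define I where "I = Inf (N ` R)"
  have bdd: "bdd_below (N ` R)" using nonneg by (intro bdd_belowI[of _ 0]) auto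
  have I: "I \<le> N r" if "r \<in> R" for r unfolding I_def by (rule cINF_lower[OF bdd that])
  have "\<exists>r\<in>R. N r < I + inverse (real (Suc n))" for n
    using cInf_lessD[of "N ` R" "I + inverse (real (Suc n))"] ne by (auto simp: I_def)
  then obtain X where X: "\<And>n. X n \<in> R" "\<And>n. N (X n) < I + inverse (real (Suc n))" by metis
  have "\<exists>r\<in>R. (\<lambda>n. N (X n)) \<longlonglongrightarrow> N r"
  proof (rule complete[OF X(1)])
    fix e :: real assume "e > 0"
    obtain K where K: "inverse (real (Suc K)) < e / 4"
      using reals_Archimedean[of "e / 4"] \<open>e > 0\<close> by auto
    have "d (X m) (X n) < e" if "m \<ge> K" "n \<ge> K" for m n
    proof -
      obtain a where a: "a \<in> R" "d (X m) (X n) \<le> 2 * N (X m) + 2 * N (X n) - 4 * N a"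
        using mid X(1) by blast
      have "inverse (real (Suc m)) \<le> inverse (real (Suc K))" "inverse (real (Suc n)) \<le> inverse (real (Suc K))"
        using that by (auto simp: divide_simps)
      then show ?thesis using a(2) I[OF a(1)] X(2)[of m] X(2)[of n] K by linarith
    qed
    then show "\<exists>K. \<forall>m\<ge>K. \<forall>n\<ge>K. d (X m) (X n) < e" by blast
  qed
  then obtain r where r: "r \<in> R" "(\<lambda>n. N (X n)) \<longlonglongrightarrow> N r" by blast
  have "(\<lambda>n. I + inverse (real (Suc n))) \<longlonglongrightarrow> I + 0"
    by (intro tendsto_add tendsto_const LIMSEQ_inverse_real_of_nat)
  then have "N r \<le> I + 0"
    by (rule LIMSEQ_le[OF r(2)]) (use X(2) in \<open>auto intro!: exI[of _ 0] less_imp_le\<close>)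
  then show ?thesis using I r(1) by force
qed

text \<open>This turns minimality of a distance along a line into orthogonality.\<close>

lemma quadratic_minimum_at_0:
  fixes b c :: real
  assumes "\<And>t. 0 \<le> 2 * t * b + t\<^sup>2 * c"
  shows "b = 0"
proof (rule ccontr)
  assume b: "b \<noteq> 0"
  define t where "t = - b / (\<bar>c\<bar> + 1)"
  have "t\<^sup>2 * c \<le> t\<^sup>2 * (\<bar>c\<bar> + 1)" by (intro mult_left_mono) auto
  also have "\<dots> = b\<^sup>2 / (\<bar>c\<bar> + 1)"
    using add_nonneg_pos[of "\<bar>c\<bar>" 1] by (simp add: t_def power2_eq_square)
  finally have "2 * t * b + t\<^sup>2 * c \<le> - (b\<^sup>2 / (\<bar>c\<bar> + 1))" by (simp add: t_def power2_eq_square)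
  moreover have "b\<^sup>2 / (\<bar>c\<bar> + 1) > 0" using b by (simp add: add_nonneg_pos)
  ultimately show False using assms[of t] by linarith
qed

lemma norm_add_scaleR_sq:
  fixes a s :: "'a::real_inner"
  shows "(norm (a + t *\<^sub>R s))\<^sup>2 = (norm a)\<^sup>2 + 2 * t * inner a s + t\<^sup>2 * (norm s)\<^sup>2"
  unfolding power2_norm_eq_inner
  by (simp add: inner_add_left inner_add_right inner_commute[of s a] power2_eq_square algebra_simps)

lemma norm_diff_midpoint_sq:
  fixes y r s :: "'a::real_inner"
  shows "(norm (r - s))\<^sup>2 = 2 * (norm (y - r))\<^sup>2 + 2 * (norm (y - s))\<^sup>2 - 4 * (norm (y - (1/2) *\<^sub>R (r + s)))\<^sup>2"
proof -
  define a b where "a = y - r" and "b = y - s"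
  have "(norm (a + 1 *\<^sub>R b))\<^sup>2 + (norm (a + (-1) *\<^sub>R b))\<^sup>2 = 2 * (norm a)\<^sup>2 + 2 * (norm b)\<^sup>2"
    unfolding norm_add_scaleR_sq by simp
  moreover have "a + (-1) *\<^sub>R b = s - r" "a + 1 *\<^sub>R b = 2 *\<^sub>R (y - (1/2) *\<^sub>R (r + s))"
    by (simp_all add: a_def b_def algebra_simps scaleR_2)
  ultimately show ?thesis
    by (simp add: power_mult_distrib norm_minus_commute a_def b_def)
qed

section \<open>Positive self-adjoint operators\<close>

locale positive_operator =
  fixes D :: "'a::{real_inner, banach, second_countable_topology} set" and B :: "'a \<Rightarrow> 'a"
  assumes psa: "positive_self_adjoint scaleR inner D B"
begin

lemma zero_dom: "0 \<in> D"
  and dom_add: "u \<in> D \<Longrightarrow> v \<in> D \<Longrightarrow> u + v \<in> D"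
  and B_add: "u \<in> D \<Longrightarrow> v \<in> D \<Longrightarrow> B (u + v) = B u + B v"
  and dom_scaleR: "u \<in> D \<Longrightarrow> c *\<^sub>R u \<in> D"
  and B_scaleR: "u \<in> D \<Longrightarrow> B (c *\<^sub>R u) = c *\<^sub>R B u"
  using psa by (auto simp: positive_self_adjoint_def linear_operator_def)

lemma B_zero: "B 0 = 0"
  using B_scaleR[OF zero_dom, of 0] by simp

lemma dom_diff: "u \<in> D \<Longrightarrow> v \<in> D \<Longrightarrow> u - v \<in> D"
  and B_diff: "u \<in> D \<Longrightarrow> v \<in> D \<Longrightarrow> B (u - v) = B u - B v"
  using dom_add[of u "(-1) *\<^sub>R v"] B_add[of u "(-1) *\<^sub>R v"] dom_scaleR[of v "-1"] B_scaleR[of v "-1"]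
  by auto

lemma in_graph_iff: "v \<in> D \<and> B v = w \<longleftrightarrow> (\<forall>u\<in>D. inner (B u) v = inner u w)"
proof -
  have "(v, w) \<in> operator_graph D B \<longleftrightarrow> (v, w) \<in> adjoint_graph inner D B"
    using psa by (simp add: positive_self_adjoint_def)
  then show ?thesis by (auto simp: operator_graph_def adjoint_graph_def)
qed

lemma symmetric: "u \<in> D \<Longrightarrow> v \<in> D \<Longrightarrow> inner (B u) v = inner u (B v)"
  using in_graph_iff by blast

lemma positive: "u \<in> D \<Longrightarrow> 0 \<le> inner (B u) u"
  using psa by (force simp: positive_self_adjoint_def nonneg_Reals_def)

lemma dense: "closure D = UNIV"
  using psa by (simp add: positive_self_adjoint_def)

lemma closed:
  assumes "\<And>n. X n \<in> D" "X \<longlonglongrightarrow> x" "(\<lambda>n. B (X n)) \<longlonglongrightarrow> y"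
  shows "x \<in> D" "B x = y"
proof -
  have "inner (B u) x = inner u y" if "u \<in> D" for u
  proof (rule LIMSEQ_unique)
    show "(\<lambda>n. inner (B u) (X n)) \<longlonglongrightarrow> inner (B u) x" by (intro tendsto_intros assms)
    show "(\<lambda>n. inner (B u) (X n)) \<longlonglongrightarrow> inner u y"
      using tendsto_inner[OF tendsto_const assms(3), of u] symmetric[OF that assms(1)] by simp
  qed
  then show "x \<in> D" "B x = y" using in_graph_iff by blast+
qed

lemma lower_bound:
  assumes "u \<in> D" "k > 0" shows "k * norm u \<le> norm (B u + k *\<^sub>R u)"
proof -
  have "k * (norm u)\<^sup>2 \<le> inner (B u + k *\<^sub>R u) u"
    using positive[OF assms(1)] by (simp add: inner_add_left power2_norm_eq_inner)
  also have "\<dots> \<le> norm (B u + k *\<^sub>R u) * norm u" by (rule norm_cauchy_schwarz)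
  finally have "(k * norm u) * norm u \<le> norm (B u + k *\<^sub>R u) * norm u" by (simp add: power2_eq_square mult_ac)
  then show ?thesis by (cases "norm u = 0") (auto simp: mult_le_cancel_right)
qed

text \<open>The lower bound makes the range of \<open>B + k\<close> closed. A vector orthogonal to the range belongs to the
  domain of the adjoint, which is \<open>B\<close>, and is an eigenvector of \<open>B\<close> for the negative number \<open>- k\<close>
  unless it is zero.\<close>

lemma shifted_surjective:
  assumes k: "k > 0" shows "\<exists>u\<in>D. B u + k *\<^sub>R u = y"
proof -
  define R where "R = (\<lambda>u. B u + k *\<^sub>R u) ` D"
  have Radd: "r + s \<in> R" if rs: "r \<in> R" "s \<in> R" for r s
  proof -
    obtain u v where "u \<in> D" "r = B u + k *\<^sub>R u" "v \<in> D" "s = B v + k *\<^sub>R v"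
      using rs by (auto simp: R_def)
    then have "u + v \<in> D" "r + s = B (u + v) + k *\<^sub>R (u + v)"
      by (auto simp: dom_add B_add algebra_simps)
    then show ?thesis unfolding R_def by (rule image_eqI[rotated])
  qed
  have Rsc: "c *\<^sub>R r \<in> R" if r: "r \<in> R" for r c
  proof -
    obtain u where "u \<in> D" "r = B u + k *\<^sub>R u" using r by (auto simp: R_def)
    then have "c *\<^sub>R u \<in> D" "c *\<^sub>R r = B (c *\<^sub>R u) + k *\<^sub>R (c *\<^sub>R u)"
      by (auto simp: dom_scaleR B_scaleR algebra_simps)
    then show ?thesis unfolding R_def by (rule image_eqI[rotated])
  qed
  have "\<exists>r\<in>R. \<forall>s\<in>R. (norm (y - r))\<^sup>2 \<le> (norm (y - s))\<^sup>2"
  proof (rule minimizer_exists[where d = "\<lambda>r s. (norm (r - s))\<^sup>2"])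
    show "R \<noteq> {}" using zero_dom by (auto simp: R_def)
    fix r s assume rs: "r \<in> R" "s \<in> R"
    show "\<exists>m\<in>R. (norm (r - s))\<^sup>2 \<le> 2 * (norm (y - r))\<^sup>2 + 2 * (norm (y - s))\<^sup>2 - 4 * (norm (y - m))\<^sup>2"
      by (intro bexI[of _ "(1/2) *\<^sub>R (r + s)"] Rsc Radd rs eq_refl norm_diff_midpoint_sq)
  next
    fix X :: "nat \<Rightarrow> 'a" assume X: "\<And>n. X n \<in> R"
      and C: "\<And>e. e > 0 \<Longrightarrow> \<exists>K. \<forall>m\<ge>K. \<forall>n\<ge>K. (norm (X m - X n))\<^sup>2 < e"
    have "Cauchy X"
    proof (rule CauchyI)
      fix e :: real assume "e > 0"
      then obtain K where "\<forall>m\<ge>K. \<forall>n\<ge>K. (norm (X m - X n))\<^sup>2 < e\<^sup>2" using C[of "e\<^sup>2"] by auto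
      then show "\<exists>K. \<forall>m\<ge>K. \<forall>n\<ge>K. norm (X m - X n) < e"
        using \<open>e > 0\<close> by (meson less_imp_le power2_less_imp_less)
    qed
    then obtain x where x: "X \<longlonglongrightarrow> x" using Cauchy_convergent convergent_def by blast
    have "\<forall>n. \<exists>u. u \<in> D \<and> X n = B u + k *\<^sub>R u" using X unfolding R_def by auto
    from choice[OF this] obtain U where U: "\<And>n. U n \<in> D" "\<And>n. X n = B (U n) + k *\<^sub>R U n"
      by blast
    have "Cauchy U"
    proof (rule CauchyI)
      fix e :: real assume "e > 0"
      then obtain K where K: "\<forall>m\<ge>K. \<forall>n\<ge>K. norm (X m - X n) < k * e"
        using CauchyD[OF \<open>Cauchy X\<close>, of "k * e"] k by auto
      have "norm (U m - U n) < e" if "m \<ge> K" "n \<ge> K" for m n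
      proof -
        have "k * norm (U m - U n) \<le> norm (X m - X n)"
          using lower_bound[OF dom_diff[OF U(1) U(1)] k, of m n] U
          by (simp add: B_diff algebra_simps)
        then have "k * norm (U m - U n) < k * e" using K that by force
        then show ?thesis using k by simp
      qed
      then show "\<exists>K. \<forall>m\<ge>K. \<forall>n\<ge>K. norm (U m - U n) < e" by blast
    qed
    then obtain u where u: "U \<longlonglongrightarrow> u" using Cauchy_convergent convergent_def by blast
    have "(\<lambda>n. B (U n)) \<longlonglongrightarrow> x - k *\<^sub>R u"
      using tendsto_diff[OF x tendsto_scaleR[OF tendsto_const[of k] u]] U(2) by simp
    from closed[OF U(1) u this] have "x \<in> R" unfolding R_def by (auto simp: image_iff intro!: bexI[of _ u])
    moreover have "(\<lambda>n. (norm (y - X n))\<^sup>2) \<longlonglongrightarrow> (norm (y - x))\<^sup>2" by (intro tendsto_intros x)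
    ultimately show "\<exists>r\<in>R. (\<lambda>n. (norm (y - X n))\<^sup>2) \<longlonglongrightarrow> (norm (y - r))\<^sup>2" by blast
  qed auto
  then obtain r where r: "r \<in> R" "\<And>s. s \<in> R \<Longrightarrow> (norm (y - r))\<^sup>2 \<le> (norm (y - s))\<^sup>2" by blast
  have orth: "inner (y - r) s = 0" if s: "s \<in> R" for s
  proof -
    have "- inner (y - r) s = 0"
    proof (rule quadratic_minimum_at_0)
      fix t :: real
      have "(norm (y - r))\<^sup>2 \<le> (norm (y - (r + t *\<^sub>R s)))\<^sup>2" by (intro r(2) Radd Rsc r(1) s)
      also have "y - (r + t *\<^sub>R s) = (y - r) + (- t) *\<^sub>R s" by simp
      finally show "0 \<le> 2 * t * (- inner (y - r) s) + t\<^sup>2 * (norm s)\<^sup>2"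
        unfolding norm_add_scaleR_sq by simp
    qed
    then show ?thesis by simp
  qed
  have "inner (B u) (y - r) = inner u (- k *\<^sub>R (y - r))" if "u \<in> D" for u
    using orth[of "B u + k *\<^sub>R u"] that by (simp add: R_def inner_add_right inner_commute)
  then have g: "y - r \<in> D" "B (y - r) = - k *\<^sub>R (y - r)" using in_graph_iff by blast+
  have "k * (norm (y - r))\<^sup>2 \<le> 0" using positive[OF g(1)] g(2) by (simp add: power2_norm_eq_inner)
  then have "y = r" using k by (simp add: mult_le_0_iff)
  then show ?thesis using r(1) by (auto simp: R_def)
qed

lemma shifted_injective:
  assumes "k > 0" "u \<in> D" "v \<in> D" "B u + k *\<^sub>R u = B v + k *\<^sub>R v"
  shows "u = v"
proof -
  have "k * norm (u - v) \<le> norm (B (u - v) + k *\<^sub>R (u - v))"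
    by (rule lower_bound[OF dom_diff]) (use assms in auto)
  also have "B (u - v) + k *\<^sub>R (u - v) = 0" using assms by (simp add: B_diff algebra_simps)
  finally show ?thesis using assms(1) by (simp add: mult_le_0_iff)
qed

definition res :: "real \<Rightarrow> 'a \<Rightarrow> 'a" where
  "res k y = (THE u. u \<in> D \<and> B u + k *\<^sub>R u = y)"

lemma res:
  assumes "k > 0" shows "res k y \<in> D" "B (res k y) = y - k *\<^sub>R res k y"
proof -
  have "\<exists>!u. u \<in> D \<and> B u + k *\<^sub>R u = y"
    using shifted_surjective[OF assms, of y] shifted_injective[OF assms] by blast
  from theI'[OF this] show "res k y \<in> D" "B (res k y) = y - k *\<^sub>R res k y"
    unfolding res_def by (auto simp: algebra_simps)
qed

lemma res_eqI: "k > 0 \<Longrightarrow> u \<in> D \<Longrightarrow> B u + k *\<^sub>R u = y \<Longrightarrow> res k y = u"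
  using res[of k y] shifted_injective[of k "res k y" u] by simp

lemma bounded_linear_res:
  assumes k: "k > 0" shows "bounded_linear (res k)"
proof (rule bounded_linear_intro[where K = "1 / k"])
  fix x y :: 'a and c :: real
  show "res k (x + y) = res k x + res k y"
    by (rule res_eqI[OF k]) (use res[OF k] in \<open>auto simp: dom_add B_add algebra_simps\<close>)
  show "res k (c *\<^sub>R x) = c *\<^sub>R res k x"
    by (rule res_eqI[OF k]) (simp_all add: dom_scaleR B_scaleR res[OF k] scaleR_diff_right)
  show "norm (res k x) \<le> norm x * (1 / k)"
    using lower_bound[OF res(1)[OF k] k, of x] res[OF k] k by (simp add: field_simps)
qed

lemma norm_res: "k > 0 \<Longrightarrow> k * norm (res k x) \<le> norm x"
  using lower_bound[OF res(1), of k k x] res[of k] by simp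

lemma res_symmetric: "k > 0 \<Longrightarrow> inner (res k x) y = inner x (res k y)"
  using symmetric[OF res(1) res(1), of k k x y] res(2)[of k]
  by (simp add: inner_diff_left inner_diff_right algebra_simps)

lemma res_positive: "k > 0 \<Longrightarrow> 0 \<le> inner (res k x) x"
proof -
  assume k: "k > 0"
  have "x = B (res k x) + k *\<^sub>R res k x" using res(2)[OF k] by simp
  then have "inner (res k x) x = inner (B (res k x)) (res k x) + k * inner (res k x) (res k x)"
    by (metis inner_add_right inner_commute inner_scaleR_right)
  then show ?thesis using positive[OF res(1)[OF k, of x]] k by simp
qed

text \<open>The Yosida approximation \<open>k B (B + k)\<^sup>-\<^sup>1\<close>, written in a form that shows its boundedness.\<close>

definition yosida :: "real \<Rightarrow> 'a \<Rightarrow> 'a" where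
  "yosida k y = k *\<^sub>R (y - k *\<^sub>R res k y)"

lemma bounded_linear_yosida: "k > 0 \<Longrightarrow> bounded_linear (yosida k)"
  unfolding yosida_def
  by (intro bounded_linear_intros bounded_linear_compose[OF bounded_linear_scaleR_right]
      bounded_linear_sub bounded_linear_ident bounded_linear_res)

lemma yosida_symmetric: "k > 0 \<Longrightarrow> inner (yosida k x) y = inner x (yosida k y)"
  by (simp add: yosida_def inner_diff_left inner_diff_right res_symmetric)

lemma yosida_positive: "k > 0 \<Longrightarrow> 0 \<le> inner (yosida k x) x"
proof -
  assume k: "k > 0"
  have "k * inner (res k x) x \<le> k * (norm (res k x) * norm x)"
    using k by (intro mult_left_mono norm_cauchy_schwarz) auto
  also have "\<dots> \<le> norm x * norm x"
    using mult_right_mono[OF norm_res[OF k, of x], of "norm x"] by (simp add: mult_ac)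
  finally have "0 \<le> inner x x - k * inner (res k x) x"
    by (simp add: power2_eq_square flip: power2_norm_eq_inner)
  then show ?thesis using k by (simp add: yosida_def inner_diff_left)
qed

lemma yosida_on_dom: "k > 0 \<Longrightarrow> u \<in> D \<Longrightarrow> yosida k u = k *\<^sub>R res k (B u)"
proof -
  assume k: "k > 0" and u: "u \<in> D"
  have "res k (B u) = u - k *\<^sub>R res k u"
    by (rule res_eqI[OF k]) (simp_all add: u dom_diff dom_scaleR B_diff B_scaleR res[OF k] scaleR_diff_right)
  then show ?thesis by (simp add: yosida_def)
qed

lemma norm_yosida_le: "k > 0 \<Longrightarrow> u \<in> D \<Longrightarrow> norm (yosida k u) \<le> norm (B u)"
  using norm_res[of k "B u"] by (simp add: yosida_on_dom)

text \<open>On the domain of \<open>B\<close> the convergence has rate \<open>1 / n\<close>; the approximating operators are contractions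
  and the domain is dense.\<close>

lemma res_tendsto: "(\<lambda>n. real (Suc n) *\<^sub>R res (real (Suc n)) y) \<longlonglongrightarrow> y"
proof (rule LIMSEQ_I)
  fix e :: real assume e: "e > 0"
  let ?J = "\<lambda>n y. real (Suc n) *\<^sub>R res (real (Suc n)) y"
  obtain u where u: "u \<in> D" "norm (y - u) < e / 3"
    using dense closure_approachable[of y D] e
    by (metis UNIV_I dist_norm norm_minus_commute zero_less_divide_iff zero_less_numeral)
  obtain K where K: "norm (B u) / (e / 3) < real K" using reals_Archimedean2 by blast
  have tri: "norm (a + b + c) < e" if "norm a < e / 3" "norm b < e / 3" "norm c < e / 3" for a b c :: 'a
    using norm_triangle_ineq[of "a + b" c] norm_triangle_ineq[of a b] that by linarith
  have "norm (?J n y - y) < e" if "n \<ge> K" for n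
  proof -
    have k: "real (Suc n) > 0" by simp
    have "?J n y - y = ?J n (y - u) + (?J n u - u) + (u - y)"
      unfolding linear_simps(2)[OF bounded_linear_res[OF k]] scaleR_diff_right by simp
    moreover have "norm (?J n (y - u)) < e / 3"
      using norm_res[OF k, of "y - u"] u(2) by simp
    moreover have "norm (?J n u - u) < e / 3"
    proof -
      have "yosida (real (Suc n)) u = real (Suc n) *\<^sub>R (u - ?J n u)" by (simp add: yosida_def)
      then have "real (Suc n) * norm (?J n u - u) \<le> norm (B u)"
        using norm_yosida_le[OF k u(1)] by (simp add: norm_minus_commute)
      also have "\<dots> < real K * (e / 3)" using K e by (simp add: field_simps)
      also have "\<dots> \<le> real (Suc n) * (e / 3)" using that e by (intro mult_right_mono) auto
      finally show ?thesis by simp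
    qed
    moreover have "norm (u - y) < e / 3" using u(2) by (simp add: norm_minus_commute)
    ultimately show ?thesis using tri by metis
  qed
  then show "\<exists>no. \<forall>n\<ge>no. norm (?J n y - y) < e" by blast
qed

end


section \<open>Weights and cutoffs\<close>

text \<open>The scale \<open>4\<close> bounds the logarithmic derivative by \<open>1 / 4\<close>, which is small enough to absorb the
  derivative of the weight into the energy.\<close>

definition weight :: "real \<Rightarrow> real \<Rightarrow> real" where
  "weight a x = 1 / (1 + ((x - a) / 4)\<^sup>2)"

definition weight_deriv :: "real \<Rightarrow> real \<Rightarrow> real" where
  "weight_deriv a x = - ((x - a) / 8) * (weight a x)\<^sup>2"

lemma weight_denom_pos: "0 < 1 + ((x - a) / 4)\<^sup>2" for x a :: real
  by (rule add_pos_nonneg) simp_all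

lemma weight_pos: "0 < weight a x"
  using weight_denom_pos by (simp add: weight_def)

lemma weight_le_1: "weight a x \<le> 1"
  using weight_denom_pos[of x a] by (simp add: weight_def divide_le_eq_1)

lemma DERIV_weight: "(weight a has_real_derivative weight_deriv a x) (at x)"
proof -
  have "((\<lambda>x. 1 / (1 + ((x - a) / 4)\<^sup>2)) has_real_derivative weight_deriv a x) (at x)"
    using weight_denom_pos[of x a]
    by (auto intro!: derivative_eq_intros simp: weight_deriv_def weight_def power2_eq_square divide_simps)
      (simp add: algebra_simps)
  then show ?thesis by (simp add: weight_def[abs_def])
qed

lemma continuous_weight: "continuous_on S (weight a)"
  by (meson DERIV_continuous DERIV_weight continuous_at_imp_continuous_on)

lemma measurable_weight [measurable]: "weight a \<in> borel_measurable borel"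
  by (rule borel_measurable_continuous_onI[OF continuous_weight])

lemma weight_deriv_bound: "\<bar>weight_deriv a x\<bar> \<le> weight a x / 4"
proof -
  define y where "y = (x - a) / 4"
  have "2 * \<bar>y\<bar> \<le> 1 + y\<^sup>2"
    using sum_squares_bound[of 1 "\<bar>y\<bar>"] by simp
  then have "2 * \<bar>y\<bar> * weight a x \<le> 1"
    using weight_denom_pos[of x a] by (simp add: weight_def y_def divide_simps)
  then have "(2 * \<bar>y\<bar> * weight a x) * (weight a x / 4) \<le> 1 * (weight a x / 4)"
    using weight_pos[of a x] by (intro mult_right_mono) auto
  then show ?thesis
    by (simp add: weight_deriv_def y_def abs_mult power2_eq_square)
qed

lemma weight_comparison: "weight a x \<le> (2 + (a - b)\<^sup>2 / 8) * weight b x"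
proof -
  define s t where "s = (x - b) / 4" and "t = (a - b) / 4"
  have "s\<^sup>2 \<le> 2 * (s - t)\<^sup>2 + 2 * t\<^sup>2"
    using zero_le_power2[of "s - 2 * t"] by (simp add: power2_eq_square algebra_simps)
  moreover have "0 \<le> 2 * t\<^sup>2 * (s - t)\<^sup>2" by simp
  moreover have "(2 + 2 * t\<^sup>2) * (1 + (s - t)\<^sup>2) = 2 + 2 * (s - t)\<^sup>2 + 2 * t\<^sup>2 + 2 * t\<^sup>2 * (s - t)\<^sup>2"
    by (simp add: distrib_left distrib_right)
  ultimately have "1 + s\<^sup>2 \<le> (2 + 2 * t\<^sup>2) * (1 + (s - t)\<^sup>2)" by linarith
  moreover have "s - t = (x - a) / 4" by (simp add: s_def t_def diff_divide_distrib)
  moreover have "2 + 2 * t\<^sup>2 = 2 + (a - b)\<^sup>2 / 8" by (simp add: t_def power_divide)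
  ultimately have le: "1 + ((x - b) / 4)\<^sup>2 \<le> (2 + (a - b)\<^sup>2 / 8) * (1 + ((x - a) / 4)\<^sup>2)"
    by (simp only: s_def)
  have "weight a x = (1 + ((x - b) / 4)\<^sup>2) / (1 + ((x - b) / 4)\<^sup>2) / (1 + ((x - a) / 4)\<^sup>2)"
    using weight_denom_pos[of x b] by (simp add: weight_def)
  also have "\<dots> \<le> ((2 + (a - b)\<^sup>2 / 8) * (1 + ((x - a) / 4)\<^sup>2)) / (1 + ((x - b) / 4)\<^sup>2) / (1 + ((x - a) / 4)\<^sup>2)"
    using weight_denom_pos[of x a] weight_denom_pos[of x b] le by (intro divide_right_mono) auto
  also have "\<dots> = (2 + (a - b)\<^sup>2 / 8) * weight b x"
    using weight_denom_pos[of x a] by (simp add: weight_def)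
  finally show ?thesis .
qed

text \<open>The square of the positive part is continuously differentiable, which makes it a convenient
  cutoff profile: the derivative is controlled by the square root of the function.\<close>

lemma DERIV_pos_part_sq: "((\<lambda>t::real. (max 0 t)\<^sup>2) has_real_derivative 2 * max 0 t) (at t)"
proof (cases t "0::real" rule: linorder_cases)
  case less
  have "((\<lambda>t. 0) has_real_derivative 2 * max 0 t) (at t)" using less by simp
  then show ?thesis
    by (rule has_field_derivative_transform_within_open[of _ _ _ "{..<0}"]) (use less in auto)
next
  case equal
  have "(\<lambda>h::real. (max 0 h)\<^sup>2 / h) \<midarrow>0\<rightarrow> 0"
  proof (rule Lim_null_comparison)
    show "\<forall>\<^sub>F h::real in at 0. norm ((max 0 h)\<^sup>2 / h) \<le> \<bar>h\<bar>"
      by (intro always_eventually allI) (auto simp: max_def power2_eq_square)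
    show "(\<lambda>h::real. \<bar>h\<bar>) \<midarrow>0\<rightarrow> 0" by (intro tendsto_eq_intros) auto
  qed
  then show ?thesis unfolding equal by (simp add: has_field_derivative_iff)
next
  case greater
  have "((\<lambda>t. t\<^sup>2) has_real_derivative 2 * max 0 t) (at t)"
    using greater by (auto intro!: derivative_eq_intros)
  then show ?thesis
    by (rule has_field_derivative_transform_within_open[of _ _ _ "{0<..}"]) (use greater in auto)
qed

definition cutoff :: "nat \<Rightarrow> real \<Rightarrow> real" where
  "cutoff n x = (max 0 (1 - (x / real n)\<^sup>2))\<^sup>2"

definition cutoff_deriv :: "nat \<Rightarrow> real \<Rightarrow> real" where
  "cutoff_deriv n x = - (2 * max 0 (1 - (x / real n)\<^sup>2) * (2 * x / (real n)\<^sup>2))"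

lemma DERIV_cutoff: "(cutoff n has_real_derivative cutoff_deriv n x) (at x)"
proof -
  have "((\<lambda>x. 1 - (x / real n)\<^sup>2) has_real_derivative - (2 * x / (real n)\<^sup>2)) (at x)"
    by (cases "n = 0") (auto intro!: derivative_eq_intros simp: power2_eq_square)
  from DERIV_chain2[OF DERIV_pos_part_sq this] show ?thesis
    by (simp add: cutoff_def[abs_def] cutoff_deriv_def)
qed

lemma cutoff_bounds: "0 \<le> cutoff n x" "cutoff n x \<le> 1"
  by (auto simp: cutoff_def max_def power_le_one)

lemma cutoff_deriv_bound:
  assumes "n > 0" shows "\<bar>cutoff_deriv n x\<bar> \<le> 4 / real n * max 0 (1 - (x / real n)\<^sup>2)"
proof (cases "\<bar>x\<bar> \<le> real n")
  case True
  have "\<bar>x\<bar> / (real n)\<^sup>2 \<le> 1 / real n" using True assms by (simp add: power2_eq_square field_simps)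
  then have "\<bar>x\<bar> / (real n)\<^sup>2 * (4 * max 0 (1 - (x / real n)\<^sup>2)) \<le> 1 / real n * (4 * max 0 (1 - (x / real n)\<^sup>2))"
    by (intro mult_right_mono) auto
  then show ?thesis by (simp add: cutoff_deriv_def abs_mult mult_ac)
next
  case False
  then have "1 \<le> (x / real n)\<^sup>2" using assms by (simp add: abs_le_square_iff[of 1 "x / real n", simplified, symmetric])
  then show ?thesis by (simp add: cutoff_deriv_def)
qed

lemma cutoff_eq_0:
  assumes "x \<notin> {-real n..real n}" "n > 0" shows "cutoff n x = 0" "cutoff_deriv n x = 0"
proof -
  have "1 \<le> (x / real n)\<^sup>2"
    using assms by (auto simp: abs_le_square_iff[of 1 "x / real n", simplified, symmetric])
  then show "cutoff n x = 0" "cutoff_deriv n x = 0" by (simp_all add: cutoff_def cutoff_deriv_def)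
qed

text \<open>The integrability of \<open>u'\<close> against the weight is a conclusion of the energy estimate, so integrating by
  parts needs a compactly supported weight. The energy estimate is uniform in the cutoff.\<close>

definition cut :: "real \<Rightarrow> nat \<Rightarrow> real \<Rightarrow> real" where
  "cut a n x = weight a x * cutoff n x"

definition cut_deriv :: "real \<Rightarrow> nat \<Rightarrow> real \<Rightarrow> real" where
  "cut_deriv a n x = weight_deriv a x * cutoff n x + cutoff_deriv n x * weight a x"

lemma DERIV_cut: "(cut a n has_real_derivative cut_deriv a n x) (at x)"
  unfolding cut_def cut_deriv_def by (intro DERIV_mult DERIV_weight DERIV_cutoff)

lemma continuous_cut: "continuous_on UNIV (cut a n)" "continuous_on UNIV (cut_deriv a n)"
proof -
  show "continuous_on UNIV (cut a n)"
    by (meson DERIV_continuous DERIV_cut continuous_at_imp_continuous_on)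
  show "continuous_on UNIV (cut_deriv a n)"
    unfolding cut_deriv_def weight_deriv_def cutoff_deriv_def cutoff_def divide_inverse
    by (intro continuous_intros continuous_weight)
qed

lemma cut_bounds: "0 \<le> cut a n x" "cut a n x \<le> weight a x"
  using weight_pos[of a x] cutoff_bounds[of n x] by (auto simp: cut_def mult_left_le)

lemma cut_eq_0: "x \<notin> {-real n..real n} \<Longrightarrow> n > 0 \<Longrightarrow> cut a n x = 0"
  "x \<notin> {-real n..real n} \<Longrightarrow> n > 0 \<Longrightarrow> cut_deriv a n x = 0"
  by (auto simp: cut_def cut_deriv_def cutoff_eq_0)

text \<open>From \<open>n = 16\<close> on the relative slope of the cutoff profile contributes at most \<open>1 / 4\<close>, like that of the
  weight.\<close>

lemma cut_deriv_sq:
  assumes n: "n \<ge> 16" shows "(cut_deriv a n x)\<^sup>2 \<le> cut a n x * weight a x / 4"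
proof -
  define m where "m = max 0 (1 - (x / real n)\<^sup>2)"
  have m: "0 \<le> m" "m \<le> 1" by (auto simp: m_def)
  have w: "0 < weight a x" by (rule weight_pos)
  have "\<bar>weight_deriv a x * cutoff n x\<bar> \<le> weight a x / 4 * m"
  proof -
    have "\<bar>weight_deriv a x * cutoff n x\<bar> = \<bar>weight_deriv a x\<bar> * m\<^sup>2"
      by (simp add: abs_mult cutoff_def m_def)
    also have "\<dots> \<le> weight a x / 4 * m"
      using m w by (intro mult_mono weight_deriv_bound) (auto simp: power2_eq_square mult_left_le)
    finally show ?thesis .
  qed
  moreover have "\<bar>cutoff_deriv n x * weight a x\<bar> \<le> weight a x / 4 * m"
  proof -
    have "\<bar>cutoff_deriv n x\<bar> \<le> 4 / real n * m" using cutoff_deriv_bound[of n x] n by (simp add: m_def)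
    also have "\<dots> \<le> 1 / 4 * m" using n m by (intro mult_right_mono) (auto simp: field_simps)
    finally have "\<bar>cutoff_deriv n x\<bar> * weight a x \<le> 1 / 4 * m * weight a x"
      using w by (intro mult_right_mono) auto
    then show ?thesis using w by (simp add: abs_mult mult_ac)
  qed
  ultimately have "\<bar>cut_deriv a n x\<bar> \<le> weight a x / 2 * m"
    unfolding cut_deriv_def by linarith
  then have "(cut_deriv a n x)\<^sup>2 \<le> (weight a x / 2 * m)\<^sup>2"
    using m w by (simp add: abs_le_square_iff[symmetric])
  also have "\<dots> = cut a n x * weight a x / 4"
    unfolding cut_def cutoff_def m_def[symmetric] by (simp add: power2_eq_square)
  finally show ?thesis .
qed

lemma cut_tendsto: "(\<lambda>n. cut a n x) \<longlonglongrightarrow> weight a x"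
proof -
  have "(\<lambda>n. x / real n) \<longlonglongrightarrow> 0" by (rule lim_const_over_n)
  then have "(\<lambda>n. weight a x * (max 0 (1 - (x / real n)\<^sup>2))\<^sup>2) \<longlonglongrightarrow> weight a x * (max 0 (1 - 0\<^sup>2))\<^sup>2"
    by (intro tendsto_intros tendsto_max)
  then show ?thesis by (simp add: cut_def cutoff_def)
qed

text \<open>The way in which the derivative of the cut weight is absorbed. Only the summand with \<open>Q\<close> involves the
  full weight: it will be built from a function known to be in the weighted space, and \<open>P\<close> from its
  derivative, about whose integrability nothing is known in advance.\<close>

lemma absorb_cut_deriv:
  assumes n: "n \<ge> 16" and t: "t\<^sup>2 \<le> P * Q" and PQ: "0 \<le> P" "0 \<le> Q"
  shows "\<bar>cut_deriv a n x * t\<bar> \<le> (cut a n x * P + weight a x * Q) / 4"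
proof -
  let ?s = "cut a n x" and ?r = "weight a x"
  have "(cut_deriv a n x * t)\<^sup>2 \<le> (?s * ?r / 4) * (P * Q)"
    unfolding power_mult_distrib
    using cut_bounds[of a n x] weight_pos[of a x] PQ by (intro mult_mono cut_deriv_sq n t) auto
  also have "\<dots> \<le> ((?s * P + ?r * Q) / 4)\<^sup>2"
    using zero_le_power2[of "?s * P - ?r * Q"] by (simp add: power2_eq_square algebra_simps)
  finally show ?thesis
    using cut_bounds[of a n x] weight_pos[of a x] PQ
    by (intro abs_le_square_iff[THEN iffD2, THEN order_trans[OF _ eq_refl]]) (auto intro!: abs_of_nonneg)
qed

text \<open>This form of Fatou's lemma removes the cutoffs from the estimates.\<close>

lemma fatou_bound:
  fixes h :: "nat \<Rightarrow> 'm \<Rightarrow> real"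
  assumes int: "\<And>n. integrable M (h n)" and nonneg: "\<And>n. AE x in M. 0 \<le> h n x"
    and lim: "AE x in M. (\<lambda>n. h n x) \<longlonglongrightarrow> H x" and K: "\<And>n. integral\<^sup>L M (h n) \<le> K"
    and H[measurable]: "H \<in> borel_measurable M"
  shows "integrable M H" "integral\<^sup>L M H \<le> K"
proof -
  have K0: "0 \<le> K" using K[of 0] Bochner_Integration.integral_nonneg_AE[OF nonneg[of 0]] by linarith
  have [measurable]: "h n \<in> borel_measurable M" for n using int by blast
  have "AE x in M. \<forall>n. 0 \<le> h n x" unfolding AE_all_countable using nonneg by blast
  then have H0: "AE x in M. 0 \<le> H x"
    using lim by eventually_elim (auto intro: LIMSEQ_le_const)
  have "(\<integral>\<^sup>+x. ennreal (H x) \<partial>M) = (\<integral>\<^sup>+x. liminf (\<lambda>n. ennreal (h n x)) \<partial>M)"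
  proof (rule nn_integral_cong_AE)
    show "AE x in M. ennreal (H x) = liminf (\<lambda>n. ennreal (h n x))"
      using lim
    proof eventually_elim
      case (elim x)
      from lim_imp_Liminf[OF sequentially_bot tendsto_ennrealI[OF this]] show ?case by simp
    qed
  qed
  also have "\<dots> \<le> liminf (\<lambda>n. \<integral>\<^sup>+x. ennreal (h n x) \<partial>M)" by (rule nn_integral_liminf) measurable
  also have "\<dots> \<le> liminf (\<lambda>n. ennreal K)"
    using K by (intro Liminf_mono always_eventually allI)
      (simp add: nn_integral_eq_integral[OF int nonneg] ennreal_leI)
  also have "\<dots> = ennreal K" by (rule Liminf_const) simp
  finally have le: "(\<integral>\<^sup>+x. ennreal (H x) \<partial>M) \<le> ennreal K" .
  then show i: "integrable M H"
    by (intro integrableI_nonneg H H0) (simp add: le_less_trans[OF le])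
  show "integral\<^sup>L M H \<le> K"
    using le K0 unfolding nn_integral_eq_integral[OF i H0] by simp
qed

text \<open>The weights with different centres are comparable by \<open>weight_comparison\<close>, so the centre \<open>0\<close> is as good
  as any other in the definition of the space.\<close>

definition weighted_L2 :: "(real \<Rightarrow> 'a::{banach, second_countable_topology}) \<Rightarrow> bool" where
  "weighted_L2 f \<longleftrightarrow> f \<in> borel_measurable borel \<and> integrable lborel (\<lambda>x. weight 0 x * (norm (f x))\<^sup>2)"

definition wnorm2 :: "real \<Rightarrow> (real \<Rightarrow> 'a::{banach, second_countable_topology}) \<Rightarrow> real" where
  "wnorm2 a f = (LINT x|lborel. weight a x * (norm (f x))\<^sup>2)"

lemma weighted_L2_measurable [measurable_dest]: "weighted_L2 f \<Longrightarrow> f \<in> borel_measurable borel"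
  by (simp add: weighted_L2_def)

lemma weighted_L2_integrable:
  assumes f: "weighted_L2 f" shows "integrable lborel (\<lambda>x. weight a x * (norm (f x))\<^sup>2)"
proof (rule Bochner_Integration.integrable_bound)
  have [measurable]: "f \<in> borel_measurable borel" using f by (simp add: weighted_L2_def)
  show "integrable lborel (\<lambda>x. (2 + (a - 0)\<^sup>2 / 8) * (weight 0 x * (norm (f x))\<^sup>2))"
    using f by (auto simp: weighted_L2_def)
  show "(\<lambda>x. weight a x * (norm (f x))\<^sup>2) \<in> borel_measurable lborel" by measurable
  have "weight a x * (norm (f x))\<^sup>2 \<le> (2 + (a - 0)\<^sup>2 / 8) * (weight 0 x * (norm (f x))\<^sup>2)" for x
    unfolding mult.assoc[symmetric] by (intro mult_right_mono weight_comparison) auto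
  then show "AE x in lborel. norm (weight a x * (norm (f x))\<^sup>2) \<le> norm ((2 + (a - 0)\<^sup>2 / 8) * (weight 0 x * (norm (f x))\<^sup>2))"
    using weight_pos[of a] weight_pos[of 0] by (intro AE_I2) (simp add: abs_mult less_imp_le)
qed

lemma wnorm2_nonneg: "0 \<le> wnorm2 a f"
  unfolding wnorm2_def using weight_pos by (intro Bochner_Integration.integral_nonneg) (simp add: less_imp_le)

lemma weighted_L2_add:
  assumes f: "weighted_L2 f" and g: "weighted_L2 g"
  shows "weighted_L2 (\<lambda>x. f x + g x)" "wnorm2 a (\<lambda>x. f x + g x) \<le> 2 * wnorm2 a f + 2 * wnorm2 a g"
proof -
  have [measurable]: "f \<in> borel_measurable borel" "g \<in> borel_measurable borel"
    using f g by (auto simp: weighted_L2_def)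
  have le: "weight a x * (norm (f x + g x))\<^sup>2 \<le> 2 * (weight a x * (norm (f x))\<^sup>2) + 2 * (weight a x * (norm (g x))\<^sup>2)" for a x
    using mult_left_mono[OF sq_norm_add[of "f x" "g x"] less_imp_le[OF weight_pos[of a x]]]
    by (simp add: algebra_simps)
  have i: "integrable lborel (\<lambda>x. weight a x * (norm (f x + g x))\<^sup>2)" for a
  proof (rule Bochner_Integration.integrable_bound)
    show "integrable lborel (\<lambda>x. 2 * (weight a x * (norm (f x))\<^sup>2) + 2 * (weight a x * (norm (g x))\<^sup>2))"
      using weighted_L2_integrable[OF f] weighted_L2_integrable[OF g] by simp
    show "AE x in lborel. norm (weight a x * (norm (f x + g x))\<^sup>2)
        \<le> norm (2 * (weight a x * (norm (f x))\<^sup>2) + 2 * (weight a x * (norm (g x))\<^sup>2))"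
      using le weight_pos[of a] by (intro AE_I2) (simp add: abs_mult less_imp_le)
  qed measurable
  then show "weighted_L2 (\<lambda>x. f x + g x)" by (simp add: weighted_L2_def)
  have "wnorm2 a (\<lambda>x. f x + g x)
      \<le> (LINT x|lborel. 2 * (weight a x * (norm (f x))\<^sup>2) + 2 * (weight a x * (norm (g x))\<^sup>2))"
    unfolding wnorm2_def
    by (intro integral_mono i le Bochner_Integration.integrable_add integrable_mult_right
        weighted_L2_integrable f g)
  also have "\<dots> = 2 * wnorm2 a f + 2 * wnorm2 a g"
    unfolding wnorm2_def using weighted_L2_integrable[OF f, of a] weighted_L2_integrable[OF g, of a] by simp
  finally show "wnorm2 a (\<lambda>x. f x + g x) \<le> 2 * wnorm2 a f + 2 * wnorm2 a g" .
qed

lemma weighted_L2_bound: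
  assumes f: "weighted_L2 f" and g[measurable]: "g \<in> borel_measurable borel"
    and le: "AE x in lborel. norm (g x) \<le> K * norm (f x)" and K: "0 \<le> K"
  shows "weighted_L2 g" "wnorm2 a g \<le> K\<^sup>2 * wnorm2 a f"
proof -
  have [measurable]: "f \<in> borel_measurable borel" using f by (auto simp: weighted_L2_def)
  have le': "AE x in lborel. weight a x * (norm (g x))\<^sup>2 \<le> K\<^sup>2 * (weight a x * (norm (f x))\<^sup>2)" for a
    using le
  proof eventually_elim
    case (elim x)
    then have "(norm (g x))\<^sup>2 \<le> (K * norm (f x))\<^sup>2" by (intro power_mono) auto
    from mult_left_mono[OF this less_imp_le[OF weight_pos[of a x]]] show ?case
      by (simp add: power_mult_distrib mult_ac)
  qed
  have i: "integrable lborel (\<lambda>x. weight a x * (norm (g x))\<^sup>2)" for a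
  proof (rule Bochner_Integration.integrable_bound)
    show "integrable lborel (\<lambda>x. K\<^sup>2 * (weight a x * (norm (f x))\<^sup>2))"
      using weighted_L2_integrable[OF f] by simp
    show "AE x in lborel. norm (weight a x * (norm (g x))\<^sup>2) \<le> norm (K\<^sup>2 * (weight a x * (norm (f x))\<^sup>2))"
      using le'[of a] by eventually_elim (use weight_pos[of a] in \<open>simp add: abs_mult less_imp_le\<close>)
  qed measurable
  then show "weighted_L2 g" by (simp add: weighted_L2_def)
  have "wnorm2 a g \<le> (LINT x|lborel. K\<^sup>2 * (weight a x * (norm (f x))\<^sup>2))"
    unfolding wnorm2_def using weighted_L2_integrable[OF f] by (intro integral_mono_AE i le') auto
  then show "wnorm2 a g \<le> K\<^sup>2 * wnorm2 a f" by (simp add: wnorm2_def)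
qed

lemma weighted_L2_loc:
  assumes f: "weighted_L2 f" shows "f \<in> L2_loc"
proof -
  have m[measurable]: "f \<in> borel_measurable borel" using f by (auto simp: weighted_L2_def)
  have "set_integrable lborel {a..b} (\<lambda>x. (norm (f x))\<^sup>2)" for a b
  proof -
    define C where "C = 1 + ((\<bar>a\<bar> + \<bar>b\<bar>) / 4)\<^sup>2"
    have C: "1 \<le> C * weight 0 x" if "x \<in> {a..b}" for x
    proof -
      have "(x / 4)\<^sup>2 \<le> ((\<bar>a\<bar> + \<bar>b\<bar>) / 4)\<^sup>2" using that by (intro abs_le_square_iff[THEN iffD1]) auto
      then show ?thesis using weight_denom_pos[of x 0] by (simp add: C_def weight_def divide_simps)
    qed
    show ?thesis
      unfolding set_integrable_def
    proof (rule Bochner_Integration.integrable_bound)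
      show "integrable lborel (\<lambda>x. C * (weight 0 x * (norm (f x))\<^sup>2))"
        using f by (auto simp: weighted_L2_def)
      show "AE x in lborel. norm (indicator {a..b} x *\<^sub>R (norm (f x))\<^sup>2) \<le> norm (C * (weight 0 x * (norm (f x))\<^sup>2))"
      proof (rule AE_I2)
        fix x
        have "(norm (f x))\<^sup>2 \<le> C * (weight 0 x * (norm (f x))\<^sup>2)" if "x \<in> {a..b}"
          using mult_right_mono[OF C[OF that], of "(norm (f x))\<^sup>2"] by (simp add: mult_ac)
        then show "norm (indicator {a..b} x *\<^sub>R (norm (f x))\<^sup>2) \<le> norm (C * (weight 0 x * (norm (f x))\<^sup>2))"
          using weight_pos[of 0 x] by (auto simp: indicator_def C_def abs_mult order.trans[OF _ abs_ge_self])
      qed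
    qed measurable
  qed
  then show ?thesis using m by (simp add: L2_loc_def)
qed

lemma weighted_L2_locally_integrable: "weighted_L2 f \<Longrightarrow> locally_integrable f"
  by (intro L2_loc_locally_integrable weighted_L2_loc)


section \<open>The weighted energy estimate\<close>

lemma cinner_scaleC_left: "cinner (c *\<^sub>C x) y = cnj c * cinner x (y::'a::complex_inner)"
  by (subst cinner_commute) (simp add: cinner_scaleC_right, subst cinner_commute, simp)

lemma inner_scaleC_left: "inner (c *\<^sub>C x) y = inner x (cnj c *\<^sub>C (y::'a::complex_inner))"
  unfolding Re_cinner[symmetric] cinner_scaleC_right cinner_scaleC_left ..

lemma cinner_self: "cinner x x = complex_of_real ((norm x)\<^sup>2)" for x :: "'a::complex_inner"
proof -
  have "Im (cinner x x) = 0" using arg_cong[OF cinner_commute[of x x], of Im] by simp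
  then show ?thesis using Re_cinner[of x x] by (simp add: complex_eq_iff power2_norm_eq_inner)
qed

lemma inner_scaleC_self: "inner (c *\<^sub>C x) x = Re c * (norm x)\<^sup>2" for x :: "'a::complex_inner"
  unfolding Re_cinner[symmetric] cinner_scaleC_left cinner_self by simp

lemma scaleC_simps:
  fixes x :: "'a::complex_vector"
  shows "0 *\<^sub>C x = 0" "1 *\<^sub>C x = x" "(- c) *\<^sub>C x = - (c *\<^sub>C x)" "c *\<^sub>C (0::'a) = 0"
    "c *\<^sub>C (- x) = - (c *\<^sub>C x)" "c *\<^sub>C (x - y) = c *\<^sub>C x - c *\<^sub>C y" "(c - d) *\<^sub>C x = c *\<^sub>C x - d *\<^sub>C x"
proof -
  show z: "0 *\<^sub>C x = 0" for x :: 'a using scaleC_of_real[of 0 x] by simp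
  show "1 *\<^sub>C x = x" using scaleC_of_real[of 1 x] by simp
  show m: "(- c) *\<^sub>C x = - (c *\<^sub>C x)" for c and x :: 'a
    using scaleC_add_left[of "- c" c x] z by (simp add: eq_neg_iff_add_eq_0)
  show z2: "c *\<^sub>C (0::'a) = 0" using scaleC_add_right[of c "0::'a" 0] by simp
  show m2: "c *\<^sub>C (- x) = - (c *\<^sub>C x)" for x :: 'a
    using scaleC_add_right[of c "- x" x] z2 by (simp add: eq_neg_iff_add_eq_0)
  show "c *\<^sub>C (x - y) = c *\<^sub>C x - c *\<^sub>C y"
    using scaleC_add_right[of c x "- y"] m2 by simp
  show "(c - d) *\<^sub>C x = c *\<^sub>C x - d *\<^sub>C x"
    using scaleC_add_left[of c "- d" x] m by simp
qed

text \<open>Rotating by \<open>\<pi> / 3\<close> towards the negative half-axis takes the complement of the sector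
  \<open>\<bar>arg w\<bar> < \<pi> / 3\<close> into the sector \<open>2 \<pi> / 3 \<le> \<bar>arg w\<bar>\<close>, while the image of \<open>1\<close> keeps the positive
  real part \<open>1 / 2\<close>.\<close>

lemma sector_rotation:
  assumes "Re w \<le> cmod w / 2"
  obtains c where "cmod c = 1" "Re c = 1 / 2" "Re (c * w) \<le> - (cmod w / 2)"
proof -
  define r where "r = cmod w"
  have r: "r\<^sup>2 = (Re w)\<^sup>2 + (Im w)\<^sup>2" "0 \<le> r" "- r \<le> Re w" "Re w \<le> r / 2"
    using assms abs_Re_le_cmod[of w] by (auto simp: r_def cmod_power2)
  have "(r + Re w)\<^sup>2 = (r + Re w) * (r + Re w)" by (simp add: power2_eq_square)
  also have "\<dots> \<le> (r + Re w) * (3 * (r - Re w))" using r by (intro mult_left_mono) auto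
  also have "\<dots> = (sqrt 3 * \<bar>Im w\<bar>)\<^sup>2"
    using r(1) by (simp add: power_mult_distrib) (simp add: power2_eq_square algebra_simps)
  finally have le: "r + Re w \<le> sqrt 3 * \<bar>Im w\<bar>" by (rule power2_le_imp_le) simp
  define c where "c = Complex (1/2) (if 0 \<le> Im w then sqrt 3 / 2 else - (sqrt 3 / 2))"
  have "cmod c = 1" by (simp add: c_def cmod_def power_divide)
  moreover have "Re (c * w) \<le> - (cmod w / 2)"
    using le by (simp add: c_def r_def[symmetric] abs_if split: if_splits)
  ultimately show thesis using that[of c] by (simp add: c_def)
qed

locale complex_positive_operator =
  fixes D :: "'a::{chilbert_space, second_countable_topology} set" and B :: "'a \<Rightarrow> 'a"
  assumes complex_psa: "positive_self_adjoint scaleC cinner D B"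
begin

lemma dom_scaleC: "u \<in> D \<Longrightarrow> c *\<^sub>C u \<in> D"
  and B_scaleC: "u \<in> D \<Longrightarrow> B (c *\<^sub>C u) = c *\<^sub>C B u"
  using complex_psa by (auto simp: positive_self_adjoint_def linear_operator_def)

lemma cinner_B_self: "u \<in> D \<Longrightarrow> \<exists>r\<ge>0. cinner (B u) u = complex_of_real r"
  using complex_psa by (auto simp: positive_self_adjoint_def nonneg_Reals_def)

text \<open>The estimates use the real inner product only. Replacing \<open>u\<close> by \<open>\<i> u\<close> recovers the complex one, so
  both define the same adjoint.\<close>

sublocale positive_operator D B
proof
  have "inner (B u) v = inner u w" if "\<forall>u\<in>D. cinner (B u) v = cinner u w" "u \<in> D" for u v w
    using that by (simp flip: Re_cinner)
  moreover have "cinner (B u) v = cinner u w" if h: "\<forall>u\<in>D. inner (B u) v = inner u w" and u: "u \<in> D" for u v w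
  proof (rule complex_eqI)
    show "Re (cinner (B u) v) = Re (cinner u w)" using h u by (simp add: Re_cinner)
    have i: "Im (cinner x y) = inner (\<i> *\<^sub>C x) y" for x y :: 'a
      unfolding Re_cinner[symmetric] cinner_scaleC_left by simp
    show "Im (cinner (B u) v) = Im (cinner u w)"
      using h[rule_format, OF dom_scaleC[OF u, of \<i>]] by (simp add: i B_scaleC u)
  qed
  ultimately have "adjoint_graph inner D B = adjoint_graph cinner D B"
    unfolding adjoint_graph_def by blast
  moreover have "inner (B u) u \<in> \<real>\<^sub>\<ge>\<^sub>0" if "u \<in> D" for u
    using cinner_B_self[OF that] by (auto simp: nonneg_Reals_def simp flip: Re_cinner)
  moreover have "linear_operator scaleR D B"
    using complex_psa dom_scaleC B_scaleC scaleC_of_real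
    unfolding positive_self_adjoint_def linear_operator_def by metis
  ultimately show "positive_self_adjoint scaleR inner D B"
    using complex_psa by (auto simp: positive_self_adjoint_def)
qed

lemma inner_scaleC_B: "u \<in> D \<Longrightarrow> inner (c *\<^sub>C B u) u = Re c * inner (B u) u"
proof -
  assume "u \<in> D"
  then obtain r where "cinner (B u) u = complex_of_real r" using cinner_B_self by blast
  then show ?thesis
    unfolding Re_cinner[symmetric] cinner_scaleC_left by simp
qed

lemma res_scaleC: "k > 0 \<Longrightarrow> res k (c *\<^sub>C x) = c *\<^sub>C res k x"
  by (rule res_eqI)
    (simp_all add: res dom_scaleC B_scaleC scaleC_simps scaleC_scaleC mult.commute flip: scaleC_of_real)

text \<open>The Cauchy-Schwarz inequality for the semi-definite form given by the Yosida approximation.\<close>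

lemma inner_yosida_sq:
  assumes "k > 0"
  shows "(inner x (yosida k y))\<^sup>2 \<le> inner x (yosida k x) * inner y (yosida k y)"
proof -
  let ?C = "yosida k"
  interpret C: bounded_linear ?C by (rule bounded_linear_yosida[OF assms])
  have pos: "0 \<le> inner z (?C z)" for z using yosida_positive[OF assms, of z] by (simp add: inner_commute)
  have sym: "inner y (?C x) = inner x (?C y)" using yosida_symmetric[OF assms, of x y] by (simp add: inner_commute)
  have q: "0 \<le> inner x (?C x) + 2 * t * inner x (?C y) + t\<^sup>2 * inner y (?C y)" for t
    using pos[of "x + t *\<^sub>R y"] sym
    by (simp add: C.add C.scaleR inner_add_left inner_add_right power2_eq_square algebra_simps)
  let ?a = "inner x (?C x)" and ?b = "inner x (?C y)" and ?c = "inner y (?C y)"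
  show ?thesis
  proof (cases "?c = 0")
    case True
    have "?b = 0"
    proof (rule ccontr)
      assume b: "?b \<noteq> 0"
      have "0 \<le> ?a + 2 * (- (?a + 1) / (2 * ?b)) * ?b" using q[of "- (?a + 1) / (2 * ?b)"] True by simp
      also have "\<dots> = - 1" using b by (simp add: field_simps)
      finally show False by simp
    qed
    then show ?thesis using True by simp
  next
    case False
    then have c: "?c > 0" using pos[of y] by simp
    have "0 \<le> (?a + 2 * (- ?b / ?c) * ?b + (- ?b / ?c)\<^sup>2 * ?c) * ?c"
      using q[of "- ?b / ?c"] c by (intro mult_nonneg_nonneg) auto
    then show ?thesis using c by (simp add: power2_eq_square field_simps)
  qed
qed

text \<open>The solution \<open>u\<close> is given as an iterated antiderivative, which allows integration by parts, and \<open>b\<close>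
  stands for \<open>B u\<close>. Each test of the equation produces a total derivative, whose integral vanishes after
  multiplication with the cut weight, up to the derivative of that weight, which \<open>absorb_cut_deriv\<close>
  takes care of.\<close>

lemma energy_estimate:
  assumes u: "antiderivative u u1" and u1: "antiderivative u1 u2"
    and L: "weighted_L2 u" "weighted_L2 u2" "weighted_L2 b"
    and b: "AE x in lborel. u x \<in> D \<and> B (u x) = b x"
    and f: "AE x in lborel. f x = - u2 x + b x + u x - w *\<^sub>C u x" and fm[measurable]: "f \<in> borel_measurable borel"
    and w: "Re w \<le> cmod w / 2"
  shows "(1 + cmod w)\<^sup>2 * wnorm2 a u \<le> 16 * wnorm2 a f"
    and "integrable lborel (\<lambda>x. weight a x * (norm (u1 x))\<^sup>2)" "wnorm2 a u1 \<le> 32 * wnorm2 a f"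
    and "wnorm2 a b \<le> 84 * wnorm2 a f" "wnorm2 a u2 \<le> 236 * wnorm2 a f"
proof -
  have [measurable]: "u \<in> borel_measurable borel" "u1 \<in> borel_measurable borel"
    "u2 \<in> borel_measurable borel" "b \<in> borel_measurable borel"
    using L antiderivative_continuous[OF u1]
    by (auto simp: weighted_L2_def intro: borel_measurable_continuous_onI)
  have cu: "continuous_on UNIV u" and cu1: "continuous_on UNIV u1"
    using antiderivative_continuous u u1 by auto
  let ?r = "weight a"
  define m where "m = 1 + cmod w"
  have m: "1 \<le> m" by (simp add: m_def)
  note iu = weighted_L2_integrable[OF L(1), of a] and iu2 = weighted_L2_integrable[OF L(2), of a]
    and ib = weighted_L2_integrable[OF L(3), of a]
  have sc: "(\<lambda>x. c *\<^sub>C h x) \<in> borel_measurable borel" if "h \<in> borel_measurable borel" for c and h :: "real \<Rightarrow> 'a"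
    using borel_measurable_continuous_on[OF linear_continuous_on[OF bounded_linear_scaleC] that] .
  have Lsc: "weighted_L2 (\<lambda>x. c *\<^sub>C h x)" if "weighted_L2 h" for c and h :: "real \<Rightarrow> 'a"
    using that by (intro weighted_L2_bound(1)[OF that sc, where K = "cmod c"])
      (auto simp: weighted_L2_def norm_scaleC)
  have Lf: "weighted_L2 f"
  proof -
    have "weighted_L2 (\<lambda>x. (((- 1) *\<^sub>C u2 x + b x) + u x) + (- w) *\<^sub>C u x)"
      by (intro weighted_L2_add(1) Lsc L)
    moreover have "AE x in lborel. norm (f x) \<le> 1 * norm ((((- 1) *\<^sub>C u2 x + b x) + u x) + (- w) *\<^sub>C u x)"
      using f by eventually_elim (simp add: scaleC_simps)
    ultimately show ?thesis by (rule weighted_L2_bound(1)[OF _ fm]) simp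
  qed
  note if' = weighted_L2_integrable[OF Lf, of a]
  obtain c where c: "cmod c = 1" "Re c = 1 / 2" "Re (c * w) \<le> - (cmod w / 2)"
    using sector_rotation[OF w] by blast
  have blc: "bounded_bilinear (\<lambda>(x::'a) y. inner (c *\<^sub>C x) y)" for c :: complex
    using bounded_bilinear.comp[OF bounded_bilinear_inner bounded_linear_scaleC[of c] bounded_linear_ident] .
  have cutsc: "antiderivative (\<lambda>x. cut a n x * P x) (\<lambda>x. cut_deriv a n x * P x + cut a n x * P' x)"
    if PP: "antiderivative P P'" for P P' n
    using antiderivative_bilinear[OF bounded_bilinear_mult antiderivative_DERIV[OF DERIV_cut continuous_cut(2)] PP] .
  have int0: "integrable lborel (\<lambda>x. cut_deriv a n x * P x + cut a n x * P' x)"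
    "(LINT x|lborel. cut_deriv a n x * P x + cut a n x * P' x) = 0"
    if PP: "antiderivative P P'" "n > 0" for P P' n
    using integral_of_compactly_supported_antiderivative[OF cutsc[OF PP(1)], of "real n"] cut_eq_0 PP(2) by auto
  have intcut: "integrable lborel (\<lambda>x. cut a n x * P x)" if "continuous_on UNIV P" "n > 0" for P :: "real \<Rightarrow> real" and n
    by (rule integrable_compact_support(1)[where a = "- real n" and b = "real n"])
      (use that cut_eq_0 in \<open>auto intro!: locally_integrable_continuous continuous_intros continuous_cut\<close>)
  \<comment> \<open>The equation, multiplied by \<open>c\<close>, is tested with \<open>u\<close>. Young's inequality for the product of \<open>f\<close> and \<open>u\<close>
      is weighted with \<open>m = 1 + \<bar>w\<bar>\<close>, so that the resulting term in \<open>u\<close> is a fixed fraction of the gain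
      \<open>m / 2\<close> for every \<open>w\<close>.\<close>
  define K where "K = (1/4 + m / 8) * wnorm2 a u + 2 / m * wnorm2 a f"
  have test_u: "(LINT x|lborel. cut a n x * (1/4 * (norm (u1 x))\<^sup>2 + m / 2 * (norm (u x))\<^sup>2)) \<le> K"
    if n: "n \<ge> 16" for n
  proof -
    let ?s = "cut a n" and ?s' = "cut_deriv a n"
    define P where "P = (\<lambda>x. inner (c *\<^sub>C u1 x) (u x))"
    define P' where "P' = (\<lambda>x. inner (c *\<^sub>C u2 x) (u x) + inner (c *\<^sub>C u1 x) (u1 x))"
    have P: "antiderivative P P'"
      unfolding P_def P'_def by (rule antiderivative_bilinear[OF blc u1 u])
    have n0: "n > 0" using n by simp
    have "AE x in lborel. ?s x * (1/4 * (norm (u1 x))\<^sup>2 + m / 2 * (norm (u x))\<^sup>2)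
        \<le> (?s' x * P x + ?s x * P' x)
          + ((1/4 + m / 8) * (?r x * (norm (u x))\<^sup>2) + 2 / m * (?r x * (norm (f x))\<^sup>2))"
      using b f
    proof eventually_elim
      case (elim x)
      have s: "0 \<le> ?s x" "?s x \<le> ?r x" by (rule cut_bounds)+
      define T where "T = inner (b x) (u x) / 2 + (norm (u x))\<^sup>2 / 2 - Re (c * w) * (norm (u x))\<^sup>2"
      have fu: "inner (c *\<^sub>C u2 x) (u x) = - inner (c *\<^sub>C f x) (u x) + T"
      proof -
        have "c *\<^sub>C f x = - (c *\<^sub>C u2 x) + c *\<^sub>C b x + c *\<^sub>C u x - (c * w) *\<^sub>C u x"
          using elim by (simp add: scaleC_add_right scaleC_simps scaleC_scaleC)
        moreover have "inner (c *\<^sub>C b x) (u x) = inner (b x) (u x) / 2"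
          using inner_scaleC_B[of "u x" c] elim(1) c by simp
        moreover have "inner (c *\<^sub>C u x) (u x) = (norm (u x))\<^sup>2 / 2" by (simp add: inner_scaleC_self c)
        ultimately show ?thesis
          by (simp only: T_def inner_add_left inner_diff_left inner_minus_left inner_scaleC_self)
      qed
      have "inner (c *\<^sub>C f x) (u x) \<le> norm (f x) * norm (u x)"
        using norm_cauchy_schwarz[of "c *\<^sub>C f x" "u x"] c by (simp add: norm_scaleC)
      also have "\<dots> \<le> m / 8 * (norm (u x))\<^sup>2 + 2 / m * (norm (f x))\<^sup>2"
      proof -
        have "0 \<le> (m / 4 * norm (u x) - norm (f x))\<^sup>2 * (2 / m)" using m by simp
        also have "\<dots> = m / 8 * (norm (u x))\<^sup>2 + 2 / m * (norm (f x))\<^sup>2 - norm (f x) * norm (u x)"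
          using m by (simp add: power2_eq_square field_simps)
        finally show ?thesis by simp
      qed
      finally have 1: "?s x * inner (c *\<^sub>C f x) (u x) \<le> ?r x * (m / 8 * (norm (u x))\<^sup>2 + 2 / m * (norm (f x))\<^sup>2)"
        by (rule order_trans[OF mult_left_mono[OF _ s(1)] mult_right_mono[OF s(2)]]) (use m in simp)
      have 2: "\<bar>?s' x * P x\<bar> \<le> (?s x * (norm (u1 x))\<^sup>2 + ?r x * (norm (u x))\<^sup>2) / 4"
      proof (rule absorb_cut_deriv[OF n])
        have "\<bar>P x\<bar> \<le> norm (u1 x) * norm (u x)"
          unfolding P_def using Cauchy_Schwarz_ineq2[of "c *\<^sub>C u1 x" "u x"] c by (simp add: norm_scaleC)
        then show "(P x)\<^sup>2 \<le> (norm (u1 x))\<^sup>2 * (norm (u x))\<^sup>2"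
          by (simp add: abs_le_square_iff[symmetric] power_mult_distrib[symmetric] abs_mult)
      qed auto
      have 3: "?s x * P' x = - (?s x * inner (c *\<^sub>C f x) (u x)) + ?s x * T + ?s x * (norm (u1 x))\<^sup>2 / 2"
        unfolding P'_def fu inner_scaleC_self c by (simp add: algebra_simps)
      have 4: "?s x * (m / 2 * (norm (u x))\<^sup>2) \<le> ?s x * T"
      proof (rule mult_left_mono[OF _ s(1)])
        have "cmod w / 2 * (norm (u x))\<^sup>2 \<le> - Re (c * w) * (norm (u x))\<^sup>2"
          using c(3) by (intro mult_right_mono) auto
        moreover have "0 \<le> inner (b x) (u x)" using positive[of "u x"] elim(1) by simp
        moreover have "m / 2 * (norm (u x))\<^sup>2 = (norm (u x))\<^sup>2 / 2 + cmod w / 2 * (norm (u x))\<^sup>2"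
          by (simp add: m_def algebra_simps)
        ultimately show "m / 2 * (norm (u x))\<^sup>2 \<le> T" unfolding T_def by linarith
      qed
      show ?case using 1 2 3 4 unfolding abs_le_iff by (simp add: algebra_simps)
    qed
    then have "(LINT x|lborel. ?s x * (1/4 * (norm (u1 x))\<^sup>2 + m / 2 * (norm (u x))\<^sup>2))
      \<le> (LINT x|lborel. (?s' x * P x + ?s x * P' x)
          + ((1/4 + m / 8) * (?r x * (norm (u x))\<^sup>2) + 2 / m * (?r x * (norm (f x))\<^sup>2)))"
      using iu if' int0(1)[OF P n0] by (intro integral_mono_AE intcut[OF _ n0] continuous_intros cu cu1) auto
    also have "\<dots> = K"
      using iu if' int0[OF P n0] by (simp add: K_def wnorm2_def)
    finally show ?thesis .
  qed
  have "integrable lborel (\<lambda>x. ?r x * (1/4 * (norm (u1 x))\<^sup>2 + m / 2 * (norm (u x))\<^sup>2))"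
    and KK: "(LINT x|lborel. ?r x * (1/4 * (norm (u1 x))\<^sup>2 + m / 2 * (norm (u x))\<^sup>2)) \<le> K"
  proof -
    let ?h = "\<lambda>n x. cut a (n + 16) x * (1/4 * (norm (u1 x))\<^sup>2 + m / 2 * (norm (u x))\<^sup>2)"
    have 1: "integrable lborel (?h n)" for n by (intro intcut continuous_intros cu cu1) auto
    have 2: "AE x in lborel. 0 \<le> ?h n x" for n using m cut_bounds(1) by (intro AE_I2 mult_nonneg_nonneg) auto
    have 3: "AE x in lborel. (\<lambda>n. ?h n x) \<longlonglongrightarrow> ?r x * (1/4 * (norm (u1 x))\<^sup>2 + m / 2 * (norm (u x))\<^sup>2)"
      by (intro AE_I2 tendsto_intros LIMSEQ_ignore_initial_segment cut_tendsto)
    have 4: "integral\<^sup>L lborel (?h n) \<le> K" for n by (rule test_u) simp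
    show "integrable lborel (\<lambda>x. ?r x * (1/4 * (norm (u1 x))\<^sup>2 + m / 2 * (norm (u x))\<^sup>2))"
      "(LINT x|lborel. ?r x * (1/4 * (norm (u1 x))\<^sup>2 + m / 2 * (norm (u x))\<^sup>2)) \<le> K"
      using fatou_bound[OF 1 2 3 4] by auto
  qed
  note iK = this(1)
  show iu1: "integrable lborel (\<lambda>x. ?r x * (norm (u1 x))\<^sup>2)"
  proof (rule Bochner_Integration.integrable_bound)
    show "integrable lborel (\<lambda>x. 4 * (?r x * (1/4 * (norm (u1 x))\<^sup>2 + m / 2 * (norm (u x))\<^sup>2)))"
      using iK by simp
    show "AE x in lborel. norm (?r x * (norm (u1 x))\<^sup>2)
        \<le> norm (4 * (?r x * (1/4 * (norm (u1 x))\<^sup>2 + m / 2 * (norm (u x))\<^sup>2)))"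
      using m weight_pos[of a] by (intro AE_I2) (simp add: abs_mult less_imp_le algebra_simps)
  qed measurable
  have eq: "(LINT x|lborel. ?r x * (1/4 * (norm (u1 x))\<^sup>2 + m / 2 * (norm (u x))\<^sup>2)) = wnorm2 a u1 / 4 + m / 2 * wnorm2 a u"
  proof -
    have "(LINT x|lborel. ?r x * (1/4 * (norm (u1 x))\<^sup>2 + m / 2 * (norm (u x))\<^sup>2))
      = (LINT x|lborel. 1/4 * (?r x * (norm (u1 x))\<^sup>2) + m / 2 * (?r x * (norm (u x))\<^sup>2))"
      by (intro Bochner_Integration.integral_cong) (auto simp: algebra_simps)
    also have "\<dots> = wnorm2 a u1 / 4 + m / 2 * wnorm2 a u"
      using iu1 iu by (simp add: wnorm2_def)
    finally show ?thesis .
  qed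
  define N F where "N = wnorm2 a u" and "F = wnorm2 a f"
  have NF: "0 \<le> N" "0 \<le> F" "0 \<le> wnorm2 a u1" by (auto simp: N_def F_def wnorm2_nonneg)
  have main: "wnorm2 a u1 / 4 + m / 2 * N \<le> (1/4 + m / 8) * N + 2 / m * F"
    using KK unfolding eq by (simp add: K_def N_def F_def)
  have mN: "N \<le> m * N" using m NF mult_right_mono[of 1 m N] by simp
  have "wnorm2 a u1 / 4 + (m * N) / 2 \<le> N / 4 + (m * N) / 8 + 2 / m * F"
    using main by (simp add: algebra_simps)
  then have "m / 8 * N \<le> 2 / m * F" using mN NF by linarith
  then have "m * (m * N) \<le> 16 * F" using m by (simp add: field_simps)
  then show est_u: "(1 + cmod w)\<^sup>2 * wnorm2 a u \<le> 16 * wnorm2 a f"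
    by (simp add: m_def[symmetric] N_def F_def power2_eq_square mult.assoc)
  have mN2: "m * N \<le> 16 * F"
    using \<open>m * (m * N) \<le> 16 * F\<close> mult_right_mono[OF m, of "m * N"] mN NF by linarith
  have "2 / m * F \<le> 2 * F" using m NF by (intro mult_right_mono) (auto simp: field_simps)
  then show "wnorm2 a u1 \<le> 32 * wnorm2 a f"
    using main mN mN2 NF by (simp add: F_def[symmetric] algebra_simps)
  \<comment> \<open>The equation is tested with \<open>yosida k u\<close> in place of \<open>B u\<close>: since \<open>yosida k\<close> is bounded, it can be
      applied to \<open>u'\<close>, which need not take its values in \<open>D\<close>, and the integration by parts produces the
      nonnegative term \<open>inner u' (yosida k u')\<close>.\<close>
  define g where "g = (\<lambda>x. - u2 x + b x)"
  have [measurable]: "g \<in> borel_measurable borel" by (simp add: g_def)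
  have Lg: "weighted_L2 g"
    using weighted_L2_add(1)[OF Lsc[OF L(2), of "- 1"] L(3)] by (simp add: g_def[abs_def] scaleC_simps)
  note ig = weighted_L2_integrable[OF Lg, of a]
  have G: "wnorm2 a g \<le> 34 * F"
  proof -
    have "wnorm2 a g \<le> (LINT x|lborel. 2 * (?r x * (norm (f x))\<^sup>2) + 2 * m\<^sup>2 * (?r x * (norm (u x))\<^sup>2))"
      unfolding wnorm2_def
    proof (rule integral_mono_AE[OF ig])
      show "integrable lborel (\<lambda>x. 2 * (?r x * (norm (f x))\<^sup>2) + 2 * m\<^sup>2 * (?r x * (norm (u x))\<^sup>2))"
        using iu if' by simp
      show "AE x in lborel. ?r x * (norm (g x))\<^sup>2 \<le> 2 * (?r x * (norm (f x))\<^sup>2) + 2 * m\<^sup>2 * (?r x * (norm (u x))\<^sup>2)"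
        using f
      proof eventually_elim
        case (elim x)
        have "g x = f x + (- u x + w *\<^sub>C u x)" using elim by (simp add: g_def)
        then have "(norm (g x))\<^sup>2 \<le> 2 * (norm (f x))\<^sup>2 + 2 * (norm (- u x + w *\<^sub>C u x))\<^sup>2"
          by (simp only: sq_norm_add)
        also have "(norm (- u x + w *\<^sub>C u x))\<^sup>2 \<le> (m * norm (u x))\<^sup>2"
          using norm_triangle_ineq[of "- u x" "w *\<^sub>C u x"]
          by (intro power_mono) (auto simp: norm_scaleC m_def algebra_simps)
        finally have "(norm (g x))\<^sup>2 \<le> 2 * (norm (f x))\<^sup>2 + 2 * m\<^sup>2 * (norm (u x))\<^sup>2"
          by (simp add: power_mult_distrib)
        from mult_left_mono[OF this less_imp_le[OF weight_pos[of a x]]] show ?case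
          by (simp add: algebra_simps)
      qed
    qed
    also have "\<dots> = 2 * F + 2 * (m\<^sup>2 * N)" using iu if' by (simp add: F_def N_def wnorm2_def)
    also have "\<dots> \<le> 34 * F" using \<open>m * (m * N) \<le> 16 * F\<close> by (simp add: power2_eq_square mult_ac)
    finally show ?thesis .
  qed
  define K2 where "K2 = wnorm2 a g + 1/4 * N + 5/16 * wnorm2 a b"
  have test_b: "integrable lborel (\<lambda>x. cut a n x * inner (b x) (yosida k (u x)))
     \<and> (LINT x|lborel. cut a n x * inner (b x) (yosida k (u x))) \<le> K2"
    if n: "n \<ge> 16" and k: "k > 0" for n k
  proof -
    let ?s = "cut a n" and ?s' = "cut_deriv a n" and ?C = "yosida k"
    have [measurable]: "(\<lambda>x. ?C (u x)) \<in> borel_measurable borel"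
      by (intro borel_measurable_continuous_on[OF linear_continuous_on[OF bounded_linear_yosida[OF k]]]) simp
    define P where "P = (\<lambda>x. inner (u1 x) (?C (u x)))"
    define P' where "P' = (\<lambda>x. inner (u2 x) (?C (u x)) + inner (u1 x) (?C (u1 x)))"
    have P: "antiderivative P P'"
      unfolding P_def P'_def
      by (rule antiderivative_bilinear[OF bounded_bilinear_inner u1 antiderivative_linear[OF bounded_linear_yosida[OF k] u]])
    have n0: "n > 0" using n by simp
    have le: "AE x in lborel. \<bar>?s x * inner (b x) (?C (u x))\<bar> \<le> ?r x * (norm (b x))\<^sup>2"
      using b
    proof eventually_elim
      case (elim x)
      have "\<bar>inner (b x) (?C (u x))\<bar> \<le> norm (b x) * norm (?C (u x))" by (rule Cauchy_Schwarz_ineq2)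
      also have "\<dots> \<le> norm (b x) * norm (b x)"
        using norm_yosida_le[OF k, of "u x"] elim by (intro mult_left_mono) auto
      finally have "?s x * \<bar>inner (b x) (?C (u x))\<bar> \<le> ?r x * (norm (b x))\<^sup>2"
        using cut_bounds[of a n x] weight_pos[of a x] by (intro mult_mono) (auto simp: power2_eq_square)
      then show ?case using cut_bounds[of a n x] by (simp add: abs_mult)
    qed
    have i: "integrable lborel (\<lambda>x. ?s x * inner (b x) (?C (u x)))"
    proof (rule Bochner_Integration.integrable_bound[OF ib])
      have [measurable]: "?s \<in> borel_measurable borel"
        by (rule borel_measurable_continuous_onI[OF continuous_cut(1)])
      show "(\<lambda>x. ?s x * inner (b x) (?C (u x))) \<in> borel_measurable lborel" by measurable
      show "AE x in lborel. norm (?s x * inner (b x) (?C (u x))) \<le> norm (?r x * (norm (b x))\<^sup>2)"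
        using le by eventually_elim (auto simp: order.trans[OF _ abs_ge_self])
    qed
    have "AE x in lborel. ?s x * inner (b x) (?C (u x)) \<le> (?s' x * P x + ?s x * P' x)
        + (?r x * (norm (g x))\<^sup>2 + 1/4 * (?r x * (norm (u x))\<^sup>2) + 5/16 * (?r x * (norm (b x))\<^sup>2))"
      using b
    proof eventually_elim
      case (elim x)
      have s: "0 \<le> ?s x" "?s x \<le> ?r x" by (rule cut_bounds)+
      have Cb: "norm (?C (u x)) \<le> norm (b x)" using norm_yosida_le[OF k, of "u x"] elim by auto
      have "inner (g x) (?C (u x)) \<le> norm (g x) * norm (b x)"
        using norm_cauchy_schwarz[of "g x" "?C (u x)"] mult_left_mono[OF Cb, of "norm (g x)"] by simp
      also have "\<dots> \<le> (norm (g x))\<^sup>2 + 1/4 * (norm (b x))\<^sup>2"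
        using zero_le_power2[of "norm (g x) - norm (b x) / 2"] by (simp add: power2_eq_square algebra_simps)
      finally have 1: "?s x * inner (g x) (?C (u x)) \<le> ?r x * ((norm (g x))\<^sup>2 + 1/4 * (norm (b x))\<^sup>2)"
        by (rule order_trans[OF mult_left_mono[OF _ s(1)] mult_right_mono[OF s(2)]]) simp
      have 2: "\<bar>?s' x * P x\<bar> \<le> (?s x * inner (u1 x) (?C (u1 x)) + ?r x * inner (u x) (?C (u x))) / 4"
        unfolding P_def using yosida_positive[OF k]
        by (intro absorb_cut_deriv[OF n] inner_yosida_sq[OF k]) (auto simp: inner_commute)
      have "inner (u x) (?C (u x)) \<le> norm (u x) * norm (b x)"
        using norm_cauchy_schwarz[of "u x" "?C (u x)"] mult_left_mono[OF Cb, of "norm (u x)"] by simp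
      also have "\<dots> \<le> (norm (u x))\<^sup>2 + 1/4 * (norm (b x))\<^sup>2"
        using zero_le_power2[of "norm (u x) - norm (b x) / 2"] by (simp add: power2_eq_square algebra_simps)
      finally have 3: "?r x * inner (u x) (?C (u x)) \<le> ?r x * ((norm (u x))\<^sup>2 + 1/4 * (norm (b x))\<^sup>2)"
        using weight_pos[of a x] by (intro mult_left_mono) auto
      have 4: "?s x * inner (b x) (?C (u x)) = ?s x * inner (g x) (?C (u x)) + ?s x * P' x - ?s x * inner (u1 x) (?C (u1 x))"
        by (simp add: g_def P'_def inner_add_left algebra_simps)
      have 5: "0 \<le> ?s x * inner (u1 x) (?C (u1 x))"
        using s yosida_positive[OF k, of "u1 x"] by (simp add: inner_commute)
      show ?case using 1 2 3 4 5 unfolding abs_le_iff by (simp add: algebra_simps)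
    qed
    then have "(LINT x|lborel. ?s x * inner (b x) (?C (u x))) \<le> (LINT x|lborel. (?s' x * P x + ?s x * P' x)
        + (?r x * (norm (g x))\<^sup>2 + 1/4 * (?r x * (norm (u x))\<^sup>2) + 5/16 * (?r x * (norm (b x))\<^sup>2)))"
      using iu ig ib int0(1)[OF P n0] by (intro integral_mono_AE i) auto
    also have "\<dots> = K2" using iu ig ib int0[OF P n0] by (simp add: K2_def wnorm2_def N_def)
    finally show ?thesis using i by simp
  qed
  have "wnorm2 a b \<le> K2"
  proof -
    let ?k = "\<lambda>n. real (Suc n)"
    let ?h = "\<lambda>n x. cut a (n + 16) x * inner (b x) (yosida (?k n) (u x))"
    have 1: "integrable lborel (?h n)" for n using test_b[of "n + 16" "?k n"] by simp
    have 2: "AE x in lborel. 0 \<le> ?h n x" for n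
      using b
    proof eventually_elim
      case (elim x)
      have "0 \<le> inner (b x) (yosida (?k n) (u x))"
        using res_positive[of "?k n" "b x"] elim by (simp add: yosida_on_dom inner_commute)
      then show ?case using cut_bounds(1) by simp
    qed
    have 3: "AE x in lborel. (\<lambda>n. ?h n x) \<longlonglongrightarrow> ?r x * inner (b x) (b x)"
      using b
    proof eventually_elim
      case (elim x)
      have "(\<lambda>n. yosida (?k n) (u x)) \<longlonglongrightarrow> b x"
        using res_tendsto[of "b x"] elim by (simp add: yosida_on_dom)
      then show ?case by (intro tendsto_intros LIMSEQ_ignore_initial_segment cut_tendsto)
    qed
    have 4: "integral\<^sup>L lborel (?h n) \<le> K2" for n using test_b[of "n + 16" "?k n"] by simp
    show ?thesis
      using fatou_bound(2)[OF 1 2 3 4] by (simp add: wnorm2_def power2_norm_eq_inner)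
  qed
  then have "11 * wnorm2 a b \<le> 16 * (34 * F) + 4 * N" using G by (simp add: K2_def)
  moreover have "N \<le> 16 * F" using mN mN2 by simp
  ultimately show est_b: "wnorm2 a b \<le> 84 * wnorm2 a f" using NF by (simp add: F_def)
  have "wnorm2 a u2 \<le> 2 * wnorm2 a b + 2 * wnorm2 a (\<lambda>x. (- 1) *\<^sub>C g x)"
    using weighted_L2_add(2)[OF L(3) Lsc[OF Lg, of "- 1"], of a] by (simp add: g_def scaleC_simps)
  also have "wnorm2 a (\<lambda>x. (- 1) *\<^sub>C g x) = wnorm2 a g" by (simp add: wnorm2_def norm_scaleC)
  finally show "wnorm2 a u2 \<le> 236 * wnorm2 a f" using G est_b by (simp add: F_def)
qed

end


section \<open>Strong solutions in the weighted space\<close>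

lemma wnorm2_cong_AE:
  assumes "AE x in lborel. norm (f x) = norm (g x)" "f \<in> borel_measurable borel" "g \<in> borel_measurable borel"
  shows "wnorm2 a f = wnorm2 a g"
  unfolding wnorm2_def using assms(2,3)
  by (intro integral_cong_AE) (use assms(1) in \<open>auto elim!: eventually_mono\<close>)

lemma wnorm2_eq_0:
  assumes f: "weighted_L2 f" and 0: "wnorm2 a f \<le> 0" shows "AE x in lborel. f x = 0"
proof -
  have "(LINT x|lborel. weight a x * (norm (f x))\<^sup>2) = 0"
    using 0 wnorm2_nonneg[of a f] by (simp add: wnorm2_def)
  then have "AE x in lborel. weight a x * (norm (f x))\<^sup>2 = 0"
    using weighted_L2_integrable[OF f, of a] weight_pos[of a]
    by (subst (asm) integral_nonneg_eq_0_iff_AE) (auto simp: less_imp_le)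
  then show ?thesis
    by eventually_elim (use weight_pos[of a] in \<open>simp add: less_imp_neq[symmetric]\<close>)
qed

lemma weighted_L2_linear:
  assumes T: "bounded_linear T" and f: "weighted_L2 f" shows "weighted_L2 (\<lambda>x. T (f x))"
proof -
  obtain K where K: "\<And>x. norm (T x) \<le> norm x * K" "K > 0" using bounded_linear.pos_bounded[OF T] by blast
  have "(\<lambda>x. T (f x)) \<in> borel_measurable borel"
    using f borel_measurable_continuous_on[OF linear_continuous_on[OF T], of f] by (simp add: weighted_L2_def)
  then show ?thesis
    using K by (intro weighted_L2_bound(1)[OF f, where K = K]) (auto simp: mult.commute)
qed

lemma weighted_L2_scaleR: "weighted_L2 f \<Longrightarrow> weighted_L2 (\<lambda>x. c *\<^sub>R f x)"
  by (rule weighted_L2_linear[OF bounded_linear_scaleR_right])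

lemma weighted_L2_scaleC:
  fixes f :: "real \<Rightarrow> 'a::{chilbert_space, second_countable_topology}"
  shows "weighted_L2 f \<Longrightarrow> weighted_L2 (\<lambda>x. c *\<^sub>C f x)"
  by (rule weighted_L2_linear[OF bounded_linear_scaleC])

lemma weighted_L2_diff: "weighted_L2 f \<Longrightarrow> weighted_L2 g \<Longrightarrow> weighted_L2 (\<lambda>x. f x - g x)"
  using weighted_L2_add(1)[OF _ weighted_L2_scaleR[of g "-1"], of f] by simp

lemma weighted_L2_compact_support:
  assumes f: "continuous_on UNIV f" and 0: "\<And>x. x \<notin> {a..b} \<Longrightarrow> f x = 0"
  shows "weighted_L2 f"
proof -
  have "integrable lborel (\<lambda>x. weight 0 x * (norm (f x))\<^sup>2)"
    by (rule integrable_compact_support(1)[where a = a and b = b])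
      (use 0 in \<open>auto intro!: locally_integrable_continuous continuous_intros continuous_weight f\<close>)
  then show ?thesis using borel_measurable_continuous_onI[OF f] by (simp add: weighted_L2_def)
qed

lemma weighted_L2_test_function:
  assumes \<theta>: "test_function \<theta>" shows "weighted_L2 (\<lambda>x. (deriv ^^ n) \<theta> x *\<^sub>R y)"
proof -
  obtain L where L: "\<forall>n x. x \<notin> {-L..L} \<longrightarrow> (deriv ^^ n) \<theta> x = 0"
    using test_function_support[OF \<theta>] by blast
  show ?thesis
    by (rule weighted_L2_compact_support[where a = "-L" and b = L])
      (use L in \<open>auto intro!: continuous_intros test_function_continuous[OF \<theta>]\<close>)
qed

lemma weighted_L2_complete:
  fixes f :: "nat \<Rightarrow> real \<Rightarrow> 'a::{banach, second_countable_topology}"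
  assumes f: "\<And>n. weighted_L2 (f n)"
    and C: "\<And>e. e > 0 \<Longrightarrow> \<exists>N. \<forall>m\<ge>N. \<forall>n\<ge>N. wnorm2 0 (\<lambda>x. f m x - f n x) < e"
  obtains g r where "weighted_L2 g" "(\<lambda>n. wnorm2 0 (\<lambda>x. f n x - g x)) \<longlonglongrightarrow> 0"
    "strict_mono (r :: nat \<Rightarrow> nat)" "AE x in lborel. (\<lambda>n. f (r n) x) \<longlonglongrightarrow> g x"
proof -
  let ?M = "density lborel (\<lambda>x. ennreal (weight 0 x))"
  have w: "AE x in lborel. 0 \<le> weight 0 x" using weight_pos[of 0] by (intro AE_I2 less_imp_le)
  have [measurable]: "f n \<in> borel_measurable borel" for n using f by (simp add: weighted_L2_def)
  have I: "integrable ?M h \<longleftrightarrow> integrable lborel (\<lambda>x. weight 0 x *\<^sub>R h x)"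
    "integral\<^sup>L ?M h = (LINT x|lborel. weight 0 x *\<^sub>R h x)" if [measurable]: "h \<in> borel_measurable borel" for h :: "real \<Rightarrow> real"
    using w by (simp_all add: integrable_density integral_density)
  have "\<exists>g r. g \<in> borel_measurable ?M \<and> integrable ?M (\<lambda>x. (norm (g x))\<^sup>2) \<and>
    (\<lambda>n. LINT x|?M. (norm (f n x - g x))\<^sup>2) \<longlonglongrightarrow> 0 \<and>
    strict_mono (r :: nat \<Rightarrow> nat) \<and> (AE x in ?M. (\<lambda>n. f (r n) x) \<longlonglongrightarrow> g x)"
  proof (rule L2_complete[of f ?M])
    show "f n \<in> borel_measurable ?M" for n by simp
    show "integrable ?M (\<lambda>x. (norm (f n x))\<^sup>2)" for n using f[of n] by (simp add: I weighted_L2_def)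
    show "\<exists>N. \<forall>m\<ge>N. \<forall>n\<ge>N. (LINT x|?M. (norm (f m x - f n x))\<^sup>2) < e" if "e > 0" for e
      using C[OF that] by (simp add: I wnorm2_def)
  qed blast
  then obtain g and r :: "nat \<Rightarrow> nat" where g: "g \<in> borel_measurable borel" "integrable ?M (\<lambda>x. (norm (g x))\<^sup>2)"
    "(\<lambda>n. LINT x|?M. (norm (f n x - g x))\<^sup>2) \<longlonglongrightarrow> 0" "strict_mono r"
    "AE x in ?M. (\<lambda>n. f (r n) x) \<longlonglongrightarrow> g x" by auto
  note g(1)[measurable]
  have "weighted_L2 g" using g(1,2) by (simp add: I weighted_L2_def)
  moreover have "(\<lambda>n. wnorm2 0 (\<lambda>x. f n x - g x)) \<longlonglongrightarrow> 0" using g(3) by (simp add: I wnorm2_def)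
  moreover have "AE x in lborel. (\<lambda>n. f (r n) x) \<longlonglongrightarrow> g x"
    using g(5) weight_pos[of 0] by (simp add: AE_density)
  ultimately show thesis using that g(4) by blast
qed

lemma integral_tendsto_of_wnorm2:
  assumes \<theta>: "test_function \<theta>" and h: "\<And>n. weighted_L2 (h n)" and 0: "(\<lambda>n. wnorm2 0 (h n)) \<longlonglongrightarrow> 0"
  shows "(\<lambda>n. LINT x|lborel. (deriv ^^ k) \<theta> x *\<^sub>R h n x) \<longlonglongrightarrow> 0"
proof (rule LIMSEQ_I)
  fix e :: real assume e: "e > 0"
  let ?t = "(deriv ^^ k) \<theta>"
  have ct: "continuous_on UNIV ?t" by (rule test_function_continuous[OF \<theta>])
  note ct[THEN borel_measurable_continuous_onI, measurable]
  have iC: "integrable lborel (\<lambda>x. (?t x)\<^sup>2 / weight 0 x)"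
    using test_function_integrable_real[OF \<theta>, of "\<lambda>x. ?t x / weight 0 x" k] weight_pos[of 0]
    by (auto simp: power2_eq_square intro!: continuous_intros ct continuous_weight less_imp_neq[symmetric])
  define C where "C = (LINT x|lborel. (?t x)\<^sup>2 / weight 0 x)"
  have C: "0 \<le> C" unfolding C_def using weight_pos[of 0] by (intro Bochner_Integration.integral_nonneg) (simp add: less_imp_le)
  define d where "d = e / (2 * (C + 1))"
  have d: "d > 0" using e C by (simp add: d_def)
  obtain N where N: "\<And>n. n \<ge> N \<Longrightarrow> wnorm2 0 (h n) < d * (e / 2)"
    using LIMSEQ_D[OF 0, of "d * (e / 2)"] d e wnorm2_nonneg[of 0 "h _"] by auto
  have "norm ((LINT x|lborel. ?t x *\<^sub>R h n x) - 0) < e" if "n \<ge> N" for n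
  proof -
    have pt: "norm (?t x *\<^sub>R h n x) \<le> d * ((?t x)\<^sup>2 / weight 0 x) + (1 / d) * (weight 0 x * (norm (h n x))\<^sup>2)" for x
    proof -
      have "0 \<le> (d * \<bar>?t x\<bar> - weight 0 x * norm (h n x))\<^sup>2 / (d * weight 0 x)"
        using d weight_pos[of 0 x] by simp
      also have "\<dots> = d * ((?t x)\<^sup>2 / weight 0 x) + (1 / d) * (weight 0 x * (norm (h n x))\<^sup>2) - 2 * (\<bar>?t x\<bar> * norm (h n x))"
        using d weight_pos[of 0 x] by (simp add: power2_eq_square field_simps)
      finally have "\<bar>?t x\<bar> * norm (h n x) * 2 \<le> d * ((?t x)\<^sup>2 / weight 0 x) + (1 / d) * (weight 0 x * (norm (h n x))\<^sup>2)"
        by simp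
      moreover have "0 \<le> \<bar>?t x\<bar> * norm (h n x)" by simp
      ultimately show ?thesis unfolding norm_scaleR by linarith
    qed
    note ih = weighted_L2_integrable[OF h, of 0 n]
    have "norm (LINT x|lborel. ?t x *\<^sub>R h n x) \<le> (LINT x|lborel. norm (?t x *\<^sub>R h n x))"
      by (rule integral_norm_bound)
    also have "\<dots> \<le> (LINT x|lborel. d * ((?t x)\<^sup>2 / weight 0 x) + (1 / d) * (weight 0 x * (norm (h n x))\<^sup>2))"
      using iC ih pt test_function_integrable[OF \<theta> weighted_L2_locally_integrable[OF h]]
      by (intro integral_mono integrable_norm Bochner_Integration.integrable_add integrable_mult_right) auto
    also have "\<dots> = d * C + wnorm2 0 (h n) / d"
      unfolding C_def wnorm2_def integral_mult_right_zero
        Bochner_Integration.integral_add[OF integrable_mult_right[OF iC] integrable_mult_right[OF ih]]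
      by simp
    also have "\<dots> < e / 2 + e / 2"
    proof (rule add_le_less_mono)
      show "d * C \<le> e / 2" using e C by (simp add: d_def field_simps)
      show "wnorm2 0 (h n) / d < e / 2" using N[OF that] d by (simp add: field_simps)
    qed
    finally show ?thesis by simp
  qed
  then show "\<exists>N. \<forall>n\<ge>N. norm ((LINT x|lborel. ?t x *\<^sub>R h n x) - 0) < e" by blast
qed

text \<open>Convergence in the weighted space implies convergence of the norms.\<close>

lemma wnorm2_tendsto:
  assumes p: "weighted_L2 p" and q: "\<And>n. weighted_L2 (q n)" and 0: "(\<lambda>n. wnorm2 0 (\<lambda>x. q n x - p x)) \<longlonglongrightarrow> 0"
  shows "(\<lambda>n. wnorm2 0 (q n)) \<longlonglongrightarrow> wnorm2 0 p"
proof (rule LIMSEQ_I)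
  fix e :: real assume e: "e > 0"
  define P where "P = wnorm2 0 p"
  have P: "0 \<le> P" by (simp add: P_def wnorm2_nonneg)
  define d where "d = e / (2 * (P + 1))"
  have d: "d > 0" using e P by (simp add: d_def)
  define c where "c = 1 + 1 / d"
  have c: "c > 0" using d by (simp add: c_def add_pos_pos)
  obtain N where N: "\<And>n. n \<ge> N \<Longrightarrow> wnorm2 0 (\<lambda>x. q n x - p x) < (e / 2) / c"
    using LIMSEQ_D[OF 0, of "(e / 2) / c"] c e by (auto simp: wnorm2_nonneg)
  have "norm (wnorm2 0 (q n) - wnorm2 0 p) < e" if "n \<ge> N" for n
  proof -
    have pt: "\<bar>(norm a)\<^sup>2 - (norm b)\<^sup>2\<bar> \<le> d * (norm b)\<^sup>2 + c * (norm (a - b))\<^sup>2" for a b :: 'a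
    proof -
      let ?r = "norm (a - b)" and ?b = "norm b"
      have ab: "norm a \<le> ?b + ?r" "?b \<le> norm a + ?r"
        using norm_triangle_ineq[of b "a - b"] norm_triangle_ineq[of a "b - a"] by (auto simp: norm_minus_commute)
      have "\<bar>(norm a)\<^sup>2 - ?b\<^sup>2\<bar> = \<bar>norm a - ?b\<bar> * (norm a + ?b)"
        by (simp add: power2_eq_square square_diff_square_factored abs_mult mult.commute)
      also have "\<dots> \<le> ?r * (2 * ?b + ?r)" using ab by (intro mult_mono) auto
      also have "\<dots> \<le> d * ?b\<^sup>2 + c * ?r\<^sup>2"
      proof -
        have "0 \<le> (d * ?b - ?r)\<^sup>2 / d" using d by simp
        also have "\<dots> = d * ?b\<^sup>2 + ?r\<^sup>2 / d - 2 * (?r * ?b)" using d by (simp add: power2_eq_square field_simps)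
        finally show ?thesis by (simp add: c_def power2_eq_square algebra_simps)
      qed
      finally show ?thesis .
    qed
    note ip = weighted_L2_integrable[OF p, of 0] and iq = weighted_L2_integrable[OF q, of 0 n]
      and id = weighted_L2_integrable[OF weighted_L2_diff[OF q p], of 0 n]
    have "norm (wnorm2 0 (q n) - wnorm2 0 p) = norm (LINT x|lborel. weight 0 x * (norm (q n x))\<^sup>2 - weight 0 x * (norm (p x))\<^sup>2)"
      unfolding wnorm2_def using ip iq by simp
    also have "\<dots> \<le> (LINT x|lborel. norm (weight 0 x * (norm (q n x))\<^sup>2 - weight 0 x * (norm (p x))\<^sup>2))"
      by (rule integral_norm_bound)
    also have "\<dots> \<le> (LINT x|lborel. d * (weight 0 x * (norm (p x))\<^sup>2) + c * (weight 0 x * (norm (q n x - p x))\<^sup>2))"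
    proof (rule integral_mono)
      show "integrable lborel (\<lambda>x. norm (weight 0 x * (norm (q n x))\<^sup>2 - weight 0 x * (norm (p x))\<^sup>2))"
        using ip iq by (intro integrable_norm Bochner_Integration.integrable_diff)
      show "integrable lborel (\<lambda>x. d * (weight 0 x * (norm (p x))\<^sup>2) + c * (weight 0 x * (norm (q n x - p x))\<^sup>2))"
        using ip id by simp
      fix x
      have "norm (weight 0 x * (norm (q n x))\<^sup>2 - weight 0 x * (norm (p x))\<^sup>2) = weight 0 x * \<bar>(norm (q n x))\<^sup>2 - (norm (p x))\<^sup>2\<bar>"
        using weight_pos[of 0 x] by (simp add: abs_mult flip: right_diff_distrib)
      also have "\<dots> \<le> weight 0 x * (d * (norm (p x))\<^sup>2 + c * (norm (q n x - p x))\<^sup>2)"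
        by (intro mult_left_mono pt less_imp_le weight_pos)
      finally show "norm (weight 0 x * (norm (q n x))\<^sup>2 - weight 0 x * (norm (p x))\<^sup>2)
          \<le> d * (weight 0 x * (norm (p x))\<^sup>2) + c * (weight 0 x * (norm (q n x - p x))\<^sup>2)"
        by (simp add: algebra_simps)
    qed
    also have "\<dots> = d * P + c * wnorm2 0 (\<lambda>x. q n x - p x)"
      using ip id by (simp add: P_def wnorm2_def)
    also have "\<dots> < e / 2 + e / 2"
    proof (rule add_le_less_mono)
      show "d * P \<le> e / 2" using e P by (simp add: d_def field_simps)
      show "c * wnorm2 0 (\<lambda>x. q n x - p x) < e / 2" using N[OF that] c by (simp add: field_simps)
    qed
    finally show ?thesis by simp
  qed
  then show "\<exists>N. \<forall>n\<ge>N. norm (wnorm2 0 (q n) - wnorm2 0 p) < e" by blast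
qed

lemma weak_derivative_cong_AE:
  assumes "AE x in lborel. u x = u' x" "u \<in> borel_measurable borel" "u' \<in> borel_measurable borel"
    and d: "weak_derivative k u v"
  shows "weak_derivative k u' v"
  unfolding weak_derivative_def
proof (intro allI impI)
  fix \<theta> assume \<theta>: "test_function \<theta>"
  note [measurable] = assms(2,3) borel_measurable_continuous_onI[OF test_function_continuous[OF \<theta>]]
  have "(LINT x|lborel. (deriv ^^ k) \<theta> x *\<^sub>R u' x) = (LINT x|lborel. (deriv ^^ k) \<theta> x *\<^sub>R u x)"
    by (rule integral_cong_AE) (use assms(1) in \<open>auto elim!: eventually_mono\<close>)
  then show "(LINT x|lborel. (deriv ^^ k) \<theta> x *\<^sub>R u' x) = (- 1) ^ k *\<^sub>R (LINT x|lborel. \<theta> x *\<^sub>R v x)"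
    using d \<theta> by (simp add: weak_derivative_def)
qed

lemma weak_derivative_add_scaleR:
  assumes u: "locally_integrable u" "locally_integrable u'" and v: "locally_integrable v" "locally_integrable v'"
    and "weak_derivative k u v" "weak_derivative k u' v'"
  shows "weak_derivative k (\<lambda>x. u x + c *\<^sub>R u' x) (\<lambda>x. v x + c *\<^sub>R v' x)"
  unfolding weak_derivative_def
proof (intro allI impI)
  fix \<theta> assume \<theta>: "test_function \<theta>"
  have lin: "(LINT x|lborel. (deriv ^^ j) \<theta> x *\<^sub>R (f x + c *\<^sub>R g x))
      = (LINT x|lborel. (deriv ^^ j) \<theta> x *\<^sub>R f x) + c *\<^sub>R (LINT x|lborel. (deriv ^^ j) \<theta> x *\<^sub>R g x)"
    if "locally_integrable f" "locally_integrable g" for j and f g :: "real \<Rightarrow> 'a"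
  proof -
    have "(LINT x|lborel. (deriv ^^ j) \<theta> x *\<^sub>R (f x + c *\<^sub>R g x))
        = (LINT x|lborel. (deriv ^^ j) \<theta> x *\<^sub>R f x + c *\<^sub>R (deriv ^^ j) \<theta> x *\<^sub>R g x)"
      by (simp only: scaleR_add_right scaleR_left_commute[of _ c])
    also have "\<dots> = (LINT x|lborel. (deriv ^^ j) \<theta> x *\<^sub>R f x) + (LINT x|lborel. c *\<^sub>R (deriv ^^ j) \<theta> x *\<^sub>R g x)"
      by (intro Bochner_Integration.integral_add integrable_scaleR_right test_function_integrable[OF \<theta>] that)
    finally show ?thesis by (simp only: integral_scaleR_right)
  qed
  show "(LINT x|lborel. (deriv ^^ k) \<theta> x *\<^sub>R (u x + c *\<^sub>R u' x)) = (- 1) ^ k *\<^sub>R (LINT x|lborel. \<theta> x *\<^sub>R (v x + c *\<^sub>R v' x))"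
    using lin[OF u, of k] lin[OF v, of 0] assms(5,6) \<theta>
    by (simp add: weak_derivative_def scaleR_add_right scaleR_left_commute[of _ c])
qed

context complex_positive_operator
begin

text \<open>Strong solutions in the weighted space. The second derivative \<open>u2\<close> and the function \<open>b\<close>, which is
  \<open>B u\<close>, are separate arguments because limits have to be taken in them as well.\<close>

definition solution ::
  "complex \<Rightarrow> (real \<Rightarrow> 'a) \<Rightarrow> (real \<Rightarrow> 'a) \<Rightarrow> (real \<Rightarrow> 'a) \<Rightarrow> (real \<Rightarrow> 'a) \<Rightarrow> bool" where
  "solution w f u u2 b \<longleftrightarrow> weighted_L2 u \<and> weighted_L2 u2 \<and> weighted_L2 b \<and> f \<in> borel_measurable borel
     \<and> weak_derivative 2 u u2 \<and> (AE x in lborel. u x \<in> D \<and> B (u x) = b x)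
     \<and> (AE x in lborel. f x = - u2 x + b x + u x - w *\<^sub>C u x)"

lemma solution_weighted_L2:
  assumes "solution w f u u2 b" shows "weighted_L2 f"
proof -
  have "weighted_L2 (\<lambda>x. ((b x - u2 x) + u x) - w *\<^sub>C u x)"
    using assms by (auto simp: solution_def intro!: weighted_L2_add(1) weighted_L2_diff weighted_L2_scaleC)
  moreover have "AE x in lborel. norm (f x) \<le> 1 * norm (((b x - u2 x) + u x) - w *\<^sub>C u x)"
  proof -
    have "AE x in lborel. f x = - u2 x + b x + u x - w *\<^sub>C u x" using assms by (simp add: solution_def)
    then show ?thesis
    proof eventually_elim
      case (elim x)
      then have "f x = ((b x - u2 x) + u x) - w *\<^sub>C u x" by simp
      then show ?case by (simp only: mult_1)
    qed
  qed
  ultimately show ?thesis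
    using assms by (intro weighted_L2_bound(1)[of "\<lambda>x. ((b x - u2 x) + u x) - w *\<^sub>C u x" f 1]) (auto simp: solution_def)
qed

text \<open>A function with a second weak derivative is almost everywhere an iterated antiderivative, to which the
  energy estimate applies.\<close>

lemma solution_estimates:
  assumes s: "solution w f u u2 b" and w: "Re w \<le> cmod w / 2"
  shows "(1 + cmod w)\<^sup>2 * wnorm2 a u \<le> 16 * wnorm2 a f"
    and "wnorm2 a b \<le> 84 * wnorm2 a f" "wnorm2 a u2 \<le> 236 * wnorm2 a f"
    and "\<exists>u1. weighted_L2 u1 \<and> weak_derivative 1 u u1 \<and> (\<forall>a. wnorm2 a u1 \<le> 32 * wnorm2 a f)"
proof -
  have L: "weighted_L2 u" "weighted_L2 u2" "weighted_L2 b" and d: "weak_derivative 2 u u2"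
    and fm: "f \<in> borel_measurable borel"
    using s by (auto simp: solution_def)
  obtain U U1 where U: "antiderivative U U1" "antiderivative U1 u2" "AE x in lborel. u x = U x"
    using second_weak_derivative_representation[OF L(1,2)[THEN weighted_L2_locally_integrable] d] by blast
  have um: "u \<in> borel_measurable borel" using L by (simp add: weighted_L2_def)
  have Um: "U \<in> borel_measurable borel" "U1 \<in> borel_measurable borel"
    using U antiderivative_continuous borel_measurable_continuous_onI by blast+
  have LU: "weighted_L2 U"
    by (rule weighted_L2_bound(1)[OF L(1) Um(1), of 1]) (use U(3) in \<open>auto elim!: eventually_mono\<close>)
  have bU: "AE x in lborel. U x \<in> D \<and> B (U x) = b x" and fU: "AE x in lborel. f x = - u2 x + b x + U x - w *\<^sub>C U x"
    using s U(3) unfolding solution_def by (auto elim!: eventually_elim2)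
  note E = energy_estimate[OF U(1,2) LU L(2,3) bU fU fm w]
  have n: "wnorm2 a u = wnorm2 a U" for a
    using U(3) um Um(1) by (intro wnorm2_cong_AE) (auto elim!: eventually_mono)
  show "(1 + cmod w)\<^sup>2 * wnorm2 a u \<le> 16 * wnorm2 a f" unfolding n by (rule E(1))
  show "wnorm2 a b \<le> 84 * wnorm2 a f" "wnorm2 a u2 \<le> 236 * wnorm2 a f" by (rule E(4), rule E(5))
  have "AE x in lborel. U x = u x" using U(3) by eventually_elim simp
  then have "weak_derivative 1 u U1"
    by (rule weak_derivative_cong_AE[OF _ Um(1) um weak_derivative_antiderivative[OF U(1)]])
  moreover have "weighted_L2 U1" using E(2)[of 0] Um(2) by (simp add: weighted_L2_def)
  ultimately show "\<exists>u1. weighted_L2 u1 \<and> weak_derivative 1 u u1 \<and> (\<forall>a. wnorm2 a u1 \<le> 32 * wnorm2 a f)"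
    using E(3) by blast
qed

lemma solution_add_scaleR:
  assumes "solution w f u u2 b" "solution w f' u' u2' b'"
  shows "solution w (\<lambda>x. f x + c *\<^sub>R f' x) (\<lambda>x. u x + c *\<^sub>R u' x) (\<lambda>x. u2 x + c *\<^sub>R u2' x) (\<lambda>x. b x + c *\<^sub>R b' x)"
proof -
  have 1: "AE x in lborel. u x + c *\<^sub>R u' x \<in> D \<and> B (u x + c *\<^sub>R u' x) = b x + c *\<^sub>R b' x"
    using assms unfolding solution_def
    by (auto elim!: eventually_elim2 simp: dom_add dom_scaleR B_add B_scaleR)
  have sc: "w *\<^sub>C (c *\<^sub>R x) = c *\<^sub>R (w *\<^sub>C x)" for x :: 'a
    by (simp add: scaleC_scaleC mult.commute flip: scaleC_of_real)
  have 2: "AE x in lborel. f x + c *\<^sub>R f' x = - (u2 x + c *\<^sub>R u2' x) + (b x + c *\<^sub>R b' x)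
      + (u x + c *\<^sub>R u' x) - w *\<^sub>C (u x + c *\<^sub>R u' x)"
  proof -
    have "AE x in lborel. f x = - u2 x + b x + u x - w *\<^sub>C u x"
      "AE x in lborel. f' x = - u2' x + b' x + u' x - w *\<^sub>C u' x"
      using assms by (auto simp: solution_def)
    then show ?thesis
      by eventually_elim (simp add: scaleC_add_right sc scaleR_add_right scaleR_diff_right)
  qed
  show ?thesis
    using assms 1 2 unfolding solution_def
    by (auto intro!: weighted_L2_add(1) weighted_L2_scaleR weak_derivative_add_scaleR
        weighted_L2_locally_integrable)
qed


text \<open>The energy estimate controls \<open>u\<close>, \<open>u2\<close> and \<open>b\<close> separately, so all three converge. Weak derivatives
  pass to the limit, and \<open>B\<close> is closed.\<close>

lemma solution_range_complete:
  assumes w: "Re w \<le> cmod w / 2" and X: "\<And>n. solution w (X n) (u n) (u2 n) (b n)"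
    and C: "\<And>e. e > 0 \<Longrightarrow> \<exists>K. \<forall>m\<ge>K. \<forall>n\<ge>K. wnorm2 0 (\<lambda>x. X m x - X n x) < e"
  shows "\<exists>g v v2 c. solution w g v v2 c \<and> (\<lambda>n. wnorm2 0 (\<lambda>x. X n x - g x)) \<longlonglongrightarrow> 0"
proof -
  have L: "weighted_L2 (u n)" "weighted_L2 (u2 n)" "weighted_L2 (b n)" for n
    using X[of n] by (auto simp: solution_def)
  note [measurable] = L[THEN weighted_L2_measurable]
  define F where "F = (\<lambda>n x. (u n x, u2 n x, b n x))"
  have [measurable]: "F n \<in> borel_measurable borel" for n
    unfolding F_def by (intro borel_measurable_Pair) auto
  have nF: "(norm (p, q, r))\<^sup>2 = (norm p)\<^sup>2 + (norm q)\<^sup>2 + (norm r)\<^sup>2" for p q r :: 'a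
    by (simp add: norm_Pair)
  have wF: "weighted_L2 (\<lambda>x. (p x, q x, r x)) \<and>
      wnorm2 0 (\<lambda>x. (p x, q x, r x)) = wnorm2 0 p + wnorm2 0 q + wnorm2 0 r"
    if pqr: "weighted_L2 p" "weighted_L2 q" "weighted_L2 r" for p q r :: "real \<Rightarrow> 'a"
  proof -
    note i = pqr[THEN weighted_L2_integrable, of 0]
    have "(\<lambda>x. weight 0 x * (norm (p x, q x, r x))\<^sup>2)
        = (\<lambda>x. weight 0 x * (norm (p x))\<^sup>2 + weight 0 x * (norm (q x))\<^sup>2 + weight 0 x * (norm (r x))\<^sup>2)"
      by (simp only: nF distrib_left)
    moreover have "(\<lambda>x. (p x, q x, r x)) \<in> borel_measurable borel"
      using pqr by (intro borel_measurable_Pair) (auto simp: weighted_L2_def)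
    ultimately show ?thesis using i by (simp add: weighted_L2_def wnorm2_def)
  qed
  have WF: "weighted_L2 (F n)" for n unfolding F_def using wF L by blast
  have CF: "\<exists>N. \<forall>m\<ge>N. \<forall>n\<ge>N. wnorm2 0 (\<lambda>x. F m x - F n x) < e" if e: "e > 0" for e
  proof -
    \<comment> \<open>\<open>336 = 16 + 84 + 236\<close> is the sum of the constants in the estimates of \<open>u\<close>, \<open>b\<close> and \<open>u2\<close>.\<close>
    obtain K where K: "\<forall>m\<ge>K. \<forall>n\<ge>K. wnorm2 0 (\<lambda>x. X m x - X n x) < e / 336"
      using C[of "e / 336"] e by auto
    have "wnorm2 0 (\<lambda>x. F m x - F n x) < e" if "m \<ge> K" "n \<ge> K" for m n
    proof -
      have s: "solution w (\<lambda>x. X m x + (-1) *\<^sub>R X n x) (\<lambda>x. u m x + (-1) *\<^sub>R u n x)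
          (\<lambda>x. u2 m x + (-1) *\<^sub>R u2 n x) (\<lambda>x. b m x + (-1) *\<^sub>R b n x)"
        by (rule solution_add_scaleR[OF X X])
      note E = solution_estimates(1-3)[OF s[simplified] w, of 0]
      let ?d = "wnorm2 0 (\<lambda>x. X m x - X n x)"
      have "1 * wnorm2 0 (\<lambda>x. u m x - u n x) \<le> (1 + cmod w)\<^sup>2 * wnorm2 0 (\<lambda>x. u m x - u n x)"
        by (intro mult_right_mono wnorm2_nonneg) simp
      then have "wnorm2 0 (\<lambda>x. u m x - u n x) \<le> 16 * ?d" using E(1) by simp
      moreover have "wnorm2 0 (\<lambda>x. F m x - F n x) = wnorm2 0 (\<lambda>x. u m x - u n x)
          + wnorm2 0 (\<lambda>x. u2 m x - u2 n x) + wnorm2 0 (\<lambda>x. b m x - b n x)"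
        using wF[OF weighted_L2_diff[OF L(1) L(1)] weighted_L2_diff[OF L(2) L(2)] weighted_L2_diff[OF L(3) L(3)], of m n m n m n]
        by (simp add: F_def)
      moreover have "?d < e / 336" using K that by blast
      ultimately show ?thesis using E(2,3) by linarith
    qed
    then show ?thesis by blast
  qed
  obtain G and r :: "nat \<Rightarrow> nat" where G: "weighted_L2 G" "(\<lambda>n. wnorm2 0 (\<lambda>x. F n x - G x)) \<longlonglongrightarrow> 0"
    "strict_mono r" "AE x in lborel. (\<lambda>n. F (r n) x) \<longlonglongrightarrow> G x"
    by (rule weighted_L2_complete[OF WF CF])
  define v v2 c where "v = (\<lambda>x. fst (G x))" and "v2 = (\<lambda>x. fst (snd (G x)))" and "c = (\<lambda>x. snd (snd (G x)))"
  have LG: "weighted_L2 v" "weighted_L2 v2" "weighted_L2 c"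
    unfolding v_def v2_def c_def
    by (intro weighted_L2_linear[OF _ G(1)] bounded_linear_fst bounded_linear_snd
        bounded_linear_compose[OF bounded_linear_fst bounded_linear_snd]
        bounded_linear_compose[OF bounded_linear_snd bounded_linear_snd])+
  have Gv: "G = (\<lambda>x. (v x, v2 x, c x))" by (auto simp: v_def v2_def c_def)
  have split: "wnorm2 0 (\<lambda>x. F n x - G x) = wnorm2 0 (\<lambda>x. u n x - v x)
      + wnorm2 0 (\<lambda>x. u2 n x - v2 x) + wnorm2 0 (\<lambda>x. b n x - c x)" for n
    using wF[OF weighted_L2_diff[OF L(1) LG(1)] weighted_L2_diff[OF L(2) LG(2)] weighted_L2_diff[OF L(3) LG(3)], of n n n]
    by (simp add: F_def Gv)
  have lim: "(\<lambda>n. wnorm2 0 (\<lambda>x. u n x - v x)) \<longlonglongrightarrow> 0" "(\<lambda>n. wnorm2 0 (\<lambda>x. u2 n x - v2 x)) \<longlonglongrightarrow> 0"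
    "(\<lambda>n. wnorm2 0 (\<lambda>x. b n x - c x)) \<longlonglongrightarrow> 0"
    by (rule tendsto_sandwich[OF _ _ tendsto_const G(2)];
        intro always_eventually allI; simp add: split wnorm2_nonneg)+
  have AEc: "AE x in lborel. v x \<in> D \<and> B (v x) = c x"
  proof -
    have "AE x in lborel. \<forall>n. u n x \<in> D \<and> B (u n x) = b n x"
      unfolding AE_all_countable using X by (auto simp: solution_def)
    then show ?thesis using G(4)
    proof eventually_elim
      case (elim x)
      have "(\<lambda>n. u (r n) x) \<longlonglongrightarrow> v x" using tendsto_fst[OF elim(2)] by (simp add: F_def v_def)
      moreover have "(\<lambda>n. b (r n) x) \<longlonglongrightarrow> c x"
        using tendsto_snd[OF tendsto_snd[OF elim(2)]] by (simp add: F_def c_def)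
      ultimately show ?case using closed[of "\<lambda>n. u (r n) x" "v x" "c x"] elim(1) by simp
    qed
  qed
  have wd: "weak_derivative 2 v v2"
    unfolding weak_derivative_def
  proof (intro allI impI)
    fix \<theta> assume \<theta>: "test_function \<theta>"
    have conv: "(\<lambda>n. LINT x|lborel. (deriv ^^ k) \<theta> x *\<^sub>R p n x) \<longlonglongrightarrow> (LINT x|lborel. (deriv ^^ k) \<theta> x *\<^sub>R q x)"
      if p: "\<And>n. weighted_L2 (p n)" and q: "weighted_L2 q" and 0: "(\<lambda>n. wnorm2 0 (\<lambda>x. p n x - q x)) \<longlonglongrightarrow> 0"
      for p and q :: "real \<Rightarrow> 'a" and k
    proof -
      have "(\<lambda>n. LINT x|lborel. (deriv ^^ k) \<theta> x *\<^sub>R (p n x - q x)) \<longlonglongrightarrow> 0"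
        by (rule integral_tendsto_of_wnorm2[OF \<theta> weighted_L2_diff[OF p q] 0])
      moreover have "(LINT x|lborel. (deriv ^^ k) \<theta> x *\<^sub>R (p n x - q x))
          = (LINT x|lborel. (deriv ^^ k) \<theta> x *\<^sub>R p n x) - (LINT x|lborel. (deriv ^^ k) \<theta> x *\<^sub>R q x)" for n
        using test_function_integrable[OF \<theta> weighted_L2_locally_integrable[OF p[of n]]]
          test_function_integrable[OF \<theta> weighted_L2_locally_integrable[OF q]]
        by (simp add: scaleR_diff_right)
      ultimately show ?thesis by (simp add: LIM_zero_iff)
    qed
    have "(LINT x|lborel. (deriv ^^ 2) \<theta> x *\<^sub>R u n x) = (LINT x|lborel. (deriv ^^ 0) \<theta> x *\<^sub>R u2 n x)" for n
      using X[of n] \<theta> by (simp add: solution_def weak_derivative_def)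
    then show "(LINT x|lborel. (deriv ^^ 2) \<theta> x *\<^sub>R v x) = (- 1)\<^sup>2 *\<^sub>R (LINT x|lborel. \<theta> x *\<^sub>R v2 x)"
      using LIMSEQ_unique[OF conv[OF L(1) LG(1) lim(1), of 2]] conv[OF L(2) LG(2) lim(2), of 0] by simp
  qed
  define g where "g = (\<lambda>x. - v2 x + c x + v x - w *\<^sub>C v x)"
  have Lg: "weighted_L2 g"
  proof -
    have "weighted_L2 (\<lambda>x. ((c x - v2 x) + v x) - w *\<^sub>C v x)"
      by (intro weighted_L2_add(1) weighted_L2_diff weighted_L2_scaleC LG)
    then show ?thesis by (simp add: g_def)
  qed
  have s: "solution w g v v2 c"
    using LG wd AEc Lg by (simp add: solution_def g_def weighted_L2_def)
  moreover have "(\<lambda>n. wnorm2 0 (\<lambda>x. X n x - g x)) \<longlonglongrightarrow> 0"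
  proof (rule tendsto_sandwich[OF _ _ tendsto_const])
    let ?R = "\<lambda>n. 2 * (2 * (wnorm2 0 (\<lambda>x. b n x - c x)) + 2 * wnorm2 0 (\<lambda>x. u2 n x - v2 x))
        + 2 * ((1 + cmod w)\<^sup>2 * wnorm2 0 (\<lambda>x. u n x - v x))"
    have "?R \<longlonglongrightarrow> 2 * (2 * 0 + 2 * 0) + 2 * ((1 + cmod w)\<^sup>2 * 0)"
      by (intro tendsto_intros lim)
    then show "?R \<longlonglongrightarrow> 0" by simp
    show "\<forall>\<^sub>F n in sequentially. 0 \<le> wnorm2 0 (\<lambda>x. X n x - g x)"
      by (intro always_eventually allI wnorm2_nonneg)
    show "\<forall>\<^sub>F n in sequentially. wnorm2 0 (\<lambda>x. X n x - g x) \<le> ?R n"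
    proof (intro always_eventually allI)
      fix n
      let ?p = "\<lambda>x. b n x - c x" and ?q = "\<lambda>x. (-1) *\<^sub>R (u2 n x - v2 x)" and ?t = "\<lambda>x. (1 - w) *\<^sub>C (u n x - v x)"
      have Ls: "weighted_L2 ?p" "weighted_L2 ?q" "weighted_L2 ?t"
        by (intro weighted_L2_diff weighted_L2_scaleR weighted_L2_scaleC L LG)+
      have AEX: "AE x in lborel. X n x - g x = ?p x + ?q x + ?t x"
      proof -
        have "AE x in lborel. X n x = - u2 n x + b n x + u n x - w *\<^sub>C u n x"
          using X[of n] by (simp add: solution_def)
        then show ?thesis by eventually_elim (simp add: g_def scaleC_simps)
      qed
      have m: "X n \<in> borel_measurable borel" using X[of n] by (simp add: solution_def)
      have "wnorm2 0 (\<lambda>x. X n x - g x) = wnorm2 0 (\<lambda>x. ?p x + ?q x + ?t x)"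
      proof (rule wnorm2_cong_AE)
        show "AE x in lborel. norm (X n x - g x) = norm (?p x + ?q x + ?t x)"
          using AEX by eventually_elim (simp only:)
        show "(\<lambda>x. X n x - g x) \<in> borel_measurable borel"
          using m Lg by (intro borel_measurable_diff) (auto simp: weighted_L2_def)
        show "(\<lambda>x. ?p x + ?q x + ?t x) \<in> borel_measurable borel"
          using weighted_L2_add(1)[OF weighted_L2_add(1)[OF Ls(1,2)] Ls(3)] by (simp add: weighted_L2_def)
      qed
      also have "\<dots> \<le> 2 * wnorm2 0 (\<lambda>x. ?p x + ?q x) + 2 * wnorm2 0 ?t"
        by (rule weighted_L2_add(2)[OF weighted_L2_add(1)[OF Ls(1,2)] Ls(3)])
      also have "\<dots> \<le> 2 * (2 * wnorm2 0 ?p + 2 * wnorm2 0 ?q) + 2 * wnorm2 0 ?t"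
        by (intro add_right_mono mult_left_mono weighted_L2_add(2)[OF Ls(1,2)]) simp
      also have "wnorm2 0 ?q = wnorm2 0 (\<lambda>x. u2 n x - v2 x)" by (simp add: wnorm2_def norm_minus_commute)
      also have "wnorm2 0 ?t \<le> (1 + cmod w)\<^sup>2 * wnorm2 0 (\<lambda>x. u n x - v x)"
      proof (rule weighted_L2_bound(2)[OF weighted_L2_diff[OF L(1) LG(1)]])
        show "?t \<in> borel_measurable borel" using Ls(3) by (simp add: weighted_L2_def)
        have "cmod (1 - w) \<le> 1 + cmod w" using norm_triangle_ineq4[of 1 w] by simp
        then show "AE x in lborel. norm (?t x) \<le> (1 + cmod w) * norm (u n x - v x)"
          by (intro AE_I2) (simp add: norm_scaleC mult_right_mono)
      qed simp
      finally show "wnorm2 0 (\<lambda>x. X n x - g x) \<le> ?R n" by simp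
    qed
  qed
  ultimately show ?thesis by blast
qed

text \<open>Orthogonality is tested with the solutions \<open>\<theta> (B + 1)\<^sup>-\<^sup>1 y\<close> for test functions \<open>\<theta>\<close>. Moving the resolvent to
  the other side shows that \<open>h = (B + 1)\<^sup>-\<^sup>1 (weight \<sqdot> g)\<close> is a strong solution of the equation for
  \<open>cnj w\<close> with right-hand side zero, so the energy estimate gives \<open>h = 0\<close>.\<close>

lemma orthogonal_to_range_zero:
  assumes w: "Re w \<le> cmod w / 2" and g: "weighted_L2 g"
    and orth: "\<And>s v v2 c. solution w s v v2 c \<Longrightarrow> (LINT x|lborel. weight 0 x * inner (g x) (s x)) = 0"
  shows "AE x in lborel. g x = 0"
proof -
  have [measurable]: "g \<in> borel_measurable borel" using g by (simp add: weighted_L2_def)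
  let ?R = "res 1"
  have k: "(1::real) > 0" by simp
  interpret R: bounded_linear ?R by (rule bounded_linear_res[OF k])
  note res1 = res[OF k, unfolded scaleR_one]
  define G where "G = (\<lambda>x. weight 0 x *\<^sub>R g x)"
  have LG: "weighted_L2 G"
    by (rule weighted_L2_bound(1)[OF g, of _ 1])
      (use weight_pos[of 0] weight_le_1[of 0] in \<open>auto simp: G_def less_imp_le mult_left_le_one_le\<close>)
  define h where "h = (\<lambda>x. ?R (G x))"
  have Lh: "weighted_L2 h" unfolding h_def by (rule weighted_L2_linear[OF R.bounded_linear_axioms LG])
  define h2 where "h2 = (\<lambda>x. G x - cnj w *\<^sub>C h x)"
  have Lh2: "weighted_L2 h2" unfolding h2_def by (intro weighted_L2_diff weighted_L2_scaleC LG Lh)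
  have wd: "weak_derivative 2 h h2"
    unfolding weak_derivative_def
  proof (intro allI impI)
    fix \<theta> assume \<theta>: "test_function \<theta>"
    define V where "V = (LINT x|lborel. (deriv ^^ 2) \<theta> x *\<^sub>R h x) - (LINT x|lborel. \<theta> x *\<^sub>R h2 x)"
    have ih: "integrable lborel (\<lambda>x. (deriv ^^ 2) \<theta> x *\<^sub>R h x)"
      by (rule test_function_integrable[OF \<theta> weighted_L2_locally_integrable[OF Lh]])
    have ih2: "integrable lborel (\<lambda>x. \<theta> x *\<^sub>R h2 x)"
      using test_function_integrable[OF \<theta> weighted_L2_locally_integrable[OF Lh2], of 0] by simp
    have "inner V y = 0" for y
    proof -
      define s where "s = (\<lambda>x. - ((deriv ^^ 2) \<theta> x *\<^sub>R ?R y) + \<theta> x *\<^sub>R (y - ?R y) + \<theta> x *\<^sub>R ?R y - w *\<^sub>C (\<theta> x *\<^sub>R ?R y))"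
      have sol: "solution w s (\<lambda>x. \<theta> x *\<^sub>R ?R y) (\<lambda>x. (deriv ^^ 2) \<theta> x *\<^sub>R ?R y) (\<lambda>x. \<theta> x *\<^sub>R (y - ?R y))"
      proof -
        have 0: "weighted_L2 (\<lambda>x. \<theta> x *\<^sub>R z)" for z :: 'a using weighted_L2_test_function[OF \<theta>, of 0] by simp
        have 2: "weighted_L2 (\<lambda>x. (deriv ^^ 2) \<theta> x *\<^sub>R z)" for z :: 'a by (rule weighted_L2_test_function[OF \<theta>])
        have a0: "antiderivative \<theta> (deriv \<theta>)" "antiderivative (deriv \<theta>) ((deriv ^^ 2) \<theta>)"
          using antiderivative_DERIV[OF test_function_DERIV[OF \<theta>] test_function_continuous[OF \<theta>], of 0]
            antiderivative_DERIV[OF test_function_DERIV[OF \<theta>] test_function_continuous[OF \<theta>], of 1]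
          by (simp_all add: numeral_2_eq_2)
        have "weak_derivative 2 (\<lambda>x. \<theta> x *\<^sub>R ?R y) (\<lambda>x. (deriv ^^ 2) \<theta> x *\<^sub>R ?R y)"
          using a0[THEN antiderivative_linear[OF bounded_linear_scaleR_left], THEN weak_derivative_antiderivative]
          by (rule weak_derivative_trans)
        moreover have "weighted_L2 (\<lambda>x. (\<theta> x *\<^sub>R (y - ?R y) - (deriv ^^ 2) \<theta> x *\<^sub>R ?R y) + \<theta> x *\<^sub>R ?R y - w *\<^sub>C (\<theta> x *\<^sub>R ?R y))"
          by (intro weighted_L2_diff weighted_L2_add(1) weighted_L2_scaleC 0 2)
        then have "s \<in> borel_measurable borel" by (simp add: weighted_L2_def s_def)
        moreover have "\<theta> x *\<^sub>R ?R y \<in> D \<and> B (\<theta> x *\<^sub>R ?R y) = \<theta> x *\<^sub>R (y - ?R y)" for x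
          using res1 by (simp add: dom_scaleR B_scaleR)
        ultimately show ?thesis using 0 2 by (simp add: solution_def s_def)
      qed
      have pt: "weight 0 x * inner (g x) (s x) = inner (\<theta> x *\<^sub>R h2 x - (deriv ^^ 2) \<theta> x *\<^sub>R h x) y" for x
      proof -
        have 1: "inner (G x) (?R y) = inner (h x) y" by (simp add: h_def res_symmetric)
        have "inner (G x) (w *\<^sub>C ?R y) = inner (cnj w *\<^sub>C G x) (?R y)"
          by (simp add: inner_scaleC_left)
        also have "\<dots> = inner (cnj w *\<^sub>C h x) y"
          by (simp add: h_def res_scaleC flip: res_symmetric)
        finally have 2: "inner (G x) (w *\<^sub>C ?R y) = inner (cnj w *\<^sub>C h x) y" .
        have "w *\<^sub>C (\<theta> x *\<^sub>R ?R y) = \<theta> x *\<^sub>R (w *\<^sub>C ?R y)"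
          by (simp add: scaleC_scaleC mult.commute flip: scaleC_of_real)
        then have s': "s x = - ((deriv ^^ 2) \<theta> x *\<^sub>R ?R y) + \<theta> x *\<^sub>R y - \<theta> x *\<^sub>R (w *\<^sub>C ?R y)"
          by (simp add: s_def scaleR_diff_right)
        have "weight 0 x * inner (g x) (s x) = inner (G x) (s x)" by (simp add: G_def)
        also have "\<dots> = - ((deriv ^^ 2) \<theta> x * inner (h x) y) + \<theta> x * inner (G x) y - \<theta> x * inner (cnj w *\<^sub>C h x) y"
          by (simp add: s' inner_add_right inner_diff_right 1 2)
        also have "\<dots> = inner (\<theta> x *\<^sub>R h2 x - (deriv ^^ 2) \<theta> x *\<^sub>R h x) y"
          by (simp add: h2_def inner_diff_left right_diff_distrib)
        finally show ?thesis .
      qed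
      have "0 = (LINT x|lborel. inner (\<theta> x *\<^sub>R h2 x - (deriv ^^ 2) \<theta> x *\<^sub>R h x) y)"
        using orth[OF sol] by (simp add: pt)
      also have "\<dots> = inner (LINT x|lborel. \<theta> x *\<^sub>R h2 x - (deriv ^^ 2) \<theta> x *\<^sub>R h x) y"
        using ih ih2 by (intro integral_inner_left) auto
      also have "(LINT x|lborel. \<theta> x *\<^sub>R h2 x - (deriv ^^ 2) \<theta> x *\<^sub>R h x) = - V"
        using ih ih2 by (simp add: V_def)
      finally show ?thesis by simp
    qed
    from this[of V] have "V = 0" by simp
    then show "(LINT x|lborel. (deriv ^^ 2) \<theta> x *\<^sub>R h x) = (- 1)\<^sup>2 *\<^sub>R (LINT x|lborel. \<theta> x *\<^sub>R h2 x)"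
      by (simp add: V_def)
  qed
  have s: "solution (cnj w) (\<lambda>x. 0) h h2 (\<lambda>x. G x - h x)"
    using Lh Lh2 LG wd weighted_L2_diff[OF LG Lh] res1
    by (simp add: solution_def h_def h2_def)
  have w': "Re (cnj w) \<le> cmod (cnj w) / 2" using w by simp
  have "(1 + cmod w)\<^sup>2 * wnorm2 0 h \<le> 0" using solution_estimates(1)[OF s w', of 0] by (simp add: wnorm2_def)
  moreover have "0 < (1 + cmod w)\<^sup>2" by (intro zero_less_power add_pos_nonneg) auto
  ultimately have "wnorm2 0 h \<le> 0" by (simp add: mult_le_0_iff)
  from wnorm2_eq_0[OF Lh this] show ?thesis
  proof eventually_elim
    case (elim x)
    then have "G x = 0" using res1(2)[of "G x"] B_zero by (simp add: h_def)
    then show ?case using weight_pos[of 0 x] by (simp add: G_def)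
  qed
qed

text \<open>The difference of \<open>f\<close> and its best approximation in the range is orthogonal to the range.\<close>

lemma solution_exists:
  assumes w: "Re w \<le> cmod w / 2" and f: "weighted_L2 f"
  shows "\<exists>u u2 b. solution w f u u2 b"
proof -
  define R where "R = {g. \<exists>u u2 b. solution w g u u2 b}"
  have RL: "weighted_L2 g" if "g \<in> R" for g using that solution_weighted_L2 by (auto simp: R_def)
  have Radd: "(\<lambda>x. g x + c *\<^sub>R h x) \<in> R" if "g \<in> R" "h \<in> R" for g h c
    using that solution_add_scaleR unfolding R_def by blast
  have zero: "(\<lambda>x. 0) \<in> R"
  proof -
    have "solution w (\<lambda>x. 0) (\<lambda>x. 0) (\<lambda>x. 0) (\<lambda>x. 0)"
      by (simp add: solution_def weighted_L2_def weak_derivative_def zero_dom B_zero scaleC_simps)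
    then show ?thesis by (auto simp: R_def)
  qed
  have "\<exists>r\<in>R. \<forall>s\<in>R. wnorm2 0 (\<lambda>x. f x - r x) \<le> wnorm2 0 (\<lambda>x. f x - s x)"
  proof (rule minimizer_exists[where d = "\<lambda>g h. wnorm2 0 (\<lambda>x. g x - h x)"])
    show "R \<noteq> {}" using zero by blast
    show "0 \<le> wnorm2 0 (\<lambda>x. f x - r x)" for r by (rule wnorm2_nonneg)
    fix g h assume gh: "g \<in> R" "h \<in> R"
    let ?m = "\<lambda>x. (1/2) *\<^sub>R (g x + h x)"
    have m: "?m \<in> R" using Radd[OF Radd[OF zero gh(1), of "1/2"] gh(2), of "1/2"] by (simp add: scaleR_add_right)
    note i = weighted_L2_integrable[OF weighted_L2_diff[OF f RL], of _ 0]
    have "wnorm2 0 (\<lambda>x. g x - h x) = (LINT x|lborel. 2 * (weight 0 x * (norm (f x - g x))\<^sup>2)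
        + 2 * (weight 0 x * (norm (f x - h x))\<^sup>2) - 4 * (weight 0 x * (norm (f x - ?m x))\<^sup>2))"
      unfolding wnorm2_def
      by (intro Bochner_Integration.integral_cong refl, subst norm_diff_midpoint_sq[of "g _" "h _" "f _"])
        (simp add: algebra_simps)
    also have "\<dots> = 2 * wnorm2 0 (\<lambda>x. f x - g x) + 2 * wnorm2 0 (\<lambda>x. f x - h x) - 4 * wnorm2 0 (\<lambda>x. f x - ?m x)"
      unfolding wnorm2_def using i[OF gh(1)] i[OF gh(2)] i[OF m]
      by (subst Bochner_Integration.integral_diff Bochner_Integration.integral_add;
          (simp only: integral_mult_right_zero)?; simp)+
    finally show "\<exists>m\<in>R. wnorm2 0 (\<lambda>x. g x - h x)
        \<le> 2 * wnorm2 0 (\<lambda>x. f x - g x) + 2 * wnorm2 0 (\<lambda>x. f x - h x) - 4 * wnorm2 0 (\<lambda>x. f x - m x)"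
      using m by (intro bexI[of _ ?m]) auto
  next
    fix X :: "nat \<Rightarrow> real \<Rightarrow> 'a"
    assume X: "\<And>n. X n \<in> R" and C: "\<And>e. e > 0 \<Longrightarrow> \<exists>K. \<forall>m\<ge>K. \<forall>n\<ge>K. wnorm2 0 (\<lambda>x. X m x - X n x) < e"
    have "\<forall>n. \<exists>t. solution w (X n) (fst t) (fst (snd t)) (snd (snd t))" using X by (auto simp: R_def)
    from choice[OF this] obtain t where t: "\<And>n. solution w (X n) (fst (t n)) (fst (snd (t n))) (snd (snd (t n)))" by blast
    obtain g v v2 c where g: "solution w g v v2 c" "(\<lambda>n. wnorm2 0 (\<lambda>x. X n x - g x)) \<longlonglongrightarrow> 0"
      using solution_range_complete[OF w t C] by blast
    have gR: "g \<in> R" using g(1) by (auto simp: R_def)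
    have "(\<lambda>n. wnorm2 0 (\<lambda>x. f x - X n x)) \<longlonglongrightarrow> wnorm2 0 (\<lambda>x. f x - g x)"
    proof (rule wnorm2_tendsto)
      have "wnorm2 0 (\<lambda>x. (f x - X n x) - (f x - g x)) = wnorm2 0 (\<lambda>x. X n x - g x)" for n
        by (simp add: wnorm2_def norm_minus_commute)
      then show "(\<lambda>n. wnorm2 0 (\<lambda>x. (f x - X n x) - (f x - g x))) \<longlonglongrightarrow> 0" using g(2) by simp
    qed (intro weighted_L2_diff f RL gR X)+
    then show "\<exists>r\<in>R. (\<lambda>n. wnorm2 0 (\<lambda>x. f x - X n x)) \<longlonglongrightarrow> wnorm2 0 (\<lambda>x. f x - r x)" using gR by blast
  qed
  then obtain r where r: "r \<in> R" "\<And>s. s \<in> R \<Longrightarrow> wnorm2 0 (\<lambda>x. f x - r x) \<le> wnorm2 0 (\<lambda>x. f x - s x)" by blast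
  have Lfr: "weighted_L2 (\<lambda>x. f x - r x)" by (intro weighted_L2_diff f RL r)
  have "AE x in lborel. f x - r x = 0"
  proof (rule orthogonal_to_range_zero[OF w Lfr])
    fix s v v2 c assume "solution w s v v2 c"
    then have s: "s \<in> R" by (auto simp: R_def)
    have [measurable]: "f \<in> borel_measurable borel" "r \<in> borel_measurable borel" "s \<in> borel_measurable borel"
      using f RL[OF r(1)] RL[OF s] by (auto simp: weighted_L2_def)
    note i1 = weighted_L2_integrable[OF Lfr, of 0] and i2 = weighted_L2_integrable[OF RL[OF s], of 0]
    have i: "integrable lborel (\<lambda>x. weight 0 x * inner (f x - r x) (s x))"
    proof (rule Bochner_Integration.integrable_bound)
      show "integrable lborel (\<lambda>x. weight 0 x * (norm (f x - r x))\<^sup>2 + weight 0 x * (norm (s x))\<^sup>2)"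
        using i1 i2 by simp
      show "AE x in lborel. norm (weight 0 x * inner (f x - r x) (s x))
          \<le> norm (weight 0 x * (norm (f x - r x))\<^sup>2 + weight 0 x * (norm (s x))\<^sup>2)"
      proof (rule AE_I2)
        fix x
        have "\<bar>inner (f x - r x) (s x)\<bar> \<le> norm (f x - r x) * norm (s x)" by (rule Cauchy_Schwarz_ineq2)
        also have "\<dots> \<le> (norm (f x - r x))\<^sup>2 + (norm (s x))\<^sup>2"
          using sum_squares_bound[of "norm (f x - r x)" "norm (s x)"]
            mult_nonneg_nonneg[OF norm_ge_zero[of "f x - r x"] norm_ge_zero[of "s x"]] by linarith
        finally have "weight 0 x * \<bar>inner (f x - r x) (s x)\<bar> \<le> weight 0 x * ((norm (f x - r x))\<^sup>2 + (norm (s x))\<^sup>2)"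
          by (rule mult_left_mono[OF _ less_imp_le[OF weight_pos]])
        then show "norm (weight 0 x * inner (f x - r x) (s x))
            \<le> norm (weight 0 x * (norm (f x - r x))\<^sup>2 + weight 0 x * (norm (s x))\<^sup>2)"
          using weight_pos[of 0 x] by (simp add: abs_mult distrib_left order.trans[OF _ abs_ge_self])
      qed
    qed measurable
    have "- (LINT x|lborel. weight 0 x * inner (f x - r x) (s x)) = 0"
    proof (rule quadratic_minimum_at_0)
      fix t :: real
      have "wnorm2 0 (\<lambda>x. f x - r x) \<le> wnorm2 0 (\<lambda>x. f x - (r x + t *\<^sub>R s x))"
        by (intro r(2) Radd r(1) s)
      also have "\<dots> = (LINT x|lborel. weight 0 x * (norm (f x - r x))\<^sup>2
          + (- 2 * t) * (weight 0 x * inner (f x - r x) (s x)) + t\<^sup>2 * (weight 0 x * (norm (s x))\<^sup>2))"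
        unfolding wnorm2_def
      proof (intro Bochner_Integration.integral_cong refl)
        fix x
        have "f x - (r x + t *\<^sub>R s x) = (f x - r x) + (- t) *\<^sub>R s x" by simp
        then show "weight 0 x * (norm (f x - (r x + t *\<^sub>R s x)))\<^sup>2 = weight 0 x * (norm (f x - r x))\<^sup>2
          + (- 2 * t) * (weight 0 x * inner (f x - r x) (s x)) + t\<^sup>2 * (weight 0 x * (norm (s x))\<^sup>2)"
          by (simp only: norm_add_scaleR_sq) (simp add: algebra_simps)
      qed
      also have "\<dots> = wnorm2 0 (\<lambda>x. f x - r x) + (- 2 * t) * (LINT x|lborel. weight 0 x * inner (f x - r x) (s x)) + t\<^sup>2 * wnorm2 0 s"
        unfolding wnorm2_def
          Bochner_Integration.integral_add[OF Bochner_Integration.integrable_add[OF i1 integrable_mult_right[OF i]] integrable_mult_right[OF i2]]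
          Bochner_Integration.integral_add[OF i1 integrable_mult_right[OF i]] integral_mult_right_zero ..
      finally show "0 \<le> 2 * t * (- (LINT x|lborel. weight 0 x * inner (f x - r x) (s x))) + t\<^sup>2 * wnorm2 0 s" by simp
    qed
    then show "(LINT x|lborel. weight 0 x * inner (f x - r x) (s x)) = 0" by simp
  qed
  then have eq: "AE x in lborel. f x = r x" by eventually_elim simp
  obtain u u2 b where "solution w r u u2 b" using r(1) by (auto simp: R_def)
  then have "solution w f u u2 b"
    using f eq unfolding solution_def weighted_L2_def by (auto elim!: eventually_elim2)
  then show ?thesis by blast
qed

end


section \<open>Uniformly local spaces\<close>

lemma integrable_weight: "integrable lborel (weight 0)"
proof -
  have "integrable lborel (\<lambda>x::real. inverse (1 + x\<^sup>2))"
    using integrable_inverse_1_plus_square by (simp add: set_integrable_def einterval_def)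
  then have "integrable lborel (\<lambda>x::real. 16 * inverse (1 + x\<^sup>2))" by simp
  then show ?thesis
  proof (rule Bochner_Integration.integrable_bound)
    show "AE x in lborel. norm (weight 0 x) \<le> norm (16 * inverse (1 + x\<^sup>2))"
    proof (rule AE_I2)
      fix x :: real
      have "0 < 1 + x\<^sup>2" "0 < 16 + x\<^sup>2" by (auto intro: add_pos_nonneg)
      then have "weight 0 x \<le> 16 * inverse (1 + x\<^sup>2)"
        by (simp add: weight_def power_divide divide_simps)
      then show "norm (weight 0 x) \<le> norm (16 * inverse (1 + x\<^sup>2))" using weight_pos[of 0 x] by simp
    qed
  qed measurable
qed

definition ul_const :: real where "ul_const = 3 * integral\<^sup>L lborel (weight 0) + 1"

lemma ul_const_pos: "0 < ul_const"
proof -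
  have "0 \<le> integral\<^sup>L lborel (weight 0)"
    using weight_pos by (intro Bochner_Integration.integral_nonneg) (simp add: less_imp_le)
  then show ?thesis by (simp add: ul_const_def)
qed

lemma nn_integral_weight: "(\<integral>\<^sup>+x. ennreal (weight a x) \<partial>lborel) = ennreal (integral\<^sup>L lborel (weight 0))"
proof -
  have "(\<integral>\<^sup>+x. ennreal (weight a x) \<partial>lborel) = (\<integral>\<^sup>+x. ennreal (weight a (a + 1 * x)) \<partial>lborel)"
    using nn_integral_real_affine[of "\<lambda>x. ennreal (weight a x)" 1 a] by simp
  also have "\<dots> = (\<integral>\<^sup>+x. ennreal (weight 0 x) \<partial>lborel)" by (simp add: weight_def)
  also have "\<dots> = ennreal (integral\<^sup>L lborel (weight 0))"
    using weight_pos by (intro nn_integral_eq_integral integrable_weight) (simp add: less_imp_le)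
  finally show ?thesis .
qed

text \<open>The weight varies slowly, so integrating it over a unit interval recovers its values up to a
  constant. Fubini's theorem then bounds the weighted norm by the norms on unit intervals.\<close>

lemma L2_ul_weighted_bound:
  assumes f: "f \<in> L2_ul"
  shows "weighted_L2 f" "wnorm2 a f \<le> ul_const * (ul_norm f)\<^sup>2"
proof -
  have [measurable]: "f \<in> borel_measurable borel" by (rule L2_ul_measurable[OF f])
  define F where "F = (\<lambda>x. (norm (f x))\<^sup>2)"
  have [measurable]: "F \<in> borel_measurable borel" by (simp add: F_def)
  have F0: "0 \<le> F x" for x by (simp add: F_def)
  have unit: "(\<integral>\<^sup>+x. indicator {y..y+1} x * ennreal (F x) \<partial>lborel) \<le> ennreal ((ul_norm f)\<^sup>2)" for y
  proof -
    have i: "integrable lborel (\<lambda>x. indicator {y..y+1} x * F x)"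
      using f by (simp add: L2_ul_def L2_loc_def set_integrable_def F_def)
    have "(\<integral>\<^sup>+x. indicator {y..y+1} x * ennreal (F x) \<partial>lborel) = (\<integral>\<^sup>+x. ennreal (indicator {y..y+1} x * F x) \<partial>lborel)"
      by (intro nn_integral_cong) (auto simp: indicator_def)
    also have "\<dots> = ennreal (LINT x|lborel. indicator {y..y+1} x * F x)"
      using F0 by (intro nn_integral_eq_integral i) (simp add: indicator_def)
    also have "(LINT x|lborel. indicator {y..y+1} x * F x) = (unit_L2_norm y f)\<^sup>2"
      by (simp add: unit_L2_norm_power2 set_lebesgue_integral_def F_def)
    also have "\<dots> \<le> (ul_norm f)\<^sup>2" by (intro power_mono unit_le_ul f unit_L2_norm_nonneg)
    finally show ?thesis by (simp add: ennreal_leI)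
  qed
  have main: "(\<integral>\<^sup>+x. ennreal (weight a x * F x) \<partial>lborel) \<le> ennreal (ul_const * (ul_norm f)\<^sup>2)" for a
  proof -
    have slow: "weight a x \<le> 3 * weight a y" if "x \<in> {y..y+1}" for x y
    proof -
      have "weight a x \<le> (2 + (a - (a + (x - y)))\<^sup>2 / 8) * weight (a + (x - y)) x" by (rule weight_comparison)
      also have "weight (a + (x - y)) x = weight a y" by (simp add: weight_def)
      also have "(2 + (a - (a + (x - y)))\<^sup>2 / 8) \<le> 3"
      proof -
        have "(x - y)\<^sup>2 \<le> 1" using that by (simp add: power_le_one)
        then show ?thesis by (simp add: power2_commute)
      qed
      finally show ?thesis using weight_pos[of a y] by simp
    qed
    have pt: "ennreal (weight a x * F x) \<le> (\<integral>\<^sup>+y. ennreal (3 * weight a y) * (indicator {y..y+1} x * ennreal (F x)) \<partial>lborel)" for x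
    proof -
      have "ennreal (weight a x * F x) = (\<integral>\<^sup>+y. ennreal (weight a x * F x) * indicator {x-1..x} y \<partial>lborel)"
        by (simp add: nn_integral_cmult_indicator)
      also have "\<dots> \<le> (\<integral>\<^sup>+y. ennreal (3 * weight a y) * (indicator {y..y+1} x * ennreal (F x)) \<partial>lborel)"
      proof (rule nn_integral_mono)
        fix y
        show "ennreal (weight a x * F x) * indicator {x-1..x} y \<le> ennreal (3 * weight a y) * (indicator {y..y+1} x * ennreal (F x))"
        proof (cases "y \<in> {x-1..x}")
          case True
          then have xy: "x \<in> {y..y+1}" by auto
          have "ennreal (weight a x * F x) \<le> ennreal (3 * weight a y * F x)"
            using slow[OF xy] F0 by (intro ennreal_leI mult_right_mono) auto
          also have "\<dots> = ennreal (3 * weight a y) * ennreal (F x)"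
            using weight_pos[of a y] F0 by (intro ennreal_mult) auto
          finally show ?thesis using True xy by simp
        qed simp
      qed
      finally show ?thesis .
    qed
    have [measurable]: "(\<lambda>p. indicator {snd p..snd p + (1::real)} (fst p) :: ennreal) \<in> borel_measurable (lborel \<Otimes>\<^sub>M lborel)"
    proof -
      have eq: "(\<lambda>p. indicator {snd p..snd p + (1::real)} (fst p) :: ennreal)
          = (\<lambda>p. ennreal (indicator {p. snd p \<le> fst p \<and> fst p \<le> snd p + 1} p))"
        by (auto simp: indicator_def fun_eq_iff)
      have "{p \<in> space (lborel \<Otimes>\<^sub>M lborel). snd p \<le> fst p \<and> fst p \<le> snd p + (1::real)} \<in> sets (lborel \<Otimes>\<^sub>M lborel)"
        by measurable
      then have "{p. snd p \<le> fst p \<and> fst p \<le> snd p + (1::real)} \<in> sets (lborel \<Otimes>\<^sub>M lborel)"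
        by (simp add: space_pair_measure)
      then show ?thesis unfolding eq
        by (rule measurable_compose[OF borel_measurable_indicator measurable_ennreal])
    qed
    have "(\<integral>\<^sup>+x. ennreal (weight a x * F x) \<partial>lborel)
      \<le> (\<integral>\<^sup>+x. \<integral>\<^sup>+y. ennreal (3 * weight a y) * (indicator {y..y+1} x * ennreal (F x)) \<partial>lborel \<partial>lborel)"
      by (intro nn_integral_mono pt)
    also have "\<dots> = (\<integral>\<^sup>+y. \<integral>\<^sup>+x. ennreal (3 * weight a y) * (indicator {y..y+1} x * ennreal (F x)) \<partial>lborel \<partial>lborel)"
    proof (rule lborel_pair.Fubini'[symmetric])
      have "(\<lambda>p. ennreal (3 * weight a (snd p)) * (indicator {snd p..snd p + 1} (fst p) * ennreal (F (fst p))))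
          \<in> borel_measurable (lborel \<Otimes>\<^sub>M lborel)" by measurable
      then show "(\<lambda>(x, y). ennreal (3 * weight a y) * (indicator {y..y+1} x * ennreal (F x))) \<in> borel_measurable (lborel \<Otimes>\<^sub>M lborel)"
        by (simp add: case_prod_beta')
    qed
    also have "\<dots> = (\<integral>\<^sup>+y. ennreal (3 * weight a y) * (\<integral>\<^sup>+x. indicator {y..y+1} x * ennreal (F x) \<partial>lborel) \<partial>lborel)"
      by (intro nn_integral_cong nn_integral_cmult) measurable
    also have "\<dots> \<le> (\<integral>\<^sup>+y. ennreal (3 * weight a y) * ennreal ((ul_norm f)\<^sup>2) \<partial>lborel)"
      by (intro nn_integral_mono mult_left_mono unit) simp
    also have "\<dots> = (\<integral>\<^sup>+y. ennreal (3 * weight a y) \<partial>lborel) * ennreal ((ul_norm f)\<^sup>2)"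
      by (rule nn_integral_multc) measurable
    also have "(\<integral>\<^sup>+y. ennreal (3 * weight a y) \<partial>lborel) = ennreal 3 * ennreal (integral\<^sup>L lborel (weight 0))"
      using weight_pos[of a] by (simp add: ennreal_mult less_imp_le nn_integral_cmult nn_integral_weight[of a])
    also have "\<dots> = ennreal (3 * integral\<^sup>L lborel (weight 0))"
      using weight_pos
      by (intro ennreal_mult[symmetric] Bochner_Integration.integral_nonneg) (auto simp: less_imp_le)
    also have "\<dots> \<le> ennreal ul_const" by (rule ennreal_leI) (simp add: ul_const_def)
    finally have "(\<integral>\<^sup>+x. ennreal (weight a x * F x) \<partial>lborel) \<le> ennreal ul_const * ennreal ((ul_norm f)\<^sup>2)"
      by (simp add: mult_right_mono)
    then show ?thesis using ul_const_pos by (simp add: ennreal_mult)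
  qed
  have wF: "0 \<le> weight a x * F x" for a x using weight_pos[of a x] F0 by simp
  have i: "integrable lborel (\<lambda>x. weight a x * F x)" for a
    using wF by (intro integrableI_nonneg) (auto intro: le_less_trans[OF main])
  then show "weighted_L2 f" using i by (simp add: weighted_L2_def F_def)
  have "ennreal (wnorm2 a f) \<le> ennreal (ul_const * (ul_norm f)\<^sup>2)"
    using main[of a] wF i by (subst (asm) nn_integral_eq_integral) (auto simp: wnorm2_def F_def)
  then show "wnorm2 a f \<le> ul_const * (ul_norm f)\<^sup>2" using ul_const_pos by simp
qed

text \<open>The weight centred at \<open>a\<close> is bounded below on the unit interval that starts at \<open>a\<close>.\<close>

lemma weighted_L2_ul:
  assumes f: "weighted_L2 f" and C: "\<And>a. wnorm2 a f \<le> C\<^sup>2" "0 \<le> C"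
  shows "f \<in> L2_ul" "ul_norm f \<le> 2 * C"
proof -
  have le: "unit_L2_norm a f \<le> 2 * C" for a
  proof -
    have "(unit_L2_norm a f)\<^sup>2 \<le> 4 * wnorm2 a f"
    proof -
      have "(LINT x:{a..a+1}|lborel. (norm (f x))\<^sup>2) \<le> (LINT x|lborel. 4 * (weight a x * (norm (f x))\<^sup>2))"
        unfolding set_lebesgue_integral_def
      proof (rule integral_mono)
        show "integrable lborel (\<lambda>x. indicator {a..a+1} x *\<^sub>R (norm (f x))\<^sup>2)"
          using weighted_L2_loc[OF f] by (simp add: L2_loc_def set_integrable_def)
        show "integrable lborel (\<lambda>x. 4 * (weight a x * (norm (f x))\<^sup>2))"
          using weighted_L2_integrable[OF f] by simp
        fix x
        show "indicator {a..a+1} x *\<^sub>R (norm (f x))\<^sup>2 \<le> 4 * (weight a x * (norm (f x))\<^sup>2)"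
        proof (cases "x \<in> {a..a+1}")
          case True
          then have "((x - a) / 4)\<^sup>2 \<le> 1" by (simp add: power_le_one)
          then have "1 \<le> 4 * weight a x" using weight_denom_pos[of x a] by (simp add: weight_def divide_simps)
          from mult_right_mono[OF this, of "(norm (f x))\<^sup>2"] show ?thesis using True by simp
        qed (use weight_pos[of a x] in simp)
      qed
      then show ?thesis by (simp add: unit_L2_norm_power2 wnorm2_def)
    qed
    also have "\<dots> \<le> (2 * C)\<^sup>2" using C(1)[of a] by (simp add: power_mult_distrib)
    finally show ?thesis by (rule power2_le_imp_le) (use C(2) in simp)
  qed
  then show "f \<in> L2_ul" using weighted_L2_loc[OF f] by (auto simp: L2_ul_def bdd_above_def)
  show "ul_norm f \<le> 2 * C" unfolding ul_norm_def using le by (intro cSUP_least) auto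
qed

lemma L2_ul_bound:
  fixes u :: "real \<Rightarrow> 'a::{banach, second_countable_topology}" and v :: "real \<Rightarrow> 'b::{banach, second_countable_topology}"
  assumes u: "u \<in> L2_ul" and v[measurable]: "v \<in> borel_measurable borel"
    and le: "AE x in lborel. norm (v x) \<le> norm (u x)"
  shows "v \<in> L2_ul"
proof -
  have [measurable]: "u \<in> borel_measurable borel" by (rule L2_ul_measurable[OF u])
  have ui: "integrable lborel (\<lambda>x. indicator {a..b} x *\<^sub>R (norm (u x))\<^sup>2)" for a b
    using u by (simp add: L2_ul_def L2_loc_def set_integrable_def)
  have le2: "AE x in lborel. indicator {a..b} x *\<^sub>R (norm (v x))\<^sup>2 \<le> indicator {a..b} x *\<^sub>R (norm (u x))\<^sup>2" for a b
    using le by eventually_elim (auto simp: indicator_def intro: power_mono)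
  have vi: "integrable lborel (\<lambda>x. indicator {a..b} x *\<^sub>R (norm (v x))\<^sup>2)" for a b
  proof (rule Bochner_Integration.integrable_bound[OF ui[of a b]])
    show "AE x in lborel. norm (indicator {a..b} x *\<^sub>R (norm (v x))\<^sup>2) \<le> norm (indicator {a..b} x *\<^sub>R (norm (u x))\<^sup>2)"
      using le2[of a b] by eventually_elim (simp add: indicator_def)
  qed measurable
  have "unit_L2_norm a v \<le> unit_L2_norm a u" for a
    unfolding unit_L2_norm_def set_lebesgue_integral_def
    by (intro real_sqrt_le_mono integral_mono_AE vi ui le2)
  then have "unit_L2_norm a v \<le> ul_norm u" for a using unit_le_ul[OF u, of a] order_trans by blast
  then show ?thesis using vi by (auto simp: L2_ul_def L2_loc_def set_integrable_def bdd_above_def)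
qed

lemma L2_ul_Pair:
  fixes f :: "real \<Rightarrow> 'a::{banach, second_countable_topology}" and g :: "real \<Rightarrow> 'b::{banach, second_countable_topology}"
  assumes f: "f \<in> L2_ul" and g: "g \<in> L2_ul" shows "(\<lambda>x. (f x, g x)) \<in> L2_ul"
proof -
  have [measurable]: "f \<in> borel_measurable borel" "g \<in> borel_measurable borel"
    using f g by (auto intro: L2_ul_measurable)
  have 1: "(\<lambda>x. (f x, 0::'b)) \<in> L2_ul" by (rule L2_ul_bound[OF f]) (auto simp: norm_Pair)
  have 2: "(\<lambda>x. (0::'a, g x)) \<in> L2_ul" by (rule L2_ul_bound[OF g]) (auto simp: norm_Pair)
  from L2_ul_add(1)[OF 1 2] show ?thesis by simp
qed

lemma L2_ul_of_Pair:
  fixes f :: "real \<Rightarrow> 'a::{banach, second_countable_topology}" and g :: "real \<Rightarrow> 'b::{banach, second_countable_topology}"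
  assumes "(\<lambda>x. (f x, g x)) \<in> L2_ul" shows "f \<in> L2_ul" "g \<in> L2_ul"
proof -
  note m = borel_measurable_continuous_on[OF linear_continuous_on L2_ul_measurable[OF assms]]
  show "f \<in> L2_ul"
    by (rule L2_ul_bound[OF assms]) (use m[OF bounded_linear_fst] in \<open>simp_all add: norm_fst_le\<close>)
  show "g \<in> L2_ul"
    by (rule L2_ul_bound[OF assms]) (use m[OF bounded_linear_snd] in \<open>simp_all add: norm_snd_le\<close>)
qed

lemma ul_eq_refl_iff: "ul_eq f f \<longleftrightarrow> f \<in> L2_ul"
  by (simp add: ul_eq_def)

lemma rep_ul_space: "rep_ul_space u \<in> L2_ul" "abs_ul_space (rep_ul_space u) = u"
  using Quotient3_rep_reflp[OF Quotient3_ul_space, of u] Quotient3_abs_rep[OF Quotient3_ul_space, of u]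
  by (auto simp: ul_eq_refl_iff)

lemma ul_space_cases: obtains f where "f \<in> L2_ul" "u = abs_ul_space f"
  using rep_ul_space by metis

lemma abs_ul_space_eq_iff:
  "f \<in> L2_ul \<Longrightarrow> g \<in> L2_ul \<Longrightarrow> abs_ul_space f = abs_ul_space g \<longleftrightarrow> (AE x in lborel. f x = g x)"
  using Quotient3_rel[OF Quotient3_ul_space, of f g] by (simp add: ul_eq_def)

lemma abs_ul_space_simps:
  assumes "f \<in> L2_ul"
  shows "norm (abs_ul_space f) = ul_norm f" "c *\<^sub>R abs_ul_space f = abs_ul_space (\<lambda>x. c *\<^sub>R f x)"
    "- abs_ul_space f = abs_ul_space (\<lambda>x. - f x)"
    "g \<in> L2_ul \<Longrightarrow> abs_ul_space f + abs_ul_space g = abs_ul_space (\<lambda>x. f x + g x)"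
    "g \<in> L2_ul \<Longrightarrow> abs_ul_space f - abs_ul_space g = abs_ul_space (\<lambda>x. f x - g x)"
  using assms by (auto simp: norm_ul_space.abs_eq scaleR_ul_space.abs_eq plus_ul_space.abs_eq
      uminus_ul_space.abs_eq minus_ul_space.abs_eq ul_eq_refl_iff)

lemma abs_ul_space_scaleC:
  fixes f :: "real \<Rightarrow> 'a::{complex_normed_vector, second_countable_topology}"
  shows "f \<in> L2_ul \<Longrightarrow> c *\<^sub>C abs_ul_space f = abs_ul_space (\<lambda>x. c *\<^sub>C f x)"
  by (simp add: scaleC_ul_space.abs_eq ul_eq_refl_iff)

lemma has_weak_deriv_abs:
  "f \<in> L2_ul \<Longrightarrow> g \<in> L2_ul \<Longrightarrow> has_weak_deriv k (abs_ul_space f) (abs_ul_space g) \<longleftrightarrow> weak_derivative k f g"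
  by (simp add: has_weak_deriv.abs_eq ul_eq_refl_iff)

lemma L2_ul_locally_integrable: "f \<in> L2_ul \<Longrightarrow> locally_integrable f"
  by (rule L2_loc_locally_integrable) (simp add: L2_ul_def)

text \<open>A Cauchy sequence is also Cauchy in the weighted space, where it has a limit; Fatou's lemma
  on unit intervals shows that this limit is approached in the uniformly local norm.\<close>

instance ul_space :: ("{banach, second_countable_topology}") banach
proof
  fix X :: "nat \<Rightarrow> 'a ul_space" assume X: "Cauchy X"
  define f where "f = (\<lambda>n. rep_ul_space (X n))"
  have f: "f n \<in> L2_ul" "X n = abs_ul_space (f n)" for n using rep_ul_space[of "X n"] by (auto simp: f_def)
  have [measurable]: "f n \<in> borel_measurable borel" for n by (rule L2_ul_measurable[OF f(1)])
  have nX: "norm (X m - X n) = ul_norm (\<lambda>x. f m x - f n x)" for m n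
    using f by (simp add: abs_ul_space_simps L2_ul_diff)
  obtain g and r :: "nat \<Rightarrow> nat" where g: "weighted_L2 g" "strict_mono r" "AE x in lborel. (\<lambda>n. f (r n) x) \<longlonglongrightarrow> g x"
  proof (rule weighted_L2_complete)
    show "weighted_L2 (f n)" for n by (rule L2_ul_weighted_bound(1)[OF f(1)])
    fix e :: real assume e: "e > 0"
    define d where "d = sqrt (e / (2 * ul_const))"
    have d: "d > 0" "ul_const * d\<^sup>2 < e" using e ul_const_pos by (auto simp: d_def)
    obtain N where N: "\<forall>m\<ge>N. \<forall>n\<ge>N. norm (X m - X n) < d" using CauchyD[OF X d(1)] by blast
    have "wnorm2 0 (\<lambda>x. f m x - f n x) < e" if "m \<ge> N" "n \<ge> N" for m n
    proof -
      have "wnorm2 0 (\<lambda>x. f m x - f n x) \<le> ul_const * (norm (X m - X n))\<^sup>2"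
        unfolding nX by (rule L2_ul_weighted_bound(2)[OF L2_ul_diff[OF f(1) f(1)]])
      also have "\<dots> \<le> ul_const * d\<^sup>2"
        using N that ul_const_pos by (intro mult_left_mono power_mono) (auto simp: less_imp_le)
      finally show ?thesis using d(2) by simp
    qed
    then show "\<exists>N. \<forall>m\<ge>N. \<forall>n\<ge>N. wnorm2 0 (\<lambda>x. f m x - f n x) < e" by blast
  qed blast
  have [measurable]: "g \<in> borel_measurable borel" using g(1) by (simp add: weighted_L2_def)
  have bd: "(\<lambda>x. f n x - g x) \<in> L2_ul \<and> ul_norm (\<lambda>x. f n x - g x) \<le> e"
    if n: "n \<ge> N" and N: "\<forall>m\<ge>N. \<forall>n\<ge>N. norm (X m - X n) < e" for n N e
  proof -
    have e: "e \<ge> 0" using N[rule_format, of N N] by simp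
    have le: "unit_L2_norm a (\<lambda>x. f n x - g x) \<le> e" for a
    proof -
      let ?h = "\<lambda>k x. indicator {a..a+1} x * (norm (f n x - f (r (k + N)) x))\<^sup>2"
      have "(LINT x|lborel. indicator {a..a+1} x * (norm (f n x - g x))\<^sup>2) \<le> e\<^sup>2"
      proof (rule fatou_bound(2))
        show "integrable lborel (?h k)" for k
          using L2_ul_diff[OF f(1) f(1), of n "r (k + N)"] by (simp add: L2_ul_def L2_loc_def set_integrable_def)
        show "AE x in lborel. 0 \<le> ?h k x" for k by (simp add: indicator_def)
        show "AE x in lborel. (\<lambda>k. ?h k x) \<longlonglongrightarrow> indicator {a..a+1} x * (norm (f n x - g x))\<^sup>2"
          using g(3)
        proof eventually_elim
          case (elim x)
          from LIMSEQ_ignore_initial_segment[OF this, of N]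
          show ?case by (intro tendsto_intros)
        qed
        fix k
        have "r (k + N) \<ge> N" using strict_mono_imp_increasing[OF g(2), of "k + N"] by simp
        then have lt: "ul_norm (\<lambda>x. f n x - f (r (k + N)) x) < e" using N n unfolding nX by blast
        have "integral\<^sup>L lborel (?h k) = (unit_L2_norm a (\<lambda>x. f n x - f (r (k + N)) x))\<^sup>2"
          by (simp add: unit_L2_norm_power2 set_lebesgue_integral_def)
        also have "\<dots> \<le> e\<^sup>2"
          using unit_le_ul[OF L2_ul_diff[OF f(1) f(1)], of a n "r (k + N)"] lt
          by (intro power_mono unit_L2_norm_nonneg) simp
        finally show "integral\<^sup>L lborel (?h k) \<le> e\<^sup>2" .
      qed measurable
      then have "(unit_L2_norm a (\<lambda>x. f n x - g x))\<^sup>2 \<le> e\<^sup>2"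
        by (simp add: unit_L2_norm_power2 set_lebesgue_integral_def)
      then show ?thesis using e by (rule power2_le_imp_le)
    qed
    have "(\<lambda>x. f n x - g x) \<in> L2_loc"
      using weighted_L2_loc[OF weighted_L2_diff[OF L2_ul_weighted_bound(1)[OF f(1)] g(1)]] .
    then show ?thesis using le by (auto simp: L2_ul_def bdd_above_def ul_norm_def intro!: cSUP_least)
  qed
  obtain N1 where N1: "\<forall>m\<ge>N1. \<forall>n\<ge>N1. norm (X m - X n) < 1" using CauchyD[OF X, of 1] by auto
  have "(\<lambda>x. f N1 x - (f N1 x - g x)) \<in> L2_ul" by (intro L2_ul_diff f(1) conjunct1[OF bd[OF order_refl N1]])
  then have gL: "g \<in> L2_ul" by simp
  have "X \<longlonglongrightarrow> abs_ul_space g"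
  proof (rule LIMSEQ_I)
    fix e :: real assume e: "e > 0"
    obtain N where N: "\<forall>m\<ge>N. \<forall>n\<ge>N. norm (X m - X n) < e / 2" using CauchyD[OF X, of "e / 2"] e by auto
    have "norm (X n - abs_ul_space g) < e" if "n \<ge> N" for n
      using bd[OF that N] e f gL by (simp add: abs_ul_space_simps L2_ul_diff)
    then show "\<exists>no. \<forall>n\<ge>no. norm (X n - abs_ul_space g) < e" by blast
  qed
  then show "convergent X" by (auto simp: convergent_def)
qed


section \<open>The differential operator and its resolvent\<close>

lemma has_weak_deriv_unique:
  assumes "has_weak_deriv k u v" "has_weak_deriv k u v'" shows "v = v'"
proof -
  obtain f where f: "f \<in> L2_ul" "u = abs_ul_space f" by (rule ul_space_cases)
  obtain g where g: "g \<in> L2_ul" "v = abs_ul_space g" by (rule ul_space_cases)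
  obtain g' where g': "g' \<in> L2_ul" "v' = abs_ul_space g'" by (rule ul_space_cases)
  have "AE x in lborel. g x = g' x"
    using assms f g g' by (intro weak_derivative_unique[of g g' k f]) (auto simp: has_weak_deriv_abs L2_ul_locally_integrable)
  then show ?thesis using g g' by (simp add: abs_ul_space_eq_iff)
qed

lemma weak_deriv_eqI: "has_weak_deriv k u v \<Longrightarrow> weak_deriv k u = v"
  unfolding weak_deriv_def using has_weak_deriv_unique by blast

lemma has_weak_deriv_0: "has_weak_deriv 0 u u"
proof -
  obtain f where f: "f \<in> L2_ul" "u = abs_ul_space f" by (rule ul_space_cases)
  then show ?thesis by (simp add: has_weak_deriv_abs weak_derivative_def)
qed

lemma H2_ul_iff: "u \<in> H2_ul \<longleftrightarrow> (\<exists>v. has_weak_deriv 1 u v) \<and> (\<exists>v. has_weak_deriv 2 u v)"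
proof -
  have "(k::nat) \<le> 2 \<longleftrightarrow> k = 0 \<or> k = 1 \<or> k = 2" for k by auto
  then show ?thesis using has_weak_deriv_0 unfolding H2_ul_def by auto
qed

lemma has_pointwise_imageD:
  fixes T :: "'a::{banach, second_countable_topology} \<Rightarrow> 'a"
  assumes "has_pointwise_image D T u v"
  shows "\<exists>f. f \<in> L2_ul \<and> (\<lambda>x. T (f x)) \<in> L2_ul \<and> (\<forall>x. f x \<in> D) \<and> u = abs_ul_space f
    \<and> v = abs_ul_space (\<lambda>x. T (f x))"
proof -
  obtain f where f: "\<forall>x. f x \<in> D" "(\<lambda>x. (f x, T (f x))) \<in> L2_ul" "u = abs_ul_space f" "v = abs_ul_space (\<lambda>x. T (f x))"
    using assms unfolding has_pointwise_image_def by blast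
  show ?thesis using L2_ul_of_Pair[OF f(2)] f by blast
qed

lemma has_pointwise_image_unique:
  fixes T :: "'a::{banach, second_countable_topology} \<Rightarrow> 'a"
  assumes "has_pointwise_image D T u v" "has_pointwise_image D T u v'" shows "v = v'"
proof -
  obtain f where f: "f \<in> L2_ul" "(\<lambda>x. T (f x)) \<in> L2_ul" "u = abs_ul_space f" "v = abs_ul_space (\<lambda>x. T (f x))"
    using has_pointwise_imageD[OF assms(1)] by blast
  obtain g where g: "g \<in> L2_ul" "(\<lambda>x. T (g x)) \<in> L2_ul" "u = abs_ul_space g" "v' = abs_ul_space (\<lambda>x. T (g x))"
    using has_pointwise_imageD[OF assms(2)] by blast
  have "abs_ul_space f = abs_ul_space g" using f(3) g(3) by simp
  then have "AE x in lborel. f x = g x" using f(1) g(1) by (simp add: abs_ul_space_eq_iff)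
  then have "AE x in lborel. T (f x) = T (g x)" by eventually_elim simp
  then show ?thesis using f g by (simp add: abs_ul_space_eq_iff)
qed

lemma pointwise_image_eqI:
  fixes T :: "'a::{banach, second_countable_topology} \<Rightarrow> 'a"
  shows "has_pointwise_image D T u v \<Longrightarrow> pointwise_image D T u = v"
  unfolding pointwise_image_def using has_pointwise_image_unique by blast

text \<open>A representative with values in \<open>D\<close> everywhere is obtained by setting \<open>f\<close> to zero on a null set, which
  requires that \<open>D\<close> contains zero.\<close>

lemma has_pointwise_image_abs:
  fixes T :: "'a::{banach, second_countable_topology} \<Rightarrow> 'a"
  assumes f: "f \<in> L2_ul" and b: "b \<in> L2_ul" and T0: "0 \<in> D" "T 0 = 0"
  shows "has_pointwise_image D T (abs_ul_space f) (abs_ul_space b) \<longleftrightarrow> (AE x in lborel. f x \<in> D \<and> T (f x) = b x)"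
proof
  assume "has_pointwise_image D T (abs_ul_space f) (abs_ul_space b)"
  then obtain g where g: "g \<in> L2_ul" "(\<lambda>x. T (g x)) \<in> L2_ul" "\<forall>x. g x \<in> D"
    "abs_ul_space f = abs_ul_space g" "abs_ul_space b = abs_ul_space (\<lambda>x. T (g x))"
    using has_pointwise_imageD by blast
  have "AE x in lborel. f x = g x" "AE x in lborel. b x = T (g x)" using f b g by (auto simp: abs_ul_space_eq_iff)
  then show "AE x in lborel. f x \<in> D \<and> T (f x) = b x" by eventually_elim (use g(3) in simp)
next
  assume "AE x in lborel. f x \<in> D \<and> T (f x) = b x"
  then obtain N where N: "{x \<in> space lborel. \<not> (f x \<in> D \<and> T (f x) = b x)} \<subseteq> N" "N \<in> sets lborel" "emeasure lborel N = 0"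
    by (rule AE_E)
  have [measurable]: "f \<in> borel_measurable borel" "b \<in> borel_measurable borel" "N \<in> sets borel"
    using f b N(2) by (auto intro: L2_ul_measurable)
  define g where "g = (\<lambda>x. if x \<in> N then 0 else f x)"
  have Tg: "T (g x) = (if x \<in> N then 0 else b x)" and gD: "g x \<in> D" for x
    using N(1) T0 by (auto simp: g_def)
  have g: "g \<in> L2_ul" unfolding g_def by (rule L2_ul_bound[OF f]) auto
  have TgL: "(\<lambda>x. T (g x)) \<in> L2_ul" unfolding Tg by (rule L2_ul_bound[OF b]) auto
  have "AE x in lborel. x \<notin> N" using N(2,3) by (simp add: AE_iff_null_sets[symmetric] null_sets_def)
  then have "AE x in lborel. f x = g x" "AE x in lborel. b x = T (g x)"
    unfolding Tg by (eventually_elim, simp add: g_def)+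
  then have "abs_ul_space f = abs_ul_space g" "abs_ul_space b = abs_ul_space (\<lambda>x. T (g x))"
    using f b g TgL by (auto simp: abs_ul_space_eq_iff)
  then show "has_pointwise_image D T (abs_ul_space f) (abs_ul_space b)"
    unfolding has_pointwise_image_def using gD L2_ul_Pair[OF g TgL] by blast
qed

text \<open>Weak derivatives and pointwise images are unique, so the definite descriptions in the definition of
  the operator can be evaluated on representatives.\<close>

lemma A_dom_op_iff:
  fixes T :: "'a::{banach, second_countable_topology} \<Rightarrow> 'a"
  assumes T0: "0 \<in> D" "T 0 = 0"
  shows "u \<in> A_dom D T \<and> A_op D T u = v \<longleftrightarrow>
    (\<exists>f f1 f2 b. f \<in> L2_ul \<and> f1 \<in> L2_ul \<and> f2 \<in> L2_ul \<and> b \<in> L2_ul \<and> weak_derivative 1 f f1 \<and> weak_derivative 2 f f2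
      \<and> (AE x in lborel. f x \<in> D \<and> T (f x) = b x) \<and> u = abs_ul_space f \<and> v = abs_ul_space (\<lambda>x. - f2 x + b x))"
  (is "?L \<longleftrightarrow> ?R")
proof
  assume L: ?L
  then obtain v1 v2 vb where v: "has_weak_deriv 1 u v1" "has_weak_deriv 2 u v2" "has_pointwise_image D T u vb"
    by (auto simp: A_dom_def H2_ul_iff L2_ul_dom_def)
  obtain f where f: "f \<in> L2_ul" "u = abs_ul_space f" by (rule ul_space_cases)
  obtain f1 where f1: "f1 \<in> L2_ul" "v1 = abs_ul_space f1" by (rule ul_space_cases)
  obtain f2 where f2: "f2 \<in> L2_ul" "v2 = abs_ul_space f2" by (rule ul_space_cases)
  obtain b where b: "b \<in> L2_ul" "vb = abs_ul_space b" by (rule ul_space_cases)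
  have "v = - v2 + vb" using L weak_deriv_eqI[OF v(2)] pointwise_image_eqI[OF v(3)] by (simp add: A_op_def)
  also have "\<dots> = abs_ul_space (\<lambda>x. - f2 x + b x)"
    using f2 b L2_ul_uminus[OF f2(1)] by (simp add: abs_ul_space_simps)
  finally show ?R
    using v f f1 f2 b has_pointwise_image_abs[of f b D T, OF _ _ T0] by (auto simp: has_weak_deriv_abs)
next
  assume ?R
  then obtain f f1 f2 b where *: "f \<in> L2_ul" "f1 \<in> L2_ul" "f2 \<in> L2_ul" "b \<in> L2_ul" "weak_derivative 1 f f1"
    "weak_derivative 2 f f2" "AE x in lborel. f x \<in> D \<and> T (f x) = b x" "u = abs_ul_space f"
    "v = abs_ul_space (\<lambda>x. - f2 x + b x)" by blast
  have d: "has_weak_deriv 1 u (abs_ul_space f1)" "has_weak_deriv 2 u (abs_ul_space f2)"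
    "has_pointwise_image D T u (abs_ul_space b)"
    using * has_pointwise_image_abs[of f b D T, OF _ _ T0] by (auto simp: has_weak_deriv_abs)
  then have "u \<in> A_dom D T" by (auto simp: A_dom_def H2_ul_iff L2_ul_dom_def)
  moreover have "A_op D T u = v"
    using * weak_deriv_eqI[OF d(2)] pointwise_image_eqI[OF d(3)] L2_ul_uminus[OF *(3)]
    by (simp add: A_op_def abs_ul_space_simps)
  ultimately show ?L by blast
qed

context complex_positive_operator
begin

abbreviation "DA \<equiv> A_dom D B"
abbreviation "A \<equiv> A_op D B"

lemma A_linear: "linear_operator scaleC DA A"
proof -
  note iff = A_dom_op_iff[of D B, OF zero_dom B_zero]
  have 1: "0 \<in> DA"
  proof -
    have "0 = abs_ul_space (\<lambda>x. 0::'a)" by (rule zero_ul_space_def[THEN meta_eq_to_obj_eq])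
    then have "0 \<in> DA \<and> A 0 = abs_ul_space (\<lambda>x. - 0 + 0)"
      unfolding iff using L2_ul_zero(1)
      by (intro exI[of _ "\<lambda>x. 0"] conjI) (auto simp: weak_derivative_def zero_dom B_zero)
    then show ?thesis by blast
  qed
  have 2: "u + v \<in> DA \<and> A (u + v) = A u + A v" if uv: "u \<in> DA" "v \<in> DA" for u v
  proof -
    have "u \<in> DA \<and> A u = A u" "v \<in> DA \<and> A v = A v" using uv by auto
    then obtain f f1 f2 b g g1 g2 c where
      f: "f \<in> L2_ul" "f1 \<in> L2_ul" "f2 \<in> L2_ul" "b \<in> L2_ul" "weak_derivative 1 f f1" "weak_derivative 2 f f2"
        "AE x in lborel. f x \<in> D \<and> B (f x) = b x" "u = abs_ul_space f" "A u = abs_ul_space (\<lambda>x. - f2 x + b x)" and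
      g: "g \<in> L2_ul" "g1 \<in> L2_ul" "g2 \<in> L2_ul" "c \<in> L2_ul" "weak_derivative 1 g g1" "weak_derivative 2 g g2"
        "AE x in lborel. g x \<in> D \<and> B (g x) = c x" "v = abs_ul_space g" "A v = abs_ul_space (\<lambda>x. - g2 x + c x)"
      unfolding iff by blast
    have w: "weak_derivative 1 (\<lambda>x. f x + g x) (\<lambda>x. f1 x + g1 x)" "weak_derivative 2 (\<lambda>x. f x + g x) (\<lambda>x. f2 x + g2 x)"
      using weak_derivative_add_scaleR[of f g f1 g1 1 1] weak_derivative_add_scaleR[of f g f2 g2 2 1] f g
      by (auto simp: L2_ul_locally_integrable)
    have AE: "AE x in lborel. f x + g x \<in> D \<and> B (f x + g x) = b x + c x"
      using f(7) g(7) by eventually_elim (simp add: dom_add B_add)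
    have "A u + A v = abs_ul_space (\<lambda>x. (- f2 x + b x) + (- g2 x + c x))"
      unfolding f(9) g(9) by (intro abs_ul_space_simps(4) L2_ul_add(1) L2_ul_uminus f g)
    also have "(\<lambda>x. (- f2 x + b x) + (- g2 x + c x)) = (\<lambda>x. - (f2 x + g2 x) + (b x + c x))" by auto
    finally show ?thesis
      unfolding iff using f g w AE
      by (intro exI[of _ "\<lambda>x. f x + g x"] exI[of _ "\<lambda>x. f1 x + g1 x"] exI[of _ "\<lambda>x. f2 x + g2 x"] exI[of _ "\<lambda>x. b x + c x"])
        (simp add: abs_ul_space_simps L2_ul_add(1))
  qed
  have 3: "z *\<^sub>C u \<in> DA \<and> A (z *\<^sub>C u) = z *\<^sub>C A u" if u: "u \<in> DA" for u z
  proof -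
    have "u \<in> DA \<and> A u = A u" using u by auto
    then obtain f f1 f2 b where
      f: "f \<in> L2_ul" "f1 \<in> L2_ul" "f2 \<in> L2_ul" "b \<in> L2_ul" "weak_derivative 1 f f1" "weak_derivative 2 f f2"
        "AE x in lborel. f x \<in> D \<and> B (f x) = b x" "u = abs_ul_space f" "A u = abs_ul_space (\<lambda>x. - f2 x + b x)"
      unfolding iff by blast
    have wd: "weak_derivative k (\<lambda>x. z *\<^sub>C p x) (\<lambda>x. z *\<^sub>C q x)"
      if pq: "weak_derivative k p q" "p \<in> L2_ul" "q \<in> L2_ul" for k p and q :: "real \<Rightarrow> 'a"
      unfolding weak_derivative_def
    proof (intro allI impI)
      fix \<theta> assume \<theta>: "test_function \<theta>"
      have lin: "(LINT x|lborel. (deriv ^^ j) \<theta> x *\<^sub>R z *\<^sub>C p x) = z *\<^sub>C (LINT x|lborel. (deriv ^^ j) \<theta> x *\<^sub>R p x)"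
        if "p \<in> L2_ul" for j and p :: "real \<Rightarrow> 'a"
        using integral_bounded_linear[OF bounded_linear_scaleC test_function_integrable[OF \<theta> L2_ul_locally_integrable[OF that], of j], of z]
        by (simp add: linear_cmul[OF bounded_linear.linear[OF bounded_linear_scaleC]])
      show "(LINT x|lborel. (deriv ^^ k) \<theta> x *\<^sub>R z *\<^sub>C p x) = (- 1) ^ k *\<^sub>R (LINT x|lborel. \<theta> x *\<^sub>R z *\<^sub>C q x)"
        using lin[OF pq(2), of k] lin[OF pq(3), of 0] pq(1) \<theta>
        by (simp add: weak_derivative_def linear_cmul[OF bounded_linear.linear[OF bounded_linear_scaleC]])
    qed
    have AE: "AE x in lborel. z *\<^sub>C f x \<in> D \<and> B (z *\<^sub>C f x) = z *\<^sub>C b x"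
      using f(7) by eventually_elim (simp add: dom_scaleC B_scaleC)
    have "z *\<^sub>C A u = abs_ul_space (\<lambda>x. z *\<^sub>C (- f2 x + b x))"
      unfolding f(9) by (intro abs_ul_space_scaleC L2_ul_add(1) L2_ul_uminus f)
    also have "(\<lambda>x. z *\<^sub>C (- f2 x + b x)) = (\<lambda>x. - (z *\<^sub>C f2 x) + z *\<^sub>C b x)"
      by (simp only: scaleC_add_right scaleC_simps)
    finally show ?thesis
      unfolding iff using f wd AE
      by (intro exI[of _ "\<lambda>x. z *\<^sub>C f x"] exI[of _ "\<lambda>x. z *\<^sub>C f1 x"] exI[of _ "\<lambda>x. z *\<^sub>C f2 x"] exI[of _ "\<lambda>x. z *\<^sub>C b x"])
        (simp add: abs_ul_space_scaleC L2_ul_scaleC(1))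
  qed
  show ?thesis using 1 2 3 by (auto simp: linear_operator_def)
qed

text \<open>The factor \<open>236\<close> is the largest constant in the weighted estimates, \<open>ul_const\<close> bounds weighted norms by
  uniformly local ones, and the factor \<open>2\<close> accounts for the opposite comparison.\<close>

definition res_const :: real where "res_const = 2 * sqrt (236 * ul_const)"

lemma res_const: "0 < res_const" "236 * ul_const = (res_const / 2)\<^sup>2"
  using ul_const_pos by (auto simp: res_const_def)

lemma shifted_bound:
  assumes w: "Re w \<le> cmod w / 2" and u: "u \<in> DA"
  shows "(1 + cmod w) * norm u \<le> res_const * norm (A u + u - w *\<^sub>C u)"
proof -
  have "u \<in> DA \<and> A u = A u" using u by auto
  then obtain f f1 f2 b where
    f: "f \<in> L2_ul" "f1 \<in> L2_ul" "f2 \<in> L2_ul" "b \<in> L2_ul" "weak_derivative 1 f f1" "weak_derivative 2 f f2"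
      "AE x in lborel. f x \<in> D \<and> B (f x) = b x" "u = abs_ul_space f" "A u = abs_ul_space (\<lambda>x. - f2 x + b x)"
    unfolding A_dom_op_iff[of D B, OF zero_dom B_zero] by blast
  define g where "g = (\<lambda>x. - f2 x + b x + f x - w *\<^sub>C f x)"
  have g: "g \<in> L2_ul" unfolding g_def
    by (intro L2_ul_diff L2_ul_add(1) L2_ul_uminus L2_ul_scaleC(1) f)
  have "A u + u - w *\<^sub>C u = abs_ul_space g"
    unfolding g_def f(9) f(8)
    using f by (simp add: abs_ul_space_simps abs_ul_space_scaleC L2_ul_add(1) L2_ul_diff L2_ul_scaleC(1))
  then have ng: "norm (A u + u - w *\<^sub>C u) = ul_norm g" using g by (simp add: abs_ul_space_simps)
  have "solution w g f f2 b"
    using f g by (simp add: solution_def L2_ul_weighted_bound(1) g_def L2_ul_measurable)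
  note E = solution_estimates(1)[OF this w]
  define m where "m = 1 + cmod w"
  have m: "m > 0" by (simp add: m_def add_pos_nonneg)
  define C where "C = res_const / 2 / m * ul_norm g"
  have ug: "0 \<le> ul_norm g" using norm_ge_zero[of "abs_ul_space g"] g by (simp add: abs_ul_space_simps)
  have "wnorm2 a f \<le> C\<^sup>2" for a
  proof -
    have "m\<^sup>2 * wnorm2 a f \<le> 16 * (ul_const * (ul_norm g)\<^sup>2)"
      using E[of a] L2_ul_weighted_bound(2)[OF g, of a] by (simp add: m_def)
    also have "\<dots> \<le> 236 * ul_const * (ul_norm g)\<^sup>2" using ul_const_pos by simp
    also have "\<dots> = m\<^sup>2 * C\<^sup>2" using m by (simp add: C_def res_const(2) power_mult_distrib power_divide)
    finally show ?thesis using m by simp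
  qed
  then have "ul_norm f \<le> 2 * C"
    using m ug res_const(1) by (intro weighted_L2_ul(2)[OF L2_ul_weighted_bound(1)[OF f(1)]]) (auto simp: C_def)
  then have "m * ul_norm f \<le> res_const * ul_norm g" using m by (simp add: C_def field_simps)
  moreover have "norm u = ul_norm f" using f(1,8) by (simp add: abs_ul_space_simps)
  ultimately show ?thesis unfolding ng m_def by simp
qed

text \<open>The constants in the weighted estimates do not depend on the centre of the weight, so the solution
  found in the weighted space is uniformly local together with its derivatives.\<close>

lemma shifted_surj:
  assumes w: "Re w \<le> cmod w / 2"
  shows "\<exists>u\<in>DA. A u + u - w *\<^sub>C u = v"
proof -
  obtain g where g: "g \<in> L2_ul" "v = abs_ul_space g" by (rule ul_space_cases)
  obtain f f2 b where s: "solution w g f f2 b"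
    using solution_exists[OF w L2_ul_weighted_bound(1)[OF g(1)]] by blast
  note E = solution_estimates[OF s w]
  obtain f1 where f1: "weighted_L2 f1" "weak_derivative 1 f f1" "\<And>a. wnorm2 a f1 \<le> 32 * wnorm2 a g"
    using E(4) by blast
  define C where "C = res_const / 2 * ul_norm g"
  have ug: "0 \<le> ul_norm g" using norm_ge_zero[of "abs_ul_space g"] g by (simp add: abs_ul_space_simps)
  have C0: "0 \<le> C" using ug res_const(1) by (simp add: C_def)
  have CC: "236 * wnorm2 a g \<le> C\<^sup>2" for a
  proof -
    have "236 * wnorm2 a g \<le> 236 * (ul_const * (ul_norm g)\<^sup>2)" using L2_ul_weighted_bound(2)[OF g(1), of a] by simp
    also have "\<dots> = C\<^sup>2" unfolding C_def power_mult_distrib res_const(2)[symmetric] by simp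
    finally show ?thesis .
  qed
  have ul: "h \<in> L2_ul" if "weighted_L2 h" "\<And>a. wnorm2 a h \<le> 236 * wnorm2 a g" for h :: "real \<Rightarrow> 'a"
    by (rule weighted_L2_ul(1)[OF that(1) _ C0]) (use that(2) CC order_trans in blast)
  have gn: "0 \<le> wnorm2 a g" for a by (rule wnorm2_nonneg)
  have "f \<in> L2_ul"
  proof (rule ul)
    fix a
    have "1 * wnorm2 a f \<le> (1 + cmod w)\<^sup>2 * wnorm2 a f" by (intro mult_right_mono wnorm2_nonneg) simp
    then show "wnorm2 a f \<le> 236 * wnorm2 a g" using E(1)[of a] gn[of a] by linarith
  qed (use s in \<open>simp add: solution_def\<close>)
  moreover have "f1 \<in> L2_ul" "f2 \<in> L2_ul" "b \<in> L2_ul"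
  proof -
    show "f1 \<in> L2_ul"
    proof (rule ul[OF f1(1)])
      show "wnorm2 a f1 \<le> 236 * wnorm2 a g" for a using f1(3)[of a] gn[of a] by linarith
    qed
    show "f2 \<in> L2_ul" by (rule ul) (use s E(3) in \<open>auto simp: solution_def\<close>)
    show "b \<in> L2_ul"
    proof (rule ul)
      show "wnorm2 a b \<le> 236 * wnorm2 a g" for a using E(2)[of a] gn[of a] by linarith
    qed (use s in \<open>simp add: solution_def\<close>)
  qed
  ultimately have L: "f \<in> L2_ul" "f1 \<in> L2_ul" "f2 \<in> L2_ul" "b \<in> L2_ul" by auto
  have AE: "AE x in lborel. f x \<in> D \<and> B (f x) = b x" "AE x in lborel. g x = - f2 x + b x + f x - w *\<^sub>C f x"
    and d2: "weak_derivative 2 f f2" using s by (auto simp: solution_def)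
  define u where "u = abs_ul_space f"
  have u: "u \<in> DA \<and> A u = abs_ul_space (\<lambda>x. - f2 x + b x)"
    unfolding A_dom_op_iff[of D B, OF zero_dom B_zero] u_def using L f1(2) d2 AE(1) by blast
  have "A u + u - w *\<^sub>C u = abs_ul_space (\<lambda>x. - f2 x + b x + f x - w *\<^sub>C f x)"
    using L u[THEN conjunct2] unfolding u_def
    by (simp add: abs_ul_space_simps abs_ul_space_scaleC L2_ul_add(1) L2_ul_diff L2_ul_scaleC(1))
  also have "\<dots> = v"
    using AE(2) L g by (simp add: abs_ul_space_eq_iff L2_ul_add(1) L2_ul_uminus L2_ul_scaleC(1) L2_ul_diff eq_commute)
  finally show ?thesis using u by blast
qed

lemma DA_diff: "u \<in> DA \<Longrightarrow> v \<in> DA \<Longrightarrow> u - v \<in> DA \<and> A (u - v) = A u - A v"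
proof -
  assume uv: "u \<in> DA" "v \<in> DA"
  have m: "(- 1) *\<^sub>C v = - v" "(- 1) *\<^sub>C A v = - A v" by (simp_all add: scaleC_simps)
  then have "- v \<in> DA \<and> A (- v) = - A v" using A_linear uv(2) unfolding linear_operator_def by metis
  then have "u + (- v) \<in> DA \<and> A (u + (- v)) = A u + (- A v)" using A_linear uv(1) unfolding linear_operator_def by metis
  then show ?thesis by simp
qed

text \<open>\<open>A + 1\<close> has a bounded inverse, by the preceding lemmas with \<open>w = 0\<close>.\<close>

lemma A_closed: "closed_operator scaleC DA A"
proof -
  have w: "Re 0 \<le> cmod 0 / 2" by simp
  have "closed (operator_graph DA A)"
    unfolding closed_sequential_limits
  proof (intro allI impI)
    fix X l assume X: "(\<forall>n. X n \<in> operator_graph DA A) \<and> X \<longlonglongrightarrow> l"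
    define U where "U = (\<lambda>n. fst (X n))"
    have U: "U n \<in> DA" "X n = (U n, A (U n))" for n
    proof -
      obtain u where "X n = (u, A u)" "u \<in> DA" using X unfolding operator_graph_def by blast
      then show "U n \<in> DA" "X n = (U n, A (U n))" by (simp_all add: U_def)
    qed
    obtain u v where l: "l = (u, v)" by (cases l)
    have XU: "X = (\<lambda>n. (U n, A (U n)))" using U(2) by blast
    have "(\<lambda>n. (U n, A (U n))) \<longlonglongrightarrow> (u, v)" using X unfolding l XU[symmetric] by blast
    from tendsto_fst[OF this] tendsto_snd[OF this]
    have lim: "U \<longlonglongrightarrow> u" "(\<lambda>n. A (U n)) \<longlonglongrightarrow> v" by simp_all
    obtain u' where u': "u' \<in> DA" "A u' + u' - 0 *\<^sub>C u' = v + u" using shifted_surj[OF w] by blast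
    then have e: "A u' + u' = v + u" by (simp add: scaleC_simps)
    have le: "norm (U n - u') \<le> res_const * norm (A (U n) + U n - (v + u))" for n
    proof -
      have eq: "A (U n - u') + (U n - u') - 0 *\<^sub>C (U n - u') = A (U n) + U n - (v + u)"
        using DA_diff[OF U(1) u'(1), of n] by (simp add: scaleC_simps e[symmetric])
      have "U n - u' \<in> DA" using DA_diff[OF U(1) u'(1), of n] ..
      from shifted_bound[OF w this] show ?thesis unfolding eq by simp
    qed
    have "(\<lambda>n. res_const * norm (A (U n) + U n - (v + u))) \<longlonglongrightarrow> res_const * norm (v + u - (v + u))"
      by (intro tendsto_intros lim)
    then have to0: "(\<lambda>n. res_const * norm (A (U n) + U n - (v + u))) \<longlonglongrightarrow> 0" by simp
    have "(\<lambda>n. U n - u') \<longlonglongrightarrow> 0"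
      by (rule Lim_null_comparison[OF _ to0]) (use le in \<open>simp add: always_eventually\<close>)
    then have "U \<longlonglongrightarrow> u'" by (simp add: LIM_zero_iff)
    from LIMSEQ_unique[OF lim(1) this] have "u = u'" .
    then show "l \<in> operator_graph DA A" using u' e l by (auto simp: operator_graph_def)
  qed
  then show ?thesis using A_linear by (simp add: closed_operator_def)
qed

text \<open>Since \<open>cos (\<pi> / 3) = 1 / 2\<close>, the sector is described by \<open>Re w \<le> \<bar>w\<bar> / 2\<close> for \<open>w = z + 1\<close>.\<close>

lemma resolvent_estimates_A: "resolvent_estimates DA A (- 1) (pi / 3) res_const"
proof -
  have main: "z \<in> resolvent_set DA A \<and> onorm (resolvent DA A z) \<le> res_const / cmod (z - complex_of_real (- 1))"
    if z: "z \<in> sector (- 1) (pi / 3)" for z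
  proof -
    define w where "w = z + 1"
    have w0: "w \<noteq> 0" and arg: "pi / 3 \<le> \<bar>Arg w\<bar>" "\<bar>Arg w\<bar> \<le> pi"
      using z by (auto simp: sector_def w_def add_eq_0_iff2)
    have polar: "w = of_real (cmod w) * cis (Arg w)" using Arg_eq[OF w0] by (simp add: cis_conv_exp)
    have "Re w = cmod w * cos (Arg w)" by (subst polar) simp
    also have "cos (Arg w) = cos \<bar>Arg w\<bar>" by (simp add: abs_if)
    also have "cos \<bar>Arg w\<bar> \<le> cos (pi / 3)" using arg by (intro cos_monotone_0_pi_le) auto
    finally have w: "Re w \<le> cmod w / 2" by (simp add: cos_60 mult_left_mono)
    have eq: "z *\<^sub>C u - A u = - (A u + u - w *\<^sub>C u)" for u
      by (simp add: w_def scaleC_add_left scaleC_simps)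
    have bound: "(1 + cmod w) * norm u \<le> res_const * norm (z *\<^sub>C u - A u)" if "u \<in> DA" for u
      using shifted_bound[OF w that] unfolding eq norm_minus_cancel .
    have inj: "inj_on (\<lambda>u. z *\<^sub>C u - A u) DA"
    proof (rule inj_onI)
      fix u v assume uv: "u \<in> DA" "v \<in> DA" "z *\<^sub>C u - A u = z *\<^sub>C v - A v"
      have "z *\<^sub>C (u - v) - A (u - v) = (z *\<^sub>C u - A u) - (z *\<^sub>C v - A v)"
        using DA_diff[OF uv(1,2)] by (simp add: scaleC_simps)
      also have "\<dots> = 0" using uv(3) by simp
      finally have "z *\<^sub>C (u - v) - A (u - v) = 0" .
      then have "(1 + cmod w) * norm (u - v) \<le> 0" using bound[of "u - v"] DA_diff[OF uv(1,2)] by simp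
      moreover have "0 < 1 + cmod w" by (simp add: add_pos_nonneg)
      ultimately show "u = v" by (simp add: mult_le_0_iff)
    qed
    have surj: "\<exists>u\<in>DA. z *\<^sub>C u - A u = v" for v
      using shifted_surj[OF w, of "- v"] unfolding eq by (metis minus_minus)
    have bij: "bij_betw (\<lambda>u. z *\<^sub>C u - A u) DA UNIV"
      unfolding bij_betw_def
    proof (intro conjI inj UNIV_eq_I[symmetric])
      fix v
      obtain u where "u \<in> DA" "z *\<^sub>C u - A u = v" using surj by blast
      then show "v \<in> (\<lambda>u. z *\<^sub>C u - A u) ` DA" by (intro image_eqI[of _ _ u]) auto
    qed
    have R: "resolvent DA A z v \<in> DA" "z *\<^sub>C resolvent DA A z v - A (resolvent DA A z v) = v" for v
      using bij unfolding resolvent_def bij_betw_def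
      by (auto intro: inv_into_into f_inv_into_f[of v "\<lambda>u. z *\<^sub>C u - A u" DA])
    have Req: "resolvent DA A z v = u" if "u \<in> DA" "z *\<^sub>C u - A u = v" for u v
      using inj R[of v] that by (auto dest: inj_onD)
    have nR: "norm (resolvent DA A z v) \<le> res_const / (1 + cmod w) * norm v" for v
    proof -
      have "0 < 1 + cmod w" by (simp add: add_pos_nonneg)
      then show ?thesis using bound[OF R(1), of v] R(2)[of v] by (simp add: field_simps)
    qed
    have lin: "linear_operator scaleC DA A" by (rule A_linear)
    have bl: "bounded_linear (resolvent DA A z)"
    proof (rule bounded_linear_intro[where K = "res_const / (1 + cmod w)"])
      fix x y and r :: real
      show "resolvent DA A z (x + y) = resolvent DA A z x + resolvent DA A z y"
      proof (rule Req)
        have "resolvent DA A z x + resolvent DA A z y \<in> DA \<and> A (resolvent DA A z x + resolvent DA A z y)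
            = A (resolvent DA A z x) + A (resolvent DA A z y)"
          using lin R(1) unfolding linear_operator_def by blast
        then show "resolvent DA A z x + resolvent DA A z y \<in> DA"
          "z *\<^sub>C (resolvent DA A z x + resolvent DA A z y) - A (resolvent DA A z x + resolvent DA A z y) = x + y"
          using R(2)[of x] R(2)[of y] by (auto simp: scaleC_add_right algebra_simps)
      qed
      show "resolvent DA A z (r *\<^sub>R x) = r *\<^sub>R resolvent DA A z x"
      proof (rule Req)
        have *: "of_real r *\<^sub>C resolvent DA A z x \<in> DA \<and> A (of_real r *\<^sub>C resolvent DA A z x) = of_real r *\<^sub>C A (resolvent DA A z x)"
          using lin R(1) unfolding linear_operator_def by blast
        then show "r *\<^sub>R resolvent DA A z x \<in> DA" by (simp add: scaleC_of_real)
        have "z *\<^sub>C r *\<^sub>R resolvent DA A z x = r *\<^sub>R z *\<^sub>C resolvent DA A z x"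
          by (rule linear_cmul[OF bounded_linear.linear[OF bounded_linear_scaleC]])
        then show "z *\<^sub>C r *\<^sub>R resolvent DA A z x - A (r *\<^sub>R resolvent DA A z x) = r *\<^sub>R x"
          using * R(2)[of x] by (simp add: scaleC_of_real flip: scaleR_diff_right)
      qed
      show "norm (resolvent DA A z x) \<le> norm x * (res_const / (1 + cmod w))"
        using nR[of x] by (simp add: mult.commute)
    qed
    have "onorm (resolvent DA A z) \<le> res_const / (1 + cmod w)" using res_const(1) by (intro onorm_bound nR) simp
    also have "\<dots> \<le> res_const / cmod w" using res_const(1) w0
      by (intro divide_left_mono mult_pos_pos add_pos_nonneg) auto
    finally show ?thesis using bij bl by (simp add: resolvent_set_def w_def)
  qed
  then show ?thesis using res_const(1) pi_gt_zero by (auto simp: resolvent_estimates_def)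
qed

end


section \<open>The domain is not dense\<close>

text \<open>Each spike has a unit of mass in the sense of \<open>L\<^sup>2\<close>, while the length of its support tends to zero.\<close>

definition spikes :: "real \<Rightarrow> real" where
  "spikes x = (if 2 \<le> x \<and> x \<le> real_of_int \<lfloor>x\<rfloor> + 1 / real_of_int \<lfloor>x\<rfloor> then sqrt (real_of_int \<lfloor>x\<rfloor>) else 0)"

lemma measurable_spikes [measurable]: "spikes \<in> borel_measurable borel"
  unfolding spikes_def by measurable

lemma spikes_on: "n \<ge> 2 \<Longrightarrow> x \<in> {real n..real n + 1 / real n} \<Longrightarrow> spikes x = sqrt (real n)"
proof -
  assume n: "n \<ge> 2" and x: "x \<in> {real n..real n + 1 / real n}"
  have "1 / real n < 1" using n by simp
  then have "\<lfloor>x\<rfloor> = int n" using x by (intro floor_unique) auto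
  then show ?thesis using n x by (simp add: spikes_def)
qed

lemma spikes_L2_ul:
  fixes y :: "'a::{banach, second_countable_topology}"
  shows "(\<lambda>x. spikes x *\<^sub>R y) \<in> L2_ul"
proof -
  define g where "g = (\<lambda>(m::int) x. if 2 \<le> m then real_of_int m * indicator {real_of_int m..real_of_int m + 1 / real_of_int m} x else 0 :: real)"
  have gi: "integrable lborel (g m) \<and> integral\<^sup>L lborel (g m) \<le> 1" for m
    by (cases "2 \<le> m") (auto simp: g_def measure_def)
  have g0: "0 \<le> g m x" for m x by (simp add: g_def)
  have sg: "(spikes x)\<^sup>2 \<le> g \<lfloor>x\<rfloor> x" for x
  proof (cases "2 \<le> x \<and> x \<le> real_of_int \<lfloor>x\<rfloor> + 1 / real_of_int \<lfloor>x\<rfloor>")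
    case True
    then have "2 \<le> \<lfloor>x\<rfloor>" by (simp add: le_floor_iff)
    then show ?thesis using True by (simp add: spikes_def g_def)
  next
    case False
    then have "spikes x = 0" by (auto simp: spikes_def)
    then show ?thesis using g0 by simp
  qed
  have le: "indicator {a..b} x * (spikes x)\<^sup>2 \<le> (\<Sum>m\<in>{\<lfloor>a\<rfloor>..\<lfloor>b\<rfloor>}. g m x)" for a b x
  proof (cases "x \<in> {a..b}")
    case True
    then have "\<lfloor>x\<rfloor> \<in> {\<lfloor>a\<rfloor>..\<lfloor>b\<rfloor>}" by (auto intro: floor_mono)
    then have "g \<lfloor>x\<rfloor> x \<le> (\<Sum>m\<in>{\<lfloor>a\<rfloor>..\<lfloor>b\<rfloor>}. g m x)" using g0 by (intro member_le_sum) auto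
    then show ?thesis using sg[of x] True by simp
  qed (simp add: sum_nonneg g0)
  have gsum: "integrable lborel (\<lambda>x. \<Sum>m\<in>{\<lfloor>a\<rfloor>..\<lfloor>b\<rfloor>}. g m x)" for a b :: real
    using gi by (intro Bochner_Integration.integrable_sum) auto
  have si: "integrable lborel (\<lambda>x. indicator {a..b} x * (spikes x)\<^sup>2)" for a b
    by (rule Bochner_Integration.integrable_bound[OF gsum[of a b]])
      (use le[of a b] in \<open>auto simp: indicator_def order.trans[OF _ abs_ge_self]\<close>)
  have eq: "(norm (spikes x *\<^sub>R y))\<^sup>2 = (norm y)\<^sup>2 * (spikes x)\<^sup>2" for x by (simp add: power_mult_distrib)
  have loc: "(\<lambda>x. spikes x *\<^sub>R y) \<in> L2_loc"
  proof -
    have "set_integrable lborel {a..b} (\<lambda>x. (norm (spikes x *\<^sub>R y))\<^sup>2)" for a b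
      using integrable_mult_right[OF si[of a b], of "(norm y)\<^sup>2"]
      unfolding set_integrable_def eq by (simp add: mult.left_commute)
    then show ?thesis by (simp add: L2_loc_def)
  qed
  moreover have "unit_L2_norm a (\<lambda>x. spikes x *\<^sub>R y) \<le> 2 * norm y" for a
  proof -
    have fl: "\<lfloor>a + 1\<rfloor> = \<lfloor>a\<rfloor> + 1" by simp
    have "(LINT x|lborel. indicator {a..a+1} x * (spikes x)\<^sup>2) \<le> (LINT x|lborel. (\<Sum>m\<in>{\<lfloor>a\<rfloor>..\<lfloor>a+1\<rfloor>}. g m x))"
      by (intro integral_mono si gsum le)
    also have "\<dots> = (\<Sum>m\<in>{\<lfloor>a\<rfloor>..\<lfloor>a+1\<rfloor>}. integral\<^sup>L lborel (g m))"
      using gi by (intro Bochner_Integration.integral_sum) auto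
    also have "\<dots> \<le> (\<Sum>m\<in>{\<lfloor>a\<rfloor>..\<lfloor>a+1\<rfloor>}. 1)" using gi by (intro sum_mono) auto
    also have "\<dots> = 2" unfolding fl by simp
    finally have "(LINT x|lborel. indicator {a..a+1} x * (spikes x)\<^sup>2) \<le> 2" .
    then have "(norm y)\<^sup>2 * (LINT x|lborel. indicator {a..a+1} x * (spikes x)\<^sup>2) \<le> (norm y)\<^sup>2 * 4"
      by (intro mult_left_mono) auto
    moreover have "(unit_L2_norm a (\<lambda>x. spikes x *\<^sub>R y))\<^sup>2 = (norm y)\<^sup>2 * (LINT x|lborel. indicator {a..a+1} x * (spikes x)\<^sup>2)"
      unfolding unit_L2_norm_power2 set_lebesgue_integral_def eq
      by (subst integral_mult_right_zero[symmetric]) (simp add: mult.left_commute)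
    ultimately have "(unit_L2_norm a (\<lambda>x. spikes x *\<^sub>R y))\<^sup>2 \<le> (2 * norm y)\<^sup>2" by (simp add: power_mult_distrib)
    then show ?thesis by (rule power2_le_imp_le) simp
  qed
  ultimately show ?thesis by (auto simp: L2_ul_def bdd_above_def)
qed

text \<open>The value at \<open>x\<close> differs from the mean over \<open>{x..x+1}\<close> at most by the integral of the norm of the
  derivative, which is bounded independently of \<open>x\<close>.\<close>

lemma bounded_of_L2_ul_derivatives:
  fixes f :: "real \<Rightarrow> 'a::{banach, second_countable_topology}"
  assumes f: "f \<in> L2_ul" "f1 \<in> L2_ul" "f2 \<in> L2_ul" and d: "weak_derivative 1 f f1" "weak_derivative 2 f f2"
  shows "\<exists>K. AE x in lborel. norm (f x) \<le> K"
proof -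
  obtain U U1 where U: "antiderivative U U1" "antiderivative U1 f2" "AE x in lborel. f x = U x"
    using second_weak_derivative_representation[OF f(1,3)[THEN L2_ul_locally_integrable] d(2)] by blast
  have cU: "continuous_on UNIV U" by (rule antiderivative_continuous[OF U(1)])
  have [measurable]: "f \<in> borel_measurable borel" "U \<in> borel_measurable borel" "f1 \<in> borel_measurable borel"
    using f L2_ul_measurable borel_measurable_continuous_onI[OF cU] by auto
  have UL: "U \<in> L2_ul"
  proof (rule L2_ul_bound[OF f(1)])
    show "AE x in lborel. norm (U x) \<le> norm (f x)" using U(3) by eventually_elim simp
  qed simp
  have "AE x in lborel. U1 x = f1 x"
  proof (rule weak_derivative_unique[OF antiderivative_locally_integrable[OF U(1)] L2_ul_locally_integrable[OF f(2)] _ d(1)])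
    have "AE x in lborel. U x = f x" using U(3) by eventually_elim simp
    then show "weak_derivative 1 f U1"
      by (rule weak_derivative_cong_AE[OF _ _ _ weak_derivative_antiderivative[OF U(1)]]) measurable
  qed
  have sqi: "integrable lborel (\<lambda>x. indicator {a..a+1} x * (1 + (norm (h x))\<^sup>2))"
    "(LINT x|lborel. indicator {a..a+1} x * (1 + (norm (h x))\<^sup>2)) \<le> 1 + (ul_norm h)\<^sup>2"
    if h: "h \<in> L2_ul" for h :: "real \<Rightarrow> 'a" and a
  proof -
    have i: "integrable lborel (\<lambda>x. indicator {a..a+1} x * (norm (h x))\<^sup>2)"
      using h by (simp add: L2_ul_def L2_loc_def set_integrable_def)
    have e: "(\<lambda>x. indicator {a..a+1} x * (1 + (norm (h x))\<^sup>2)) = (\<lambda>x. indicator {a..a+1} x + indicator {a..a+1} x * (norm (h x))\<^sup>2)"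
      by (simp add: distrib_left)
    have one: "integrable lborel (indicator {a..a+1} :: real \<Rightarrow> real)" "integral\<^sup>L lborel (indicator {a..a+1} :: real \<Rightarrow> real) = 1"
      by (auto simp: measure_def)
    show "integrable lborel (\<lambda>x. indicator {a..a+1} x * (1 + (norm (h x))\<^sup>2))"
      unfolding e by (intro Bochner_Integration.integrable_add one i)
    have "(LINT x|lborel. indicator {a..a+1} x * (1 + (norm (h x))\<^sup>2)) = 1 + (unit_L2_norm a h)\<^sup>2"
      unfolding e Bochner_Integration.integral_add[OF one(1) i] one(2)
      by (simp add: unit_L2_norm_power2 set_lebesgue_integral_def)
    also have "\<dots> \<le> 1 + (ul_norm h)\<^sup>2"
      using power_mono[OF unit_le_ul[OF h, of a] unit_L2_norm_nonneg, of 2] by simp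
    finally show "(LINT x|lborel. indicator {a..a+1} x * (1 + (norm (h x))\<^sup>2)) \<le> 1 + (ul_norm h)\<^sup>2" .
  qed
  have n1: "norm z \<le> 1 + (norm z)\<^sup>2" for z :: 'a
    using sum_squares_bound[of 1 "norm z"] norm_ge_zero[of z] by (simp only: one_power2 mult_1_right)
  have "norm (U x) \<le> 2 + (ul_norm U)\<^sup>2 + (ul_norm f1)\<^sup>2" for x
  proof -
    let ?I = "{x..x+1}"
    have step: "norm (U x) \<le> (1 + (norm (U s))\<^sup>2) + (1 + (ul_norm f1)\<^sup>2)" if s: "s \<in> ?I" for s
    proof -
      have "U s - U x = (LINT t|lborel. indicator {x..s} t *\<^sub>R U1 t)"
        using antiderivative_diff[OF U(1), of x s] s by (simp add: set_lebesgue_integral_def)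
      also have "\<dots> = (LINT t|lborel. indicator {x..s} t *\<^sub>R f1 t)"
        using antiderivative_locally_integrable[OF U(1)] \<open>AE x in lborel. U1 x = f1 x\<close>
        by (intro integral_cong_AE) (auto simp: locally_integrable_def elim!: eventually_mono)
      finally have "norm (U s - U x) \<le> (LINT t|lborel. norm (indicator {x..s} t *\<^sub>R f1 t))"
        using integral_norm_bound by metis
      also have "\<dots> \<le> (LINT t|lborel. indicator ?I t * (1 + (norm (f1 t))\<^sup>2))"
      proof (rule integral_mono[OF _ sqi(1)[OF f(2)]])
        show "integrable lborel (\<lambda>t. norm (indicator {x..s} t *\<^sub>R f1 t))"
          by (intro integrable_norm locally_integrable_indicator L2_ul_locally_integrable f(2))
        fix t
        show "norm (indicator {x..s} t *\<^sub>R f1 t) \<le> indicator ?I t * (1 + (norm (f1 t))\<^sup>2)"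
          using s n1[of "f1 t"] by (auto simp: indicator_def)
      qed
      also have "\<dots> \<le> 1 + (ul_norm f1)\<^sup>2" by (rule sqi(2)[OF f(2)])
      finally show ?thesis
        using n1[of "U s"] norm_triangle_sub[of "U x" "U s"] by (simp add: norm_minus_commute)
    qed
    have one: "integrable lborel (indicator ?I :: real \<Rightarrow> real)" "integral\<^sup>L lborel (indicator ?I :: real \<Rightarrow> real) = 1"
      by (auto simp: measure_def)
    have "norm (U x) = (LINT s|lborel. indicator ?I s * norm (U x))" using one by simp
    also have "\<dots> \<le> (LINT s|lborel. indicator ?I s * (1 + (norm (U s))\<^sup>2) + indicator ?I s * (1 + (ul_norm f1)\<^sup>2))"
    proof (rule integral_mono)
      show "integrable lborel (\<lambda>s. indicator ?I s * norm (U x))" using one by simp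
      show "integrable lborel (\<lambda>s. indicator ?I s * (1 + (norm (U s))\<^sup>2) + indicator ?I s * (1 + (ul_norm f1)\<^sup>2))"
        using one by (intro Bochner_Integration.integrable_add sqi(1) UL integrable_mult_left) auto
      show "indicator ?I s * norm (U x) \<le> indicator ?I s * (1 + (norm (U s))\<^sup>2) + indicator ?I s * (1 + (ul_norm f1)\<^sup>2)" for s
        using step[of s] by (auto simp: indicator_def)
    qed
    also have "\<dots> = (LINT s|lborel. indicator ?I s * (1 + (norm (U s))\<^sup>2)) + (1 + (ul_norm f1)\<^sup>2)"
      using one by (subst Bochner_Integration.integral_add[OF sqi(1)[OF UL] integrable_mult_left]) auto
    also have "\<dots> \<le> (1 + (ul_norm U)\<^sup>2) + (1 + (ul_norm f1)\<^sup>2)" using sqi(2)[OF UL, of x] by simp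
    finally show ?thesis by simp
  qed
  then have "AE x in lborel. norm (f x) \<le> 2 + (ul_norm U)\<^sup>2 + (ul_norm f1)\<^sup>2"
    using U(3) by (auto elim!: eventually_mono)
  then show ?thesis by blast
qed

text \<open>The domain consists of bounded functions, which carry arbitrarily little mass on the short
  intervals supporting the spikes.\<close>

lemma spikes_not_in_closure:
  fixes T :: "'a::{banach, second_countable_topology} \<Rightarrow> 'a"
  assumes y: "y \<noteq> 0" and T0: "0 \<in> D" "T 0 = 0"
  shows "abs_ul_space (\<lambda>x. spikes x *\<^sub>R y) \<notin> closure (A_dom D T)"
proof
  let ?s = "\<lambda>x. spikes x *\<^sub>R y"
  assume "abs_ul_space ?s \<in> closure (A_dom D T)"
  then obtain v where v: "v \<in> A_dom D T" "norm (v - abs_ul_space ?s) < norm y / 2"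
    using y closure_approachable[of "abs_ul_space ?s"] by (metis dist_norm half_gt_zero_iff zero_less_norm_iff)
  have "v \<in> A_dom D T \<and> A_op D T v = A_op D T v" using v by simp
  then obtain f f1 f2 where f: "f \<in> L2_ul" "f1 \<in> L2_ul" "f2 \<in> L2_ul" "weak_derivative 1 f f1" "weak_derivative 2 f f2"
    "v = abs_ul_space f" unfolding A_dom_op_iff[of D T, OF T0] by blast
  obtain K where K: "AE x in lborel. norm (f x) \<le> K" using bounded_of_L2_ul_derivatives[OF f(1-5)] by blast
  define h where "h = (\<lambda>x. f x - ?s x)"
  have h: "h \<in> L2_ul" unfolding h_def by (intro L2_ul_diff f spikes_L2_ul)
  have nh: "norm (v - abs_ul_space ?s) = ul_norm h"
    using f(1,6) spikes_L2_ul[of y] h by (simp add: abs_ul_space_simps h_def)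
  have bound: "(norm y)\<^sup>2 \<le> 2 * (ul_norm h)\<^sup>2 + 2 * K\<^sup>2 / real n" if n: "n \<ge> 2" for n
  proof -
    let ?I = "{real n..real n + 1 / real n}"
    have I: "?I \<subseteq> {real n..real n + 1}" using n by (auto simp: field_simps)
    have ind: "integrable lborel (indicator ?I :: real \<Rightarrow> real)" "integral\<^sup>L lborel (indicator ?I :: real \<Rightarrow> real) = 1 / real n"
      using n by (auto simp: measure_def)
    have hi: "integrable lborel (\<lambda>x. indicator {real n..real n + 1} x * (norm (h x))\<^sup>2)"
      using h by (simp add: L2_ul_def L2_loc_def set_integrable_def)
    have "(norm y)\<^sup>2 = (LINT x|lborel. indicator ?I x * (real n * (norm y)\<^sup>2))" using ind n by simp
    also have "\<dots> \<le> (LINT x|lborel. 2 * (indicator {real n..real n + 1} x * (norm (h x))\<^sup>2) + indicator ?I x * (2 * K\<^sup>2))"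
    proof (rule integral_mono_AE)
      show "AE x in lborel. indicator ?I x * (real n * (norm y)\<^sup>2)
          \<le> 2 * (indicator {real n..real n + 1} x * (norm (h x))\<^sup>2) + indicator ?I x * (2 * K\<^sup>2)"
        using K
      proof eventually_elim
        case (elim x)
        show ?case
        proof (cases "x \<in> ?I")
          case True
          have "real n * (norm y)\<^sup>2 = (norm (?s x))\<^sup>2"
            using spikes_on[OF n True] by (simp add: power_mult_distrib)
          also have "\<dots> = (norm (- h x + f x))\<^sup>2" by (simp add: h_def)
          also have "\<dots> \<le> 2 * (norm (- h x))\<^sup>2 + 2 * (norm (f x))\<^sup>2" by (rule sq_norm_add)
          also have "(norm (f x))\<^sup>2 \<le> K\<^sup>2" using elim by (intro power_mono) auto
          finally show ?thesis using True I by auto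
        next
          case False
          then have "indicator ?I x = (0::real)" by simp
          then show ?thesis by simp
        qed
      qed
    qed (use ind hi in auto)
    also have "\<dots> = (LINT x|lborel. 2 * (indicator {real n..real n + 1} x * (norm (h x))\<^sup>2)) + (LINT x|lborel. indicator ?I x * (2 * K\<^sup>2))"
      using ind hi by (intro Bochner_Integration.integral_add) auto
    also have "(LINT x|lborel. indicator ?I x * (2 * K\<^sup>2)) = 2 * K\<^sup>2 / real n" using ind by simp
    also have "(LINT x|lborel. 2 * (indicator {real n..real n + 1} x * (norm (h x))\<^sup>2)) = 2 * (LINT x|lborel. indicator {real n..real n + 1} x * (norm (h x))\<^sup>2)"
      by simp
    also have "(LINT x|lborel. indicator {real n..real n + 1} x * (norm (h x))\<^sup>2) = (unit_L2_norm (real n) h)\<^sup>2"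
      by (simp add: unit_L2_norm_power2 set_lebesgue_integral_def)
    also have "\<dots> \<le> (ul_norm h)\<^sup>2" by (intro power_mono unit_le_ul h unit_L2_norm_nonneg)
    finally show ?thesis by simp
  qed
  have "(\<lambda>n. 2 * (ul_norm h)\<^sup>2 + 2 * K\<^sup>2 / real n) \<longlonglongrightarrow> 2 * (ul_norm h)\<^sup>2 + 0"
    by (intro tendsto_add tendsto_const lim_const_over_n)
  then have "(norm y)\<^sup>2 \<le> 2 * (ul_norm h)\<^sup>2 + 0"
    by (rule LIMSEQ_le_const) (use bound in blast)
  also have "(ul_norm h)\<^sup>2 \<le> (norm y / 2)\<^sup>2" using v(2) nh norm_ge_zero[of "v - abs_ul_space ?s"]
    by (intro power_mono) auto
  finally have "(norm y)\<^sup>2 \<le> (norm y)\<^sup>2 / 2" by (simp add: power_divide)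
  then show False using y by simp
qed


section \<open>Integrals over the real line with values in a Banach space\<close>

text \<open>An antiderivative of a bounded function is Lipschitz continuous, hence it extends to the exceptional
  point, and the fundamental theorem of calculus applies to the extension.\<close>

lemma integrable_of_bounded_continuous_half_open:
  fixes f :: "real \<Rightarrow> 'a::banach"
  assumes c: "continuous_on {a<..b} f" and K: "\<And>x. x \<in> {a<..b} \<Longrightarrow> norm (f x) \<le> K"
  shows "f integrable_on {a..b}"
proof (cases "a < b")
  case False
  then show ?thesis using integrable_on_refl[of f a] by (cases "a = b") auto
next
  case ab: True
  have K0: "0 \<le> K" using order_trans[OF norm_ge_zero K[of b]] ab by simp
  define G where "G = (\<lambda>x. - integral {x..b} f)"
  have i: "f integrable_on {x..y}" if "a < x" "y \<le> b" for x y
    using that by (intro integrable_continuous_real continuous_on_subset[OF c]) auto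
  have Lip: "norm (G y - G x) \<le> K * (y - x)" if "a < x" "x \<le> y" "y \<le> b" for x y
  proof -
    have "integral {x..y} f + integral {y..b} f = integral {x..b} f"
      using that by (intro Henstock_Kurzweil_Integration.integral_combine i) auto
    then have "G y - G x = integral {x..y} f" by (simp add: G_def algebra_simps)
    also have "norm \<dots> \<le> K * (y - x)"
      using that K by (intro integral_bound continuous_on_subset[OF c]) auto
    finally show ?thesis .
  qed
  have Lip2: "dist (G y) (G x) \<le> K * dist y x" if "x \<in> {a<..b}" "y \<in> {a<..b}" for x y
    using Lip[of x y] Lip[of y x] that by (cases "x \<le> y") (auto simp: dist_norm norm_minus_commute)
  have "uniformly_continuous_on {a<..b} G"
    unfolding uniformly_continuous_on_def
  proof (intro allI impI)
    fix e :: real assume e: "0 < e"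
    show "\<exists>d>0. \<forall>x\<in>{a<..b}. \<forall>x'\<in>{a<..b}. dist x' x < d \<longrightarrow> dist (G x') (G x) < e"
    proof (intro exI conjI ballI impI)
      show "0 < e / (K + 1)" using e K0 by simp
      fix x x' assume x: "x \<in> {a<..b}" "x' \<in> {a<..b}" "dist x' x < e / (K + 1)"
      have "dist (G x') (G x) \<le> K * dist x' x" by (rule Lip2[OF x(1,2)])
      also have "\<dots> \<le> (K + 1) * dist x' x" by (intro mult_right_mono) auto
      also have "\<dots> < e" using x(3) K0 by (simp add: pos_less_divide_eq mult.commute)
      finally show "dist (G x') (G x) < e" .
    qed
  qed
  then have "\<exists>g. uniformly_continuous_on (closure {a<..b}) g \<and> (\<forall>x\<in>{a<..b}. G x = g x)"
    by (rule uniformly_continuous_on_extension_on_closure) blast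
  then obtain g where g: "uniformly_continuous_on (closure {a<..b}) g" "\<forall>x\<in>{a<..b}. G x = g x" by blast
  have "(f has_integral (g b - g a)) {a..b}"
  proof (rule fundamental_theorem_of_calculus_interior)
    show "continuous_on {a..b} g" using uniformly_continuous_imp_continuous[OF g(1)] ab by simp
    fix x assume x: "x \<in> {a<..<b}"
    define m where "m = (a + x) / 2"
    have m: "a < m" "m < x" using x by (auto simp: m_def)
    have "((\<lambda>u. integral {u..b} f) has_vector_derivative - f x) (at x within {m..b})"
      using x m by (intro integral_has_vector_derivative' continuous_on_subset[OF c]) auto
    then have "((\<lambda>u. integral {u..b} f) has_vector_derivative - f x) (at x)"
      using x m by (simp add: at_within_Icc_at)
    from has_vector_derivative_minus[OF this]
    have "(G has_vector_derivative f x) (at x)" by (simp add: G_def)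
    then show "(g has_vector_derivative f x) (at x)"
      by (rule has_vector_derivative_transform_within_open[where S = "{a<..<b}"]) (use x g(2) in auto)
  qed (use ab in simp)
  then show ?thesis by blast
qed

lemma integrable_of_bounded_continuous_off_finite:
  fixes f :: "real \<Rightarrow> 'a::banach"
  assumes S: "finite S" and c: "continuous_on ({a<..<b} - S) f" and K: "\<forall>x\<in>{a<..<b} - S. norm (f x) \<le> K"
  shows "f integrable_on {a..b}"
  using assms
proof (induction S arbitrary: a b)
  case empty
  show ?case
  proof (cases "a < b")
    case False
    then show ?thesis using integrable_on_refl[of f a] by (cases "a = b") auto
  next
    case True
    define m where "m = (a + b) / 2"
    have m: "a < m" "m < b" using True by (auto simp: m_def)
    have l: "f integrable_on {a..m}"
      using m empty.prems by (intro integrable_of_bounded_continuous_half_open[of a m f K] continuous_on_subset[OF empty.prems(1)]) auto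
    have "(\<lambda>x. f (- x)) integrable_on {- b..- m}"
    proof (rule integrable_of_bounded_continuous_half_open[of _ _ _ K])
      show "continuous_on {- b<..- m} (\<lambda>x. f (- x))"
        using m by (intro continuous_on_compose2[OF empty.prems(1)] continuous_intros) auto
    qed (use m empty.prems in auto)
    then have "f integrable_on {m..b}" using Henstock_Kurzweil_Integration.integrable_reflect_real[of f b m] by simp
    then show ?thesis using m l by (intro Henstock_Kurzweil_Integration.integrable_combine[of a m b]) auto
  qed
next
  case (insert p F)
  show ?case
  proof (cases "p \<in> {a<..<b}")
    case True
    have "f integrable_on {a..p}"
    proof (rule insert.IH)
      show "continuous_on ({a<..<p} - F) f" using True by (intro continuous_on_subset[OF insert.prems(1)]) auto
      show "\<forall>x\<in>{a<..<p} - F. norm (f x) \<le> K" using True insert.prems(2) by auto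
    qed
    moreover have "f integrable_on {p..b}"
    proof (rule insert.IH)
      show "continuous_on ({p<..<b} - F) f" using True by (intro continuous_on_subset[OF insert.prems(1)]) auto
      show "\<forall>x\<in>{p<..<b} - F. norm (f x) \<le> K" using True insert.prems(2) by auto
    qed
    ultimately show ?thesis using True by (intro Henstock_Kurzweil_Integration.integrable_combine[of a p b]) auto
  next
    case False
    then have "{a<..<b} - insert p F = {a<..<b} - F" by auto
    then show ?thesis using insert.IH[of a b] insert.prems by metis
  qed
qed

lemma integrable_of_integrable_majorant:
  fixes g :: "real \<Rightarrow> 'a::banach"
  assumes g: "\<And>a b. g integrable_on {a..b}" and G: "G integrable_on (UNIV :: real set)"
    and le: "\<And>s. norm (g s) \<le> (G s :: real)"
  shows "g integrable_on UNIV"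
proof (rule integrable_alt_subset[THEN iffD2], intro conjI allI impI)
  show "(\<lambda>x. if x \<in> UNIV then g x else 0) integrable_on cbox a b" for a b using g by simp
  fix e :: real assume "0 < e"
  from integrable_alt_subset[of G UNIV, THEN iffD1, OF G, THEN conjunct2, rule_format, OF this]
  obtain B where B: "B > 0" "\<forall>a b c d. ball 0 B \<subseteq> cbox a b \<and> cbox a b \<subseteq> cbox c d \<longrightarrow>
      norm (integral (cbox a b) (\<lambda>x. if x \<in> UNIV then G x else 0) - integral (cbox c d) (\<lambda>x. if x \<in> UNIV then G x else 0)) < e"
    by (elim exE conjE) (rule that)
  show "\<exists>B>0. \<forall>a b c d. ball 0 B \<subseteq> cbox a b \<and> cbox a b \<subseteq> cbox c d \<longrightarrow>
      norm (integral (cbox a b) (\<lambda>x. if x \<in> UNIV then g x else 0) - integral (cbox c d) (\<lambda>x. if x \<in> UNIV then g x else 0)) < e"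
  proof (intro exI[of _ B] conjI B(1) allI impI)
    fix a b c d :: real assume h: "ball 0 B \<subseteq> cbox a b \<and> cbox a b \<subseteq> cbox c d"
    have "(0::real) \<in> cbox a b" using h B(1) centre_in_ball[of "0::real" B] by blast
    then have "a \<le> b" by simp
    then have o: "c \<le> a" "a \<le> b" "b \<le> d" using h by auto
    have Gi: "G integrable_on {x..y}" for x y using G by (rule integrable_on_subinterval) simp
    have comb: "integral {c..d} h = integral {c..a} h + integral {a..b} h + integral {b..d} h"
      if h: "\<And>x y. h integrable_on {x..y}" for h :: "real \<Rightarrow> 'b::banach"
    proof -
      have "integral {c..a} h + integral {a..b} h = integral {c..b} h" "integral {c..b} h + integral {b..d} h = integral {c..d} h"
        using o h by (intro Henstock_Kurzweil_Integration.integral_combine; simp)+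
      then show ?thesis by simp
    qed
    have n: "norm (integral {x..y} g) \<le> integral {x..y} G" for x y
      by (intro integral_norm_bound_integral g Gi le)
    have "norm (integral {a..b} g - integral {c..d} g) = norm (integral {c..a} g + integral {b..d} g)"
      unfolding comb[of g, OF g] by (subst norm_minus_commute) (simp add: algebra_simps)
    also have "\<dots> \<le> integral {c..a} G + integral {b..d} G"
      by (rule norm_triangle_le[OF add_mono[OF n n]])
    also have "\<dots> \<le> norm (integral {a..b} G - integral {c..d} G)"
      unfolding comb[of G, OF Gi] by simp
    also have "\<dots> < e" using B(2) h by simp
    finally show "norm (integral (cbox a b) (\<lambda>x. if x \<in> UNIV then g x else 0) - integral (cbox c d) (\<lambda>x. if x \<in> UNIV then g x else 0)) < e"
      by simp
  qed
qed

text \<open>The integral is a limit of Riemann sums.\<close>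

lemma integral_in_closed_subspace:
  fixes f :: "real \<Rightarrow> 'a::banach"
  assumes S: "subspace S" "closed S" and f: "\<And>x. f x \<in> S"
  shows "integral UNIV f \<in> S"
proof (cases "f integrable_on UNIV")
  case False
  then show ?thesis using subspace_0[OF S(1)] by (simp add: not_integrable_integral)
next
  case True
  have Icc: "integral (cbox a b) f \<in> S" for a b
  proof -
    have "f integrable_on cbox a b" using True by (rule integrable_on_subcbox) simp
    then have h: "(f has_integral integral (cbox a b) f) (cbox a b)" by blast
    have "\<exists>y\<in>S. dist y (integral (cbox a b) f) < e" if e: "e > 0" for e
    proof -
      obtain \<gamma> where \<gamma>: "gauge \<gamma>" "\<And>\<D>. \<D> tagged_division_of (cbox a b) \<Longrightarrow> \<gamma> fine \<D> \<Longrightarrow>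
          norm ((\<Sum>(x,k)\<in>\<D>. measure lborel k *\<^sub>R f x) - integral (cbox a b) f) < e"
        using has_integralD[OF h e] by metis
      obtain \<D> where \<D>: "\<D> tagged_division_of (cbox a b)" "\<gamma> fine \<D>"
        using fine_division_exists[OF \<gamma>(1)] by blast
      have "(\<Sum>(x,k)\<in>\<D>. measure lborel k *\<^sub>R f x) \<in> S"
        by (intro subspace_sum[OF S(1)]) (auto intro: subspace_scale[OF S(1)] f)
      then show ?thesis using \<gamma>(2)[OF \<D>] by (auto simp: dist_norm)
    qed
    then have "integral (cbox a b) f \<in> closure S" by (simp add: closure_approachable)
    then show ?thesis using S(2) by simp
  qed
  have "\<exists>y\<in>S. dist y (integral UNIV f) < e" if e: "e > 0" for e
  proof -
    have "(f has_integral integral UNIV f) UNIV" using True by blast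
    from has_integral_alt'[of f, THEN iffD1, OF this, THEN conjunct2, rule_format, OF e]
    obtain B where "\<forall>a b. ball 0 B \<subseteq> cbox a b \<longrightarrow>
        norm (integral (cbox a b) (\<lambda>x. if x \<in> UNIV then f x else 0) - integral UNIV f) < e"
      by (elim exE conjE) (rule that)
    then have "norm (integral (cbox (-B) B) f - integral UNIV f) < e"
      by (simp add: ball_eq_greaterThanLessThan greaterThanLessThan_subseteq_atLeastAtMost_iff)
    then show ?thesis using Icc by (auto simp: dist_norm)
  qed
  then have "integral UNIV f \<in> closure S" by (simp add: closure_approachable)
  then show ?thesis using S(2) by simp
qed


section \<open>Resolvents and the contour integral\<close>

lemma resolvent_works:
  assumes "z \<in> resolvent_set D T"
  shows "resolvent D T z v \<in> D" "z *\<^sub>C resolvent D T z v - T (resolvent D T z v) = v"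
proof -
  have v: "v \<in> (\<lambda>u. z *\<^sub>C u - T u) ` D" using assms unfolding resolvent_set_def bij_betw_def by blast
  show "resolvent D T z v \<in> D" unfolding resolvent_def by (rule inv_into_into[OF v])
  show "z *\<^sub>C resolvent D T z v - T (resolvent D T z v) = v" unfolding resolvent_def by (rule f_inv_into_f[OF v])
qed

lemma resolvent_bounded_linear: "z \<in> resolvent_set D T \<Longrightarrow> bounded_linear (resolvent D T z)"
  unfolding resolvent_set_def by blast

lemma resolvent_identity:
  assumes z: "z \<in> resolvent_set D T" "z0 \<in> resolvent_set D T"
  shows "resolvent D T z u - resolvent D T z0 u = resolvent D T z0 ((z0 - z) *\<^sub>C resolvent D T z u)"
proof -
  let ?v = "resolvent D T z u"
  have bl: "bounded_linear (resolvent D T z0)" by (rule resolvent_bounded_linear[OF z(2)])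
  have inj: "inj_on (\<lambda>u. z0 *\<^sub>C u - T u) D"
    using z(2) unfolding resolvent_set_def bij_betw_def by blast
  let ?w = "resolvent D T z0 (u + (z0 - z) *\<^sub>C ?v)"
  have sp: "z0 *\<^sub>C ?v = z *\<^sub>C ?v + (z0 - z) *\<^sub>C ?v" using scaleC_add_left[of z "z0 - z" ?v] by simp
  have "z0 *\<^sub>C ?v - T ?v = (z *\<^sub>C ?v - T ?v) + (z0 - z) *\<^sub>C ?v" unfolding sp by (simp only: diff_add_eq)
  also have "\<dots> = u + (z0 - z) *\<^sub>C ?v" by (simp only: resolvent_works(2)[OF z(1)])
  also have "\<dots> = z0 *\<^sub>C ?w - T ?w" by (simp only: resolvent_works(2)[OF z(2)])
  finally have "?v = ?w" by (rule inj_onD[OF inj _ resolvent_works(1)[OF z(1)] resolvent_works(1)[OF z(2)]])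
  also have "\<dots> = resolvent D T z0 u + resolvent D T z0 ((z0 - z) *\<^sub>C ?v)"
    by (rule linear_add[OF bounded_linear.linear[OF bl]])
  also have "\<dots> = resolvent D T z0 ((z0 - z) *\<^sub>C ?v) + resolvent D T z0 u" by (rule add.commute)
  finally show ?thesis by (rule diff_eq_eq[THEN iffD2])
qed

text \<open>Close to \<open>z0\<close> the resolvent identity first bounds \<open>resolvent D T z u\<close> by twice its value at \<open>z0\<close>, and
  with this bound the right-hand side of the identity tends to zero.\<close>

lemma continuous_on_resolvent:
  "continuous_on (resolvent_set D T) (\<lambda>z. resolvent D T z u)"
  unfolding continuous_on_def
proof
  fix z0 assume z0: "z0 \<in> resolvent_set D T"
  let ?R = "\<lambda>z. resolvent D T z u"
  have "bounded_linear (resolvent D T z0)" by (rule resolvent_bounded_linear[OF z0])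
  then obtain C where C: "C > 0" "\<And>x. norm (resolvent D T z0 x) \<le> norm x * C"
    using bounded_linear.pos_bounded by blast
  have est: "norm (?R z - ?R z0) \<le> cmod (z0 - z) * C * norm (?R z)" if "z \<in> resolvent_set D T" for z
    using C(2)[of "(z0 - z) *\<^sub>C ?R z"] unfolding resolvent_identity[OF that z0] by (simp add: norm_scaleC mult_ac)
  have ev: "\<forall>\<^sub>F z in at z0 within resolvent_set D T. norm (?R z - ?R z0) \<le> cmod (z0 - z) * C * (2 * norm (?R z0))"
    unfolding eventually_at
  proof (intro exI[of _ "1 / (2 * C)"] conjI ballI impI)
    show "0 < 1 / (2 * C)" using C(1) by simp
    fix z assume z: "z \<in> resolvent_set D T" "z \<noteq> z0 \<and> dist z z0 < 1 / (2 * C)"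
    have "cmod (z0 - z) * C < 1 / 2"
    proof -
      have "dist z z0 * (2 * C) < 1" using z(2) C(1) by (subst (asm) pos_less_divide_eq) auto
      then show ?thesis unfolding dist_norm norm_minus_commute[of z z0] by linarith
    qed
    then have "cmod (z0 - z) * C * norm (?R z) \<le> 1 / 2 * norm (?R z)" by (intro mult_right_mono) auto
    then have "norm (?R z) \<le> 2 * norm (?R z0)"
      using est[OF z(1)] norm_triangle_sub[of "?R z" "?R z0"] by linarith
    then have "cmod (z0 - z) * C * norm (?R z) \<le> cmod (z0 - z) * C * (2 * norm (?R z0))"
      using C(1) by (intro mult_left_mono) auto
    then show "norm (?R z - ?R z0) \<le> cmod (z0 - z) * C * (2 * norm (?R z0))" using est[OF z(1)] by linarith
  qed
  have "((\<lambda>z. cmod (z0 - z) * C * (2 * norm (?R z0))) \<longlongrightarrow> cmod (z0 - z0) * C * (2 * norm (?R z0))) (at z0 within resolvent_set D T)"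
    by (intro tendsto_intros)
  then have "((\<lambda>z. cmod (z0 - z) * C * (2 * norm (?R z0))) \<longlongrightarrow> 0) (at z0 within resolvent_set D T)" by simp
  from Lim_null_comparison[OF ev this]
  have "((\<lambda>z. ?R z - ?R z0) \<longlongrightarrow> 0) (at z0 within resolvent_set D T)" .
  then show "(?R \<longlongrightarrow> ?R z0) (at z0 within resolvent_set D T)" by (simp add: LIM_zero_iff)
qed

text \<open>After division by \<open>s\<close> the number tends to \<open>- cis \<theta>\<close>, whose argument has modulus \<open>\<pi> - \<bar>\<theta>\<bar> > \<phi>\<close>.\<close>

lemma ray_in_sector:
  assumes \<theta>: "pi / 2 < \<bar>\<theta>\<bar>" "\<bar>\<theta>\<bar> < pi - \<phi>" and \<phi>: "0 < \<phi>"
  shows "\<forall>\<^sub>F s in at_top. - (a + of_real s * cis \<theta>) \<in> sector \<omega> \<phi> \<and> 1 \<le> cmod (- (a + of_real s * cis \<theta>) - of_real \<omega>)"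
proof -
  define b where "b = - (a + of_real \<omega>)"
  define w where "w = (\<lambda>s::real. b - of_real s * cis \<theta>)"
  have w: "- (a + of_real s * cis \<theta>) - of_real \<omega> = w s" for s by (simp add: w_def b_def)
  define \<alpha> where "\<alpha> = (if 0 < \<theta> then \<theta> - pi else \<theta> + pi)"
  have \<alpha>: "- cis \<theta> = cis \<alpha>" "\<bar>\<alpha>\<bar> = pi - \<bar>\<theta>\<bar>" "- pi < \<alpha>" "\<alpha> < pi"
  proof -
    show "- cis \<theta> = cis \<alpha>" by (simp add: \<alpha>_def complex_eq_iff)
    have "\<bar>\<theta>\<bar> < pi" using \<theta>(2) \<phi> by simp
    then show "\<bar>\<alpha>\<bar> = pi - \<bar>\<theta>\<bar>" "- pi < \<alpha>" "\<alpha> < pi" using \<theta>(1) pi_gt_zero by (auto simp: \<alpha>_def)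
  qed
  have Arg\<alpha>: "Arg (cis \<alpha>) = \<alpha>" using \<alpha> by (intro Arg_cis) auto
  have "sin \<alpha> \<noteq> 0"
  proof
    assume "sin \<alpha> = 0"
    then have "\<alpha> = 0" using \<alpha> sin_eq_0_pi by blast
    then show False using \<alpha>(2) \<theta>(2) \<phi> by simp
  qed
  then have nr: "cis \<alpha> \<notin> \<real>\<^sub>\<le>\<^sub>0" by (auto simp: complex_nonpos_Reals_iff)
  have "((\<lambda>s. b / of_real s + cis \<alpha>) \<longlongrightarrow> 0 + cis \<alpha>) at_top"
    by (intro tendsto_add tendsto_const tendsto_divide_0[OF tendsto_const]
        filterlim_of_real_at_infinity)
  then have "((\<lambda>s. Arg (b / of_real s + cis \<alpha>)) \<longlongrightarrow> Arg (cis \<alpha>)) at_top"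
    using isCont_tendsto_compose[OF continuous_at_Arg[OF nr]] by simp
  then have "((\<lambda>s. \<bar>Arg (b / of_real s + cis \<alpha>)\<bar>) \<longlongrightarrow> pi - \<bar>\<theta>\<bar>) at_top"
    unfolding Arg\<alpha> \<alpha>(2)[symmetric] by (rule tendsto_rabs)
  then have "\<forall>\<^sub>F s in at_top. \<phi> < \<bar>Arg (b / of_real s + cis \<alpha>)\<bar>"
    by (rule order_tendstoD) (use \<theta>(2) in simp)
  then show ?thesis
    using eventually_ge_at_top[of "1 + cmod b"]
  proof eventually_elim
    case (elim s)
    have s: "s > 0" using elim(2) norm_ge_zero[of b] by linarith
    have "w s = of_real s * (b / of_real s + cis \<alpha>)" using s by (simp add: w_def \<alpha>(1)[symmetric] algebra_simps)
    then have A: "Arg (w s) = Arg (b / of_real s + cis \<alpha>)" using s by simp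
    have "cmod (of_real s * cis \<theta>) \<le> cmod b + cmod (w s)"
      unfolding w_def using norm_triangle_sub[of "of_real s * cis \<theta>" b] by (simp add: norm_minus_commute)
    then have n: "1 \<le> cmod (w s)" using elim(2) s by (simp add: norm_mult)
    have "w s \<noteq> 0" using n by auto
    then show ?case unfolding sector_def using elim(1) A n Arg_bounded[of "w s"]
      by (auto simp: w[symmetric])
  qed
qed

lemma exp_minus_le_inverse_square:
  assumes c: "0 < (c::real)" and s: "0 \<le> s"
  shows "exp (- c * s) \<le> (1 + 2 / c\<^sup>2) * inverse (1 + s\<^sup>2)"
proof -
  have "1 + c * s + (c * s)\<^sup>2 / 2 \<le> exp (c * s)" using c s by (intro exp_lower_Taylor_quadratic) simp
  moreover have "0 \<le> c * s" using c s by simp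
  ultimately have e: "1 + (c * s)\<^sup>2 / 2 \<le> exp (c * s)" by simp
  have "1 + s\<^sup>2 \<le> (1 + 2 / c\<^sup>2) * (1 + (c * s)\<^sup>2 / 2)"
  proof -
    have "(1 + 2 / c\<^sup>2) * (1 + (c * s)\<^sup>2 / 2) = 1 + s\<^sup>2 + (2 / c\<^sup>2 + (c * s)\<^sup>2 / 2)"
      using c by (simp add: power_mult_distrib field_simps)
    then show ?thesis by simp
  qed
  also have "\<dots> \<le> (1 + 2 / c\<^sup>2) * exp (c * s)" by (intro mult_left_mono e) simp
  finally have "1 + s\<^sup>2 \<le> (1 + 2 / c\<^sup>2) * exp (c * s)" .
  moreover have Q: "0 < 1 + s\<^sup>2" by (simp add: add_pos_nonneg)
  ultimately have "(1 + s\<^sup>2) / exp (c * s) \<le> 1 + 2 / c\<^sup>2" by (simp only: pos_divide_le_eq[OF exp_gt_zero])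
  then have "(1 + s\<^sup>2) * exp (- c * s) \<le> 1 + 2 / c\<^sup>2" by (simp only: divide_inverse exp_minus mult_minus_left)
  then have "exp (- c * s) \<le> (1 + 2 / c\<^sup>2) / (1 + s\<^sup>2)" by (simp only: pos_le_divide_eq[OF Q] mult.commute)
  then show ?thesis by (simp only: divide_inverse)
qed

lemma bounded_bilinear_scaleC:
  "bounded_bilinear (\<lambda>c (x::'a::complex_normed_vector). c *\<^sub>C x)"
proof (rule bounded_bilinear.intro)
  fix a a' :: complex and b b' :: 'a and r :: real
  show "(a + a') *\<^sub>C b = a *\<^sub>C b + a' *\<^sub>C b" by (rule scaleC_add_left)
  show "a *\<^sub>C (b + b') = a *\<^sub>C b + a *\<^sub>C b'" by (rule scaleC_add_right)
  show "(r *\<^sub>R a) *\<^sub>C b = r *\<^sub>R a *\<^sub>C b"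
    by (simp add: scaleR_conv_of_real scaleC_scaleC flip: scaleC_of_real)
  show "a *\<^sub>C (r *\<^sub>R b) = r *\<^sub>R a *\<^sub>C b"
    by (simp add: scaleC_scaleC mult.commute flip: scaleC_of_real)
  show "\<exists>K. \<forall>a (b::'a). norm (a *\<^sub>C b) \<le> norm a * norm b * K"
    by (rule exI[of _ 1]) (simp add: norm_scaleC)
qed

lemma resolvent_bound_on_sector:
  assumes est: "resolvent_estimates D T \<omega> \<phi> M" and z: "- z \<in> sector \<omega> \<phi>" "1 \<le> cmod (- z - of_real \<omega>)"
  shows "norm (resolvent D (\<lambda>u. - T u) z u) \<le> M * norm u"
proof -
  have M: "0 < M" and rs: "- z \<in> resolvent_set D T" and on: "onorm (resolvent D T (- z)) \<le> M / cmod (- z - of_real \<omega>)"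
    using est z(1) by (auto simp: resolvent_estimates_def)
  have "norm (resolvent D (\<lambda>u. - T u) z u) = norm (resolvent D T (- z) u)"
    using resolvent_uminus(2)[OF rs, of u] by simp
  also have "\<dots> \<le> onorm (resolvent D T (- z)) * norm u"
    by (intro onorm resolvent_bounded_linear rs)
  also have "\<dots> \<le> M * norm u"
  proof (rule mult_right_mono)
    have "M / cmod (- z - of_real \<omega>) \<le> M / 1" using M z(2) by (intro divide_left_mono) auto
    then show "onorm (resolvent D T (- z)) \<le> M" using on by simp
  qed simp
  finally show ?thesis .
qed

text \<open>On the ray the exponential decays because \<open>cos \<theta> < 0\<close>, and the resolvent stays bounded. The bound
  \<open>inverse (1 + s\<^sup>2)\<close> is convenient because it is a single integrable function on the whole line.\<close>

lemma semigroup_integrand_tail: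
  fixes T :: "'a::{complex_normed_vector, banach} \<Rightarrow> 'a"
  assumes est: "resolvent_estimates D T \<omega> \<phi> M" and \<theta>: "pi / 2 < \<bar>\<theta>\<bar>" "\<bar>\<theta>\<bar> < pi - \<phi>" and t: "0 < t"
  shows "\<exists>C R. 0 \<le> C \<and> (\<forall>s\<ge>R. norm (exp ((a + of_real s * cis \<theta>) * of_real t))
            * norm (resolvent D (\<lambda>u. - T u) (a + of_real s * cis \<theta>) u) \<le> C * inverse (1 + s\<^sup>2))"
proof -
  have \<phi>: "0 < \<phi>" and M: "0 < M" using est by (auto simp: resolvent_estimates_def)
  obtain R where R: "\<forall>s\<ge>R. - (a + of_real s * cis \<theta>) \<in> sector \<omega> \<phi> \<and> 1 \<le> cmod (- (a + of_real s * cis \<theta>) - of_real \<omega>)"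
    using ray_in_sector[OF \<theta> \<phi>, of a \<omega>] unfolding eventually_at_top_linorder by blast
  define c where "c = - cos \<theta> * t"
  have "cos \<bar>\<theta>\<bar> < 0"
  proof -
    have "cos \<bar>\<theta>\<bar> < cos (pi / 2)" using \<theta> \<phi> by (intro cos_monotone_0_pi) auto
    then show ?thesis by simp
  qed
  then have c: "0 < c" unfolding c_def using t by (simp add: mult_neg_pos)
  define C where "C = exp (Re a * t) * (1 + 2 / c\<^sup>2) * (M * norm u)"
  have "norm (exp ((a + of_real s * cis \<theta>) * of_real t)) * norm (resolvent D (\<lambda>u. - T u) (a + of_real s * cis \<theta>) u)
      \<le> C * inverse (1 + s\<^sup>2)" if s: "max 0 R \<le> s" for s
  proof -
    have "norm (exp ((a + of_real s * cis \<theta>) * of_real t)) = exp (Re a * t) * exp (- c * s)"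
      by (simp add: c_def exp_add[symmetric] algebra_simps)
    also have "\<dots> \<le> exp (Re a * t) * ((1 + 2 / c\<^sup>2) * inverse (1 + s\<^sup>2))"
      using exp_minus_le_inverse_square[OF c, of s] s by (intro mult_left_mono) auto
    finally have e: "norm (exp ((a + of_real s * cis \<theta>) * of_real t)) \<le> exp (Re a * t) * ((1 + 2 / c\<^sup>2) * inverse (1 + s\<^sup>2))" .
    have "norm (resolvent D (\<lambda>u. - T u) (a + of_real s * cis \<theta>) u) \<le> M * norm u"
      using R s by (intro resolvent_bound_on_sector[OF est]) auto
    from mult_mono[OF e this] show ?thesis by (simp add: C_def mult_ac)
  qed
  moreover have "0 \<le> C" using M by (simp add: C_def)
  ultimately show ?thesis by blast
qed

lemma semigroup_integrand_integrable:
  fixes T :: "'a::{complex_normed_vector, banach} \<Rightarrow> 'a"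
  assumes est: "resolvent_estimates D T \<omega> \<phi> M" and \<Gamma>: "semigroup_contour D T \<omega> \<phi> \<Gamma>" and t: "0 < t"
  shows "semigroup_integrand \<Gamma> D T t u integrable_on UNIV"
proof -
  let ?R = "\<lambda>s. resolvent D (\<lambda>u. - T u) (\<Gamma> s) u" and ?\<Gamma>' = "\<lambda>s. vector_derivative \<Gamma> (at s)"
  let ?g = "semigroup_integrand \<Gamma> D T t u"
  have pw: "\<And>r. \<Gamma> piecewise_C1_differentiable_on {-r..r}"
    and rs: "range \<Gamma> \<subseteq> resolvent_set D (\<lambda>u. - T u)" and bd: "bounded (range ?\<Gamma>')"
    using \<Gamma> by (auto simp: semigroup_contour_def)
  obtain K where K: "0 < K" "\<And>s. norm (?\<Gamma>' s) \<le> K" using bd unfolding bounded_pos by blast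
  define h where "h = (\<lambda>s. norm (exp (\<Gamma> s * of_real t)) * norm (?R s))"
  have gh: "norm (?g s) \<le> K * h s" for s
  proof -
    have "norm (?g s) = norm (?\<Gamma>' s) * h s" by (simp add: semigroup_integrand_def h_def norm_scaleC norm_mult mult_ac)
    also have "\<dots> \<le> K * h s" by (intro mult_right_mono K) (simp add: h_def)
    finally show ?thesis .
  qed
  have c\<Gamma>: "continuous_on {-r..r} \<Gamma>" for r using pw[of r] by (simp add: piecewise_C1_differentiable_on_def)
  have cR: "continuous_on {-r..r} ?R" for r
    using rs by (intro continuous_on_compose2[OF continuous_on_resolvent c\<Gamma>]) auto
  have ch: "continuous_on {-r..r} h" for r
    unfolding h_def by (intro continuous_intros cR c\<Gamma>)
  have bdd: "\<exists>C. \<forall>s\<in>{-r..r}. h s \<le> C" for r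
  proof -
    have "bounded (h ` {-r..r})" by (intro compact_imp_bounded compact_continuous_image ch compact_Icc)
    then obtain C where "\<forall>x\<in>h ` {-r..r}. norm x \<le> C" unfolding bounded_iff by blast
    then have "\<forall>s\<in>{-r..r}. h s \<le> C" by (auto intro: order_trans[OF abs_ge_self])
    then show ?thesis ..
  qed
  have int_r: "?g integrable_on {-r..r}" for r
  proof -
    obtain S where S: "finite S" "\<Gamma> C1_differentiable_on ({-r..r} - S)"
      using pw[of r] by (auto simp: piecewise_C1_differentiable_on_def)
    obtain C where C: "\<forall>s\<in>{-r..r}. h s \<le> C" using bdd by blast
    show ?thesis
    proof (rule integrable_of_bounded_continuous_off_finite[OF S(1)])
      have "continuous_on ({-r<..<r} - S) ?\<Gamma>'"
        using S(2) unfolding C1_differentiable_on_eq by (auto intro: continuous_on_subset)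
      moreover have "continuous_on ({-r<..<r} - S) \<Gamma>" "continuous_on ({-r<..<r} - S) ?R"
        by (rule continuous_on_subset[OF c\<Gamma>[of r]] continuous_on_subset[OF cR[of r]], auto)+
      ultimately show "continuous_on ({-r<..<r} - S) ?g"
        unfolding semigroup_integrand_def
        by (intro bounded_bilinear.continuous_on[OF bounded_bilinear_scaleC] continuous_intros)
      show "\<forall>s\<in>{-r<..<r} - S. norm (?g s) \<le> K * C"
      proof
        fix s assume "s \<in> {-r<..<r} - S"
        then have "K * h s \<le> K * C" using C K(1) by (intro mult_left_mono) auto
        then show "norm (?g s) \<le> K * C" using gh[of s] by simp
      qed
    qed
  qed
  obtain \<psi> a b r0 where \<psi>: "pi / 2 < \<psi>" "\<psi> < pi - \<phi>"
    and rays: "\<forall>s\<ge>r0. \<Gamma> s = a + of_real s * cis \<psi> \<and> \<Gamma> (- s) = b + of_real s * cis (- \<psi>)"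
    using \<Gamma> unfolding semigroup_contour_def by blast
  have th: "pi / 2 < \<bar>\<psi>\<bar>" "\<bar>\<psi>\<bar> < pi - \<phi>" "pi / 2 < \<bar>- \<psi>\<bar>" "\<bar>- \<psi>\<bar> < pi - \<phi>"
    using \<psi> pi_gt_zero by linarith+
  obtain C1 R1 where 1: "0 \<le> C1" "\<forall>s\<ge>R1. norm (exp ((a + of_real s * cis \<psi>) * of_real t))
            * norm (resolvent D (\<lambda>u. - T u) (a + of_real s * cis \<psi>) u) \<le> C1 * inverse (1 + s\<^sup>2)"
    using semigroup_integrand_tail[OF est th(1,2) t, of a u] by blast
  obtain C2 R2 where 2: "0 \<le> C2" "\<forall>s\<ge>R2. norm (exp ((b + of_real s * cis (- \<psi>)) * of_real t))
            * norm (resolvent D (\<lambda>u. - T u) (b + of_real s * cis (- \<psi>)) u) \<le> C2 * inverse (1 + s\<^sup>2)"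
    using semigroup_integrand_tail[OF est th(3,4) t, of b u] by blast
  define r where "r = max r0 (max R1 R2)"
  obtain C3 where 3: "\<forall>s\<in>{-r..r}. h s \<le> C3" using bdd by blast
  define C where "C = C1 + C2 + \<bar>C3\<bar> * (1 + r\<^sup>2)"
  have hC: "h s \<le> C * inverse (1 + s\<^sup>2)" for s
  proof -
    have q: "0 < inverse (1 + s\<^sup>2)" by (simp add: add_pos_nonneg)
    consider "r \<le> s" | "r \<le> - s" | "\<bar>s\<bar> \<le> r" by linarith
    then show ?thesis
    proof cases
      case 1
      then have "h s \<le> C1 * inverse (1 + s\<^sup>2)"
        using rays \<open>\<forall>s\<ge>R1. _\<close> by (simp add: h_def r_def)
      also have "\<dots> \<le> C * inverse (1 + s\<^sup>2)"
        using q \<open>0 \<le> C2\<close> by (intro mult_right_mono) (auto simp: C_def)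
      finally show ?thesis .
    next
      case 2
      define s' where "s' = - s"
      have s': "s = - s'" "r \<le> s'" using 2 by (auto simp: s'_def)
      then have "h s \<le> C2 * inverse (1 + s\<^sup>2)"
        using rays \<open>\<forall>s\<ge>R2. _\<close> by (simp add: h_def r_def)
      also have "\<dots> \<le> C * inverse (1 + s\<^sup>2)"
        using q \<open>0 \<le> C1\<close> by (intro mult_right_mono) (auto simp: C_def)
      finally show ?thesis .
    next
      case 3
      then have "s \<in> {-r..r}" by (simp add: abs_le_iff)
      then have "h s \<le> \<bar>C3\<bar>" using \<open>\<forall>s\<in>{-r..r}. _\<close> order_trans[OF _ abs_ge_self] by blast
      also have "\<bar>C3\<bar> * 1 \<le> \<bar>C3\<bar> * ((1 + r\<^sup>2) * inverse (1 + s\<^sup>2))"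
      proof (rule mult_left_mono)
        have "s\<^sup>2 \<le> r\<^sup>2" using 3 by (rule abs_le_square_iff[THEN iffD1, OF order_trans[OF _ abs_ge_self]])
        then show "1 \<le> (1 + r\<^sup>2) * inverse (1 + s\<^sup>2)" using q by (simp add: field_simps)
      qed simp
      also have "\<dots> \<le> C * inverse (1 + s\<^sup>2)"
        unfolding mult.assoc[symmetric] using q \<open>0 \<le> C1\<close> \<open>0 \<le> C2\<close> by (intro mult_right_mono) (auto simp: C_def)
      finally show ?thesis by simp
    qed
  qed
  show ?thesis
  proof (rule integrable_of_integrable_majorant)
    fix x y :: real
    show "?g integrable_on {x..y}"
      by (rule integrable_subinterval_real[OF int_r[of "max \<bar>x\<bar> \<bar>y\<bar>"]]) auto
  next
    have "integrable lborel (\<lambda>x::real. inverse (1 + x\<^sup>2))"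
      using integrable_inverse_1_plus_square by (simp add: set_integrable_def einterval_def)
    then show "(\<lambda>s. K * (C * inverse (1 + s\<^sup>2))) integrable_on UNIV"
      by (intro integrable_on_lborel integrable_mult_right)
    show "norm (?g s) \<le> K * (C * inverse (1 + s\<^sup>2))" for s
      using gh[of s] mult_left_mono[OF hC[of s], of K] K(1) by linarith
  qed
qed

text \<open>The resolvent maps into the domain, so the integrand takes its values there, and the
  closure of the domain is a closed subspace.\<close>

lemma contour_semigroup_in_closure:
  fixes T :: "'a::{complex_normed_vector, banach} \<Rightarrow> 'a"
  assumes lin: "linear_operator scaleC D T" and \<Gamma>: "semigroup_contour D T \<omega> \<phi> \<Gamma>" and t: "t \<noteq> 0"
  shows "contour_semigroup \<Gamma> D T t u \<in> closure D"
proof -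
  have cl: "c *\<^sub>C x \<in> closure D" if "x \<in> closure D" for c x
  proof -
    have "(\<lambda>x. c *\<^sub>C x) ` D \<subseteq> D" using lin by (auto simp: linear_operator_def)
    then have "closure ((\<lambda>x. c *\<^sub>C x) ` D) \<subseteq> closure D" by (rule closure_mono)
    moreover have "c *\<^sub>C x \<in> (\<lambda>x. c *\<^sub>C x) ` closure D" using that by blast
    ultimately show ?thesis
      using closure_bounded_linear_image_subset[OF bounded_linear_scaleC, of c D] by blast
  qed
  have S: "subspace (closure D)"
    unfolding subspace_def
  proof (intro conjI ballI allI)
    show "0 \<in> closure D" using lin closure_subset[of D] by (auto simp: linear_operator_def)
    show "r *\<^sub>R x \<in> closure D" if "x \<in> closure D" for r x
      using cl[OF that, of "of_real r"] by (simp only: scaleC_of_real)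
    fix x y assume "x \<in> closure D" "y \<in> closure D"
    then obtain X Y where X: "\<forall>n. X n \<in> D" "X \<longlonglongrightarrow> x" and Y: "\<forall>n. Y n \<in> D" "Y \<longlonglongrightarrow> y"
      unfolding closure_sequential by blast
    have "\<forall>n. X n + Y n \<in> D" using X(1) Y(1) lin by (simp add: linear_operator_def)
    moreover have "(\<lambda>n. X n + Y n) \<longlonglongrightarrow> x + y" by (intro tendsto_add X Y)
    ultimately show "x + y \<in> closure D" unfolding closure_sequential
      by (intro exI[of _ "\<lambda>n. X n + Y n"]) simp
  qed
  have "semigroup_integrand \<Gamma> D T t u s \<in> closure D" for s
  proof -
    have "\<Gamma> s \<in> resolvent_set D (\<lambda>u. - T u)" using \<Gamma> by (auto simp: semigroup_contour_def)
    then have "resolvent D (\<lambda>u. - T u) (\<Gamma> s) u \<in> closure D"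
      using resolvent_works(1) closure_subset by blast
    then show ?thesis unfolding semigroup_integrand_def by (rule cl)
  qed
  from integral_in_closed_subspace[OF S closed_closure this]
  show ?thesis using t by (simp add: contour_semigroup_def cl)
qed

lemma contour_semigroup_not_continuous:
  fixes T :: "'a::{complex_normed_vector, banach} \<Rightarrow> 'a"
  assumes lin: "linear_operator scaleC D T" and \<Gamma>: "semigroup_contour D T \<omega> \<phi> \<Gamma>" and u: "u \<notin> closure D"
  shows "\<not> ((\<lambda>t. contour_semigroup \<Gamma> D T t u) \<longlongrightarrow> u) (at_right 0)"
proof
  assume lim: "((\<lambda>t. contour_semigroup \<Gamma> D T t u) \<longlongrightarrow> u) (at_right 0)"
  have "\<forall>\<^sub>F t in at_right (0::real). contour_semigroup \<Gamma> D T t u \<in> closure D"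
    using eventually_at_right_less[of "0::real"]
    by eventually_elim (rule contour_semigroup_in_closure[OF lin \<Gamma>], simp)
  from Lim_in_closed_set[OF closed_closure this trivial_limit_at_right_real lim] u
  show False by simp
qed


section \<open>Real Hilbert spaces\<close>

lemma bounded_linear_re_part: "bounded_linear (re_part :: 'a::real_inner complexified \<Rightarrow> 'a)"
  and bounded_linear_Complexify: "bounded_linear (\<lambda>y::'a::real_inner. Complexify y 0)"
proof -
  show "bounded_linear (re_part :: 'a complexified \<Rightarrow> 'a)"
    by (rule bounded_linear_intro[where K = 1]) (simp_all add: complexified_defs norm_complexified_eq norm_fst_le)
  show "bounded_linear (\<lambda>y::'a. Complexify y 0)"
    by (rule bounded_linear_intro[where K = 1]) (simp_all add: complexified_defs norm_complexified_eq)
qed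

context positive_operator
begin

lemma complexified_linear: "linear_operator scaleC (complexify_dom D) (complexify_op B)"
  unfolding linear_operator_def
proof (intro conjI ballI allI)
  show "0 \<in> complexify_dom D" by (simp add: complexify_dom_def complexified_defs zero_dom)
  fix z assume z: "z \<in> complexify_dom D"
  then have zD: "re_part z \<in> D" "im_part z \<in> D" by (simp_all add: complexify_dom_def)
  show "c *\<^sub>C z \<in> complexify_dom D" for c
    using zD by (simp add: complexify_dom_def complexified_defs dom_add dom_diff dom_scaleR)
  show "complexify_op B (c *\<^sub>C z) = c *\<^sub>C complexify_op B z" for c
    using zD by (simp add: complexify_op_def complexified_defs B_add B_diff B_scaleR dom_scaleR)
  fix w assume "w \<in> complexify_dom D"
  then have wD: "re_part w \<in> D" "im_part w \<in> D" by (simp_all add: complexify_dom_def)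
  show "z + w \<in> complexify_dom D" using zD wD by (simp add: complexify_dom_def complexified_defs dom_add)
  show "complexify_op B (z + w) = complexify_op B z + complexify_op B w"
    using zD wD by (simp add: complexify_op_def complexified_defs B_add)
qed

text \<open>Testing the adjoint relation with real vectors separates its real and imaginary parts.\<close>

lemma complexified_positive_self_adjoint:
  "positive_self_adjoint scaleC cinner (complexify_dom D) (complexify_op B)"
  unfolding positive_self_adjoint_def
proof (intro conjI ballI complexified_linear)
  have "z \<in> closure (complexify_dom D)" for z :: "'a complexified"
    unfolding closure_approachable
  proof (intro allI impI)
    fix e :: real assume e: "0 < e"
    have "\<forall>y. \<exists>x\<in>D. dist x y < e / 2"
      using dense e closure_approachable[of _ D] by (metis UNIV_I half_gt_zero)
    then obtain x y where x: "x \<in> D" "dist x (re_part z) < e / 2" and y: "y \<in> D" "dist y (im_part z) < e / 2" by blast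
    have "dist (Complexify x y) z \<le> norm (x - re_part z) + norm (y - im_part z)"
      unfolding dist_norm norm_complexified_eq
      by (simp add: complexified_defs norm_Pair sqrt_sum_squares_le_sum)
    then have "dist (Complexify x y) z < e" using x(2) y(2) by (simp add: dist_norm)
    moreover have "Complexify x y \<in> complexify_dom D" using x y by (simp add: complexify_dom_def)
    ultimately show "\<exists>w\<in>complexify_dom D. dist w z < e" by blast
  qed
  then show "closure (complexify_dom D) = UNIV" by blast
  show "adjoint_graph cinner (complexify_dom D) (complexify_op B) = operator_graph (complexify_dom D) (complexify_op B)"
  proof (intro equalityI subsetI)
    fix p assume "p \<in> adjoint_graph cinner (complexify_dom D) (complexify_op B)"
    then obtain v w where p: "p = (v, w)" and h: "\<forall>u\<in>complexify_dom D. cinner (complexify_op B u) v = cinner u w"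
      unfolding adjoint_graph_def by blast
    have "inner (B a) (re_part v) = inner a (re_part w) \<and> inner (B a) (im_part v) = inner a (im_part w)" if a: "a \<in> D" for a
    proof -
      have "Complexify a 0 \<in> complexify_dom D" using a zero_dom by (simp add: complexify_dom_def)
      then have "cinner (complexify_op B (Complexify a 0)) v = cinner (Complexify a 0) w" using h by blast
      then show ?thesis by (simp add: complexify_op_def complexified_defs B_zero)
    qed
    then have "re_part v \<in> D \<and> B (re_part v) = re_part w" "im_part v \<in> D \<and> B (im_part v) = im_part w"
      unfolding in_graph_iff by blast+
    then show "p \<in> operator_graph (complexify_dom D) (complexify_op B)"
      unfolding operator_graph_def p by (auto simp: complexify_dom_def complexify_op_def intro!: exI[of _ v] complexified_eqI)
  next
    fix p assume "p \<in> operator_graph (complexify_dom D) (complexify_op B)"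
    then show "p \<in> adjoint_graph cinner (complexify_dom D) (complexify_op B)"
      by (auto simp: operator_graph_def adjoint_graph_def complexify_dom_def complexify_op_def complexified_defs symmetric)
  qed
  fix z assume "z \<in> complexify_dom D"
  then have zD: "re_part z \<in> D" "im_part z \<in> D" by (simp_all add: complexify_dom_def)
  show "cinner (complexify_op B z) z \<in> \<real>\<^sub>\<ge>\<^sub>0"
    using positive[OF zD(1)] positive[OF zD(2)] symmetric[OF zD]
    by (simp add: complex_nonneg_Reals_iff complexify_op_def complexified_defs inner_commute)
qed

end

lemma weak_derivative_linear:
  assumes T: "bounded_linear T" and f: "locally_integrable f" "locally_integrable g" and d: "weak_derivative k f g"
  shows "weak_derivative k (\<lambda>x. T (f x)) (\<lambda>x. T (g x))"
  unfolding weak_derivative_def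
proof (intro allI impI)
  fix \<theta> assume \<theta>: "test_function \<theta>"
  interpret bounded_linear T by (rule T)
  have "(LINT x|lborel. (deriv ^^ k) \<theta> x *\<^sub>R T (f x)) = (LINT x|lborel. T ((deriv ^^ k) \<theta> x *\<^sub>R f x))" by (simp add: scaleR)
  also have "\<dots> = T (LINT x|lborel. (deriv ^^ k) \<theta> x *\<^sub>R f x)"
    by (rule integral_bounded_linear[OF T test_function_integrable[OF \<theta> f(1)]])
  also have "\<dots> = T ((- 1) ^ k *\<^sub>R (LINT x|lborel. \<theta> x *\<^sub>R g x))" using d \<theta> by (simp add: weak_derivative_def)
  also have "\<dots> = (- 1) ^ k *\<^sub>R T (LINT x|lborel. \<theta> x *\<^sub>R g x)" by (rule scaleR)
  also have "T (LINT x|lborel. \<theta> x *\<^sub>R g x) = (LINT x|lborel. T (\<theta> x *\<^sub>R g x))"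
    using integral_bounded_linear[OF T test_function_integrable[OF \<theta> f(2), of 0]] by simp
  finally show "(LINT x|lborel. (deriv ^^ k) \<theta> x *\<^sub>R T (f x)) = (- 1) ^ k *\<^sub>R (LINT x|lborel. \<theta> x *\<^sub>R T (g x))"
    by (simp add: scaleR)
qed

lemma L2_ul_Complexify:
  fixes f :: "real \<Rightarrow> 'a::{real_inner, banach, second_countable_topology}"
  assumes "f \<in> L2_ul" shows "(\<lambda>x. Complexify (f x) 0) \<in> L2_ul"
  by (rule L2_ul_bound[OF assms])
    (use borel_measurable_continuous_on[OF linear_continuous_on[OF bounded_linear_Complexify] L2_ul_measurable[OF assms]]
      in \<open>simp_all add: norm_complexified_eq\<close>)

lemma L2_ul_re_part:
  fixes f :: "real \<Rightarrow> 'a::{real_inner, banach, second_countable_topology} complexified"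
  assumes "f \<in> L2_ul" shows "(\<lambda>x. re_part (f x)) \<in> L2_ul"
  by (rule L2_ul_bound[OF assms])
    (use borel_measurable_continuous_on[OF linear_continuous_on[OF bounded_linear_re_part] L2_ul_measurable[OF assms]]
      in \<open>simp_all add: norm_complexified_eq norm_fst_le\<close>)

lemma complexify_ul_abs: "f \<in> L2_ul \<Longrightarrow> complexify_ul (abs_ul_space f) = abs_ul_space (\<lambda>x. Complexify (f x) 0)"
  by (simp add: complexify_ul.abs_eq ul_eq_refl_iff)

lemma bounded_linear_complexify_ul:
  "bounded_linear (complexify_ul :: 'a::{real_inner, banach, second_countable_topology} ul_space \<Rightarrow> _)"
proof (rule bounded_linear_intro[where K = 1])
  fix u v :: "'a ul_space" and r :: real
  obtain f g where fg: "f \<in> L2_ul" "u = abs_ul_space f" "g \<in> L2_ul" "v = abs_ul_space g" using rep_ul_space by metis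
  note fgC = fg(1,3)[THEN L2_ul_Complexify]
  show "complexify_ul (u + v) = complexify_ul u + complexify_ul v"
    using fg fgC by (simp add: abs_ul_space_simps complexify_ul_abs L2_ul_add(1) complexified_defs)
  show "complexify_ul (r *\<^sub>R u) = r *\<^sub>R complexify_ul u"
    using fg fgC by (simp add: abs_ul_space_simps complexify_ul_abs L2_ul_scaleR(1) complexified_defs)
  have "ul_norm (\<lambda>x. Complexify (f x) 0) = ul_norm f"
    by (simp add: ul_norm_def unit_L2_norm_def norm_complexified_eq)
  then show "norm (complexify_ul u) \<le> norm u * 1"
    using fg fgC by (simp add: abs_ul_space_simps complexify_ul_abs)
qed

lemma complexify_ul_eq_iff:
  fixes f :: "real \<Rightarrow> 'a::{real_inner, banach, second_countable_topology}"
  assumes "f \<in> L2_ul" "g \<in> L2_ul" "complexify_ul (abs_ul_space f) = abs_ul_space g"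
  shows "abs_ul_space f = abs_ul_space (\<lambda>x. re_part (g x))"
proof -
  have "AE x in lborel. Complexify (f x) 0 = g x"
    using assms by (simp add: complexify_ul_abs L2_ul_Complexify abs_ul_space_eq_iff)
  then have "AE x in lborel. f x = re_part (g x)" by eventually_elim (metis complexified.sel(1))
  then show ?thesis using assms by (simp add: abs_ul_space_eq_iff L2_ul_re_part)
qed

text \<open>Complexification and taking real parts are bounded linear maps, so they commute with weak
  derivatives, and they intertwine \<open>B\<close> with its complexification.\<close>

lemma (in positive_operator) A_complexify:
  "u \<in> A_dom D B \<and> A_op D B u = v \<longleftrightarrow>
    complexify_ul u \<in> A_dom (complexify_dom D) (complexify_op B)
    \<and> A_op (complexify_dom D) (complexify_op B) (complexify_ul u) = complexify_ul v"
proof -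
  have 0: "0 \<in> complexify_dom D" "complexify_op B 0 = 0"
    by (simp_all add: complexify_dom_def complexify_op_def complexified_defs zero_dom B_zero)
  note iff = A_dom_op_iff[of D B, OF zero_dom B_zero]
  note iffC = A_dom_op_iff[of "complexify_dom D" "complexify_op B", OF 0]
  note LI = L2_ul_locally_integrable
  show ?thesis
  proof
    assume "u \<in> A_dom D B \<and> A_op D B u = v"
    then obtain f f1 f2 b where f: "f \<in> L2_ul" "f1 \<in> L2_ul" "f2 \<in> L2_ul" "b \<in> L2_ul"
      "weak_derivative 1 f f1" "weak_derivative 2 f f2" "AE x in lborel. f x \<in> D \<and> B (f x) = b x"
      "u = abs_ul_space f" "v = abs_ul_space (\<lambda>x. - f2 x + b x)" unfolding iff by blast
    note C = f(1-4)[THEN L2_ul_Complexify]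
    note W = weak_derivative_linear[OF bounded_linear_Complexify LI[OF f(1)] LI[OF f(2)] f(5)]
      weak_derivative_linear[OF bounded_linear_Complexify LI[OF f(1)] LI[OF f(3)] f(6)]
    have "AE x in lborel. Complexify (f x) 0 \<in> complexify_dom D \<and> complexify_op B (Complexify (f x) 0) = Complexify (b x) 0"
      using f(7) by eventually_elim (simp add: complexify_dom_def complexify_op_def zero_dom B_zero)
    moreover have "complexify_ul u = abs_ul_space (\<lambda>x. Complexify (f x) 0)" using f by (simp add: complexify_ul_abs)
    moreover have "complexify_ul v = abs_ul_space (\<lambda>x. - Complexify (f2 x) 0 + Complexify (b x) 0)"
      unfolding f(9) by (subst complexify_ul_abs[OF L2_ul_add(1)[OF L2_ul_uminus[OF f(3)] f(4)]]) (simp add: complexified_defs)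
    ultimately show "complexify_ul u \<in> A_dom (complexify_dom D) (complexify_op B)
      \<and> A_op (complexify_dom D) (complexify_op B) (complexify_ul u) = complexify_ul v"
      unfolding iffC using C W by blast
  next
    assume "complexify_ul u \<in> A_dom (complexify_dom D) (complexify_op B)
      \<and> A_op (complexify_dom D) (complexify_op B) (complexify_ul u) = complexify_ul v"
    then obtain f f1 f2 b where f: "f \<in> L2_ul" "f1 \<in> L2_ul" "f2 \<in> L2_ul" "b \<in> L2_ul"
      "weak_derivative 1 f f1" "weak_derivative 2 f f2"
      "AE x in lborel. f x \<in> complexify_dom D \<and> complexify_op B (f x) = b x"
      "complexify_ul u = abs_ul_space f" "complexify_ul v = abs_ul_space (\<lambda>x. - f2 x + b x)" unfolding iffC by blast
    note C = f(1-4)[THEN L2_ul_re_part]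
    note W = weak_derivative_linear[OF bounded_linear_re_part LI[OF f(1)] LI[OF f(2)] f(5)]
      weak_derivative_linear[OF bounded_linear_re_part LI[OF f(1)] LI[OF f(3)] f(6)]
    obtain u' v' where uv: "u' \<in> L2_ul" "u = abs_ul_space u'" "v' \<in> L2_ul" "v = abs_ul_space v'" using rep_ul_space by metis
    have "AE x in lborel. re_part (f x) \<in> D \<and> B (re_part (f x)) = re_part (b x)"
      using f(7) by eventually_elim (metis (mono_tags, lifting) complexified.sel(1) complexify_dom_def complexify_op_def mem_Collect_eq)
    moreover have "u = abs_ul_space (\<lambda>x. re_part (f x))"
      using complexify_ul_eq_iff[OF uv(1) f(1)] f(8) uv(2) by simp
    moreover have "v = abs_ul_space (\<lambda>x. - re_part (f2 x) + re_part (b x))"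
    proof -
      have m: "(\<lambda>x. - f2 x + b x) \<in> L2_ul" by (intro L2_ul_add(1) L2_ul_uminus f)
      show ?thesis using complexify_ul_eq_iff[OF uv(3) m] f(9) uv(4) by (simp add: complexified_defs)
    qed
    ultimately show "u \<in> A_dom D B \<and> A_op D B u = v" unfolding iff using C W by blast
  qed
qed

lemma operator_graph_iff: "(u, v) \<in> operator_graph D T \<longleftrightarrow> u \<in> D \<and> T u = v"
  by (auto simp: operator_graph_def)

lemma linear_operatorD:
  assumes "linear_operator sc D T"
  shows "0 \<in> D" "\<And>u v. u \<in> D \<Longrightarrow> v \<in> D \<Longrightarrow> u + v \<in> D \<and> T (u + v) = T u + T v"
    "\<And>u. u \<in> D \<Longrightarrow> sc c u \<in> D \<and> T (sc c u) = sc c (T u)"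
  using assms by (auto simp: linear_operator_def)

text \<open>By \<open>A_complexify\<close> the graph is the preimage of the graph of the complexified operator under a continuous
  linear map.\<close>

lemma (in positive_operator) real_A_closed: "closed_operator scaleR (A_dom D B) (A_op D B)"
proof -
  interpret C: complex_positive_operator "complexify_dom D" "complexify_op B"
    by unfold_locales (rule complexified_positive_self_adjoint)
  interpret L: bounded_linear "complexify_ul :: 'a ul_space \<Rightarrow> _" by (rule bounded_linear_complexify_ul)
  have lin: "linear_operator scaleC C.DA C.A" by (rule C.A_linear)
  have "operator_graph (A_dom D B) (A_op D B) = (\<lambda>p. (complexify_ul (fst p), complexify_ul (snd p))) -` operator_graph C.DA C.A"
  proof (intro set_eqI)
    fix p :: "'a ul_space \<times> 'a ul_space"
    obtain u v where p: "p = (u, v)" by (cases p)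
    have "(u, v) \<in> operator_graph (A_dom D B) (A_op D B) \<longleftrightarrow> u \<in> A_dom D B \<and> A_op D B u = v"
      by (rule operator_graph_iff)
    also have "\<dots> \<longleftrightarrow> complexify_ul u \<in> C.DA \<and> C.A (complexify_ul u) = complexify_ul v" by (rule A_complexify)
    also have "\<dots> \<longleftrightarrow> (complexify_ul u, complexify_ul v) \<in> operator_graph C.DA C.A"
      by (rule operator_graph_iff[symmetric])
    finally show "p \<in> operator_graph (A_dom D B) (A_op D B) \<longleftrightarrow>
        p \<in> (\<lambda>p. (complexify_ul (fst p), complexify_ul (snd p))) -` operator_graph C.DA C.A"
      by (simp add: p)
  qed
  moreover have "closed (operator_graph C.DA C.A)" using C.A_closed by (simp add: closed_operator_def)
  moreover have "continuous_on UNIV (\<lambda>p. (complexify_ul (fst p :: 'a ul_space), complexify_ul (snd p :: 'a ul_space)))"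
    by (intro continuous_on_Pair L.continuous_on continuous_on_fst continuous_on_snd continuous_on_id)
  ultimately have cl: "closed (operator_graph (A_dom D B) (A_op D B))" by (simp only: closed_vimage)
  have z: "0 \<in> C.DA \<and> C.A 0 = 0"
  proof -
    have "0 \<in> C.DA" by (rule linear_operatorD(1)[OF lin])
    then show ?thesis using C.DA_diff[of 0 0] by simp
  qed
  have "linear_operator scaleR (A_dom D B) (A_op D B)"
    unfolding linear_operator_def
  proof (intro conjI ballI allI)
    show "0 \<in> A_dom D B" using A_complexify[of 0 0, THEN iffD2] z L.zero by simp
    fix u assume "u \<in> A_dom D B"
    then have u: "complexify_ul u \<in> C.DA \<and> C.A (complexify_ul u) = complexify_ul (A_op D B u)"
      by (intro A_complexify[THEN iffD1] conjI refl)
    have "c *\<^sub>R u \<in> A_dom D B \<and> A_op D B (c *\<^sub>R u) = c *\<^sub>R A_op D B u" for c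
    proof -
      have "of_real c *\<^sub>C complexify_ul u \<in> C.DA \<and> C.A (of_real c *\<^sub>C complexify_ul u) = of_real c *\<^sub>C C.A (complexify_ul u)"
        by (rule linear_operatorD(3)[OF lin u[THEN conjunct1]])
      then show ?thesis by (intro A_complexify[THEN iffD2]) (simp add: L.scaleR scaleC_of_real u)
    qed
    then show "c *\<^sub>R u \<in> A_dom D B" "A_op D B (c *\<^sub>R u) = c *\<^sub>R A_op D B u" for c by auto
    fix v assume "v \<in> A_dom D B"
    then have v: "complexify_ul v \<in> C.DA \<and> C.A (complexify_ul v) = complexify_ul (A_op D B v)"
      by (intro A_complexify[THEN iffD1] conjI refl)
    have "complexify_ul u + complexify_ul v \<in> C.DA \<and> C.A (complexify_ul u + complexify_ul v) = C.A (complexify_ul u) + C.A (complexify_ul v)"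
      by (rule linear_operatorD(2)[OF lin u[THEN conjunct1] v[THEN conjunct1]])
    then have "u + v \<in> A_dom D B \<and> A_op D B (u + v) = A_op D B u + A_op D B v"
      by (intro A_complexify[THEN iffD2]) (simp add: L.add u v)
    then show "u + v \<in> A_dom D B" "A_op D B (u + v) = A_op D B u + A_op D B v" by auto
  qed
  then show ?thesis using cl by (simp add: closed_operator_def)
qed


section \<open>The theorem\<close>

theorem proposition1p2:
  fixes D :: "'c::{chilbert_space, second_countable_topology} set"
    and B :: "'c \<Rightarrow> 'c"
    and D' :: "'r::{real_inner, banach, second_countable_topology} set"
    and B' :: "'r \<Rightarrow> 'r"
  shows
    "(\<comment> \<open>complex Hilbert space\<close>
      (\<exists>y::'c. y \<noteq> 0) \<and> positive_self_adjoint scaleC cinner D B \<longrightarrow>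
      (let DA = A_dom D B; A = A_op D B in
         closed_operator scaleC DA A
       \<and> (\<exists>\<omega> \<phi> M. resolvent_estimates DA A \<omega> \<phi> M)
       \<and> closure DA \<noteq> UNIV
       \<and> (\<forall>\<omega> \<phi> M \<Gamma>. resolvent_estimates DA A \<omega> \<phi> M \<and> semigroup_contour DA A \<omega> \<phi> \<Gamma> \<longrightarrow>
            (\<forall>t>0. \<forall>u. semigroup_integrand \<Gamma> DA A t u integrable_on UNIV))
       \<and> (\<exists>u0. \<forall>\<omega> \<phi> M \<Gamma>. resolvent_estimates DA A \<omega> \<phi> M \<and> semigroup_contour DA A \<omega> \<phi> \<Gamma> \<longrightarrow>
            \<not> ((\<lambda>t. contour_semigroup \<Gamma> DA A t u0) \<longlongrightarrow> u0) (at_right 0))))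
   \<and> (\<comment> \<open>real Hilbert space\<close>
      (\<exists>y::'r. y \<noteq> 0) \<and> positive_self_adjoint scaleR inner D' B' \<longrightarrow>
      (let DA = A_dom D' B'; A = A_op D' B';
           DAc = A_dom (complexify_dom D') (complexify_op B');
           Ac = A_op (complexify_dom D') (complexify_op B') in
         closed_operator scaleR DA A
       \<and> (\<exists>\<omega> \<phi> M. resolvent_estimates DAc Ac \<omega> \<phi> M)
       \<and> closure DA \<noteq> UNIV
       \<and> (\<forall>\<omega> \<phi> M \<Gamma>. resolvent_estimates DAc Ac \<omega> \<phi> M \<and> semigroup_contour DAc Ac \<omega> \<phi> \<Gamma> \<longrightarrow>
            (\<forall>t>0. \<forall>u. semigroup_integrand \<Gamma> DAc Ac t u integrable_on UNIV))
       \<and> (\<exists>u0. \<forall>\<omega> \<phi> M \<Gamma>. resolvent_estimates DAc Ac \<omega> \<phi> M \<and> semigroup_contour DAc Ac \<omega> \<phi> \<Gamma> \<longrightarrow>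
            \<not> ((\<lambda>t. contour_semigroup \<Gamma> DAc Ac t (complexify_ul u0)) \<longlongrightarrow> complexify_ul u0)
                (at_right 0))))"
proof (intro conjI impI; unfold Let_def)
  assume h: "(\<exists>y::'c. y \<noteq> 0) \<and> positive_self_adjoint scaleC cinner D B"
  interpret complex_positive_operator D B by unfold_locales (use h in blast)
  obtain y :: 'c where y: "y \<noteq> 0" using h by blast
  note nd = spikes_not_in_closure[of y D B, OF y zero_dom B_zero]
  show "closed_operator scaleC DA A
    \<and> (\<exists>\<omega> \<phi> M. resolvent_estimates DA A \<omega> \<phi> M)
    \<and> closure DA \<noteq> UNIV
    \<and> (\<forall>\<omega> \<phi> M \<Gamma>. resolvent_estimates DA A \<omega> \<phi> M \<and> semigroup_contour DA A \<omega> \<phi> \<Gamma> \<longrightarrow>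
         (\<forall>t>0. \<forall>u. semigroup_integrand \<Gamma> DA A t u integrable_on UNIV))
    \<and> (\<exists>u0. \<forall>\<omega> \<phi> M \<Gamma>. resolvent_estimates DA A \<omega> \<phi> M \<and> semigroup_contour DA A \<omega> \<phi> \<Gamma> \<longrightarrow>
         \<not> ((\<lambda>t. contour_semigroup \<Gamma> DA A t u0) \<longlongrightarrow> u0) (at_right 0))"
  proof (intro conjI A_closed)
    show "\<exists>\<omega> \<phi> M. resolvent_estimates DA A \<omega> \<phi> M" using resolvent_estimates_A by blast
    show "closure DA \<noteq> UNIV" using nd by blast
    show "\<forall>\<omega> \<phi> M \<Gamma>. resolvent_estimates DA A \<omega> \<phi> M \<and> semigroup_contour DA A \<omega> \<phi> \<Gamma> \<longrightarrow>
         (\<forall>t>0. \<forall>u. semigroup_integrand \<Gamma> DA A t u integrable_on UNIV)"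
      using semigroup_integrand_integrable by blast
    show "\<exists>u0. \<forall>\<omega> \<phi> M \<Gamma>. resolvent_estimates DA A \<omega> \<phi> M \<and> semigroup_contour DA A \<omega> \<phi> \<Gamma> \<longrightarrow>
         \<not> ((\<lambda>t. contour_semigroup \<Gamma> DA A t u0) \<longlongrightarrow> u0) (at_right 0)"
      using contour_semigroup_not_continuous[OF A_linear _ nd] by blast
  qed
next
  assume h: "(\<exists>y::'r. y \<noteq> 0) \<and> positive_self_adjoint scaleR inner D' B'"
  interpret positive_operator D' B' by unfold_locales (use h in blast)
  interpret C: complex_positive_operator "complexify_dom D'" "complexify_op B'"
    by unfold_locales (rule complexified_positive_self_adjoint)
  obtain y :: 'r where y: "y \<noteq> 0" using h by blast
  have yC: "Complexify y 0 \<noteq> 0" using y by (simp add: complexified_defs)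
  note nd = spikes_not_in_closure[of "Complexify y 0" "complexify_dom D'" "complexify_op B'", OF yC C.zero_dom C.B_zero]
  have "complexify_ul (abs_ul_space (\<lambda>x. spikes x *\<^sub>R y)) = abs_ul_space (\<lambda>x. spikes x *\<^sub>R Complexify y 0)"
    by (subst complexify_ul_abs[OF spikes_L2_ul]) (simp add: complexified_defs)
  then have nd': "complexify_ul (abs_ul_space (\<lambda>x. spikes x *\<^sub>R y)) \<notin> closure C.DA" using nd by simp
  show "closed_operator scaleR (A_dom D' B') (A_op D' B')
    \<and> (\<exists>\<omega> \<phi> M. resolvent_estimates C.DA C.A \<omega> \<phi> M)
    \<and> closure (A_dom D' B') \<noteq> UNIV
    \<and> (\<forall>\<omega> \<phi> M \<Gamma>. resolvent_estimates C.DA C.A \<omega> \<phi> M \<and> semigroup_contour C.DA C.A \<omega> \<phi> \<Gamma> \<longrightarrow>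
         (\<forall>t>0. \<forall>u. semigroup_integrand \<Gamma> C.DA C.A t u integrable_on UNIV))
    \<and> (\<exists>u0. \<forall>\<omega> \<phi> M \<Gamma>. resolvent_estimates C.DA C.A \<omega> \<phi> M \<and> semigroup_contour C.DA C.A \<omega> \<phi> \<Gamma> \<longrightarrow>
         \<not> ((\<lambda>t. contour_semigroup \<Gamma> C.DA C.A t (complexify_ul u0)) \<longlongrightarrow> complexify_ul u0) (at_right 0))"
  proof (intro conjI real_A_closed)
    show "\<exists>\<omega> \<phi> M. resolvent_estimates C.DA C.A \<omega> \<phi> M" using C.resolvent_estimates_A by blast
    show "closure (A_dom D' B') \<noteq> UNIV"
      using spikes_not_in_closure[of y D' B', OF y zero_dom B_zero] by blast
    show "\<forall>\<omega> \<phi> M \<Gamma>. resolvent_estimates C.DA C.A \<omega> \<phi> M \<and> semigroup_contour C.DA C.A \<omega> \<phi> \<Gamma> \<longrightarrow>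
         (\<forall>t>0. \<forall>u. semigroup_integrand \<Gamma> C.DA C.A t u integrable_on UNIV)"
      using semigroup_integrand_integrable by blast
    show "\<exists>u0. \<forall>\<omega> \<phi> M \<Gamma>. resolvent_estimates C.DA C.A \<omega> \<phi> M \<and> semigroup_contour C.DA C.A \<omega> \<phi> \<Gamma> \<longrightarrow>
         \<not> ((\<lambda>t. contour_semigroup \<Gamma> C.DA C.A t (complexify_ul u0)) \<longlongrightarrow> complexify_ul u0) (at_right 0)"
      using contour_semigroup_not_continuous[OF C.A_linear _ nd'] by blast
  qed
qed

end
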